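(* Let $V=(V,\alpha)\in\mathcal{P}$. Then $V$ admits a parabolic Morse minimizer if and only if $V\in\Pi$.
   Context: Let $d\ge 2$ and let $\mathbb{S}^{d-1}$ be the unit sphere of $\mathbb{R}^d$. Fix $\xi^+\neq\xi^-$ in $\mathbb{S}^{d-1}$ and a real number $V_{\min}>0$. Let $\mathcal{S}$ be the set of $V\in C^2(\mathbb{S}^{d-1})$ such that $V(s)\ge V(\xi^\pm)=V_{\min}$ for all $s\in\mathbb{S}^{d-1}$ and there exist $\delta>0$, $\mu>0$ such that $|s-\xi^\pm|<\delta$ implies $V(s)-V(\xi^\pm)\ge\mu|s-\xi^\pm|^2$ (for $s\in\mathbb{S}^{d-1}$). Let $\mathcal{P}=\{(V,\alpha)\in C^2(\mathbb{S}^{d-1})\times(0,2): V\in\mathcal{S}\}$, equipped with the product distance. An element $(V,\alpha)\in\mathcal{P}$ is identified with the potential $V(x)=V(x/|x|)/|x|^\alpha$ on $\mathbb{R}^d\setminus\{0\}$ (with value $+\infty$ at $0$), and is often denoted simply by $V$. For $a<b$ and $x\in H^1((a,b);\mathbb{R}^d)$ the (possibly infinite) action is $\mathcal{A}([a,b];x)=\int_a^b\left(\frac12|\dot x|^2+V(x)\right)dt$. Define $c(V)=\inf\{\mathcal{A}([a,b];x): a<b,\ x\in H^1((a,b);\mathbb{R}^d),\ x(a)=\xi^-,\ x(b)=\xi^+\}$, $\mathrm{In}=\{V\in\mathcal{P}: c(V)=4\sqrt{2V_{\min}}/(2-\alpha)\}$, $\mathrm{Out}=\{V\in\mathcal{P}: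 c(V)<4\sqrt{2V_{\min}}/(2-\alpha)\}$, and $\Pi=\partial\,\mathrm{In}\cap\partial\,\mathrm{Out}$ (boundaries in $\mathcal{P}$). A parabolic Morse minimizer for $V$ (a free minimizer of $\mathcal{A}$ of parabolic type, in the sense of Morse) is $x\in H^1_{\mathrm{loc}}(\mathbb{R};\mathbb{R}^d)$ such that: (i) $\min_{t\in\mathbb{R}}|x(t)|>0$; (ii) $|x(t)|\to+\infty$ and $x(t)/|x(t)|\to\xi^\pm$ as $t\to\pm\infty$; (iii) for every $a<b$, $a'<b'$ and $z\in H^1((a',b');\mathbb{R}^d)$ with $z(a')=x(a)$, $z(b')=x(b)$, one has $\mathcal{A}([a,b];x)\le\mathcal{A}([a',b'];z)$. *)

theory Defs
  imports "HOL-Analysis.Analysis"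
begin

section \<open>The space of C2 functions on the unit sphere\<close>

definition fderiv :: "('a::euclidean_space \<Rightarrow> 'b::real_normed_vector) \<Rightarrow> 'a \<Rightarrow> 'a \<Rightarrow>\<^sub>L 'b" where
  "fderiv f x = Blinfun (frechet_derivative f (at x))"

text \<open>Meant for open \<open>U\<close> only.\<close>

definition C2_on :: "'a set \<Rightarrow> ('a::euclidean_space \<Rightarrow> 'b::real_normed_vector) \<Rightarrow> bool" where
  "C2_on U f \<longleftrightarrow>
     (\<forall>x\<in>U. f differentiable (at x)) \<and>
     (\<forall>x\<in>U. fderiv f differentiable (at x)) \<and>
     continuous_on U (fderiv (fderiv f))"

text \<open>The extension of a function on the sphere to the complement of the origin that is
  constant along rays. Regularity on the sphere and the C2 distance are expressed
  through it: the radial projection is a smooth submersion that restricts to the identity on the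
  sphere, so \<open>V\<close> is C2 on the sphere iff \<open>radial_ext V\<close> is C2 away from the origin, and at points
  of the sphere the derivatives of \<open>radial_ext V\<close> up to order two are determined by the covariant
  derivatives of \<open>V\<close> up to order two, and conversely.\<close>

definition radial_ext :: "('a::euclidean_space \<Rightarrow> real) \<Rightarrow> 'a \<Rightarrow> real" where
  "radial_ext V x = V (x /\<^sub>R norm x)"

text \<open>Extensionality makes a function on the sphere a unique element of the set, whence
  \<open>C2_dist\<close> below is a genuine metric.\<close>

definition C2_sphere :: "('a::euclidean_space \<Rightarrow> real) set" where
  "C2_sphere = {V \<in> extensional (sphere 0 1). C2_on (- {0}) (radial_ext V)}"

text \<open>Locale \<open>Metric_space\<close> asks for a nonnegative distance on the whole type, whence the
  value 0 outside \<open>C2_sphere\<close>, where the suprema may be junk.\<close>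

definition C2_dist :: "('a::euclidean_space \<Rightarrow> real) \<Rightarrow> ('a \<Rightarrow> real) \<Rightarrow> real" where
  "C2_dist V W =
     (if V \<in> C2_sphere \<and> W \<in> C2_sphere then
        (SUP s\<in>sphere 0 1. dist (V s) (W s)) +
        (SUP s\<in>sphere 0 1. dist (fderiv (radial_ext V) s) (fderiv (radial_ext W) s)) +
        (SUP s\<in>sphere 0 1. dist (fderiv (fderiv (radial_ext V)) s)
                                  (fderiv (fderiv (radial_ext W)) s))
      else 0)"

lemma C2_sphere_continuous:
  fixes V :: "'a::euclidean_space \<Rightarrow> real"
  assumes "V \<in> C2_sphere"
  shows "continuous_on (sphere 0 1) V"
    and "continuous_on (sphere 0 1) (fderiv (radial_ext V))"
    and "continuous_on (sphere 0 1) (fderiv (fderiv (radial_ext V)))"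
proof -
  have sub: "sphere 0 1 \<subseteq> (- {0} :: 'a set)" by auto
  have C2: "C2_on (- {0}) (radial_ext V)" using assms by (simp add: C2_sphere_def)
  have "continuous_on (sphere 0 1) (radial_ext V)"
    using C2 sub unfolding C2_on_def
    by (meson continuous_at_imp_continuous_on differentiable_imp_continuous_within subsetD)
  then show "continuous_on (sphere 0 1) V"
    by (rule continuous_on_eq) (simp add: radial_ext_def)
  show "continuous_on (sphere 0 1) (fderiv (radial_ext V))"
    using C2 sub unfolding C2_on_def
    by (meson continuous_at_imp_continuous_on differentiable_imp_continuous_within subsetD)
  show "continuous_on (sphere 0 1) (fderiv (fderiv (radial_ext V)))"
    using C2 sub unfolding C2_on_def by (meson continuous_on_subset)
qed

lemma SUP_dist_bdd:
  fixes f g :: "'a::euclidean_space \<Rightarrow> 'b::metric_space"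
  assumes "continuous_on (sphere 0 1) f" "continuous_on (sphere 0 1) g"
  shows "bdd_above ((\<lambda>s. dist (f s) (g s)) ` sphere 0 1)"
  by (intro bounded_imp_bdd_above compact_imp_bounded compact_continuous_image
      continuous_intros assms compact_sphere)

lemma unit_sphere_nonempty: "sphere 0 1 \<noteq> ({} :: 'a::euclidean_space set)"
  by simp

lemma SUP_dist_nonneg:
  fixes f g :: "'a::euclidean_space \<Rightarrow> 'b::metric_space"
  assumes "continuous_on (sphere 0 1) f" "continuous_on (sphere 0 1) g"
  shows "0 \<le> (SUP s\<in>sphere 0 1. dist (f s) (g s))"
proof -
  obtain s :: 'a where "s \<in> sphere 0 1" using unit_sphere_nonempty by blast
  then have "dist (f s) (g s) \<le> (SUP s\<in>sphere 0 1. dist (f s) (g s))"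
    using cSUP_upper SUP_dist_bdd[OF assms] by fast
  then show ?thesis using zero_le_dist order_trans by blast
qed

lemma SUP_dist_triangle:
  fixes f g h :: "'a::euclidean_space \<Rightarrow> 'b::metric_space"
  assumes "continuous_on (sphere 0 1) f" "continuous_on (sphere 0 1) g"
    "continuous_on (sphere 0 1) h"
  shows "(SUP s\<in>sphere 0 1. dist (f s) (h s))
    \<le> (SUP s\<in>sphere 0 1. dist (f s) (g s)) + (SUP s\<in>sphere 0 1. dist (g s) (h s))"
proof (rule cSUP_least[OF unit_sphere_nonempty])
  fix s :: 'a assume s: "s \<in> sphere 0 1"
  have "dist (f s) (g s) \<le> (SUP s\<in>sphere 0 1. dist (f s) (g s))"
    using cSUP_upper[OF s SUP_dist_bdd[OF assms(1,2)]] .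
  moreover have "dist (g s) (h s) \<le> (SUP s\<in>sphere 0 1. dist (g s) (h s))"
    using cSUP_upper[OF s SUP_dist_bdd[OF assms(2,3)]] .
  ultimately show "dist (f s) (h s)
      \<le> (SUP s\<in>sphere 0 1. dist (f s) (g s)) + (SUP s\<in>sphere 0 1. dist (g s) (h s))"
    using dist_triangle[of "f s" "h s" "g s"] by linarith
qed

lemma C2_Metric_space: "Metric_space (C2_sphere :: ('a::euclidean_space \<Rightarrow> real) set) C2_dist"
proof
  fix V W :: "'a \<Rightarrow> real"
  show "C2_dist V W = C2_dist W V" by (simp add: C2_dist_def dist_commute)
  show "0 \<le> C2_dist V W"
    by (auto simp: C2_dist_def intro!: add_nonneg_nonneg SUP_dist_nonneg C2_sphere_continuous)
next
  fix V W :: "'a \<Rightarrow> real"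
  assume V: "V \<in> C2_sphere" and W: "W \<in> C2_sphere"
  show "C2_dist V W = 0 \<longleftrightarrow> V = W"
  proof
    assume "V = W"
    then show "C2_dist V W = 0" by (simp add: C2_dist_def)
  next
    assume "C2_dist V W = 0"
    then have *: "(SUP s\<in>sphere 0 1. dist (V s) (W s)) \<le> 0"
      using V W
        SUP_dist_nonneg[OF C2_sphere_continuous(2)[OF V] C2_sphere_continuous(2)[OF W]]
        SUP_dist_nonneg[OF C2_sphere_continuous(3)[OF V] C2_sphere_continuous(3)[OF W]]
      by (simp add: C2_dist_def)
    have "V s = W s" if "s \<in> sphere 0 1" for s
      using cSUP_upper[OF that SUP_dist_bdd[OF C2_sphere_continuous(1)[OF V]
            C2_sphere_continuous(1)[OF W]]] * by (metis dist_le_zero_iff order_trans)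
    then show "V = W"
      using V W by (auto simp: C2_sphere_def intro: extensionalityI)
  qed
next
  fix U V W :: "'a \<Rightarrow> real"
  assume U: "U \<in> C2_sphere" and V: "V \<in> C2_sphere" and W: "W \<in> C2_sphere"
  note c = C2_sphere_continuous[OF U] C2_sphere_continuous[OF V] C2_sphere_continuous[OF W]
  show "C2_dist U W \<le> C2_dist U V + C2_dist V W"
    using SUP_dist_triangle[OF c(1,4,7)] SUP_dist_triangle[OF c(2,5,8)]
      SUP_dist_triangle[OF c(3,6,9)] U V W
    by (simp add: C2_dist_def)
qed

section \<open>The parameter space\<close>

definition calS :: "'a::euclidean_space \<Rightarrow> 'a \<Rightarrow> real \<Rightarrow> ('a \<Rightarrow> real) set" where
  "calS \<xi>p \<xi>m Vmin =
     {V \<in> C2_sphere. V \<xi>p = Vmin \<and> V \<xi>m = Vmin \<and>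
        (\<forall>s\<in>sphere 0 1. V s \<ge> Vmin) \<and>
        (\<exists>\<delta>>0. \<exists>\<mu>>0. \<forall>\<xi>\<in>{\<xi>p, \<xi>m}. \<forall>s\<in>sphere 0 1.
           norm (s - \<xi>) < \<delta> \<longrightarrow> V s - V \<xi> \<ge> \<mu> * (norm (s - \<xi>))\<^sup>2)}"

definition calP :: "'a::euclidean_space \<Rightarrow> 'a \<Rightarrow> real \<Rightarrow> (('a \<Rightarrow> real) \<times> real) set" where
  "calP \<xi>p \<xi>m Vmin = calS \<xi>p \<xi>m Vmin \<times> {0<..<2}"

definition calP_topology ::
    "'a::euclidean_space \<Rightarrow> 'a \<Rightarrow> real \<Rightarrow> (('a \<Rightarrow> real) \<times> real) topology" where
  "calP_topology \<xi>p \<xi>m Vmin =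
     Metric_space.mtopology (calP \<xi>p \<xi>m Vmin) (prod_dist C2_dist dist)"

lemma calP_Metric_space: "Metric_space (calP \<xi>p \<xi>m Vmin) (prod_dist C2_dist dist)"
proof -
  interpret Metric_space12 C2_sphere C2_dist "UNIV :: real set" dist
    by (simp add: Metric_space12_def C2_Metric_space Met_TC.Metric_space_axioms)
  show ?thesis
    by (rule Prod_metric.subspace) (auto simp: calP_def calS_def)
qed

lemma topspace_calP_topology: "topspace (calP_topology \<xi>p \<xi>m Vmin) = calP \<xi>p \<xi>m Vmin"
  unfolding calP_topology_def by (rule Metric_space.topspace_mtopology[OF calP_Metric_space])

section \<open>Sobolev paths and the action\<close>

definition L2_on :: "real \<Rightarrow> real \<Rightarrow> (real \<Rightarrow> 'a::euclidean_space) \<Rightarrow> bool" where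
  "L2_on a b f \<longleftrightarrow>
     set_borel_measurable lborel {a<..<b} f \<and>
     set_integrable lborel {a<..<b} (\<lambda>t. (norm (f t))\<^sup>2)"

text \<open>Distributional derivative on \<open>(a, b)\<close>, tested against continuously differentiable functions
  with compact support in \<open>(a, b)\<close>.\<close>

definition has_weak_deriv ::
    "real \<Rightarrow> real \<Rightarrow> (real \<Rightarrow> 'a::euclidean_space) \<Rightarrow> (real \<Rightarrow> 'a) \<Rightarrow> bool" where
  "has_weak_deriv a b x g \<longleftrightarrow>
     (\<forall>\<phi> \<phi>'. (\<forall>t. (\<phi> has_real_derivative \<phi>' t) (at t)) \<and> continuous_on UNIV \<phi>' \<and>
         (\<exists>c d. a < c \<and> c < d \<and> d < b \<and> (\<forall>t. t \<notin> {c..d} \<longrightarrow> \<phi> t = 0)) \<longrightarrow>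
       (LINT t:{a<..<b}|lborel. \<phi>' t *\<^sub>R x t) = - (LINT t:{a<..<b}|lborel. \<phi> t *\<^sub>R g t))"

text \<open>Elements of the Sobolev space on \<open>(a, b)\<close> are taken through their representatives continuous
  on \<open>[a, b]\<close>, which give meaning to boundary values; values outside \<open>[a, b]\<close> are irrelevant.\<close>

definition H1 :: "real \<Rightarrow> real \<Rightarrow> (real \<Rightarrow> 'a::euclidean_space) set" where
  "H1 a b = {x. continuous_on {a..b} x \<and> L2_on a b x \<and> (\<exists>g. L2_on a b g \<and> has_weak_deriv a b x g)}"

definition H1_loc :: "(real \<Rightarrow> 'a::euclidean_space) set" where
  "H1_loc = {x. \<forall>a b. a < b \<longrightarrow> x \<in> H1 a b}"

text \<open>Unique up to a null set.\<close>

definition weak_deriv :: "real \<Rightarrow> real \<Rightarrow> (real \<Rightarrow> 'a::euclidean_space) \<Rightarrow> real \<Rightarrow> 'a" where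
  "weak_deriv a b x = (SOME g. L2_on a b g \<and> has_weak_deriv a b x g)"

text \<open>Potentials in \<open>calP\<close> are positive when \<open>Vmin > 0\<close>, so nothing is lost by truncation in
  \<open>ennreal\<close>.\<close>

definition potential :: "('a::euclidean_space \<Rightarrow> real) \<times> real \<Rightarrow> 'a \<Rightarrow> ennreal" where
  "potential = (\<lambda>(V, \<alpha>) x. if x = 0 then \<infinity> else ennreal (V (x /\<^sub>R norm x) / norm x powr \<alpha>))"

definition action ::
    "('a::euclidean_space \<Rightarrow> real) \<times> real \<Rightarrow> real \<Rightarrow> real \<Rightarrow> (real \<Rightarrow> 'a) \<Rightarrow> ennreal" where
  "action V a b x =
     (\<integral>\<^sup>+t\<in>{a<..<b}. (ennreal ((norm (weak_deriv a b x t))\<^sup>2 / 2) + potential V (x t)) \<partial>lborel)"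

section \<open>Level sets and parabolic Morse minimizers\<close>

definition min_action ::
    "'a::euclidean_space \<Rightarrow> 'a \<Rightarrow> ('a \<Rightarrow> real) \<times> real \<Rightarrow> ennreal" where
  "min_action \<xi>p \<xi>m V =
     Inf {action V a b x | a b x. a < b \<and> x \<in> H1 a b \<and> x a = \<xi>m \<and> x b = \<xi>p}"

definition In_set :: "'a::euclidean_space \<Rightarrow> 'a \<Rightarrow> real \<Rightarrow> (('a \<Rightarrow> real) \<times> real) set" where
  "In_set \<xi>p \<xi>m Vmin =
     {(V, \<alpha>) \<in> calP \<xi>p \<xi>m Vmin. min_action \<xi>p \<xi>m (V, \<alpha>) = ennreal (4 * sqrt (2 * Vmin) / (2 - \<alpha>))}"

definition Out_set :: "'a::euclidean_space \<Rightarrow> 'a \<Rightarrow> real \<Rightarrow> (('a \<Rightarrow> real) \<times> real) set" where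
  "Out_set \<xi>p \<xi>m Vmin =
     {(V, \<alpha>) \<in> calP \<xi>p \<xi>m Vmin. min_action \<xi>p \<xi>m (V, \<alpha>) < ennreal (4 * sqrt (2 * Vmin) / (2 - \<alpha>))}"

definition Pi_set :: "'a::euclidean_space \<Rightarrow> 'a \<Rightarrow> real \<Rightarrow> (('a \<Rightarrow> real) \<times> real) set" where
  "Pi_set \<xi>p \<xi>m Vmin =
     calP_topology \<xi>p \<xi>m Vmin frontier_of In_set \<xi>p \<xi>m Vmin \<inter>
     calP_topology \<xi>p \<xi>m Vmin frontier_of Out_set \<xi>p \<xi>m Vmin"

definition parabolic_Morse_minimizer ::
    "'a::euclidean_space \<Rightarrow> 'a \<Rightarrow> ('a \<Rightarrow> real) \<times> real \<Rightarrow> (real \<Rightarrow> 'a) \<Rightarrow> bool" where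
  "parabolic_Morse_minimizer \<xi>p \<xi>m V x \<longleftrightarrow>
     x \<in> H1_loc \<and>
     (\<exists>t0. 0 < norm (x t0) \<and> (\<forall>t. norm (x t0) \<le> norm (x t))) \<and>
     filterlim (\<lambda>t. norm (x t)) at_top at_top \<and>
     filterlim (\<lambda>t. norm (x t)) at_top at_bot \<and>
     ((\<lambda>t. x t /\<^sub>R norm (x t)) \<longlongrightarrow> \<xi>p) at_top \<and>
     ((\<lambda>t. x t /\<^sub>R norm (x t)) \<longlongrightarrow> \<xi>m) at_bot \<and>
     (\<forall>a b a' b' z. a < b \<and> a' < b' \<and> z \<in> H1 a' b' \<and> z a' = x a \<and> z b' = x b \<longrightarrow>
        action V a b x \<le> action V a' b' z)"

end

theory Submission
  imports Defs "HOL-Complex_Analysis.Great_Picard"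
begin

text \<open>Let \<open>jd p q\<close> be the infimum of the action over all paths from \<open>p\<close> to \<open>q\<close> on free time intervals. It
  is a distance, homogeneous of degree \<open>\<beta> = 1 - \<alpha> / 2\<close>, and \<open>h r = sqrt (2 Vmin) r\<^sup>\<beta> / \<beta>\<close> is the cost of
  the segment from 0 to \<open>r \<xi>p\<close>. Hence \<open>jd \<xi>m \<xi>p \<le> 2 h 1\<close>, with equality on In and strict inequality on
  Out. As Out is open, \<open>\<Pi>\<close> consists of the points of In that are limits of points of Out.

  If \<open>V\<close> is such a limit, an almost minimal path for a nearby potential in Out avoids the origin, and can
  be rescaled to have distance 1 from it. Its end points are then far away, since passing through the
  origin is optimal for \<open>V\<close>. These paths converge to a Morse minimizer; a calibration
  shows that the limit has the directions \<open>\<xi>p\<close> and \<open>\<xi>m\<close> at infinity.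

  Conversely, a parabolic Morse minimizer realizes \<open>jd\<close> between its points, so that \<open>jd\<close> between its two
  points at distance \<open>R\<close> from the origin is at least \<open>2 h R\<close> up to a constant, which by homogeneity
  forces \<open>jd \<xi>m \<xi>p = 2 h 1\<close>.
  Moreover the minimizer can be connected to the rays through \<open>\<xi>p\<close> and \<open>\<xi>m\<close> with arbitrarily small
  excess of action along a suitable sequence of times, because its direction converges fast enough and \<open>V\<close> is
  quadratic at its minima. Replacing \<open>V\<close> by \<open>(1 - e) V + e Vmin\<close> decreases the action of the
  minimizer by a fixed amount and therefore leads into Out.\<close>

section \<open>Absolutely continuous paths and the Sobolev space\<close>

text \<open>The passage to the limit rests on equipartition: changing the speed of an almost minimal
  path cannot lower its action by more than its excess, so kinetic and potential action agree up to
  that excess. Pointwise convergence carries the potential action, hence also the kinetic one, to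
  the limit, and upper semicontinuity of \<open>jd\<close>, obtained by testing with one fixed path,
  makes the limit minimal. All lower bounds come from one family of functions
  \<open>G k \<sigma>\<close>. The choice \<open>k = 0\<close> gives the radial bound
  \<open>h\<close>; the choice \<open>k = \<beta>\<^sup>2\<close> also sees the angle to
  \<open>\<sigma>\<close> and shows that, along suitable times, \<open>h r\<close> times the squared
  distance of the direction from its limit tends to 0. This is exactly the rate required: as V is
  C2, joining such a point to the ray costs in excess a multiple of the same quantity. The excess
  can thus be made smaller than the gain from lowering V. That gain is positive because the
  direction has to travel from \<open>\<xi>m\<close> to \<open>\<xi>p\<close>, and the nondegenerate
  minimum at \<open>\<xi>m\<close> forces it through values of V above Vmin.\<close>

definition AC :: "real \<Rightarrow> real \<Rightarrow> (real \<Rightarrow> 'a::euclidean_space) \<Rightarrow> (real \<Rightarrow> 'a) \<Rightarrow> bool" where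
  "AC a b x g \<longleftrightarrow> g \<in> borel_measurable borel \<and> integrable lborel (\<lambda>t. (norm (g t))\<^sup>2) \<and>
     (\<forall>t. t \<notin> {a<..<b} \<longrightarrow> g t = 0) \<and> (\<forall>t\<in>{a..b}. x t = x a + (LINT s:{..t}|lborel. g s))"

lemma square_integrable_imp_integrable:
  fixes g :: "real \<Rightarrow> 'a::euclidean_space"
  assumes [measurable]: "g \<in> borel_measurable borel"
    and "integrable lborel (\<lambda>t. (norm (g t))\<^sup>2)" "\<And>t. t \<notin> {a<..<b} \<Longrightarrow> g t = 0"
  shows "integrable lborel g"
proof (rule Bochner_Integration.integrable_bound)
  show "integrable lborel (\<lambda>t. (norm (g t))\<^sup>2 + indicator {a<..<b} t)"
    using assms(2) by (intro Bochner_Integration.integrable_add integrable_real_indicator)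
      (cases "a \<le> b"; auto)+
  have *: "y \<le> y\<^sup>2 + 1" for y :: real
    using zero_le_power2[of "y - 1/2"] by (simp add: power2_eq_square algebra_simps)
  show "AE t in lborel. norm (g t) \<le> norm ((norm (g t))\<^sup>2 + indicator {a<..<b} t)"
    using assms(3) *[of "norm (g _)"] by (intro AE_I2) (auto simp: indicator_def abs_of_nonneg)
qed auto

lemma
  assumes "AC a b x g"
  shows AC_measurable: "g \<in> borel_measurable borel"
    and AC_square: "integrable lborel (\<lambda>t. (norm (g t))\<^sup>2)"
    and AC_zero: "\<And>t. t \<notin> {a<..<b} \<Longrightarrow> g t = 0"
    and AC_eq: "t \<in> {a..b} \<Longrightarrow> x t = x a + (LINT s:{..t}|lborel. g s)"
    and AC_integrable: "integrable lborel g"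
proof -
  show 1: "g \<in> borel_measurable borel" and 2: "integrable lborel (\<lambda>t. (norm (g t))\<^sup>2)"
    and 3: "\<And>t. t \<notin> {a<..<b} \<Longrightarrow> g t = 0"
    using assms unfolding AC_def by blast+
  show "t \<in> {a..b} \<Longrightarrow> x t = x a + (LINT s:{..t}|lborel. g s)"
    using assms unfolding AC_def by blast
  show "integrable lborel g"
    by (rule square_integrable_imp_integrable[OF 1 2 3])
qed

lemma set_integrable_of_integrable:
  fixes g :: "real \<Rightarrow> 'a::euclidean_space"
  assumes "integrable lborel g" "A \<in> sets borel"
  shows "set_integrable lborel A g"
  using assms unfolding set_integrable_def by (intro integrable_mult_indicator) auto

lemma set_integral_atMost_diff:
  fixes g :: "real \<Rightarrow> 'a::euclidean_space"
  assumes "integrable lborel g" "s \<le> t"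
  shows "(LINT u:{..t}|lborel. g u) - (LINT u:{..s}|lborel. g u) = (LINT u:{s<..t}|lborel. g u)"
proof -
  have "{..t} = {..s} \<union> {s<..t}" using assms by auto
  moreover have "(LINT u:{..s} \<union> {s<..t}|lborel. g u) = (LINT u:{..s}|lborel. g u) + (LINT u:{s<..t}|lborel. g u)"
    by (rule set_integral_Un) (auto intro: set_integrable_of_integrable[OF assms(1)])
  ultimately show ?thesis by (simp only: add_diff_cancel_left')
qed

lemma AC_diff:
  assumes "AC a b x g" "a \<le> s" "s \<le> t" "t \<le> b"
  shows "x t - x s = (LINT u:{s<..t}|lborel. g u)"
  using AC_eq[OF assms(1), of s] AC_eq[OF assms(1), of t] assms
    set_integral_atMost_diff[OF AC_integrable[OF assms(1)], of s t] by (simp add: algebra_simps)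

lemma continuous_indefinite_integral:
  fixes g :: "real \<Rightarrow> 'a::euclidean_space"
  assumes g: "integrable lborel g"
  shows "continuous_on UNIV (\<lambda>t. LINT s:{..t}|lborel. g s)"
proof (rule continuous_on_sequentiallyI)
  fix u :: "nat \<Rightarrow> real" and a :: real
  assume u: "u \<longlonglongrightarrow> a"
  show "(\<lambda>n. LINT s:{..u n}|lborel. g s) \<longlonglongrightarrow> (LINT s:{..a}|lborel. g s)"
    unfolding set_lebesgue_integral_def
  proof (rule integral_dominated_convergence[where w="\<lambda>s. norm (g s)"])
    show "AE x in lborel. (\<lambda>i. indicat_real {..u i} x *\<^sub>R g x) \<longlonglongrightarrow> indicat_real {..a} x *\<^sub>R g x"
    proof (rule AE_mp[OF AE_lborel_singleton[of a]], rule AE_I2, rule impI)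
      fix x assume "x \<noteq> a"
      then consider "x < a" | "x > a" by linarith
      then have "\<forall>\<^sub>F i in sequentially. indicat_real {..u i} x = indicat_real {..a} x"
      proof cases
        case 1
        then have "\<forall>\<^sub>F i in sequentially. x < u i" using u order_tendstoD(1) by blast
        then show ?thesis by eventually_elim (use 1 in \<open>auto simp: indicator_def\<close>)
      next
        case 2
        then have "\<forall>\<^sub>F i in sequentially. x > u i" using u order_tendstoD(2) by blast
        then show ?thesis by eventually_elim (use 2 in \<open>auto simp: indicator_def\<close>)
      qed
      then show "(\<lambda>i. indicat_real {..u i} x *\<^sub>R g x) \<longlonglongrightarrow> indicat_real {..a} x *\<^sub>R g x"
        by (intro tendsto_eventually) (auto elim: eventually_mono)
    qed
  qed (use g in \<open>auto simp: indicator_def\<close>)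
qed

lemma AC_continuous:
  assumes "AC a b x g"
  shows "continuous_on {a..b} x"
proof -
  have "continuous_on {a..b} (\<lambda>t. x a + (LINT s:{..t}|lborel. g s))"
    by (rule continuous_on_add[OF continuous_on_const
        continuous_on_subset[OF continuous_indefinite_integral[OF AC_integrable[OF assms]] subset_UNIV]])
  then show ?thesis by (rule continuous_on_eq) (rule AC_eq[OF assms, symmetric])
qed

text \<open>Composition with \<open>clamp1 a b\<close> extends a path constantly past its end
  points. The extension is continuous on the whole line, hence Borel, whatever values the path takes
  outside \<open>{a..b}\<close>.\<close>

definition clamp1 :: "real \<Rightarrow> real \<Rightarrow> real \<Rightarrow> real" where
  "clamp1 a b t = max a (min b t)"

lemma clamp1_in: "a \<le> b \<Longrightarrow> clamp1 a b t \<in> {a..b}"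
  by (auto simp: clamp1_def)

lemma clamp1_id: "t \<in> {a..b} \<Longrightarrow> clamp1 a b t = t"
  by (auto simp: clamp1_def)

lemma clamp1_mono: "s \<le> t \<Longrightarrow> clamp1 a b s \<le> clamp1 a b t"
  by (auto simp: clamp1_def)

lemma continuous_clamp1:
  assumes "a \<le> b" "continuous_on {a..b} x"
  shows "continuous_on UNIV (\<lambda>t. x (clamp1 a b t))"
  by (rule continuous_on_compose2[OF assms(2)])
     (auto simp: clamp1_in[OF assms(1), simplified] clamp1_def assms(1) intro!: continuous_intros)

lemma L2_on_continuous:
  fixes x :: "real \<Rightarrow> 'a::euclidean_space"
  assumes "a \<le> b" "continuous_on {a..b} x"
  shows "L2_on a b x"
proof -
  let ?y = "\<lambda>t. x (clamp1 a b t)"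
  have y: "continuous_on UNIV ?y" by (rule continuous_clamp1[OF assms])
  have [measurable]: "?y \<in> borel_measurable borel"
    using y by (rule borel_measurable_continuous_onI)
  have eq: "t \<in> {a<..<b} \<Longrightarrow> x t = ?y t" for t
    using clamp1_id[of t a b] by auto
  have "(\<lambda>t. indicat_real {a<..<b} t *\<^sub>R x t) = (\<lambda>t. indicat_real {a<..<b} t *\<^sub>R ?y t)"
    using eq by (auto simp: indicator_def fun_eq_iff)
  then have 1: "set_borel_measurable lborel {a<..<b} x"
    by (simp add: set_borel_measurable_def)
  have "set_integrable lborel {a<..<b} (\<lambda>t. (norm (?y t))\<^sup>2)"
    by (rule set_integrable_subset[OF borel_integrable_atLeastAtMost'[of a b]])
       (auto intro!: continuous_intros continuous_on_subset[OF y])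
  then have 2: "set_integrable lborel {a<..<b} (\<lambda>t. (norm (x t))\<^sup>2)"
    by (subst set_integrable_cong[OF refl refl]) (use eq in auto)
  show ?thesis using 1 2 by (simp add: L2_on_def)
qed

text \<open>Integration by parts through Fubini, applied to \<open>\<phi>' t *\<^sub>R g s\<close>
  on the half plane where s is at most t. Integrating over t first leaves \<open>- \<phi> s\<close>,
  because \<open>\<phi>\<close> vanishes far to the right; the constant \<open>x a\<close>
  disappears because \<open>\<phi>'\<close> has integral 0.\<close>

lemma AC_has_weak_deriv:
  fixes x :: "real \<Rightarrow> 'a::euclidean_space"
  assumes ac: "AC a b x g"
  shows "has_weak_deriv a b x g"
  unfolding has_weak_deriv_def
proof (intro allI impI, elim conjE exE)
  fix \<phi> \<phi>' :: "real \<Rightarrow> real" and c d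
  assume D: "\<forall>t. (\<phi> has_real_derivative \<phi>' t) (at t)" and cont: "continuous_on UNIV \<phi>'"
    and cd: "a < c" "c < d" "d < b" and z: "\<forall>t. t \<notin> {c..d} \<longrightarrow> \<phi> t = 0"
  have [measurable]: "\<phi>' \<in> borel_measurable borel" "g \<in> borel_measurable borel"
    using cont ac by (auto intro: borel_measurable_continuous_onI simp: AC_measurable)
  have \<phi>c: "continuous_on UNIV \<phi>"
    using D by (meson DERIV_isCont continuous_at_imp_continuous_on)
  then have [measurable]: "\<phi> \<in> borel_measurable borel"
    by (auto intro: borel_measurable_continuous_onI)
  have z': "\<phi>' t = 0" if "t \<notin> {c..d}" for t
  proof -
    have o: "open (- {c..d})" by auto
    have "((\<lambda>_. 0) has_real_derivative 0) (at t)" by simp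
    then have "(\<phi> has_real_derivative 0) (at t)"
      by (rule has_field_derivative_transform_within_open[OF _ o]) (use that z in auto)
    then show ?thesis using D DERIV_unique by blast
  qed
  have int\<phi>: "integrable lborel \<phi>'"
  proof -
    have "integrable lborel (\<lambda>t. indicator {c..d} t *\<^sub>R \<phi>' t)"
      using borel_integrable_atLeastAtMost'[of c d \<phi>'] cont
      by (auto simp: set_integrable_def intro: continuous_on_subset)
    moreover have "(\<lambda>t. indicator {c..d} t *\<^sub>R \<phi>' t) = \<phi>'" using z' by (auto simp: indicator_def fun_eq_iff)
    ultimately show ?thesis by simp
  qed
  have tail: "(\<integral>t. indicat_real {s..} t * \<phi>' t \<partial>lborel) = - \<phi> s" for s
  proof -
    define M where "M = max (d + 1) s"
    have "(\<integral>t. \<phi>' t * indicator {s..M} t \<partial>lborel) = \<phi> M - \<phi> s"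
      by (rule integral_FTC_Icc_real) (use D cont in \<open>auto simp: M_def continuous_on_eq_continuous_at\<close>)
    moreover have "\<phi> M = 0" using z by (auto simp: M_def)
    moreover have "(\<lambda>t. \<phi>' t * indicator {s..M} t) = (\<lambda>t. indicat_real {s..} t * \<phi>' t)"
      by (auto simp: indicator_def fun_eq_iff M_def intro!: z')
    ultimately show ?thesis by simp
  qed
  have tot: "(\<integral>t. \<phi>' t \<partial>lborel) = 0"
  proof -
    have "(\<lambda>t. indicat_real {c - 1..} t * \<phi>' t) = \<phi>'"
      using z' by (auto simp: indicator_def fun_eq_iff)
    then show ?thesis using tail[of "c - 1"] z by auto
  qed
  have g: "integrable lborel g" by (rule AC_integrable[OF ac])
  define f where "f = (\<lambda>t s. (\<phi>' t * indicat_real {..t} s) *\<^sub>R g s)"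
  have f_eq: "f t s = (indicat_real {s..} t * \<phi>' t) *\<^sub>R g s" for t s
    by (auto simp: f_def indicator_def)
  have fm: "case_prod f \<in> borel_measurable (lborel \<Otimes>\<^sub>M lborel)"
  proof -
    have eqf: "case_prod f = (\<lambda>p. (if snd p \<le> fst p then \<phi>' (fst p) else 0) *\<^sub>R g (snd p))"
      by (auto simp: f_def indicator_def fun_eq_iff)
    show ?thesis unfolding eqf by measurable
  qed
  have fi: "integrable (lborel \<Otimes>\<^sub>M lborel) (case_prod f)"
  proof (rule lborel_pair.Fubini_integrable[OF fm])
    have nm: "(\<integral>s. norm (f t s) \<partial>lborel) = \<bar>\<phi>' t\<bar> * (\<integral>s. indicat_real {..t} s * norm (g s) \<partial>lborel)" for t
      by (simp add: f_def abs_mult mult.assoc)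
    show "integrable lborel (\<lambda>t. \<integral>s. norm (case_prod f (t, s)) \<partial>lborel)"
    proof (rule Bochner_Integration.integrable_bound)
      show "integrable lborel (\<lambda>t. \<bar>\<phi>' t\<bar> * (\<integral>s. norm (g s) \<partial>lborel))"
        using int\<phi> by auto
      show "(\<lambda>t. \<integral>s. norm (case_prod f (t, s)) \<partial>lborel) \<in> borel_measurable lborel"
        using fm by measurable
      show "AE t in lborel. norm (\<integral>s. norm (case_prod f (t, s)) \<partial>lborel)
          \<le> norm (\<bar>\<phi>' t\<bar> * (\<integral>s. norm (g s) \<partial>lborel))"
      proof (rule AE_I2)
        fix t
        have "(\<integral>s. indicat_real {..t} s * norm (g s) \<partial>lborel) \<le> (\<integral>s. norm (g s) \<partial>lborel)"
        proof (rule integral_mono_AE)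
          show "integrable lborel (\<lambda>s. indicat_real {..t} s * norm (g s))"
            using integrable_mult_indicator[of "{..t}" lborel "\<lambda>s. norm (g s)"] g by auto
        qed (use g in \<open>auto simp: indicator_def\<close>)
        moreover have "0 \<le> (\<integral>s. indicat_real {..t} s * norm (g s) \<partial>lborel)"
          by (rule Bochner_Integration.integral_nonneg) auto
        ultimately show "norm (\<integral>s. norm (case_prod f (t, s)) \<partial>lborel)
          \<le> norm (\<bar>\<phi>' t\<bar> * (\<integral>s. norm (g s) \<partial>lborel))"
          by (simp add: nm abs_mult mult_left_mono)
      qed
    qed
    show "AE t in lborel. integrable lborel (\<lambda>s. case_prod f (t, s))"
    proof (rule AE_I2)
      fix t
      have "integrable lborel (\<lambda>s. \<phi>' t *\<^sub>R (indicat_real {..t} s *\<^sub>R g s))"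
        using g by (intro integrable_scaleR_right integrable_mult_indicator) auto
      then show "integrable lborel (\<lambda>s. case_prod f (t, s))" by (simp add: f_def)
    qed
  qed
  have "(LINT t:{a<..<b}|lborel. \<phi>' t *\<^sub>R x t) = (\<integral>t. \<phi>' t *\<^sub>R x a + (\<integral>s. f t s \<partial>lborel) \<partial>lborel)"
    unfolding set_lebesgue_integral_def
  proof (rule Bochner_Integration.integral_cong[OF refl])
    fix t :: real
    have in1: "(\<integral>s. f t s \<partial>lborel) = \<phi>' t *\<^sub>R (LINT s:{..t}|lborel. g s)"
      unfolding set_lebesgue_integral_def
      by (subst integral_scaleR_right[symmetric]) (simp add: f_def)
    show "indicat_real {a<..<b} t *\<^sub>R \<phi>' t *\<^sub>R x t = \<phi>' t *\<^sub>R x a + (\<integral>s. f t s \<partial>lborel)"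
    proof (cases "t \<in> {c..d}")
      case True
      then have "t \<in> {a<..<b}" using cd by auto
      then show ?thesis using AC_eq[OF ac, of t] unfolding in1 by (simp add: scaleR_add_right)
    next
      case False
      then show ?thesis unfolding in1 using z' by simp
    qed
  qed
  also have "\<dots> = (\<integral>t. \<phi>' t *\<^sub>R x a \<partial>lborel) + (\<integral>t. (\<integral>s. f t s \<partial>lborel) \<partial>lborel)"
    by (rule Bochner_Integration.integral_add)
       (use int\<phi> lborel_pair.integrable_fst'[OF fi] in auto)
  also have "(\<integral>t. \<phi>' t *\<^sub>R x a \<partial>lborel) = 0"
    using tot integral_scaleR_left[of "x a" lborel \<phi>'] int\<phi> by simp
  also have "(\<integral>t. (\<integral>s. f t s \<partial>lborel) \<partial>lborel) = (\<integral>s. (\<integral>t. f t s \<partial>lborel) \<partial>lborel)"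
    using lborel_pair.Fubini_integral[OF fi] by simp
  also have "\<dots> = (\<integral>s. - (\<phi> s *\<^sub>R g s) \<partial>lborel)"
  proof (rule Bochner_Integration.integral_cong[OF refl])
    fix s :: real
    have "(\<integral>t. f t s \<partial>lborel) = (\<integral>t. indicat_real {s..} t * \<phi>' t \<partial>lborel) *\<^sub>R g s"
      unfolding f_eq using integrable_mult_indicator[of "{s..}" lborel \<phi>'] int\<phi>
      by (intro integral_scaleR_left) auto
    then show "(\<integral>t. f t s \<partial>lborel) = - (\<phi> s *\<^sub>R g s)" by (simp add: tail)
  qed
  also have "\<dots> = - (LINT t:{a<..<b}|lborel. \<phi> t *\<^sub>R g t)"
    unfolding set_lebesgue_integral_def Bochner_Integration.integral_minus
    by (rule arg_cong[where f=uminus], rule Bochner_Integration.integral_cong[OF refl])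
       (use AC_zero[OF ac] in \<open>auto simp: indicator_def\<close>)
  finally show "(LINT t:{a<..<b}|lborel. \<phi>' t *\<^sub>R x t) = - (LINT t:{a<..<b}|lborel. \<phi> t *\<^sub>R g t)"
    by simp
qed

lemma AC_L2: "AC a b x g \<Longrightarrow> L2_on a b g"
  unfolding L2_on_def set_borel_measurable_def set_integrable_def
  by (intro conjI integrable_mult_indicator AC_square borel_measurable_scaleR)
     (auto simp: AC_measurable)

lemma AC_H1:
  assumes "a \<le> b" "AC a b x g"
  shows "x \<in> H1 a b"
  using assms AC_continuous[OF assms(2)] L2_on_continuous[of a b x] AC_L2[OF assms(2)]
    AC_has_weak_deriv[OF assms(2)]
  by (auto simp: H1_def)

section \<open>Weak derivatives are densities (lemma of du Bois-Reymond)\<close>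

definition ramp :: "real \<Rightarrow> real" where
  "ramp v = ((max 0 v)\<^sup>2 - 2 * (max 0 (v - 1))\<^sup>2 + (max 0 (v - 2))\<^sup>2) / 2"

text \<open>A tent on [0, 2] with integral 1. Its primitive \<open>ramp\<close> is a step from 0 to
  1 that is just C1, the regularity of the test functions in \<open>has_weak_deriv\<close>.\<close>

definition hat :: "real \<Rightarrow> real" where
  "hat v = max 0 v - 2 * max 0 (v - 1) + max 0 (v - 2)"

lemma has_derivative_max_square: "((\<lambda>v. (max 0 v)\<^sup>2) has_real_derivative 2 * max 0 v) (at v)"
  for v :: real
proof -
  consider "v < 0" | "v = 0" | "v > 0" by linarith
  then show ?thesis
  proof cases
    case 1
    have "((\<lambda>v::real. 0) has_real_derivative 0) (at v)" by simp
    then have "((\<lambda>v. (max 0 v)\<^sup>2) has_real_derivative 0) (at v)"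
      by (rule has_field_derivative_transform_within_open[of _ _ _ "{..<0}"]) (use 1 in auto)
    then show ?thesis using 1 by simp
  next
    case 3
    have "((\<lambda>v::real. v\<^sup>2) has_real_derivative 2 * v) (at v)"
      by (auto intro!: derivative_eq_intros)
    then have "((\<lambda>v. (max 0 v)\<^sup>2) has_real_derivative 2 * v) (at v)"
      by (rule has_field_derivative_transform_within_open[of _ _ _ "{0<..}"]) (use 3 in auto)
    then show ?thesis using 3 by simp
  next
    case 2
    have "((\<lambda>h::real. (max 0 h)\<^sup>2 / h) \<longlongrightarrow> 0) (at 0)"
    proof (rule Lim_null_comparison[where g="\<lambda>h. \<bar>h\<bar>"])
      show "\<forall>\<^sub>F h in at 0. norm ((max 0 h)\<^sup>2 / h) \<le> \<bar>h::real\<bar>"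
        by (rule always_eventually) (auto simp: max_def power2_eq_square)
      show "((\<lambda>h. \<bar>h::real\<bar>) \<longlongrightarrow> 0) (at 0)" by (auto intro!: tendsto_eq_intros)
    qed
    then show ?thesis using 2 by (simp add: DERIV_def)
  qed
qed

lemma ramp_deriv: "(ramp has_real_derivative hat v) (at v)"
proof -
  note d = DERIV_chain'[OF _ has_derivative_max_square]
  have 1: "((\<lambda>v. (max 0 (v - c))\<^sup>2) has_real_derivative 2 * max 0 (v - c)) (at v)" for c :: real
    by (rule DERIV_cong[OF d[of "\<lambda>v. v - c" 1]]) (auto intro!: derivative_eq_intros)
  show ?thesis unfolding ramp_def[abs_def]
    by (rule derivative_eq_intros 1 has_derivative_max_square refl)+ (auto simp: hat_def)
qed

lemma ramp_simps:
  "v \<le> 0 \<Longrightarrow> ramp v = 0" "v \<ge> 2 \<Longrightarrow> ramp v = 1"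
  "v \<le> 0 \<Longrightarrow> hat v = 0" "v \<ge> 2 \<Longrightarrow> hat v = 0" "0 \<le> hat v" "hat v \<le> 1"
  by (auto simp: ramp_def hat_def max_def power2_eq_square algebra_simps)

lemma hat_cont: "continuous_on UNIV hat"
  unfolding hat_def[abs_def] by (intro continuous_intros)

lemma ramp_bounds: "0 \<le> ramp v" "ramp v \<le> 1"
proof -
  have mono: "u \<le> w \<Longrightarrow> ramp u \<le> ramp w" for u w
    by (rule DERIV_nonneg_imp_nondecreasing[of u w ramp]) (use ramp_deriv ramp_simps(5) in blast)+
  show "0 \<le> ramp v" "ramp v \<le> 1"
    using mono[of "min 0 v" v] ramp_simps(1)[of "min 0 v"] mono[of v "max 2 v"] ramp_simps(2)[of "max 2 v"]
    by auto
qed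

lemma hat_integral: "has_bochner_integral lborel hat 1"
proof -
  have "has_bochner_integral lborel (\<lambda>v. hat v * indicator {0..2} v) (ramp 2 - ramp 0)"
    by (rule has_bochner_integral_FTC_Icc_real)
       (use ramp_deriv hat_cont in \<open>auto simp: continuous_on_eq_continuous_at\<close>)
  moreover have "(\<lambda>v. hat v * indicator {0..2} v) = hat"
  proof
    fix v show "hat v * indicator {0..2} v = hat v"
      using ramp_simps(3)[of v] ramp_simps(4)[of v] by (cases "v \<le> 0"; cases "v \<ge> 2") auto
  qed
  ultimately show ?thesis by (simp add: ramp_simps)
qed

text \<open>The rescaled tents are an approximate identity concentrated just to the right of s; the
  substitution \<open>u = s + v / n\<close> exposes the limit to dominated convergence.\<close>

lemma hat_average:
  fixes y :: "real \<Rightarrow> 'a::euclidean_space"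
  assumes y: "continuous_on UNIV y" and B: "\<And>u. norm (y u) \<le> B"
  shows "(\<lambda>n. \<integral>u. (real (Suc n) * hat (real (Suc n) * (u - s))) *\<^sub>R y u \<partial>lborel) \<longlonglongrightarrow> y s"
proof -
  have [measurable]: "y \<in> borel_measurable borel" "hat \<in> borel_measurable borel"
    using y hat_cont by (auto intro: borel_measurable_continuous_onI)
  have eq: "(\<integral>u. (real (Suc n) * hat (real (Suc n) * (u - s))) *\<^sub>R y u \<partial>lborel)
      = (\<integral>v. hat v *\<^sub>R y (s + v / real (Suc n)) \<partial>lborel)" for n
  proof -
    define k where "k = real (Suc n)"
    have k: "k > 0" by (simp add: k_def)
    have "(\<integral>u. (k * hat (k * (u - s))) *\<^sub>R y u \<partial>lborel)
        = (1 / k) *\<^sub>R (\<integral>v. (k * hat (k * (s + 1 / k * v - s))) *\<^sub>R y (s + 1 / k * v) \<partial>lborel)"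
      using k by (subst lborel_integral_real_affine[where c="1 / k" and t=s]) auto
    also have "\<dots> = (\<integral>v. (1 / k) *\<^sub>R ((k * hat (k * (s + 1 / k * v - s))) *\<^sub>R y (s + 1 / k * v)) \<partial>lborel)"
      by (rule integral_scaleR_right[symmetric])
    also have "\<dots> = (\<integral>v. hat v *\<^sub>R y (s + v / k) \<partial>lborel)"
      using k by (intro Bochner_Integration.integral_cong) auto
    finally show ?thesis by (simp add: k_def)
  qed
  have "(\<lambda>n. \<integral>v. hat v *\<^sub>R y (s + v / real (Suc n)) \<partial>lborel) \<longlonglongrightarrow> (\<integral>v. hat v *\<^sub>R y s \<partial>lborel)"
  proof (rule integral_dominated_convergence[where w="\<lambda>v. hat v * B"])
    show "integrable lborel (\<lambda>v. hat v * B)"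
      using hat_integral by (auto simp: has_bochner_integral_iff)
    show "AE v in lborel. (\<lambda>n. hat v *\<^sub>R y (s + v / real (Suc n))) \<longlonglongrightarrow> hat v *\<^sub>R y s"
    proof (intro AE_I2 tendsto_scaleR tendsto_const)
      fix v :: real
      have "(\<lambda>n. s + v / real (Suc n)) \<longlonglongrightarrow> s + 0"
        by (intro tendsto_add tendsto_const LIMSEQ_Suc) (rule lim_const_over_n)
      then have *: "(\<lambda>n. s + v / real (Suc n)) \<longlonglongrightarrow> s" by simp
      have "isCont y s" using y by (simp add: continuous_on_eq_continuous_at)
      from isCont_tendsto_compose[OF this *] show "(\<lambda>n. y (s + v / real (Suc n))) \<longlonglongrightarrow> y s" .
    qed
    show "AE v in lborel. norm (hat v *\<^sub>R y (s + v / real (Suc n))) \<le> hat v * B" for n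
      using ramp_simps(5) B by (intro AE_I2) (auto intro!: mult_mono)
  qed auto
  moreover have "(\<integral>v. hat v *\<^sub>R y s \<partial>lborel) = y s"
    using integral_scaleR_left[of "y s" lborel hat] hat_integral by (auto simp: has_bochner_integral_iff)
  ultimately show ?thesis unfolding eq by simp
qed

text \<open>Test functions that step up at s and down at t tend to the indicator of (s, t], and
  their derivatives to the difference of the point masses at s and t. The weak formulation therefore
  becomes the fundamental theorem between interior points.\<close>

lemma weak_deriv_AC:
  fixes x g :: "real \<Rightarrow> 'a::euclidean_space"
  assumes ab: "a \<le> b" and x: "continuous_on {a..b} x" and g: "L2_on a b g"
    and w: "has_weak_deriv a b x g"
  shows "AC a b x (\<lambda>t. indicator {a<..<b} t *\<^sub>R g t)" (is "AC a b x ?g")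
proof -
  have m [measurable]: "?g \<in> borel_measurable borel"
    using g by (auto simp: L2_on_def set_borel_measurable_def)
  have "integrable lborel (\<lambda>t. indicator {a<..<b} t *\<^sub>R (norm (g t))\<^sup>2)"
    using g by (auto simp: L2_on_def set_integrable_def)
  moreover have "(\<lambda>t. indicator {a<..<b} t *\<^sub>R (norm (g t))\<^sup>2) = (\<lambda>t. (norm (?g t))\<^sup>2)"
    by (auto simp: indicator_def fun_eq_iff)
  ultimately have sq: "integrable lborel (\<lambda>t. (norm (?g t))\<^sup>2)" by simp
  have gi: "integrable lborel ?g"
    by (rule square_integrable_imp_integrable[OF m sq, of a b]) auto
  let ?y = "\<lambda>t. x (clamp1 a b t)"
  have y: "continuous_on UNIV ?y" by (rule continuous_clamp1[OF ab x])
  have [measurable]: "?y \<in> borel_measurable borel" "hat \<in> borel_measurable borel"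
    using y hat_cont by (auto intro: borel_measurable_continuous_onI)
  have "bounded (x ` {a..b})" using x by (simp add: compact_continuous_image compact_imp_bounded)
  then obtain B where "\<forall>v\<in>x ` {a..b}. norm v \<le> B" unfolding bounded_iff by blast
  then have B: "\<And>u. norm (?y u) \<le> B"
    using clamp1_in[OF ab] by blast
  let ?I = "\<lambda>t. LINT s:{..t}|lborel. ?g s"
  have inner: "x t - x s = ?I t - ?I s" if st: "a < s" "s < t" "t < b" for s t
  proof -
    define k where "k = (\<lambda>n. real (Suc n))"
    \<comment> \<open>Each step takes a time \<open>2 / k n\<close> to the right of its starting
      point, so the support lies inside (a, b) only once \<open>2 / k n < b - t\<close>.\<close>
    define \<phi> where "\<phi> = (\<lambda>n u. ramp (k n * (u - s)) - ramp (k n * (u - t)))"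
    define \<psi> where "\<psi> = (\<lambda>n u. k n * hat (k n * (u - s)) - k n * hat (k n * (u - t)))"
    have kpos: "k n > 0" for n by (simp add: k_def)
    have \<psi>c: "continuous_on UNIV (\<psi> n)" for n
      unfolding \<psi>_def by (intro continuous_intros continuous_on_compose2[OF hat_cont]) auto
    have \<phi>d: "(\<phi> n has_real_derivative \<psi> n u) (at u)" for n u
    proof -
      have 1: "((\<lambda>u. ramp (k n * (u - c))) has_real_derivative k n * hat (k n * (u - c))) (at u)" for c
        by (rule DERIV_cong[OF DERIV_chain'[OF _ ramp_deriv, of "\<lambda>u. k n * (u - c)" "k n"]])
           (auto intro!: derivative_eq_intros)
      show ?thesis unfolding \<phi>_def \<psi>_def by (intro DERIV_diff 1)
    qed
    have kn: "\<forall>\<^sub>F n in sequentially. 2 / k n < e" if "e > 0" for e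
    proof -
      have "(\<lambda>n. 2 / k n) \<longlonglongrightarrow> 0" unfolding k_def by (rule LIMSEQ_Suc[OF lim_const_over_n])
      then show ?thesis using that order_tendstoD(2) by blast
    qed
    have supp: "\<phi> n u = 0" if "2 / k n < b - t" "u \<notin> {s..t + 2 / k n}" for n u
    proof (cases "u < s")
      case True
      then show ?thesis using st kpos[of n] by (auto simp: \<phi>_def ramp_simps mult_nonneg_nonpos)
    next
      case False
      then have "u > t + 2 / k n" using that by auto
      then have "k n * (u - t) \<ge> 2" "k n * (u - s) \<ge> k n * (u - t)"
        using kpos[of n] st by (auto simp: field_simps)
      then show ?thesis by (auto simp: \<phi>_def ramp_simps)
    qed
    have 1: "(\<lambda>n. \<integral>u. \<psi> n u *\<^sub>R ?y u \<partial>lborel) \<longlonglongrightarrow> ?y s - ?y t"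
    proof -
      have i: "integrable lborel (\<lambda>u. (k n * hat (k n * (u - c))) *\<^sub>R ?y u)" for n c
      proof (rule Bochner_Integration.integrable_bound)
        have "integrable lborel (\<lambda>u. hat (- (k n * c) + k n * u))"
          by (rule lborel_integrable_real_affine) (use hat_integral kpos[of n] in \<open>auto simp: has_bochner_integral_iff\<close>)
        then have "integrable lborel (\<lambda>u. hat (k n * (u - c)))" by (simp add: algebra_simps)
        then show "integrable lborel (\<lambda>u. k n * hat (k n * (u - c)) * B)" by auto
        show "AE u in lborel. norm ((k n * hat (k n * (u - c))) *\<^sub>R ?y u) \<le> norm (k n * hat (k n * (u - c)) * B)"
          using B ramp_simps(5) kpos[of n] order_trans[OF norm_ge_zero B]
          by (intro AE_I2) (auto simp: abs_mult intro!: mult_mono)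
      qed auto
      have "(\<lambda>n. \<integral>u. \<psi> n u *\<^sub>R ?y u \<partial>lborel) =
         (\<lambda>n. (\<integral>u. (k n * hat (k n * (u - s))) *\<^sub>R ?y u \<partial>lborel) - (\<integral>u. (k n * hat (k n * (u - t))) *\<^sub>R ?y u \<partial>lborel))"
        unfolding \<psi>_def scaleR_diff_left by (subst Bochner_Integration.integral_diff) (use i in auto)
      then show ?thesis unfolding k_def by (simp del: of_nat_Suc add: tendsto_diff hat_average[OF y B])
    qed
    have 2: "(\<lambda>n. \<integral>u. \<phi> n u *\<^sub>R ?g u \<partial>lborel) \<longlonglongrightarrow> (\<integral>u. indicator {s<..t} u *\<^sub>R ?g u \<partial>lborel)"
    proof (rule integral_dominated_convergence[where w="\<lambda>u. norm (?g u)"])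
      show "AE u in lborel. (\<lambda>n. \<phi> n u *\<^sub>R ?g u) \<longlonglongrightarrow> indicator {s<..t} u *\<^sub>R ?g u"
      proof (intro AE_I2 tendsto_scaleR tendsto_const tendsto_eventually)
        fix u
        have r: "\<forall>\<^sub>F n in sequentially. ramp (k n * (u - c)) = (if u > c then 1 else 0)" for c
        proof (cases "u > c")
          case True
          from kn[of "u - c"] True have "\<forall>\<^sub>F n in sequentially. 2 / k n < u - c" by auto
          then show ?thesis
          proof eventually_elim
            case (elim n)
            then have "2 \<le> k n * (u - c)" using kpos[of n] by (simp add: field_simps)
            then show ?case using True by (simp add: ramp_simps)
          qed
        next
          case False
          then show ?thesis using kpos by (auto simp: ramp_simps mult_nonneg_nonpos less_imp_le)
        qed
        from r[of s] r[of t] show "\<forall>\<^sub>F n in sequentially. \<phi> n u = indicator {s<..t} u"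
          by eventually_elim (use st in \<open>auto simp: \<phi>_def indicator_def\<close>)
      qed
      show "AE u in lborel. norm (\<phi> n u *\<^sub>R ?g u) \<le> norm (?g u)" for n
      proof (rule AE_I2)
        fix u
        have "\<bar>\<phi> n u\<bar> \<le> 1" unfolding \<phi>_def
          using ramp_bounds[of "k n * (u - s)"] ramp_bounds[of "k n * (u - t)"] by linarith
        then show "norm (\<phi> n u *\<^sub>R ?g u) \<le> norm (?g u)"
          using mult_right_mono[of "\<bar>\<phi> n u\<bar>" 1 "norm (?g u)"] unfolding norm_scaleR by simp
      qed
      show "integrable lborel (\<lambda>u. norm (?g u))" by (rule integrable_norm[OF gi])
      have "continuous_on UNIV (\<phi> n)" for n
        using \<phi>d by (meson DERIV_isCont continuous_at_imp_continuous_on)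
      then have [measurable]: "\<phi> n \<in> borel_measurable borel" for n
        by (rule borel_measurable_continuous_onI)
      show "(\<lambda>u. \<phi> n u *\<^sub>R ?g u) \<in> borel_measurable lborel" for n by measurable
      show "(\<lambda>u. indicator {s<..t} u *\<^sub>R ?g u) \<in> borel_measurable lborel" by measurable
    qed
    have "\<forall>\<^sub>F n in sequentially. (\<integral>u. \<psi> n u *\<^sub>R ?y u \<partial>lborel) = - (\<integral>u. \<phi> n u *\<^sub>R ?g u \<partial>lborel)"
      using kn[of "b - t", simplified, OF st(3)]
    proof eventually_elim
      case (elim n)
      have "(LINT u:{a<..<b}|lborel. \<psi> n u *\<^sub>R x u) = - (LINT u:{a<..<b}|lborel. \<phi> n u *\<^sub>R g u)"
      proof (rule w[unfolded has_weak_deriv_def, rule_format], intro conjI exI)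
        show "\<forall>u. (\<phi> n has_real_derivative \<psi> n u) (at u)" using \<phi>d by blast
        show "continuous_on UNIV (\<psi> n)" by (rule \<psi>c)
        show "a < s" "s < t + 2 / k n" "t + 2 / k n < b" using st elim kpos[of n] by (auto simp: add_pos_pos less_trans[of s t])
        show "\<forall>u. u \<notin> {s..t + 2 / k n} \<longrightarrow> \<phi> n u = 0" using supp[OF elim] by blast
      qed
      moreover have "(LINT u:{a<..<b}|lborel. \<psi> n u *\<^sub>R x u) = (\<integral>u. \<psi> n u *\<^sub>R ?y u \<partial>lborel)"
        unfolding set_lebesgue_integral_def
      proof (rule Bochner_Integration.integral_cong[OF refl])
        fix u
        show "indicat_real {a<..<b} u *\<^sub>R \<psi> n u *\<^sub>R x u = \<psi> n u *\<^sub>R ?y u"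
        proof (cases "u \<in> {a<..<b}")
          case True
          then show ?thesis using clamp1_id[of u a b] by auto
        next
          case False
          have "hat (k n * (u - c)) = 0" if c: "a < c" "c + 2 / k n < b" for c
          proof (cases "u \<le> c")
            case True
            then show ?thesis using kpos[of n] by (simp add: ramp_simps mult_nonneg_nonpos)
          next
            case F: False
            then have "u \<ge> c + 2 / k n" using False c by auto
            then have "k n * (u - c) \<ge> 2" using kpos[of n] by (simp add: field_simps)
            then show ?thesis by (simp add: ramp_simps)
          qed
          from this[of s] this[of t] have "\<psi> n u = 0" using elim st by (simp add: \<psi>_def)
          then show ?thesis by simp
        qed
      qed
      moreover have "(LINT u:{a<..<b}|lborel. \<phi> n u *\<^sub>R g u) = (\<integral>u. \<phi> n u *\<^sub>R ?g u \<partial>lborel)"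
        unfolding set_lebesgue_integral_def by (auto simp: mult.commute)
      ultimately show ?case by simp
    qed
    with 1 have "(\<lambda>n. - (\<integral>u. \<phi> n u *\<^sub>R ?g u \<partial>lborel)) \<longlonglongrightarrow> ?y s - ?y t"
      by (rule Lim_transform_eventually)
    moreover from tendsto_minus[OF 2] have "(\<lambda>n. - (\<integral>u. \<phi> n u *\<^sub>R ?g u \<partial>lborel))
        \<longlonglongrightarrow> - (LINT u:{s<..t}|lborel. ?g u)" by (simp add: set_lebesgue_integral_def)
    ultimately have "?y s - ?y t = - (LINT u:{s<..t}|lborel. ?g u)" using LIMSEQ_unique by blast
    moreover have "?y s = x s" "?y t = x t" using st clamp1_id by auto
    ultimately show ?thesis
      using set_integral_atMost_diff[OF gi, of s t] st by (simp add: algebra_simps)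
  qed
  \<comment> \<open>So far the identity holds between interior points only. The difference z is
    constant there, and continuity extends this to the closed interval.\<close>
  define z where "z = (\<lambda>t. ?y t - ?I t)"
  have zc: "continuous_on UNIV z"
    unfolding z_def by (intro continuous_intros y continuous_indefinite_integral[OF gi])
  have zeq: "z t = z a" if t: "t \<in> {a..b}" for t
  proof (cases "a < b")
    case True
    define m where "m = (a + b) / 2"
    have m: "a < m" "m < b" using True by (auto simp: m_def)
    have inn: "z u = z m" if "u \<in> {a<..<b}" for u
      using inner[of u m] inner[of m u] that m clamp1_id[of u a b] clamp1_id[of m a b]
      by (cases u m rule: linorder_cases) (auto simp: z_def algebra_simps)
    have cl: "closure {a<..<b} = {a..b}" using True by simp
    have "z u = z m" if "u \<in> {a..b}" for u
      by (rule continuous_constant_on_closure[of "{a<..<b}" z "z m" u])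
         (use that cl inn in \<open>auto intro: continuous_on_subset[OF zc]\<close>)
    from this[OF t] this[of a] True show ?thesis by auto
  next
    case False
    then have "t = a" using t by auto
    then show ?thesis by simp
  qed
  have Ia: "?I a = 0"
    unfolding set_lebesgue_integral_def by (rule integral_eq_zero_AE) (auto simp: indicator_def)
  show ?thesis
    unfolding AC_def
  proof (intro conjI ballI allI impI m sq)
    fix t assume "t \<in> {a..b}"
    then show "x t = x a + ?I t"
      using zeq[of t] Ia clamp1_id[of t a b] clamp1_id[of a a b] ab by (simp add: z_def algebra_simps)
  qed (auto simp: indicator_def)
qed

text \<open>The positive and the negative part of f are densities of measures that are finite and
  equal on all rays \<open>{x<..}\<close>. Such measures coincide, hence so do their densities
  almost everywhere.\<close>

lemma integral_Ioc_zero_real: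
  fixes f :: "real \<Rightarrow> real"
  assumes f: "integrable lborel f" and z: "\<And>t. (LINT u:{..t}|lborel. f u) = 0"
  shows "AE u in lborel. f u = 0"
proof -
  have [measurable]: "f \<in> borel_measurable borel" using f by auto
  have split: "integrable lborel (\<lambda>u. max 0 (f u))" "integrable lborel (\<lambda>u. max 0 (- f u))"
    using f by (auto intro!: Bochner_Integration.integrable_bound[OF f])
  have tot: "(\<integral>u. f u \<partial>lborel) = 0"
  proof -
    have "((\<lambda>t. LINT u:{..t}|lborel. f u) \<longlongrightarrow> (\<integral>u. f u \<partial>lborel)) at_top"
      unfolding set_lebesgue_integral_def
    proof (rule integral_dominated_convergence_at_top[where w="\<lambda>u. \<bar>f u\<bar>"])
      show "AE x in lborel. ((\<lambda>i. indicat_real {..i} x *\<^sub>R f x) \<longlongrightarrow> f x) at_top"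
      proof (intro AE_I2 tendsto_eventually)
        fix x show "\<forall>\<^sub>F i in at_top. indicat_real {..i} x *\<^sub>R f x = f x"
          using eventually_ge_at_top[of x] by eventually_elim auto
      qed
    qed (use f in \<open>auto simp: indicator_def\<close>)
    then show ?thesis using z by (simp add: tendsto_const_iff)
  qed
  have gt: "(LINT u:{x<..}|lborel. f u) = 0" for x
  proof -
    have "(LINT u:{..x} \<union> {x<..}|lborel. f u) = (LINT u:{..x}|lborel. f u) + (LINT u:{x<..}|lborel. f u)"
      by (rule set_integral_Un) (auto intro: set_integrable_of_integrable[OF f])
    moreover have "{..x} \<union> {x<..} = UNIV" by auto
    ultimately show ?thesis using z tot by (simp add: set_lebesgue_integral_def)
  qed
  have em: "emeasure (density lborel (\<lambda>u. ennreal (max 0 (h u)))) {x<..} = ennreal (LINT u:{x<..}|lborel. max 0 (h u))"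
    if "integrable lborel (\<lambda>u. max 0 (h u))" for h :: "real \<Rightarrow> real" and x
  proof -
    have [measurable]: "(\<lambda>u. max 0 (h u)) \<in> borel_measurable borel" using that by auto
    have "integrable lborel (\<lambda>u. indicator {x<..} u *\<^sub>R max 0 (h u))"
      using that by (intro integrable_mult_indicator) auto
    then have "(\<integral>\<^sup>+u. ennreal (indicator {x<..} u *\<^sub>R max 0 (h u)) \<partial>lborel) = ennreal (LINT u:{x<..}|lborel. max 0 (h u))"
      unfolding set_lebesgue_integral_def by (intro nn_integral_eq_integral) auto
    moreover have "(\<lambda>u. ennreal (indicator {x<..} u *\<^sub>R max 0 (h u))) = (\<lambda>u. ennreal (max 0 (h u)) * indicator {x<..} u)"
      by (auto simp: indicator_def fun_eq_iff)
    ultimately show ?thesis by (subst emeasure_density) auto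
  qed
  have "density lborel (\<lambda>u. ennreal (max 0 (f u))) = density lborel (\<lambda>u. ennreal (max 0 (- f u)))"
  proof (rule measure_eqI_lessThan)
    fix x
    show "emeasure (density lborel (\<lambda>u. ennreal (max 0 (f u)))) {x<..} < \<infinity>"
      unfolding em[OF split(1)] by simp
    have "(LINT u:{x<..}|lborel. max 0 (f u)) - (LINT u:{x<..}|lborel. max 0 (- f u)) = (LINT u:{x<..}|lborel. f u)"
      by (subst set_integral_diff(2)[symmetric])
         (auto intro!: set_integrable_of_integrable split set_lebesgue_integral_cong)
    then show "emeasure (density lborel (\<lambda>u. ennreal (max 0 (f u)))) {x<..} = emeasure (density lborel (\<lambda>u. ennreal (max 0 (- f u)))) {x<..}"
      unfolding em[OF split(1)] em[OF split(2)] gt by simp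
  qed auto
  then have "AE u in lborel. ennreal (max 0 (f u)) = ennreal (max 0 (- f u))"
    by (subst (asm) sigma_finite_measure.density_unique_iff[OF sigma_finite_lborel]) auto
  then show ?thesis
  proof eventually_elim
    case (elim u)
    then have "max 0 (f u) = max 0 (- f u)" by (subst (asm) ennreal_inj) auto
    then show ?case by (auto simp: max_def split: if_splits)
  qed
qed

lemma AE_zero_componentwise:
  fixes f :: "real \<Rightarrow> 'a::euclidean_space"
  assumes "\<And>i. i \<in> Basis \<Longrightarrow> AE u in lborel. f u \<bullet> i = 0"
  shows "AE u in lborel. f u = 0"
proof -
  have "AE u in lborel. \<forall>i\<in>Basis. f u \<bullet> i = 0"
    using assms by (intro AE_finite_allI) auto
  then show ?thesis by eventually_elim (simp add: euclidean_all_zero_iff)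
qed

lemma integral_Ioc_zero:
  fixes f :: "real \<Rightarrow> 'a::euclidean_space"
  assumes f: "integrable lborel f" and z: "\<And>t. (LINT u:{..t}|lborel. f u) = 0"
  shows "AE u in lborel. f u = 0"
proof (rule AE_zero_componentwise)
  fix i :: 'a assume "i \<in> Basis"
  have "(LINT u:{..t}|lborel. f u \<bullet> i) = (LINT u:{..t}|lborel. f u) \<bullet> i" for t
    using set_integrable_of_integrable[OF f, of "{..t}"] unfolding set_lebesgue_integral_def set_integrable_def
    by (subst integral_inner_left[symmetric]) auto
  then show "AE u in lborel. f u \<bullet> i = 0"
    using z f by (intro integral_Ioc_zero_real) auto
qed

lemma AC_unique:
  assumes ab: "a \<le> b" and "AC a b x g" "AC a b x h"
  shows "AE u in lborel. g u = h u"
proof -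
  have i: "integrable lborel g" "integrable lborel h" using assms AC_integrable by auto
  have "(LINT u:{..t}|lborel. g u - h u) = 0" for t
  proof -
    \<comment> \<open>Densities vanish off (a, b), so agreement of the integrals for t in
      \<open>{a..b}\<close> gives agreement for all t.\<close>
    have red: "(LINT u:{..t}|lborel. k u) = (LINT u:{..clamp1 a b t}|lborel. k u)" if "AC a b x k" for k
      unfolding set_lebesgue_integral_def
      by (rule Bochner_Integration.integral_cong[OF refl])
         (use AC_zero[OF that] ab in \<open>auto simp: indicator_def clamp1_def max_def min_def split: if_splits\<close>)
    have "(LINT u:{..t}|lborel. g u) = (LINT u:{..t}|lborel. h u)"
      unfolding red[OF assms(2)] red[OF assms(3)]
      using AC_eq[OF assms(2), of "clamp1 a b t"] AC_eq[OF assms(3), of "clamp1 a b t"] clamp1_in[OF ab, of t] by simp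
    then show ?thesis by (subst set_integral_diff(2)) (auto intro: set_integrable_of_integrable i)
  qed
  then have "AE u in lborel. g u - h u = 0" using i by (intro integral_Ioc_zero) auto
  then show ?thesis by eventually_elim simp
qed

lemma H1_AC:
  assumes "a \<le> b" "x \<in> H1 a b"
  shows "AC a b x (\<lambda>t. indicator {a<..<b} t *\<^sub>R weak_deriv a b x t)"
proof -
  have "\<exists>g. L2_on a b g \<and> has_weak_deriv a b x g" using assms by (auto simp: H1_def)
  then have "L2_on a b (weak_deriv a b x) \<and> has_weak_deriv a b x (weak_deriv a b x)"
    unfolding weak_deriv_def by (rule someI_ex)
  then show ?thesis using assms by (intro weak_deriv_AC) (auto simp: H1_def)
qed

text \<open>Makes the choice hidden in \<open>weak_deriv\<close> harmless: any density of the path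
  computes the action, by uniqueness almost everywhere.\<close>

lemma action_AC:
  assumes ab: "a \<le> b" and g: "AC a b x g"
  shows "action W a b x = (\<integral>\<^sup>+t\<in>{a<..<b}. (ennreal ((norm (g t))\<^sup>2 / 2) + potential W (x t)) \<partial>lborel)"
proof -
  have "AE t in lborel. indicator {a<..<b} t *\<^sub>R weak_deriv a b x t = g t"
    using AC_unique[OF ab H1_AC[OF ab AC_H1[OF ab g]] g] .
  then have "AE t in lborel. (ennreal ((norm (weak_deriv a b x t))\<^sup>2 / 2) + potential W (x t)) * indicator {a<..<b} t
     = (ennreal ((norm (g t))\<^sup>2 / 2) + potential W (x t)) * indicator {a<..<b} t"
    by eventually_elim (auto simp: indicator_def split: if_splits)
  then show ?thesis unfolding action_def by (rule nn_integral_cong_AE)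
qed

section \<open>Criteria for absolute continuity\<close>

text \<open>The density is obtained from the theorem of Radon and Nikodym, applied to the image of Lebesgue
  measure under the inverse of \<open>F\<close>; this avoids differentiating \<open>F\<close> almost everywhere.\<close>

lemma lipschitz_has_density:
  fixes F :: "real \<Rightarrow> real"
  assumes c: "c > 0" and lo: "\<And>s t. s \<le> t \<Longrightarrow> c * (t - s) \<le> F t - F s"
    and up: "\<And>s t. s \<le> t \<Longrightarrow> F t - F s \<le> C * (t - s)"
  obtains k where "k \<in> borel_measurable borel" "\<And>t. 0 \<le> k t"
    "\<And>s t. s \<le> t \<Longrightarrow> (\<integral>\<^sup>+u. ennreal (k u) * indicator {s<..t} u \<partial>lborel) = ennreal (F t - F s)"
proof -
  have sm: "F s < F t" if "s < t" for s t
  proof -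
    have "c * (t - s) > 0" using that c by simp
    then show ?thesis using lo[of s t] that by linarith
  qed
  then have smF: "strict_mono F" by (simp add: strict_mono_def)
  have C: "C > 0" using up[of 0 1] lo[of 0 1] c by auto
  have abs: "\<bar>F t - F s\<bar> \<le> C * \<bar>t - s\<bar>" for s t
  proof (cases "s \<le> t")
    case True
    then have "c * (t - s) \<ge> 0" using c by simp
    then show ?thesis using up[OF True] lo[OF True] True by (simp add: abs_of_nonneg)
  next
    case False
    then have "c * (s - t) \<ge> 0" "t \<le> s" using c by auto
    then show ?thesis using up[of t s] lo[of t s] by (simp add: abs_of_nonneg abs_minus_commute)
  qed
  have contF: "continuous_on UNIV F"
    by (rule lipschitz_on_continuous_on[of C]) (use abs C in \<open>auto simp: lipschitz_on_def dist_real_def\<close>)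
  have surj: "\<exists>t. F t = y" for y
  proof -
    \<comment> \<open>By the lower slope bound c, the values of F at - r and r lie on either side of
      y.\<close>
    define r where "r = \<bar>y - F 0\<bar> / c + 1"
    have r: "r > 0" "c * r > \<bar>y - F 0\<bar>" using c by (auto simp: r_def field_simps add_pos_nonneg intro!: add_nonneg_pos)
    have "F (-r) \<le> y" "y \<le> F r" using lo[of "-r" 0] lo[of 0 r] r by auto
    then have "\<exists>t\<ge>-r. t \<le> r \<and> F t = y"
      using r by (intro IVT' continuous_on_subset[OF contF subset_UNIV]) auto
    then show ?thesis by blast
  qed
  define G where "G = inv F"
  have FG: "F (G y) = y" and GF: "G (F t) = t" for y t
    unfolding G_def using surj smF by (metis f_inv_into_f rangeI, simp add: strict_mono_imp_inj_on)
  have "mono G"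
    by (rule monoI) (metis FG linorder_not_less sm)
  then have Gm [measurable]: "G \<in> borel_measurable borel" by (rule borel_measurable_mono)
  \<comment> \<open>\<open>N A\<close> is the Lebesgue measure of the image of A under F. The
    Lipschitz bound makes F map null sets to null sets, whence absolute continuity; the bound from
    below supplied the inverse G.\<close>
  define N where "N = distr lborel borel G"
  have vim: "G -` A = F ` A" for A
    using FG GF by (auto simp: image_iff) (metis FG)
  have Nem: "emeasure N A = emeasure lborel (F ` A)" if "A \<in> sets borel" for A
    using that unfolding N_def by (subst emeasure_distr) (auto simp: vim)
  have F_Ioc: "F ` {s<..t} = {F s<..F t}" for s t
  proof -
    have *: "F u \<in> {F s<..F t} \<longleftrightarrow> u \<in> {s<..t}" for u
      using smF by (simp add: strict_mono_less strict_mono_less_eq)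
    show ?thesis
    proof (intro set_eqI iffI)
      fix y assume "y \<in> {F s<..F t}"
      moreover obtain u where "F u = y" using surj by blast
      ultimately show "y \<in> F ` {s<..t}" using * by blast
    next
      fix y assume "y \<in> F ` {s<..t}"
      then show "y \<in> {F s<..F t}" using * by blast
    qed
  qed
  have "absolutely_continuous lborel N"
    unfolding absolutely_continuous_def
  proof
    fix A :: "real set" assume A: "A \<in> null_sets lborel"
    then have Ab: "A \<in> sets borel" by auto
    have "negligible A"
      using A by (auto simp: negligible_iff_null_sets null_sets_completionI)
    then have "negligible (F ` A)"
    proof (rule negligible_locally_Lipschitz_image[OF order_refl])
      fix x assume "x \<in> A"
      show "\<exists>T B. open T \<and> x \<in> T \<and> (\<forall>y\<in>A \<inter> T. norm (F y - F x) \<le> B * norm (y - x))"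
        using abs by (intro exI[of _ UNIV] exI[of _ C]) auto
    qed
    moreover have "F ` A \<in> sets lborel"
      using measurable_sets[OF Gm Ab] by (simp add: vim)
    ultimately have "F ` A \<in> null_sets lborel"
      by (simp add: negligible_iff_null_sets null_sets_completion_iff)
    then show "A \<in> null_sets N"
      using Ab Nem[OF Ab] by (auto simp: null_sets_def N_def)
  qed
  then obtain f where f: "f \<in> borel_measurable lborel" "density lborel f = N"
    using sigma_finite_measure.Radon_Nikodym[OF sigma_finite_lborel, of N] by (auto simp: N_def)
  then have [measurable]: "f \<in> borel_measurable borel" by simp
  have ff: "(\<integral>\<^sup>+u. f u * indicator {s<..t} u \<partial>lborel) = ennreal (F t - F s)" if "s \<le> t" for s t
    using Nem[of "{s<..t}"] f(2) that smF emeasure_density[of f lborel "{s<..t}"]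
    by (auto simp: F_Ioc strict_mono_less_eq)
  have fin: "AE u in lborel. f u < \<infinity>"
  proof -
    have "AE u in lborel. f u * indicator {- real n<..real n} u \<noteq> \<infinity>" for n
      by (rule nn_integral_PInf_AE) (use ff[of "- real n" "real n"] in auto)
    then have "AE u in lborel. \<forall>n. f u * indicator {- real n<..real n} u \<noteq> \<infinity>"
      by (simp add: AE_all_countable)
    then show ?thesis
    proof eventually_elim
      case (elim u)
      obtain n where "real n > \<bar>u\<bar>" using reals_Archimedean2 by blast
      then have "u \<in> {- real n<..real n}" by auto
      then show ?case using elim[rule_format, of n] by (auto simp: less_top)
    qed
  qed
  show ?thesis
  proof (rule that[of "\<lambda>u. enn2real (f u)"])
    fix s t :: real assume "s \<le> t"
    have "(\<integral>\<^sup>+u. ennreal (enn2real (f u)) * indicator {s<..t} u \<partial>lborel) = (\<integral>\<^sup>+u. f u * indicator {s<..t} u \<partial>lborel)"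
      by (rule nn_integral_cong_AE) (use fin in \<open>eventually_elim, auto\<close>)
    then show "(\<integral>\<^sup>+u. ennreal (enn2real (f u)) * indicator {s<..t} u \<partial>lborel) = ennreal (F t - F s)"
      using ff[OF \<open>s \<le> t\<close>] by simp
  qed auto
qed

lemma lipschitz_has_density_on:
  fixes F :: "real \<Rightarrow> real"
  assumes ab: "a \<le> b" and c: "c > 0" and lo: "\<And>s t. a \<le> s \<Longrightarrow> s \<le> t \<Longrightarrow> t \<le> b \<Longrightarrow> c * (t - s) \<le> F t - F s"
    and up: "\<And>s t. a \<le> s \<Longrightarrow> s \<le> t \<Longrightarrow> t \<le> b \<Longrightarrow> F t - F s \<le> C * (t - s)"
  obtains k where "\<And>t. 0 \<le> k t" "integrable lborel k" "\<And>t. t \<notin> {a<..<b} \<Longrightarrow> k t = 0"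
    "\<And>t. t \<in> {a..b} \<Longrightarrow> F t - F a = (LINT u:{..t}|lborel. k u)"
proof -
  \<comment> \<open>Extending F with slope 1 outside \<open>{a..b}\<close> preserves bounds on the
    slope from both sides, with constants \<open>min c 1\<close> and \<open>max C 1\<close>.\<close>
  define H where "H = (\<lambda>t. F (clamp1 a b t) + (t - clamp1 a b t))"
  have loH: "min c 1 * (t - s) \<le> H t - H s" and upH: "H t - H s \<le> max C 1 * (t - s)" if st: "s \<le> t" for s t
  proof -
    let ?s = "clamp1 a b s" and ?t = "clamp1 a b t"
    have i: "a \<le> ?s" "?s \<le> ?t" "?t \<le> b" using clamp1_in[OF ab] clamp1_mono[OF st] by auto
    have o: "(t - s) - (?t - ?s) \<ge> 0" using ab st by (auto simp: clamp1_def max_def min_def)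
    have "min c 1 * (t - s) = min c 1 * (?t - ?s) + min c 1 * ((t - s) - (?t - ?s))" by (simp add: algebra_simps)
    also have "\<dots> \<le> c * (?t - ?s) + 1 * ((t - s) - (?t - ?s))"
      using i o by (intro add_mono mult_right_mono) auto
    also have "\<dots> \<le> H t - H s" using lo[OF i] by (simp add: H_def)
    finally show "min c 1 * (t - s) \<le> H t - H s" .
    have "H t - H s \<le> C * (?t - ?s) + 1 * ((t - s) - (?t - ?s))"
      using up[OF i] by (simp add: H_def)
    also have "\<dots> \<le> max C 1 * (?t - ?s) + max C 1 * ((t - s) - (?t - ?s))"
      using i o by (intro add_mono mult_right_mono) auto
    also have "\<dots> = max C 1 * (t - s)" by (simp add: algebra_simps)
    finally show "H t - H s \<le> max C 1 * (t - s)" .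
  qed
  obtain k where k: "k \<in> borel_measurable borel" "\<And>t. 0 \<le> k t"
    "\<And>s t. s \<le> t \<Longrightarrow> (\<integral>\<^sup>+u. ennreal (k u) * indicator {s<..t} u \<partial>lborel) = ennreal (H t - H s)"
    by (rule lipschitz_has_density[of "min c 1" H "max C 1"]) (use c loH upH in auto)
  note [measurable] = k(1)
  let ?k = "\<lambda>u. indicator {a<..<b} u * k u"
  have *: "(\<integral>\<^sup>+u. ennreal (indicator {..t} u * ?k u) \<partial>lborel) = ennreal (F t - F a)" if "t \<in> {a..b}" for t
  proof -
    have "(\<integral>\<^sup>+u. ennreal (indicator {..t} u * ?k u) \<partial>lborel) = (\<integral>\<^sup>+u. ennreal (k u) * indicator {a<..t} u \<partial>lborel)"
      by (rule nn_integral_cong_AE, rule AE_mp[OF AE_lborel_singleton[of b]], rule AE_I2)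
         (use that in \<open>auto simp: indicator_def\<close>)
    also have "\<dots> = ennreal (F t - F a)"
      using k(3)[of a t] that clamp1_id[of a a b] clamp1_id[of t a b] by (auto simp: H_def)
    finally show ?thesis .
  qed
  have ineq: "F t - F a \<ge> 0" if "t \<in> {a..b}" for t
  proof -
    have "c * (t - a) \<ge> 0" using that c by simp
    then show ?thesis using lo[of a t] that by auto
  qed
  show ?thesis
  proof (rule that[of ?k])
    show "integrable lborel ?k"
    proof (rule integrableI_nonneg)
      have "?k u = indicator {..b} u * ?k u" for u by (auto simp: indicator_def)
      then have e: "(\<lambda>u. ennreal (?k u)) = (\<lambda>u. ennreal (indicator {..b} u * ?k u))" by presburger
      show "(\<integral>\<^sup>+u. ennreal (?k u) \<partial>lborel) < \<infinity>" unfolding e using *[of b] ab by simp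
    qed (use k(2) in auto)
    fix t assume t: "t \<in> {a..b}"
    have "(LINT u:{..t}|lborel. ?k u) = enn2real (\<integral>\<^sup>+u. ennreal (indicator {..t} u * ?k u) \<partial>lborel)"
      unfolding set_lebesgue_integral_def by (subst integral_eq_nn_integral) (use k(2) in auto)
    then show "F t - F a = (LINT u:{..t}|lborel. ?k u)"
      using *[OF t] ineq[OF t] by simp
  qed (use k(2) in auto)
qed

text \<open>For each vector u the scalar function
  \<open>(norm u + 1 / real (Suc n)) * P t - u \<bullet> x t\<close> is increasing. The summand
  \<open>1 / real (Suc n)\<close> bounds its slope away from 0, as the scalar density lemma
  requires. That its density is nonnegative says that the density h of x satisfies
  \<open>u \<bullet> h t \<le> norm u * M t\<close> in the limit, and the choice
  \<open>u = h t\<close> bounds the norm of h.\<close>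

lemma AC_of_metric_bound:
  fixes x :: "real \<Rightarrow> 'a::euclidean_space"
  assumes ab: "a \<le> b" and M: "continuous_on {a..b} M" "\<And>t. t \<in> {a..b} \<Longrightarrow> M t > 0"
    and P: "\<And>t. t \<in> {a..b} \<Longrightarrow> (P has_real_derivative M t) (at t within {a..b})"
    and x: "\<And>s t. a \<le> s \<Longrightarrow> s \<le> t \<Longrightarrow> t \<le> b \<Longrightarrow> norm (x t - x s) \<le> P t - P s"
  obtains g where "AC a b x g" "\<And>t. t \<in> {a..b} \<Longrightarrow> norm (g t) \<le> M t"
proof -
  let ?M = "\<lambda>t. indicator {a<..<b} t * M t"
  have PI: "(\<integral>u. indicator {s..t} u *\<^sub>R M u \<partial>lborel) = P t - P s" if "a \<le> s" "s \<le> t" "t \<le> b" for s t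
  proof (rule integral_FTC_Icc[OF that(2)])
    fix u assume u: "s \<le> u" "u \<le> t"
    have "(P has_real_derivative M u) (at u within {s..t})"
      by (rule DERIV_subset[OF P]) (use u that in auto)
    then show "(P has_vector_derivative M u) (at u within {s..t})"
      by (simp add: has_real_derivative_iff_has_vector_derivative)
  next
    show "continuous_on {s..t} M" by (rule continuous_on_subset[OF M(1)]) (use that in auto)
  qed
  obtain t0 where t0: "t0 \<in> {a..b}" "\<And>t. t \<in> {a..b} \<Longrightarrow> M t0 \<le> M t"
    using continuous_attains_inf[of "{a..b}" M] ab M(1) by auto
  obtain t1 where t1: "t1 \<in> {a..b}" "\<And>t. t \<in> {a..b} \<Longrightarrow> M t \<le> M t1"
    using continuous_attains_sup[of "{a..b}" M] ab M(1) by auto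
  have Mi: "integrable lborel (\<lambda>u. indicator {a..b} u *\<^sub>R M u)"
    using borel_integrable_atLeastAtMost'[OF M(1)] by (simp add: set_integrable_def)
  have Meq: "?M = (\<lambda>u. indicator {a<..<b} u *\<^sub>R (indicator {a..b} u *\<^sub>R M u))"
    by (auto simp: indicator_def fun_eq_iff)
  have Mi': "integrable lborel ?M"
    unfolding Meq by (rule integrable_mult_indicator[OF _ Mi]) auto
  have P1: "P t - P s \<le> M t1 * (t - s)" and P0: "M t0 * (t - s) \<le> P t - P s" if st: "a \<le> s" "s \<le> t" "t \<le> b" for s t
  proof -
    have ii: "integrable lborel (\<lambda>u. indicator {s..t} u *\<^sub>R M u)"
      using borel_integrable_atLeastAtMost'[OF continuous_on_subset[OF M(1), of "{s..t}"]] st by (simp add: set_integrable_def)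
    have ic: "integrable lborel (\<lambda>u. indicator {s..t} u *\<^sub>R c)" for c :: real
      using borel_integrable_atLeastAtMost'[of s t "\<lambda>_. c"] by (simp add: set_integrable_def)
    have "(\<integral>u. indicator {s..t} u *\<^sub>R c \<partial>lborel) = c * (t - s)" for c :: real
      using st by simp
    moreover have "(\<integral>u. indicator {s..t} u *\<^sub>R M u \<partial>lborel) \<le> (\<integral>u. indicator {s..t} u *\<^sub>R M t1 \<partial>lborel)"
      using st t1(2) by (intro Bochner_Integration.integral_mono ii ic) (auto simp: indicator_def)
    moreover have "(\<integral>u. indicator {s..t} u *\<^sub>R M t0 \<partial>lborel) \<le> (\<integral>u. indicator {s..t} u *\<^sub>R M u \<partial>lborel)"
      using st t0(2) by (intro Bochner_Integration.integral_mono ii ic) (auto simp: indicator_def)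
    ultimately show "P t - P s \<le> M t1 * (t - s)" "M t0 * (t - s) \<le> P t - P s" using PI[OF st] st by (auto simp: mult.commute)
  qed
  have m0: "M t0 > 0" "M t1 > 0" using M(2) t0 t1 by auto
  have PM: "P t - P a = (LINT u:{..t}|lborel. ?M u)" if t: "t \<in> {a..b}" for t
  proof -
    have "(\<integral>u. indicator {a..t} u *\<^sub>R M u \<partial>lborel) = (LINT u:{..t}|lborel. ?M u)"
      unfolding set_lebesgue_integral_def
    proof (rule integral_cong_AE)
      show "AE u in lborel. indicat_real {a..t} u *\<^sub>R M u = indicat_real {..t} u *\<^sub>R (indicat_real {a<..<b} u * M u)"
        by (rule AE_mp[OF AE_lborel_singleton[of a]], rule AE_mp[OF AE_lborel_singleton[of b]], rule AE_I2)
           (use t in \<open>auto simp: indicator_def\<close>)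
      show "(\<lambda>u. indicat_real {a..t} u *\<^sub>R M u) \<in> borel_measurable lborel"
        using borel_integrable_atLeastAtMost'[OF continuous_on_subset[OF M(1), of "{a..t}"]] t by (auto simp: set_integrable_def)
      show "(\<lambda>u. indicat_real {..t} u *\<^sub>R (indicat_real {a<..<b} u * M u)) \<in> borel_measurable lborel"
        using borel_measurable_integrable[OF Mi'] by measurable
    qed
    then show ?thesis using PI[of a t] t by auto
  qed
  have dens: "\<exists>k. (\<forall>t. 0 \<le> k t) \<and> integrable lborel k \<and> (\<forall>t. t \<notin> {a<..<b} \<longrightarrow> k t = 0) \<and>
     (\<forall>t\<in>{a..b}. (norm u + 1 / real (Suc n)) * (P t - P a) - u \<bullet> (x t - x a) = (LINT s:{..t}|lborel. k s))"
    for u :: 'a and n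
  proof -
    let ?\<nu> = "norm u + 1 / real (Suc n)"
    let ?F = "\<lambda>t. ?\<nu> * P t - u \<bullet> x t"
    have cs: "\<bar>u \<bullet> (x t - x s)\<bar> \<le> norm u * (P t - P s)" if "a \<le> s" "s \<le> t" "t \<le> b" for s t
      using Cauchy_Schwarz_ineq2[of u "x t - x s"] x[OF that] mult_left_mono[of "norm (x t - x s)" "P t - P s" "norm u"] by auto
    obtain k where k: "\<And>t. 0 \<le> k t" "integrable lborel k" "\<And>t. t \<notin> {a<..<b} \<Longrightarrow> k t = 0"
      "\<And>t. t \<in> {a..b} \<Longrightarrow> ?F t - ?F a = (LINT u:{..t}|lborel. k u)"
    proof (rule lipschitz_has_density_on[OF ab, of "1 / real (Suc n) * M t0" ?F "(?\<nu> + norm u) * M t1"])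
      fix s t assume st: "a \<le> s" "s \<le> t" "t \<le> b"
      have e: "?F t - ?F s = ?\<nu> * (P t - P s) - u \<bullet> (x t - x s)"
        unfolding right_diff_distrib inner_diff_right by linarith
      have "1 / real (Suc n) * (M t0 * (t - s)) \<le> 1 / real (Suc n) * (P t - P s)"
        using P0[OF st] by (intro mult_left_mono) auto
      also have "\<dots> \<le> ?F t - ?F s" unfolding e using cs[OF st] unfolding distrib_right by linarith
      finally show "1 / real (Suc n) * M t0 * (t - s) \<le> ?F t - ?F s" by (simp only: mult.assoc)
      have "?F t - ?F s \<le> (?\<nu> + norm u) * (P t - P s)" unfolding e using cs[OF st] unfolding distrib_right by linarith
      also have "\<dots> \<le> (?\<nu> + norm u) * (M t1 * (t - s))"
        using P1[OF st] by (intro mult_left_mono) auto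
      finally show "?F t - ?F s \<le> (?\<nu> + norm u) * M t1 * (t - s)" by (simp only: mult.assoc)
    qed (use m0 in auto)
    have "?\<nu> * (P t - P a) - u \<bullet> (x t - x a) = (LINT s:{..t}|lborel. k s)" if "t \<in> {a..b}" for t
      using k(4)[OF that] unfolding right_diff_distrib inner_diff_right by linarith
    then show ?thesis using k(1-3) by blast
  qed
  then obtain K where K: "\<And>u n t. 0 \<le> K u n t" "\<And>u n. integrable lborel (K u n)"
    "\<And>u n t. t \<notin> {a<..<b} \<Longrightarrow> K u n t = 0"
    "\<And>u n t. t \<in> {a..b} \<Longrightarrow> (norm u + 1 / real (Suc n)) * (P t - P a) - u \<bullet> (x t - x a) = (LINT s:{..t}|lborel. K u n s)"
    by metis
  \<comment> \<open>For a basis vector i and n = 0 the factor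
    \<open>norm i + 1 / real (Suc n)\<close> equals 2, so \<open>2 * ?M t - K i 0 t\<close> is the
    density of the component \<open>i \<bullet> x t\<close>.\<close>
  define h where "h = (\<lambda>t. \<Sum>i\<in>Basis. (2 * ?M t - K i 0 t) *\<^sub>R i)"
  have hi: "integrable lborel h" unfolding h_def
    by (intro Bochner_Integration.integrable_sum integrable_scaleR_left Bochner_Integration.integrable_diff integrable_mult_right Mi' K)
  have Isum: "(LINT s:{..t}|lborel. h s) = (\<Sum>i\<in>Basis. (2 * (LINT s:{..t}|lborel. ?M s) - (LINT s:{..t}|lborel. K i 0 s)) *\<^sub>R i)" for t
  proof -
    have si: "set_integrable lborel {..t} ?M" "set_integrable lborel {..t} (K u n)" for u n
      by (auto intro!: set_integrable_of_integrable Mi' K)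
    have i: "integrable lborel (\<lambda>s. (indicat_real {..t} s *\<^sub>R (2 * ?M s - K i 0 s)) *\<^sub>R i)" for i
      by (intro integrable_scaleR_left integrable_mult_indicator Bochner_Integration.integrable_diff integrable_mult_right Mi' K) auto
    have "(LINT s:{..t}|lborel. h s) = (\<integral>s. (\<Sum>i\<in>Basis. (indicat_real {..t} s *\<^sub>R (2 * ?M s - K i 0 s)) *\<^sub>R i) \<partial>lborel)"
      unfolding set_lebesgue_integral_def h_def by (simp add: scaleR_sum_right)
    also have "\<dots> = (\<Sum>i\<in>Basis. (\<integral>s. (indicat_real {..t} s *\<^sub>R (2 * ?M s - K i 0 s)) *\<^sub>R i \<partial>lborel))"
      by (rule Bochner_Integration.integral_sum) (rule i)
    also have "\<dots> = (\<Sum>i\<in>Basis. (LINT s:{..t}|lborel. 2 * ?M s - K i 0 s) *\<^sub>R i)"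
      unfolding set_lebesgue_integral_def
      by (intro sum.cong refl integral_scaleR_left integrable_mult_indicator Bochner_Integration.integrable_diff integrable_mult_right Mi' K) auto
    also have "\<dots> = (\<Sum>i\<in>Basis. (2 * (LINT s:{..t}|lborel. ?M s) - (LINT s:{..t}|lborel. K i 0 s)) *\<^sub>R i)"
      by (intro sum.cong refl arg_cong2[where f=scaleR], subst set_integral_diff(2)) (use si in \<open>auto simp: set_integral_mult_right\<close>)
    finally show ?thesis .
  qed
  have hx: "x t - x a = (LINT s:{..t}|lborel. h s)" if t: "t \<in> {a..b}" for t
  proof -
    have "(LINT s:{..t}|lborel. h s) = (\<Sum>i\<in>Basis. (i \<bullet> (x t - x a)) *\<^sub>R i)"
      unfolding Isum PM[OF t, symmetric] K(4)[OF t, symmetric] by (intro sum.cong) auto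
    then show ?thesis using euclidean_representation[of "x t - x a"] by (simp add: inner_commute[of _ "x t - x a"])
  qed
  have hz: "h t = 0" if "t \<notin> {a<..<b}" for t using that K(3) by (auto simp: h_def)
  have AEu: "AE t in lborel. u \<bullet> h t \<le> norm u * ?M t" for u
  proof -
    have "AE t in lborel. (norm u + 1 / real (Suc n)) * ?M t - u \<bullet> h t - K u n t = 0" for n
    proof (rule integral_Ioc_zero_real)
      let ?q = "\<lambda>t. (norm u + 1 / real (Suc n)) * ?M t - u \<bullet> h t - K u n t"
      show qi: "integrable lborel ?q" by (intro Bochner_Integration.integrable_diff integrable_mult_right Mi' K integrable_inner_right hi)
      fix t
      have q0: "?q s = 0" if "s \<notin> {a<..<b}" for s using that K(3) hz by auto
      have "(LINT s:{..t}|lborel. ?q s) = (LINT s:{..clamp1 a b t}|lborel. ?q s)"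
        unfolding set_lebesgue_integral_def
      proof (rule Bochner_Integration.integral_cong[OF refl])
        fix s
        show "indicat_real {..t} s *\<^sub>R ?q s = indicat_real {..clamp1 a b t} s *\<^sub>R ?q s"
          using q0[of s] ab by (cases "s \<in> {a<..<b}") (auto simp: indicator_def clamp1_def)
      qed
      also have "\<dots> = (norm u + 1 / real (Suc n)) * (LINT s:{..clamp1 a b t}|lborel. ?M s)
          - u \<bullet> (LINT s:{..clamp1 a b t}|lborel. h s) - (LINT s:{..clamp1 a b t}|lborel. K u n s)"
      proof -
        have si: "set_integrable lborel A ?M" "set_integrable lborel A (K u n)" "set_integrable lborel A h"
          "set_integrable lborel A (\<lambda>s. u \<bullet> h s)" if "A \<in> sets borel" for A
          using that by (auto intro!: set_integrable_of_integrable Mi' K hi integrable_inner_right)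
        have "u \<bullet> (LINT s:A|lborel. h s) = (LINT s:A|lborel. u \<bullet> h s)" if "A \<in> sets borel" for A
          using si(3)[OF that] unfolding set_lebesgue_integral_def set_integrable_def
          by (subst integral_inner_right[symmetric]) auto
        then show ?thesis
          using si by (simp add: set_integral_diff(2))
      qed
      also have "\<dots> = 0"
        using clamp1_in[OF ab, of t]
        by (simp add: PM[symmetric] hx[symmetric] K(4)[symmetric])
      finally show "(LINT s:{..t}|lborel. ?q s) = 0" .
    qed
    then have "AE t in lborel. \<forall>n. (norm u + 1 / real (Suc n)) * ?M t - u \<bullet> h t - K u n t = 0"
      by (simp add: AE_all_countable)
    then show ?thesis
    proof eventually_elim
      case (elim t)
      have "u \<bullet> h t \<le> (norm u + 1 / real (Suc n)) * ?M t" for n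
        using elim[rule_format, of n] K(1)[of u n t] by linarith
      moreover have "(\<lambda>n. (norm u + 1 / real (Suc n)) * ?M t) \<longlonglongrightarrow> (norm u + 0) * ?M t"
        by (intro tendsto_intros LIMSEQ_Suc[OF lim_const_over_n[of 1]])
      ultimately show ?case using LIMSEQ_le_const by fastforce
    qed
  qed
  \<comment> \<open>The exceptional null set depends on u. A countable dense set of vectors gives a
    common null set, and closedness of the inequality then covers every u.\<close>
  obtain D :: "'a set" where D: "countable D" "\<And>X. open X \<Longrightarrow> X \<noteq> {} \<Longrightarrow> \<exists>d\<in>D. d \<in> X"
    by (rule countable_dense_setE) blast
  have "AE t in lborel. \<forall>u\<in>D. u \<bullet> h t \<le> norm u * ?M t"
    using D(1) AEu by (simp add: AE_ball_countable)
  then have AEh: "AE t in lborel. norm (h t) \<le> ?M t"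
  proof eventually_elim
    case (elim t)
    let ?C = "{u. u \<bullet> h t \<le> norm u * ?M t}"
    have "closed ?C" by (intro closed_Collect_le continuous_intros)
    have "-?C = {}"
    proof (rule ccontr)
      assume "-?C \<noteq> {}"
      with D(2)[of "-?C"] \<open>closed ?C\<close> elim show False by auto
    qed
    then have "h t \<bullet> h t \<le> norm (h t) * ?M t" by auto
    then have "norm (h t) * norm (h t) \<le> norm (h t) * ?M t" by (simp add: dot_square_norm power2_eq_square)
    moreover have "?M t \<ge> 0" using M(2)[of t] by (auto simp: indicator_def)
    ultimately show ?case by (cases "h t = 0") auto
  qed
  \<comment> \<open>Altering h on a null set turns the almost everywhere bound into one at every
    time.\<close>
  define g where "g = (\<lambda>t. if norm (h t) \<le> ?M t then h t else 0)"
  have [measurable]: "h \<in> borel_measurable borel" "?M \<in> borel_measurable borel" using hi Mi' by auto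
  have gm [measurable]: "g \<in> borel_measurable borel" unfolding g_def by measurable
  have gh: "AE t in lborel. g t = h t" using AEh by eventually_elim (simp add: g_def)
  have gM: "norm (g t) \<le> ?M t" for t
    using M(2)[of t] by (auto simp: g_def indicator_def)
  have "AC a b x g"
    unfolding AC_def
  proof (intro conjI allI impI ballI gm)
    show "integrable lborel (\<lambda>t. (norm (g t))\<^sup>2)"
    proof (rule Bochner_Integration.integrable_bound)
      show "integrable lborel (\<lambda>t. M t1 * ?M t)" using Mi' by auto
      show "AE t in lborel. norm ((norm (g t))\<^sup>2) \<le> norm (M t1 * ?M t)"
      proof (rule AE_I2)
        fix t
        have "(norm (g t))\<^sup>2 \<le> ?M t * ?M t" using gM[of t] by (simp add: power2_eq_square mult_mono')
        also have "\<dots> \<le> M t1 * ?M t" using M(2)[of t] t1(2)[of t] by (auto simp: indicator_def intro!: mult_right_mono)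
        finally show "norm ((norm (g t))\<^sup>2) \<le> norm (M t1 * ?M t)" by simp
      qed
    qed auto
    show "g t = 0" if "t \<notin> {a<..<b}" for t using that hz by (simp add: g_def)
    fix t assume t: "t \<in> {a..b}"
    have "(LINT s:{..t}|lborel. g s) = (LINT s:{..t}|lborel. h s)"
      unfolding set_lebesgue_integral_def
      by (rule integral_cong_AE) (use gh in \<open>auto elim: AE_mp\<close>)
    then show "x t = x a + (LINT s:{..t}|lborel. g s)" using hx[OF t] by (simp add: algebra_simps)
  qed
  then show ?thesis
  proof (rule that)
    fix t assume "t \<in> {a..b}"
    show "norm (g t) \<le> M t" using gM[of t] M(2)[OF \<open>t \<in> {a..b}\<close>]
      by (cases "t \<in> {a<..<b}") auto
  qed
qed

section \<open>Restriction, concatenation, reparametrization and reversal of paths\<close>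

lemma AC_I:
  assumes ab: "a \<le> b" and "g \<in> borel_measurable borel" "integrable lborel (\<lambda>t. (norm (g t))\<^sup>2)"
    "\<And>t. t \<notin> {a<..<b} \<Longrightarrow> g t = 0"
    and d: "\<And>t. t \<in> {a..b} \<Longrightarrow> x t - x a = (LINT u:{a<..t}|lborel. g u)"
  shows "AC a b x g"
  unfolding AC_def
proof (intro conjI ballI allI impI assms(2-3))
  fix t assume t: "t \<in> {a..b}"
  have "(LINT u:{a<..t}|lborel. g u) = (LINT u:{..t}|lborel. g u)"
    unfolding set_lebesgue_integral_def
    by (rule Bochner_Integration.integral_cong[OF refl]) (use assms(4) in \<open>auto simp: indicator_def\<close>)
  then show "x t = x a + (LINT u:{..t}|lborel. g u)" using d[OF t] by (simp add: algebra_simps)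
qed (use assms in auto)

lemma AC_restrict:
  assumes ac: "AC a b x g" and st: "a \<le> s" "s \<le> t" "t \<le> b"
  shows "AC s t x (\<lambda>u. indicator {s<..<t} u *\<^sub>R g u)"
proof (rule AC_I[OF st(2)])
  note [measurable] = AC_measurable[OF ac]
  show "(\<lambda>u. indicat_real {s<..<t} u *\<^sub>R g u) \<in> borel_measurable borel" by measurable
  have "integrable lborel (\<lambda>u. indicat_real {s<..<t} u *\<^sub>R (norm (g u))\<^sup>2)"
    by (rule integrable_mult_indicator[OF _ AC_square[OF ac]]) auto
  moreover have "(\<lambda>u. (norm (indicat_real {s<..<t} u *\<^sub>R g u))\<^sup>2) = (\<lambda>u. indicat_real {s<..<t} u *\<^sub>R (norm (g u))\<^sup>2)"
    by (auto simp: indicator_def fun_eq_iff)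
  ultimately show "integrable lborel (\<lambda>u. (norm (indicat_real {s<..<t} u *\<^sub>R g u))\<^sup>2)" by simp
  fix u assume u: "u \<in> {s..t}"
  have "(LINT v:{s<..u}|lborel. indicat_real {s<..<t} v *\<^sub>R g v) = (LINT v:{s<..u}|lborel. g v)"
    unfolding set_lebesgue_integral_def
  proof (rule integral_cong_AE)
    show "AE v in lborel. indicat_real {s<..u} v *\<^sub>R indicat_real {s<..<t} v *\<^sub>R g v = indicat_real {s<..u} v *\<^sub>R g v"
      by (rule AE_mp[OF AE_lborel_singleton[of t]], rule AE_I2) (use u in \<open>auto simp: indicator_def\<close>)
  qed auto
  then show "x u - x s = (LINT v:{s<..u}|lborel. indicat_real {s<..<t} v *\<^sub>R g v)"
    using AC_diff[OF ac, of s u] st u by simp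
qed (auto simp: indicator_def)

text \<open>Densities are zero off their open intervals, so at every time at most one of g and h is
  nonzero and the density of the joined path is simply their sum.\<close>

lemma AC_concat:
  fixes x y :: "real \<Rightarrow> 'a::euclidean_space"
  assumes x: "AC a b x g" and y: "AC b c y h" and eq: "x b = y b" and ab: "a \<le> b" "b \<le> c"
  shows "AC a c (\<lambda>t. if t \<le> b then x t else y t) (\<lambda>t. g t + h t)" (is "AC a c ?z _")
proof (rule AC_I)
  show "a \<le> c" using ab by simp
  note [measurable] = AC_measurable[OF x] AC_measurable[OF y]
  have z: "g t = 0 \<or> h t = 0" for t
    using AC_zero[OF x, of t] AC_zero[OF y, of t] by (cases "t < b") auto
  show "(\<lambda>t. g t + h t) \<in> borel_measurable borel" by measurable
  have "(norm (g t + h t))\<^sup>2 = (norm (g t))\<^sup>2 + (norm (h t))\<^sup>2" for t using z[of t] by auto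
  then show "integrable lborel (\<lambda>t. (norm (g t + h t))\<^sup>2)"
    using AC_square[OF x] AC_square[OF y] by auto
  show "g t + h t = 0" if "t \<notin> {a<..<c}" for t
    using that AC_zero[OF x, of t] AC_zero[OF y, of t] ab by auto
  fix t assume t: "t \<in> {a..c}"
  have gi: "set_integrable lborel {a<..t} g" "set_integrable lborel {a<..t} h"
    by (rule set_integrable_of_integrable; use AC_integrable[OF x] AC_integrable[OF y] in simp)+
  have s: "(LINT u:{a<..t}|lborel. g u + h u) = (LINT u:{a<..t}|lborel. g u) + (LINT u:{a<..t}|lborel. h u)"
    by (rule set_integral_add(2)[OF gi])
  show "?z t - ?z a = (LINT u:{a<..t}|lborel. g u + h u)"
  proof (cases "t \<le> b")
    case True
    have "(LINT u:{a<..t}|lborel. h u) = 0"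
      unfolding set_lebesgue_integral_def
      by (rule integral_eq_zero_AE, rule AE_I2) (use AC_zero[OF y] True in \<open>auto simp: indicator_def\<close>)
    then show ?thesis using AC_diff[OF x, of a t] t True ab s by auto
  next
    case False
    have "(LINT u:{a<..t}|lborel. h u) = (LINT u:{b<..t}|lborel. h u)"
      unfolding set_lebesgue_integral_def
      by (rule Bochner_Integration.integral_cong[OF refl]) (use AC_zero[OF y] ab in \<open>auto simp: indicator_def\<close>)
    moreover have "(LINT u:{a<..t}|lborel. g u) = (LINT u:{a<..b}|lborel. g u)"
      unfolding set_lebesgue_integral_def
      by (rule Bochner_Integration.integral_cong[OF refl]) (use AC_zero[OF x] False in \<open>auto simp: indicator_def\<close>)
    ultimately show ?thesis using AC_diff[OF x, of a b] AC_diff[OF y, of b t] t False ab s eq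
      by (auto simp: algebra_simps)
  qed
qed

lemma AC_affine:
  fixes x :: "real \<Rightarrow> 'a::euclidean_space"
  assumes x: "AC (c + l * a) (c + l * b) x g" and ab: "a \<le> b" and l: "l > 0"
  shows "AC a b (\<lambda>t. m *\<^sub>R x (c + l * t)) (\<lambda>t. (m * l) *\<^sub>R g (c + l * t))"
proof (rule AC_I[OF ab])
  note [measurable] = AC_measurable[OF x]
  show "(\<lambda>t. (m * l) *\<^sub>R g (c + l * t)) \<in> borel_measurable borel" by measurable
  have "integrable lborel (\<lambda>t. (norm (g (c + l * t)))\<^sup>2)"
    by (rule lborel_integrable_real_affine[OF AC_square[OF x]]) (use l in auto)
  then show "integrable lborel (\<lambda>t. (norm ((m * l) *\<^sub>R g (c + l * t)))\<^sup>2)"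
    by (simp add: power_mult_distrib)
  show "(m * l) *\<^sub>R g (c + l * t) = 0" if "t \<notin> {a<..<b}" for t
    using that l AC_zero[OF x, of "c + l * t"] by auto
  fix t assume t: "t \<in> {a..b}"
  have "x (c + l * t) - x (c + l * a) = (LINT u:{c + l * a<..c + l * t}|lborel. g u)"
    using AC_diff[OF x, of "c + l * a" "c + l * t"] t l by auto
  also have "\<dots> = l *\<^sub>R (\<integral>u. indicator {c + l * a<..c + l * t} (c + l * u) *\<^sub>R g (c + l * u) \<partial>lborel)"
    unfolding set_lebesgue_integral_def
    by (subst lborel_integral_real_affine[of l _ c]) (use l in auto)
  also have "(\<lambda>u. indicat_real {c + l * a<..c + l * t} (c + l * u)) = indicator {a<..t}"
    using l by (auto simp: indicator_def fun_eq_iff)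
  finally have "x (c + l * t) - x (c + l * a) = l *\<^sub>R (LINT u:{a<..t}|lborel. g (c + l * u))"
    by (simp add: set_lebesgue_integral_def)
  then show "m *\<^sub>R x (c + l * t) - m *\<^sub>R x (c + l * a) = (LINT u:{a<..t}|lborel. (m * l) *\<^sub>R g (c + l * u))"
    by (simp add: scaleR_diff_right[symmetric])
qed

lemma AC_reverse:
  fixes x :: "real \<Rightarrow> 'a::euclidean_space"
  assumes x: "AC a b x g" and ab: "a \<le> b"
  shows "AC (- b) (- a) (\<lambda>t. x (- t)) (\<lambda>t. - g (- t))"
proof (rule AC_I)
  note [measurable] = AC_measurable[OF x]
  show "- b \<le> - a" using ab by simp
  show "(\<lambda>t. - g (- t)) \<in> borel_measurable borel" by measurable
  show "integrable lborel (\<lambda>t. (norm (- g (- t)))\<^sup>2)"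
    using lborel_integrable_real_affine[OF AC_square[OF x], of "-1" 0] by simp
  show "- g (- t) = 0" if "t \<notin> {- b<..<- a}" for t
    using that AC_zero[OF x, of "- t"] by auto
  fix t assume t: "t \<in> {- b..- a}"
  have "x b - x (- t) = (LINT u:{- t<..b}|lborel. g u)"
    using AC_diff[OF x, of "- t" b] t by auto
  also have "\<dots> = (\<integral>u. indicator {- t<..b} (- u) *\<^sub>R g (- u) \<partial>lborel)"
    unfolding set_lebesgue_integral_def
    by (subst lborel_integral_real_affine[of "-1" _ 0]) auto
  also have "\<dots> = (\<integral>u. indicator {- b<..t} u *\<^sub>R g (- u) \<partial>lborel)"
  proof (rule integral_cong_AE)
    show "AE u in lborel. indicat_real {- t<..b} (- u) *\<^sub>R g (- u) = indicat_real {- b<..t} u *\<^sub>R g (- u)"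
      by (rule AE_mp[OF AE_lborel_singleton[of t]], rule AE_mp[OF AE_lborel_singleton[of "- b"]], rule AE_I2)
         (auto simp: indicator_def)
  qed auto
  finally show "x (- t) - x (- (- b)) = (LINT u:{- b<..t}|lborel. - g (- u))"
    by (simp add: set_lebesgue_integral_def algebra_simps)
qed

section \<open>Kinetic and potential action\<close>

definition kin :: "real \<Rightarrow> real \<Rightarrow> (real \<Rightarrow> 'a::euclidean_space) \<Rightarrow> ennreal" where
  "kin a b x = (\<integral>\<^sup>+t\<in>{a<..<b}. ennreal ((norm (weak_deriv a b x t))\<^sup>2 / 2) \<partial>lborel)"

definition pote :: "('a::euclidean_space \<Rightarrow> real) \<times> real \<Rightarrow> real \<Rightarrow> real \<Rightarrow> (real \<Rightarrow> 'a) \<Rightarrow> ennreal" where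
  "pote W a b x = (\<integral>\<^sup>+t\<in>{a<..<b}. potential W (x t) \<partial>lborel)"

lemma H1_iff_AC:
  assumes "a \<le> b"
  shows "x \<in> H1 a b \<longleftrightarrow> (\<exists>g. AC a b x g)"
  using AC_H1[OF assms] H1_AC[OF assms] by blast

lemma H1_continuous: "x \<in> H1 a b \<Longrightarrow> continuous_on {a..b} x"
  by (simp add: H1_def)

lemma kin_AC:
  assumes ab: "a \<le> b" and g: "AC a b x g"
  shows "kin a b x = (\<integral>\<^sup>+t. ennreal ((norm (g t))\<^sup>2 / 2) \<partial>lborel)"
proof -
  have "AE t in lborel. indicator {a<..<b} t *\<^sub>R weak_deriv a b x t = g t"
    using AC_unique[OF ab H1_AC[OF ab AC_H1[OF ab g]] g] .
  then have "AE t in lborel. ennreal ((norm (weak_deriv a b x t))\<^sup>2 / 2) * indicator {a<..<b} t = ennreal ((norm (g t))\<^sup>2 / 2)"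
  proof eventually_elim
    case (elim t)
    then show ?case using AC_zero[OF g, of t] by (cases "t \<in> {a<..<b}") auto
  qed
  then show ?thesis unfolding kin_def by (rule nn_integral_cong_AE)
qed

lemma kin_eq_integral:
  assumes ab: "a \<le> b" and g: "AC a b x g"
  shows "kin a b x = ennreal ((\<integral>t. (norm (g t))\<^sup>2 \<partial>lborel) / 2)"
proof -
  have "(\<integral>\<^sup>+t. ennreal ((norm (g t))\<^sup>2 / 2) \<partial>lborel) = ennreal (\<integral>t. (norm (g t))\<^sup>2 / 2 \<partial>lborel)"
    by (rule nn_integral_eq_integral) (use AC_square[OF g] in auto)
  then show ?thesis unfolding kin_AC[OF assms] by simp
qed

lemma kin_finite: "a \<le> b \<Longrightarrow> x \<in> H1 a b \<Longrightarrow> kin a b x < \<infinity>"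
  using kin_eq_integral H1_AC by (metis ennreal_less_top infinity_ennreal_def)

lemma AC_cong:
  assumes "\<And>t. t \<in> {a..b} \<Longrightarrow> x t = y t" "a \<le> b"
  shows "AC a b x g \<longleftrightarrow> AC a b y g"
  using assms unfolding AC_def by auto

lemma H1_cong: "\<lbrakk>\<And>t. t \<in> {a..b} \<Longrightarrow> x t = y t; a \<le> b; x \<in> H1 a b\<rbrakk> \<Longrightarrow> y \<in> H1 a b"
  using AC_cong H1_iff_AC by metis

lemma kin_cong:
  assumes xy: "\<And>t. t \<in> {a..b} \<Longrightarrow> x t = y t" and ab: "a \<le> b" and x: "x \<in> H1 a b"
  shows "kin a b y = kin a b x"
proof -
  obtain g where g: "AC a b x g" using x H1_iff_AC[OF ab] by blast
  have "AC a b y g" using g AC_cong[of a b x y g] xy ab by blast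
  then show ?thesis using g kin_AC[OF ab, of x g] kin_AC[OF ab, of y g] by simp
qed

lemma pote_cong: "(\<And>t. t \<in> {a<..<b} \<Longrightarrow> x t = y t) \<Longrightarrow> pote W a b x = pote W a b y"
  unfolding pote_def by (intro nn_integral_cong) (auto simp: indicator_def)

lemma pote_clamp: "pote W a b x = (\<integral>\<^sup>+t. potential W (x (clamp1 a b t)) * indicator {a<..<b} t \<partial>lborel)"
  unfolding pote_def by (intro nn_integral_cong) (use clamp1_id[of _ a b] in \<open>auto simp: indicator_def\<close>)

lemma potential_clamp_measurable:
  assumes W: "potential W \<in> borel_measurable borel" and ab: "a \<le> b" and x: "continuous_on {a..b} x"
  shows "(\<lambda>t. potential W (x (clamp1 a b t))) \<in> borel_measurable borel"
  by (rule measurable_compose[OF borel_measurable_continuous_onI[OF continuous_clamp1[OF ab x]] W])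

lemma action_split:
  assumes W: "potential W \<in> borel_measurable borel" and ab: "a \<le> b" and x: "x \<in> H1 a b"
  shows "action W a b x = kin a b x + pote W a b x"
proof -
  obtain g where g: "AC a b x g" using x H1_iff_AC[OF ab] by blast
  note [measurable] = potential_clamp_measurable[OF W ab H1_continuous[OF x]] AC_measurable[OF g]
  have "action W a b x = (\<integral>\<^sup>+t. (ennreal ((norm (g t))\<^sup>2 / 2) + potential W (x (clamp1 a b t)) * indicator {a<..<b} t) \<partial>lborel)"
    unfolding action_AC[OF ab g]
    by (intro nn_integral_cong) (use clamp1_id[of _ a b] AC_zero[OF g] in \<open>auto simp: indicator_def\<close>)
  also have "\<dots> = kin a b x + pote W a b x"
    unfolding kin_AC[OF ab g] pote_clamp by (rule nn_integral_add) measurable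
  finally show ?thesis .
qed

lemma H1_restrict: "\<lbrakk>x \<in> H1 a b; a \<le> s; s \<le> t; t \<le> b\<rbrakk> \<Longrightarrow> x \<in> H1 s t"
  using AC_restrict[of a b x _ s t] H1_iff_AC[of a b x] H1_iff_AC[of s t x] by fastforce

lemma kin_add:
  assumes x: "x \<in> H1 a c" and ab: "a \<le> b" "b \<le> c"
  shows "kin a c x = kin a b x + kin b c x"
proof -
  have ac: "a \<le> c" using ab by simp
  obtain g where g: "AC a c x g" using x H1_iff_AC[OF ac] by blast
  note [measurable] = AC_measurable[OF g]
  have 1: "AC a b x (\<lambda>u. indicator {a<..<b} u *\<^sub>R g u)" by (rule AC_restrict[OF g]) (use ab in auto)
  have 2: "AC b c x (\<lambda>u. indicator {b<..<c} u *\<^sub>R g u)" by (rule AC_restrict[OF g]) (use ab in auto)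
  have "kin a c x = (\<integral>\<^sup>+t. (ennreal ((norm (indicat_real {a<..<b} t *\<^sub>R g t))\<^sup>2 / 2) + ennreal ((norm (indicat_real {b<..<c} t *\<^sub>R g t))\<^sup>2 / 2)) \<partial>lborel)"
    unfolding kin_AC[OF ac g]
    by (rule nn_integral_cong_AE, rule AE_mp[OF AE_lborel_singleton[of b]], rule AE_I2)
       (use AC_zero[OF g] ab in \<open>auto simp: indicator_def\<close>)
  also have "\<dots> = kin a b x + kin b c x"
    unfolding kin_AC[OF ab(1) 1] kin_AC[OF ab(2) 2] by (rule nn_integral_add) measurable
  finally show ?thesis .
qed

lemma pote_add:
  assumes W: "potential W \<in> borel_measurable borel" and x: "continuous_on {a..c} x" and ab: "a \<le> b" "b \<le> c"
  shows "pote W a c x = pote W a b x + pote W b c x"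
proof -
  have ac: "a \<le> c" using ab by simp
  note [measurable] = potential_clamp_measurable[OF W ac x]
  have 1: "pote W a b x = (\<integral>\<^sup>+t. potential W (x (clamp1 a c t)) * indicator {a<..<b} t \<partial>lborel)"
    unfolding pote_def by (intro nn_integral_cong) (use clamp1_id[of _ a c] ab in \<open>auto simp: indicator_def\<close>)
  have 2: "pote W b c x = (\<integral>\<^sup>+t. potential W (x (clamp1 a c t)) * indicator {b<..<c} t \<partial>lborel)"
    unfolding pote_def by (intro nn_integral_cong) (use clamp1_id[of _ a c] ab in \<open>auto simp: indicator_def\<close>)
  have "pote W a c x = (\<integral>\<^sup>+t. (potential W (x (clamp1 a c t)) * indicator {a<..<b} t + potential W (x (clamp1 a c t)) * indicator {b<..<c} t) \<partial>lborel)"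
    unfolding pote_clamp
    by (rule nn_integral_cong_AE, rule AE_mp[OF AE_lborel_singleton[of b]], rule AE_I2)
       (use ab in \<open>auto simp: indicator_def\<close>)
  also have "\<dots> = pote W a b x + pote W b c x"
    unfolding 1 2 by (rule nn_integral_add) measurable
  finally show ?thesis .
qed

lemma action_add:
  assumes W: "potential W \<in> borel_measurable borel" and x: "x \<in> H1 a c" and ab: "a \<le> b" "b \<le> c"
  shows "action W a c x = action W a b x + action W b c x"
proof -
  have "x \<in> H1 a b" "x \<in> H1 b c" using H1_restrict[OF x] ab by auto
  moreover have "a \<le> c" using ab by simp
  ultimately show ?thesis
    using kin_add[OF x ab] pote_add[OF W H1_continuous[OF x] ab] x ab
    by (simp add: action_split[OF W] ac_simps)
qed

lemma action_degenerate: "action W a a x = 0"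
  by (simp add: action_def)

lemma H1_concat:
  assumes x: "x \<in> H1 a b" and y: "y \<in> H1 b c" and eq: "x b = y b" and ab: "a \<le> b" "b \<le> c"
  shows "(\<lambda>t. if t \<le> b then x t else y t) \<in> H1 a c"
proof -
  obtain g h where g: "AC a b x g" and h: "AC b c y h" using x y H1_iff_AC[OF ab(1), of x] H1_iff_AC[OF ab(2), of y] by blast
  show ?thesis by (rule AC_H1[OF _ AC_concat[OF g h eq ab]]) (use ab in simp)
qed

lemma action_cong:
  assumes W: "potential W \<in> borel_measurable borel"
    and xy: "\<And>t. t \<in> {a..b} \<Longrightarrow> x t = y t" and ab: "a \<le> b" and x: "x \<in> H1 a b"
  shows "action W a b y = action W a b x"
  using action_split[OF W ab x] action_split[OF W ab H1_cong[OF xy ab x]] kin_cong[OF xy ab x]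
    pote_cong[of a b x y W] xy by auto

lemma action_concat:
  assumes W: "potential W \<in> borel_measurable borel"
    and x: "x \<in> H1 a b" and y: "y \<in> H1 b c" and eq: "x b = y b" and ab: "a \<le> b" "b \<le> c"
  shows "action W a c (\<lambda>t. if t \<le> b then x t else y t) = action W a b x + action W b c y" (is "action W a c ?z = _")
proof -
  have "action W a b ?z = action W a b x" by (rule action_cong[OF W _ ab(1) x]) auto
  moreover have "action W b c ?z = action W b c y" by (rule action_cong[OF W _ ab(2) y]) (use eq in auto)
  ultimately show ?thesis using action_add[OF W H1_concat[OF x y eq ab] ab] by simp
qed

lemma H1_affine:
  assumes x: "x \<in> H1 (c + l * a) (c + l * b)" and ab: "a \<le> b" and l: "l > 0"
  shows "(\<lambda>t. m *\<^sub>R x (c + l * t)) \<in> H1 a b"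
    and "kin a b (\<lambda>t. m *\<^sub>R x (c + l * t)) = ennreal (m\<^sup>2 * l) * kin (c + l * a) (c + l * b) x"
proof -
  have lab: "c + l * a \<le> c + l * b" using ab l by simp
  obtain g where g: "AC (c + l * a) (c + l * b) x g" using x H1_iff_AC[OF lab] by blast
  note ac = AC_affine[OF g ab l, of m]
  show "(\<lambda>t. m *\<^sub>R x (c + l * t)) \<in> H1 a b" by (rule AC_H1[OF ab ac])
  have "(\<integral>t. (norm (g t))\<^sup>2 \<partial>lborel) = l * (\<integral>t. (norm (g (c + l * t)))\<^sup>2 \<partial>lborel)"
    by (subst lborel_integral_real_affine[of l _ c]) (use l in auto)
  then have "(\<integral>t. (norm ((m * l) *\<^sub>R g (c + l * t)))\<^sup>2 \<partial>lborel) / 2 = m\<^sup>2 * l * ((\<integral>t. (norm (g t))\<^sup>2 \<partial>lborel) / 2)"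
    by (simp add: power_mult_distrib power2_eq_square[of l])
  then show "kin a b (\<lambda>t. m *\<^sub>R x (c + l * t)) = ennreal (m\<^sup>2 * l) * kin (c + l * a) (c + l * b) x"
    unfolding kin_eq_integral[OF ab ac] kin_eq_integral[OF lab g]
    using l by (subst ennreal_mult[symmetric]) auto
qed

lemma pote_affine:
  assumes W: "potential W \<in> borel_measurable borel" and l: "l > 0" and ab: "a \<le> b"
    and x: "continuous_on {c + l * a..c + l * b} x"
  shows "pote W a b (\<lambda>t. x (c + l * t)) = ennreal (1 / l) * pote W (c + l * a) (c + l * b) x"
proof -
  have lab: "c + l * a \<le> c + l * b" using ab l by simp
  let ?y = "\<lambda>t. x (clamp1 (c + l * a) (c + l * b) t)"
  note [measurable] = potential_clamp_measurable[OF W lab x]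
  have "pote W (c + l * a) (c + l * b) x = ennreal l * (\<integral>\<^sup>+t. potential W (?y (c + l * t)) * indicator {c + l * a<..<c + l * b} (c + l * t) \<partial>lborel)"
    unfolding pote_clamp by (subst nn_integral_real_affine[of _ l c]) (use l in auto)
  also have "(\<integral>\<^sup>+t. potential W (?y (c + l * t)) * indicator {c + l * a<..<c + l * b} (c + l * t) \<partial>lborel) = pote W a b (\<lambda>t. x (c + l * t))"
    unfolding pote_def
    by (intro nn_integral_cong) (use l clamp1_id[of _ "c + l * a" "c + l * b"] in \<open>auto simp: indicator_def\<close>)
  finally have "pote W (c + l * a) (c + l * b) x = ennreal l * pote W a b (\<lambda>t. x (c + l * t))" .
  then have "ennreal (1 / l) * pote W (c + l * a) (c + l * b) x = (ennreal (1 / l) * ennreal l) * pote W a b (\<lambda>t. x (c + l * t))"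
    by (simp add: mult.assoc)
  also have "ennreal (1 / l) * ennreal l = 1" using l by (simp flip: ennreal_mult)
  finally show ?thesis by simp
qed

lemma reverse_action:
  assumes W: "potential W \<in> borel_measurable borel" and ab: "a \<le> b" and x: "x \<in> H1 a b"
  shows "(\<lambda>t. x (- t)) \<in> H1 (- b) (- a)" "action W (- b) (- a) (\<lambda>t. x (- t)) = action W a b x"
proof -
  obtain g where g: "AC a b x g" using x H1_iff_AC[OF ab] by blast
  note ac = AC_reverse[OF g ab]
  have ab': "- b \<le> - a" using ab by simp
  show h: "(\<lambda>t. x (- t)) \<in> H1 (- b) (- a)" by (rule AC_H1[OF ab' ac])
  note [measurable] = potential_clamp_measurable[OF W ab H1_continuous[OF x]] AC_measurable[OF g]
  have "(\<integral>\<^sup>+t. ennreal ((norm (g t))\<^sup>2 / 2) \<partial>lborel) = (\<integral>\<^sup>+t. ennreal ((norm (g (- t)))\<^sup>2 / 2) \<partial>lborel)"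
    by (subst nn_integral_real_affine[of _ "-1" 0]) auto
  then have 1: "kin (- b) (- a) (\<lambda>t. x (- t)) = kin a b x"
    unfolding kin_AC[OF ab' ac] kin_AC[OF ab g] by simp
  have "pote W a b x = (\<integral>\<^sup>+t. potential W (x (clamp1 a b (- t))) * indicator {a<..<b} (- t) \<partial>lborel)"
    unfolding pote_clamp by (subst nn_integral_real_affine[of _ "-1" 0]) auto
  also have "\<dots> = pote W (- b) (- a) (\<lambda>t. x (- t))"
    unfolding pote_def
    by (intro nn_integral_cong) (use clamp1_id[of _ a b] in \<open>auto simp: indicator_def\<close>)
  finally have 2: "pote W (- b) (- a) (\<lambda>t. x (- t)) = pote W a b x" by simp
  show "action W (- b) (- a) (\<lambda>t. x (- t)) = action W a b x"
    unfolding action_split[OF W ab' h] action_split[OF W ab x] 1 2 ..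
qed

lemma kin_lower:
  assumes x: "x \<in> H1 s t" and st: "s < t"
  shows "ennreal ((norm (x t - x s))\<^sup>2 / (2 * (t - s))) \<le> kin s t x"
proof -
  have le: "s \<le> t" using st by simp
  obtain g where g: "AC s t x g" using x H1_iff_AC[OF le] by blast
  define d where "d = norm (x t - x s)"
  \<comment> \<open>The mean speed. Integrating \<open>(norm (g u) - l)\<^sup>2 \<ge> 0\<close> over
    the interval gives the inequality of Cauchy and Schwarz in the form needed.\<close>
  define l where "l = d / (t - s)"
  have l: "l \<ge> 0" using st by (auto simp: l_def d_def)
  have gi: "integrable lborel g" by (rule AC_integrable[OF g])
  have "d \<le> (\<integral>u. norm (indicator {s<..t} u *\<^sub>R g u) \<partial>lborel)"
    unfolding d_def AC_diff[OF g order_refl le order_refl] set_lebesgue_integral_def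
    by (rule integral_norm_bound)
  also have "\<dots> \<le> (\<integral>u. norm (g u) \<partial>lborel)"
    by (rule Bochner_Integration.integral_mono)
       (use gi integrable_norm[OF integrable_mult_indicator[of "{s<..t}" lborel g]] in \<open>auto simp: indicator_def\<close>)
  finally have d: "d \<le> (\<integral>u. norm (g u) \<partial>lborel)" .
  have ii: "integrable lborel (indicat_real {s<..<t})" by (rule integrable_real_indicator) (use st in auto)
  have iI: "(\<integral>u. indicat_real {s<..<t} u \<partial>lborel) = t - s" using st by simp
  have "2 * l * (\<integral>u. norm (g u) \<partial>lborel) - l\<^sup>2 * (t - s) = (\<integral>u. 2 * l * norm (g u) - l\<^sup>2 * indicator {s<..<t} u \<partial>lborel)"
    using gi ii iI by (subst Bochner_Integration.integral_diff) auto
  also have "\<dots> \<le> (\<integral>u. (norm (g u))\<^sup>2 \<partial>lborel)"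
  proof (rule Bochner_Integration.integral_mono)
    fix u
    have "0 \<le> (norm (g u) - l)\<^sup>2" by simp
    then show "2 * l * norm (g u) - l\<^sup>2 * indicator {s<..<t} u \<le> (norm (g u))\<^sup>2"
      using AC_zero[OF g, of u] by (cases "u \<in> {s<..<t}") (auto simp: power2_diff algebra_simps)
  qed (use gi ii AC_square[OF g] in auto)
  finally have "2 * l * d - l\<^sup>2 * (t - s) \<le> (\<integral>u. (norm (g u))\<^sup>2 \<partial>lborel)"
    using mult_left_mono[OF d, of "2 * l"] l by linarith
  moreover have "2 * l * d - l\<^sup>2 * (t - s) = d\<^sup>2 / (t - s)"
  proof -
    have "2 * (d / T) * d - (d / T)\<^sup>2 * T = d\<^sup>2 / T" if "T > 0" for T :: real
      using that by (simp add: power2_eq_square)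
    then show ?thesis using st by (simp add: l_def)
  qed
  ultimately have "d\<^sup>2 / (t - s) \<le> (\<integral>u. (norm (g u))\<^sup>2 \<partial>lborel)" by (simp only:)
  then have "d\<^sup>2 / (t - s) / 2 \<le> (\<integral>u. (norm (g u))\<^sup>2 \<partial>lborel) / 2" by (rule divide_right_mono) simp
  then have "d\<^sup>2 / (2 * (t - s)) \<le> (\<integral>u. (norm (g u))\<^sup>2 \<partial>lborel) / 2"
    unfolding divide_divide_eq_left' .
  then show ?thesis unfolding kin_eq_integral[OF le g] d_def by (rule ennreal_leI)
qed

lemma pote_lower:
  assumes "s \<le> t" "u \<ge> 0" "\<And>v. v \<in> {s<..<t} \<Longrightarrow> ennreal u \<le> potential W (x v)"
  shows "ennreal (u * (t - s)) \<le> pote W s t x"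
proof -
  have "ennreal (u * (t - s)) = (\<integral>\<^sup>+v. ennreal u * indicator {s<..<t} v \<partial>lborel)"
    using assms(1,2) by (subst nn_integral_cmult_indicator) (auto simp: ennreal_mult)
  also have "\<dots> \<le> pote W s t x" unfolding pote_def
    by (intro nn_integral_mono) (use assms(3) in \<open>auto simp: indicator_def\<close>)
  finally show ?thesis .
qed

lemma pote_upper:
  assumes "s \<le> t" "u \<ge> 0" "\<And>v. v \<in> {s<..<t} \<Longrightarrow> potential W (x v) \<le> ennreal u"
  shows "pote W s t x \<le> ennreal (u * (t - s))"
proof -
  have "pote W s t x \<le> (\<integral>\<^sup>+v. ennreal u * indicator {s<..<t} v \<partial>lborel)" unfolding pote_def
    by (intro nn_integral_mono) (use assms(3) in \<open>auto simp: indicator_def\<close>)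
  also have "\<dots> = ennreal (u * (t - s))"
    using assms(1,2) by (subst nn_integral_cmult_indicator) (auto simp: ennreal_mult)
  finally show ?thesis .
qed

text \<open>By the inequality between the means, \<open>d\<^sup>2 / (2 * T) + u * T\<close> is at
  least \<open>sqrt (2 * u) * d\<close> for every duration T. This removes time from the lower
  bound.\<close>

lemma action_lower:
  assumes W: "potential W \<in> borel_measurable borel" and x: "x \<in> H1 s t" and st: "s \<le> t"
    and u: "u \<ge> 0" "\<And>v. v \<in> {s<..<t} \<Longrightarrow> ennreal u \<le> potential W (x v)"
  shows "ennreal (sqrt (2 * u) * norm (x t - x s)) \<le> action W s t x"
proof (cases "s < t")
  case True
  let ?d = "norm (x t - x s)" and ?T = "t - s"
  have T: "?T > 0" using True by simp
  have "0 \<le> (?d - sqrt (2 * u) * ?T)\<^sup>2 / (2 * ?T)" using T by simp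
  also have "\<dots> = ?d\<^sup>2 / (2 * ?T) + u * ?T - sqrt (2 * u) * ?d"
  proof -
    have *: "(d - q * T)\<^sup>2 / (2 * T) = d\<^sup>2 / (2 * T) + u * T - q * d" if "q\<^sup>2 = 2 * u" "T > 0" for d q T :: real
    proof -
      have "(d - q * T)\<^sup>2 = d\<^sup>2 + 2 * u * T\<^sup>2 - 2 * T * (q * d)"
        by (simp add: power2_diff power_mult_distrib that(1))
      then show ?thesis using that(2) by (simp add: power2_eq_square field_simps)
    qed
    show ?thesis by (rule *) (use T u in auto)
  qed
  finally have "ennreal (sqrt (2 * u) * ?d) \<le> ennreal (?d\<^sup>2 / (2 * ?T) + u * ?T)"
    by (intro ennreal_leI) simp
  also have "\<dots> = ennreal (?d\<^sup>2 / (2 * ?T)) + ennreal (u * ?T)"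
    using T u by (intro ennreal_plus) auto
  also have "\<dots> \<le> kin s t x + pote W s t x"
    by (intro add_mono kin_lower[OF x True] pote_lower[OF st u])
  finally show ?thesis by (simp add: action_split[OF W st x])
next
  case False
  then have "s = t" using st by simp
  then show ?thesis by simp
qed

lemma H1_of_derivative_bound:
  fixes x :: "real \<Rightarrow> 'a::euclidean_space"
  assumes ab: "a \<le> b" and M: "continuous_on {a..b} M" "\<And>t. t \<in> {a..b} \<Longrightarrow> M t > 0"
    and P: "\<And>t. t \<in> {a..b} \<Longrightarrow> (P has_real_derivative M t) (at t within {a..b})"
    and x: "\<And>s t. a \<le> s \<Longrightarrow> s \<le> t \<Longrightarrow> t \<le> b \<Longrightarrow> norm (x t - x s) \<le> P t - P s"
  shows "x \<in> H1 a b"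
    and "kin a b x \<le> (\<integral>\<^sup>+t\<in>{a<..<b}. ennreal ((M t)\<^sup>2 / 2) \<partial>lborel)"
proof -
  obtain g where g: "AC a b x g" "\<And>t. t \<in> {a..b} \<Longrightarrow> norm (g t) \<le> M t"
    by (rule AC_of_metric_bound[OF ab M P x]) auto
  show "x \<in> H1 a b" by (rule AC_H1[OF ab g(1)])
  show "kin a b x \<le> (\<integral>\<^sup>+t\<in>{a<..<b}. ennreal ((M t)\<^sup>2 / 2) \<partial>lborel)"
    unfolding kin_AC[OF ab g(1)]
  proof (rule nn_integral_mono)
    fix t
    show "ennreal ((norm (g t))\<^sup>2 / 2) \<le> ennreal ((M t)\<^sup>2 / 2) * indicator {a<..<b} t"
      using AC_zero[OF g(1), of t] g(2)[of t]
      by (cases "t \<in> {a<..<b}") (auto intro!: ennreal_leI power_mono)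
  qed
qed

section \<open>Paths of bounded action\<close>

definition reach :: "('a::euclidean_space \<Rightarrow> real) \<times> real \<Rightarrow> 'a set \<Rightarrow> 'a \<Rightarrow> 'a \<Rightarrow> real \<Rightarrow> bool" where
  "reach W S p q c \<longleftrightarrow> 0 \<le> c \<and> (\<exists>a b x. a \<le> b \<and> x \<in> H1 a b \<and> x a = p \<and> x b = q \<and>
     (\<forall>t\<in>{a..b}. x t \<in> S) \<and> action W a b x \<le> ennreal c)"

text \<open>The distance of the Jacobi metric \<open>2 V |dx|\<^sup>2\<close> at energy zero: with
  free time the optimal speed makes kinetic and potential energy equal.\<close>

definition jd :: "('a::euclidean_space \<Rightarrow> real) \<times> real \<Rightarrow> 'a \<Rightarrow> 'a \<Rightarrow> real" where
  "jd W p q = Inf {c. reach W UNIV p q c}"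

lemma reachI:
  "\<lbrakk>a \<le> b; x \<in> H1 a b; x a = p; x b = q; \<And>t. t \<in> {a..b} \<Longrightarrow> x t \<in> S; action W a b x \<le> ennreal c; 0 \<le> c\<rbrakk>
   \<Longrightarrow> reach W S p q c"
  unfolding reach_def by blast

lemma reach_mono:
  assumes "reach W S p q c" "c \<le> c'" "S \<subseteq> S'"
  shows "reach W S' p q c'"
proof -
  from assms(1) obtain a b x where x: "a \<le> b" "x \<in> H1 a b" "x a = p" "x b = q" "\<forall>t\<in>{a..b}. x t \<in> S"
    "action W a b x \<le> ennreal c" and c: "0 \<le> c" unfolding reach_def by blast
  show ?thesis
    by (rule reachI[OF x(1-4)]) (use x assms(2,3) c in \<open>auto intro: order_trans ennreal_leI\<close>)
qed

lemma H1_const: "a \<le> b \<Longrightarrow> (\<lambda>_. p) \<in> H1 a b"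
  by (rule AC_H1[where g="\<lambda>_. 0"]) (auto simp: AC_def set_lebesgue_integral_def)

lemma H1_time_shift:
  assumes x: "x \<in> H1 a b" and ab: "a \<le> b" and W: "potential W \<in> borel_measurable borel"
  shows "(\<lambda>t. x (d + t)) \<in> H1 (a - d) (b - d)" "action W (a - d) (b - d) (\<lambda>t. x (d + t)) = action W a b x"
proof -
  have x': "x \<in> H1 (d + 1 * (a - d)) (d + 1 * (b - d))" using x by simp
  have ab': "a - d \<le> b - d" using ab by simp
  show 1: "(\<lambda>t. x (d + t)) \<in> H1 (a - d) (b - d)"
    using H1_affine(1)[OF x' ab', of 1] by simp
  have "kin (a - d) (b - d) (\<lambda>t. x (d + t)) = kin a b x" using H1_affine(2)[OF x' ab', of 1] by simp
  moreover have "pote W (a - d) (b - d) (\<lambda>t. x (d + t)) = pote W a b x"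
    using pote_affine[OF W _ ab', of 1 d x] H1_continuous[OF x] by simp
  ultimately show "action W (a - d) (b - d) (\<lambda>t. x (d + t)) = action W a b x"
    by (simp add: action_split[OF W ab' 1] action_split[OF W ab x])
qed

text \<open>Serves paths that start at the origin, where the speed of the zero energy motion blows
  up: derivative and continuity of f are required in the open interval only.\<close>

lemma FTC_open_nonneg:
  fixes F f :: "real \<Rightarrow> real"
  assumes ab: "a < b" and F: "continuous_on {a..b} F"
    and D: "\<And>t. a < t \<Longrightarrow> t < b \<Longrightarrow> (F has_real_derivative f t) (at t)"
    and f: "\<And>t. a < t \<Longrightarrow> t < b \<Longrightarrow> isCont f t" "\<And>t. a < t \<Longrightarrow> t < b \<Longrightarrow> 0 \<le> f t"
  shows "set_integrable lborel {a<..<b} f" "(LINT t:{a<..<b}|lborel. f t) = F b - F a"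
proof -
  have A: "(F \<longlongrightarrow> F a) (at_right a)" and B: "(F \<longlongrightarrow> F b) (at_left b)"
    using F ab continuous_on_Icc_at_rightD continuous_on_Icc_at_leftD by blast+
  note r = interval_integral_FTC_nonneg[of "ereal a" "ereal b" F f "F a" "F b", unfolded ereal_tendsto_simps, OF _ _ _ _ A B]
  show "set_integrable lborel {a<..<b} f"
    using r(1) D f ab by auto
  have "(LBINT t=a..b. f t) = F b - F a"
    using r(2) D f ab by auto
  then show "(LINT t:{a<..<b}|lborel. f t) = F b - F a"
    using ab by (simp add: interval_lebesgue_integral_def)
qed

text \<open>The constant \<open>v0\<close> is only a lower bound of V here. It is kept fixed when V
  and \<open>\<alpha>\<close> are perturbed; lemmas about the directions \<open>\<xi>p\<close> and
  \<open>\<xi>m\<close> add that V attains it there.\<close>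

locale kepler =
  fixes V :: "'a::euclidean_space \<Rightarrow> real" and \<alpha> v0 :: real
  assumes V_cont: "continuous_on (sphere 0 1) V" and v0: "v0 > 0"
    and V_ge: "\<And>s. s \<in> sphere 0 1 \<Longrightarrow> v0 \<le> V s" and \<alpha>: "0 < \<alpha>" "\<alpha> < 2"
begin

abbreviation W :: "('a \<Rightarrow> real) \<times> real" where "W \<equiv> (V, \<alpha>)"

definition \<beta> :: real where "\<beta> = 1 - \<alpha> / 2"

lemma \<beta>: "0 < \<beta>" "\<beta> < 1"
  using \<alpha> by (auto simp: \<beta>_def)

lemma sgn_in_sphere: "p \<noteq> 0 \<Longrightarrow> p /\<^sub>R norm p \<in> sphere 0 1" for p :: 'a
  by simp

lemma pot_eq: "p \<noteq> 0 \<Longrightarrow> potential W p = ennreal (V (p /\<^sub>R norm p) / norm p powr \<alpha>)"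
  by (simp add: potential_def)

lemma pot_zero: "potential W 0 = \<infinity>"
  by (simp add: potential_def)

lemma continuous_pot: "continuous_on (- {0}) (\<lambda>p. V (p /\<^sub>R norm p) / norm p powr \<alpha>)"
proof -
  have "continuous_on (- {0}) (\<lambda>p. V (p /\<^sub>R norm p))"
  proof (rule continuous_on_compose2[OF V_cont])
    show "continuous_on (- {0}) (\<lambda>p::'a. p /\<^sub>R norm p)" by (intro continuous_intros) auto
    show "(\<lambda>p::'a. p /\<^sub>R norm p) ` (- {0}) \<subseteq> sphere 0 1" by (intro image_subsetI sgn_in_sphere) auto
  qed
  then show ?thesis by (intro continuous_intros) auto
qed

lemma W_meas: "potential W \<in> borel_measurable borel"
proof -
  have 1: "(\<lambda>p. indicator (- {0}) p *\<^sub>R (V (p /\<^sub>R norm p) / norm p powr \<alpha>)) \<in> borel_measurable borel"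
    by (rule borel_measurable_continuous_on_indicator[OF _ continuous_pot]) auto
  have "potential W = (\<lambda>p. if p = 0 then \<infinity> else ennreal (indicator (- {0}) p *\<^sub>R (V (p /\<^sub>R norm p) / norm p powr \<alpha>)))"
    by (auto simp: potential_def fun_eq_iff)
  also have "\<dots> \<in> borel_measurable borel" using 1 by measurable
  finally show ?thesis .
qed

lemma pot_scale:
  assumes "m > 0"
  shows "potential W (m *\<^sub>R p) = ennreal (m powr - \<alpha>) * potential W p"
proof (cases "p = 0")
  case True
  then show ?thesis using assms by (simp add: pot_zero ennreal_mult_top)
next
  case False
  have "(m *\<^sub>R p) /\<^sub>R norm (m *\<^sub>R p) = p /\<^sub>R norm p" using assms by simp
  then have "V ((m *\<^sub>R p) /\<^sub>R norm (m *\<^sub>R p)) / norm (m *\<^sub>R p) powr \<alpha> = m powr - \<alpha> * (V (p /\<^sub>R norm p) / norm p powr \<alpha>)"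
    using assms by (simp add: powr_mult powr_minus divide_simps)
  moreover have "V (p /\<^sub>R norm p) / norm p powr \<alpha> \<ge> 0"
    using V_ge[OF sgn_in_sphere[OF False]] v0 by simp
  ultimately show ?thesis using False assms by (simp add: pot_eq flip: ennreal_mult)
qed

lemma reach_refl: "p \<in> S \<Longrightarrow> reach W S p p 0"
  by (rule reachI[of 0 0 "\<lambda>_. p"]) (auto simp: action_degenerate H1_const)

lemma reach_trans:
  assumes "reach W S p q c" "reach W S q r d"
  shows "reach W S p r (c + d)"
proof -
  from assms(1) obtain a b x where x: "a \<le> b" "x \<in> H1 a b" "x a = p" "x b = q" "\<forall>t\<in>{a..b}. x t \<in> S"
    "action W a b x \<le> ennreal c" and c: "0 \<le> c" unfolding reach_def by blast
  from assms(2) obtain a' b' y where y: "a' \<le> b'" "y \<in> H1 a' b'" "y a' = q" "y b' = r" "\<forall>t\<in>{a'..b'}. y t \<in> S"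
    "action W a' b' y \<le> ennreal d" and d: "0 \<le> d" unfolding reach_def by blast
  define k where "k = a' - b"
  let ?y = "\<lambda>t. y (k + t)"
  have y': "?y \<in> H1 b (b' - k)" "action W b (b' - k) ?y = action W a' b' y"
    using H1_time_shift[OF y(2,1) W_meas, of k] by (auto simp: k_def)
  have eq: "x b = ?y b" using x y by (simp add: k_def)
  have bb: "b \<le> b' - k" using y(1) by (simp add: k_def)
  show ?thesis
  proof (rule reachI[of a "b' - k" "\<lambda>t. if t \<le> b then x t else ?y t"])
    show "(\<lambda>t. if t \<le> b then x t else ?y t) \<in> H1 a (b' - k)"
      by (rule H1_concat[OF x(2) y'(1) eq x(1) bb])
    show "action W a (b' - k) (\<lambda>t. if t \<le> b then x t else ?y t) \<le> ennreal (c + d)"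
      unfolding action_concat[OF W_meas x(2) y'(1) eq x(1) bb] y'(2)
      using x(6) y(6) c d by (simp add: add_mono)
    show "(if t \<le> b then x t else ?y t) \<in> S" if "t \<in> {a..b' - k}" for t
      using that x(5) y(5) by (auto simp: k_def)
  qed (use x y c d bb eq in \<open>auto simp: k_def\<close>)
qed

lemma reach_sym:
  assumes "reach W S p q c"
  shows "reach W S q p c"
proof -
  from assms obtain a b x where x: "a \<le> b" "x \<in> H1 a b" "x a = p" "x b = q" "\<forall>t\<in>{a..b}. x t \<in> S"
    "action W a b x \<le> ennreal c" and c: "0 \<le> c" unfolding reach_def by blast
  show ?thesis
    by (rule reachI[of "-b" "-a" "\<lambda>t. x (- t)"]) (use x c reverse_action[OF W_meas x(1,2)] in auto)
qed

lemma reach_scale: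
  assumes "reach W S p q c" and m: "m > 0"
  shows "reach W ((\<lambda>p. m *\<^sub>R p) ` S) (m *\<^sub>R p) (m *\<^sub>R q) (m powr \<beta> * c)"
proof -
  from assms obtain a b x where x: "a \<le> b" "x \<in> H1 a b" "x a = p" "x b = q" "\<forall>t\<in>{a..b}. x t \<in> S"
    "action W a b x \<le> ennreal c" and c: "0 \<le> c" unfolding reach_def by blast
  \<comment> \<open>The change of speed for which the kinetic factor \<open>m\<^sup>2 * l\<close>
    and the potential factor \<open>m powr - \<alpha> / l\<close> are both
    \<open>m powr \<beta>\<close>.\<close>
  define l where "l = m powr - (1 + \<alpha> / 2)"
  have l: "l > 0" using m by (simp add: l_def)
  let ?a = "a / l" and ?b = "b / l" and ?x = "\<lambda>t. x (0 + l * t)"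
  have x': "x \<in> H1 (0 + l * ?a) (0 + l * ?b)" and ab: "?a \<le> ?b" using x l by (auto simp: divide_right_mono)
  have h: "(\<lambda>t. m *\<^sub>R ?x t) \<in> H1 ?a ?b" by (rule H1_affine(1)[OF x' ab l])
  have h1: "?x \<in> H1 ?a ?b" using H1_affine(1)[OF x' ab l, of 1] by simp
  have k: "kin ?a ?b (\<lambda>t. m *\<^sub>R ?x t) = ennreal (m\<^sup>2 * l) * kin a b x"
    using H1_affine(2)[OF x' ab l, of m] l by simp
  have "pote W ?a ?b (\<lambda>t. m *\<^sub>R ?x t) = ennreal (m powr - \<alpha>) * pote W ?a ?b ?x"
  proof -
    note [measurable] = potential_clamp_measurable[OF W_meas ab H1_continuous[OF h1]]
    show ?thesis
      unfolding pote_clamp pot_scale[OF m] mult.assoc by (rule nn_integral_cmult) measurable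
  qed
  also have "pote W ?a ?b ?x = ennreal (1 / l) * pote W a b x"
    using pote_affine[OF W_meas l ab, of 0 x] H1_continuous[OF x(2)] l by simp
  finally have p: "pote W ?a ?b (\<lambda>t. m *\<^sub>R ?x t) = ennreal (m powr - \<alpha> / l) * pote W a b x"
    using l by (simp add: mult.assoc[symmetric] flip: ennreal_mult)
  have m2: "m\<^sup>2 = m powr 2" using m by (simp add: powr_numeral)
  have "m\<^sup>2 * l = m powr \<beta>" unfolding m2 l_def by (simp flip: powr_add add: \<beta>_def)
  moreover have "m powr - \<alpha> / l = m powr \<beta>" unfolding l_def by (simp flip: powr_diff add: \<beta>_def)
  ultimately have "action W ?a ?b (\<lambda>t. m *\<^sub>R ?x t) = ennreal (m powr \<beta>) * action W a b x"
    unfolding action_split[OF W_meas ab h] action_split[OF W_meas x(1,2)] k p by (simp add: distrib_left)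
  then have act: "action W ?a ?b (\<lambda>t. m *\<^sub>R ?x t) \<le> ennreal (m powr \<beta> * c)"
    using x(6) c by (simp add: ennreal_mult mult_left_mono)
  show ?thesis
  proof (rule reachI[OF ab h _ _ _ act])
    fix t assume "t \<in> {a / l..b / l}"
    then have "l * t \<in> {a..b}" using l by (auto simp: field_simps)
    then show "m *\<^sub>R x (0 + l * t) \<in> (*\<^sub>R) m ` S" using x(5) by auto
  qed (use x l c in auto)
qed

text \<open>The line is run through with \<open>R' = sqrt (2 * v) * R powr (- \<alpha> / 2)\<close>,
  the radial motion of energy zero, for which kinetic and potential action are bounded by the same
  quantity. The factor m absorbs a vector B that is longer than 1 and a potential above its radial
  value, so that the lemma covers true rays as well as the slightly tilted segments of
  \<open>connection\<close>.\<close>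

lemma reach_affine_ray:
  fixes A B :: 'a
  assumes v: "v > 0" and r: "0 \<le> r0" "r0 \<le> r1" and m: "m \<ge> 0" and B: "(norm B)\<^sup>2 \<le> m"
    and pot: "\<And>r. r0 < r \<Longrightarrow> r < r1 \<Longrightarrow> potential W (A + r *\<^sub>R B) \<le> ennreal (m * v * r powr - \<alpha>)"
    and S: "\<And>r. r0 \<le> r \<Longrightarrow> r \<le> r1 \<Longrightarrow> A + r *\<^sub>R B \<in> S"
  shows "reach W S (A + r0 *\<^sub>R B) (A + r1 *\<^sub>R B) (m * (sqrt (2 * v) * (r1 powr \<beta> - r0 powr \<beta>) / \<beta>))"
proof (cases "r0 < r1")
  case False
  then have "r0 = r1" using r by simp
  then show ?thesis using S[of r1] r by (auto intro!: reach_refl)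
next
  case True
  \<comment> \<open>The equation for R integrates to \<open>R powr e = k * t\<close> with k as
    below; the segment is traversed between the times t0 and t1 at which R equals r0 and r1.\<close>
  define e where "e = 1 + \<alpha> / 2"
  define k where "k = e * sqrt (2 * v)"
  define R where "R = (\<lambda>t. (k * t) powr (1 / e))"
  define R' where "R' = (\<lambda>t. sqrt (2 * v) * (k * t) powr (1 / e - 1))"
  define t0 where "t0 = r0 powr e / k"
  define t1 where "t1 = r1 powr e / k"
  have e: "e > 1" using \<alpha> by (simp add: e_def)
  have k: "k > 0" using e v by (simp add: k_def)
  have t: "0 \<le> t0" "t0 < t1" using k e r True by (auto simp: t0_def t1_def divide_strict_right_mono powr_less_mono2)
  have Rt: "R t0 = r0" "R t1 = r1" using k e r by (auto simp: R_def t0_def t1_def powr_powr)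
  have Rin: "r0 < R t \<and> R t < r1" if "t0 < t" "t < t1" for t
  proof -
    have "(k * t0) powr (1 / e) < (k * t) powr (1 / e)" "(k * t) powr (1 / e) < (k * t1) powr (1 / e)"
      using that k e t by (auto intro!: powr_less_mono2)
    then show ?thesis using Rt by (simp add: R_def)
  qed
  have Rin': "r0 \<le> R t \<and> R t \<le> r1" if "t0 \<le> t" "t \<le> t1" for t
  proof -
    have "(k * t0) powr (1 / e) \<le> (k * t) powr (1 / e)" "(k * t) powr (1 / e) \<le> (k * t1) powr (1 / e)"
      using that k e t by (auto intro!: powr_mono2)
    then show ?thesis using Rt by (simp add: R_def)
  qed
  have Rc: "continuous_on {t0..s} R" for s
    unfolding R_def by (intro continuous_on_powr' continuous_intros) (use k e t in auto)
  have RD: "(R has_real_derivative R' t) (at t)" if "t > 0" for t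
  proof -
    have "(R has_real_derivative (1 / e) * (k * t) powr (1 / e - 1) * k) (at t)"
      unfolding R_def using that k by (auto intro!: derivative_eq_intros)
    moreover have "(1 / e) * (k * t) powr (1 / e - 1) * k = R' t" using e by (simp add: R'_def k_def)
    ultimately show ?thesis by simp
  qed
  have R'c: "isCont R' t" if "t > 0" for t
    unfolding R'_def using that k by (intro continuous_intros) auto
  have R'0: "R' t \<ge> 0" for t using v by (simp add: R'_def)
  \<comment> \<open>The primitive of \<open>(R' t)\<^sup>2\<close>, that is,
    \<open>sqrt (2 * v) / \<beta>\<close> times \<open>R t powr \<beta>\<close>. Kinetic and
    potential action are each at most m / 2 times its increment.\<close>
  define F where "F = (\<lambda>t. sqrt (2 * v) / \<beta> * (k * t) powr (\<beta> / e))"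
  have Fc: "continuous_on {t0..t1} F"
    unfolding F_def by (intro continuous_on_mult continuous_on_powr' continuous_intros) (use k e t \<beta> in auto)
  have R'2: "(R' t)\<^sup>2 = 2 * v * (k * t) powr (- \<alpha> / e)" if "t > 0" for t
  proof -
    have "((k * t) powr (1 / e - 1))\<^sup>2 = (k * t) powr (2 * (1 / e - 1))"
      by (simp add: power2_eq_square flip: powr_add)
    moreover have "2 * (1 / e - 1) = - \<alpha> / e" using e by (simp add: field_simps) (simp add: e_def field_simps)
    ultimately show ?thesis using v by (simp add: R'_def power_mult_distrib)
  qed
  have FD: "(F has_real_derivative (R' t)\<^sup>2) (at t)" if "t > 0" for t
  proof -
    have "(F has_real_derivative sqrt (2 * v) / \<beta> * ((\<beta> / e) * (k * t) powr (\<beta> / e - 1) * k)) (at t)"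
      unfolding F_def using that k by (auto intro!: derivative_eq_intros)
    moreover have "\<beta> / e - 1 = - \<alpha> / e" using e by (simp add: field_simps) (simp add: e_def \<beta>_def field_simps)
    moreover have "sqrt (2 * v) / \<beta> * ((\<beta> / e) * z * k) = 2 * v * z" for z
    proof -
      have "sqrt (2 * v) / \<beta> * ((\<beta> / e) * z * k) = sqrt (2 * v) * (z * k) / e" using \<beta> by simp
      also have "\<dots> = sqrt (2 * v) * sqrt (2 * v) * z" using e by (simp add: k_def)
      finally show ?thesis using v by simp
    qed
    ultimately show ?thesis using R'2[OF that] by simp
  qed
  have Ft: "F t1 - F t0 = sqrt (2 * v) * (r1 powr \<beta> - r0 powr \<beta>) / \<beta>"
    using k e r by (simp add: F_def t0_def t1_def powr_powr diff_divide_distrib right_diff_distrib)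
  note I2 = FTC_open_nonneg[of t0 t1 F "\<lambda>t. (R' t)\<^sup>2", OF t(2) Fc]
  have I2i: "set_integrable lborel {t0<..<t1} (\<lambda>t. (R' t)\<^sup>2)" and I2e: "(LINT t:{t0<..<t1}|lborel. (R' t)\<^sup>2) = F t1 - F t0"
    using I2 FD R'c t by (auto intro!: continuous_power)
  let ?x = "\<lambda>t. A + R t *\<^sub>R B"
  define g where "g = (\<lambda>t. (indicator {t0<..<t1} t * R' t) *\<^sub>R B)"
  have t01: "t0 \<le> t1" using t by simp
  have [measurable]: "R' \<in> borel_measurable borel" unfolding R'_def by measurable
  have g2: "(norm (g t))\<^sup>2 = (norm B)\<^sup>2 * (indicator {t0<..<t1} t *\<^sub>R (R' t)\<^sup>2)" for t
    by (auto simp: g_def power_mult_distrib indicator_def)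
  have ac: "AC t0 t1 ?x g"
  proof (rule AC_I[OF t01])
    show "g \<in> borel_measurable borel" unfolding g_def by measurable
    show "integrable lborel (\<lambda>t. (norm (g t))\<^sup>2)"
      unfolding g2 using I2i by (auto simp: set_integrable_def)
    fix t assume tt: "t \<in> {t0..t1}"
    show "?x t - ?x t0 = (LINT u:{t0<..t}|lborel. g u)"
    proof (cases "t0 < t")
      case True
      have I: "set_integrable lborel {t0<..<t} R'" "(LINT u:{t0<..<t}|lborel. R' u) = R t - R t0"
        by (rule FTC_open_nonneg[OF True Rc]; use RD R'c R'0 t in auto)+
      have "(LINT u:{t0<..t}|lborel. g u) = (\<integral>u. (indicator {t0<..<t} u *\<^sub>R R' u) *\<^sub>R B \<partial>lborel)"
        unfolding set_lebesgue_integral_def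
      proof (rule integral_cong_AE)
        show "AE u in lborel. indicat_real {t0<..t} u *\<^sub>R g u = (indicator {t0<..<t} u *\<^sub>R R' u) *\<^sub>R B"
          by (rule AE_mp[OF AE_lborel_singleton[of t]], rule AE_I2)
             (use tt in \<open>auto simp: g_def indicator_def\<close>)
      qed (auto simp: g_def)
      also have "\<dots> = (R t - R t0) *\<^sub>R B"
        using I unfolding set_lebesgue_integral_def set_integrable_def by (subst integral_scaleR_left) auto
      finally show ?thesis by (simp add: scaleR_diff_left)
    next
      case False
      then show ?thesis using tt by (simp add: set_lebesgue_integral_def)
    qed
  qed (auto simp: g_def)
  have h: "?x \<in> H1 t0 t1" by (rule AC_H1[OF t01 ac])
  have R2I: "(\<integral>\<^sup>+t. ennreal (indicator {t0<..<t1} t *\<^sub>R (R' t)\<^sup>2) \<partial>lborel) = ennreal (F t1 - F t0)"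
    unfolding I2e[symmetric] set_lebesgue_integral_def
    by (rule nn_integral_eq_integral) (use I2i in \<open>auto simp: set_integrable_def\<close>)
  have F0: "F t1 - F t0 \<ge> 0" unfolding Ft using v r \<beta> by (auto intro!: divide_nonneg_pos mult_nonneg_nonneg powr_mono2)
  have K: "kin t0 t1 ?x \<le> ennreal (m / 2 * (F t1 - F t0))"
  proof -
    have "(\<integral>t. (norm (g t))\<^sup>2 \<partial>lborel) = (norm B)\<^sup>2 * (F t1 - F t0)"
      unfolding g2 using I2e by (simp add: set_lebesgue_integral_def)
    moreover have "(norm B)\<^sup>2 * (F t1 - F t0) / 2 \<le> m / 2 * (F t1 - F t0)"
      using mult_right_mono[OF B F0] by simp
    ultimately show ?thesis unfolding kin_eq_integral[OF t01 ac] by (simp add: ennreal_leI)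
  qed
  have Pp: "pote W t0 t1 ?x \<le> ennreal (m / 2 * (F t1 - F t0))"
  proof -
    have "pote W t0 t1 ?x \<le> (\<integral>\<^sup>+t. ennreal (m / 2) * ennreal (indicator {t0<..<t1} t *\<^sub>R (R' t)\<^sup>2) \<partial>lborel)"
      unfolding pote_def
    proof (rule nn_integral_mono)
      fix t
      show "potential W (?x t) * indicator {t0<..<t1} t \<le> ennreal (m / 2) * ennreal (indicator {t0<..<t1} t *\<^sub>R (R' t)\<^sup>2)"
      proof (cases "t \<in> {t0<..<t1}")
        case True
        then have t': "t > 0" using t by auto
        have "R t powr - \<alpha> = (k * t) powr (- \<alpha> / e)" by (simp add: R_def powr_powr)
        then have "m * v * R t powr - \<alpha> = m / 2 * (R' t)\<^sup>2" using R'2[OF t'] by simp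
        then have "potential W (?x t) \<le> ennreal (m / 2 * (R' t)\<^sup>2)"
          using pot[of "R t"] Rin[of t] True by (simp only: greaterThanLessThan_iff)
        then show ?thesis using True m by (simp flip: ennreal_mult)
      qed simp
    qed
    also have "\<dots> = ennreal (m / 2) * ennreal (F t1 - F t0)"
      by (subst nn_integral_cmult, measurable) (simp only: R2I)
    also have "\<dots> = ennreal (m / 2 * (F t1 - F t0))" using m F0 by (intro ennreal_mult[symmetric]) auto
    finally show ?thesis .
  qed
  have "action W t0 t1 ?x \<le> ennreal (m / 2 * (F t1 - F t0)) + ennreal (m / 2 * (F t1 - F t0))"
    unfolding action_split[OF W_meas t01 h] by (rule add_mono[OF K Pp])
  also have "\<dots> = ennreal (m * (F t1 - F t0))"
    using m F0 by (simp flip: ennreal_plus)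
  finally have act: "action W t0 t1 ?x \<le> ennreal (m * (F t1 - F t0))" .
  show ?thesis
    unfolding Ft[symmetric]
    by (rule reachI[OF t01 h _ _ _ act]) (use Rt m F0 S Rin' in auto)
qed

end

section \<open>Calibrations\<close>

context kepler
begin

text \<open>At radius r and angle \<theta> to \<open>\<sigma>\<close> this is
  \<open>r powr \<beta> / \<beta>\<close> times \<open>1 - k * (1 - cos \<theta>)\<close>. For k = 0
  it is the radial coordinate; for \<open>k = \<beta>\<^sup>2\<close> it agrees to second order in
  \<theta> with \<open>r powr \<beta> * cos (\<beta> * \<theta>) / \<beta>\<close>, the linear
  coordinate of the flat cone.\<close>

definition G :: "real \<Rightarrow> 'a \<Rightarrow> 'a \<Rightarrow> real" where
  "G k \<sigma> p = ((1 - k) * norm p powr \<beta> + k * norm p powr (\<beta> - 1) * (p \<bullet> \<sigma>)) / \<beta>"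

lemma has_derivative_norm_powr:
  fixes p :: 'a assumes "p \<noteq> 0"
  shows "((\<lambda>p. norm p powr a) has_derivative (\<lambda>h. a * norm p powr (a - 1) * (sgn p \<bullet> h))) (at p)"
proof -
  have "((\<lambda>r. r powr a) has_real_derivative a * norm p powr (a - 1)) (at (norm p))"
    by (rule has_real_derivative_powr) (use assms in simp)
  from DERIV_compose_FDERIV[OF this has_derivative_norm[OF assms]]
  show ?thesis by (simp add: ac_simps inner_commute)
qed

text \<open>Up to the factor \<open>r powr (\<beta> - 1)\<close> the gradient is D0, with radial
  part \<open>1 - b * \<beta> * (1 - c)\<close> and tangential part of square
  \<open>b\<^sup>2 * (1 - c\<^sup>2)\<close>, where c is the cosine of the angle to
  \<open>\<sigma>\<close> and \<open>b = k / \<beta>\<close>. The sum of squares is 1 minus two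
  terms, the first nonnegative because \<open>k \<le> \<beta>\<^sup>2\<close> means
  \<open>b \<le> \<beta>\<close>, the second because \<open>\<beta> \<le> 1\<close>.\<close>

lemma G_derivative:
  fixes p :: 'a
  assumes p: "p \<noteq> 0" and \<sigma>: "norm \<sigma> = 1" and k: "0 \<le> k" "k \<le> \<beta>\<^sup>2"
  obtains D where "(G k \<sigma> has_derivative (\<lambda>h. D \<bullet> h)) (at p)" "norm D \<le> norm p powr (\<beta> - 1)"
proof -
  define r where "r = norm p"
  define s where "s = sgn p"
  define c where "c = s \<bullet> \<sigma>"
  define b where "b = k / \<beta>"
  define a where "a = (1 - k) + b * (\<beta> - 1) * c"
  define D0 where "D0 = a *\<^sub>R s + b *\<^sub>R \<sigma>"
  have r: "r > 0" using p by (simp add: r_def)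
  have kb: "k = b * \<beta>" using \<beta> by (simp add: b_def)
  have b: "0 \<le> b" "b \<le> \<beta>" using k \<beta> by (auto simp: b_def power2_eq_square divide_le_eq)
  have s1: "s \<bullet> s = 1" using p by (simp add: s_def dot_square_norm norm_sgn)
  have \<sigma>1: "\<sigma> \<bullet> \<sigma> = 1" using \<sigma> by (simp add: dot_square_norm)
  have c: "\<bar>c\<bar> \<le> 1" using Cauchy_Schwarz_ineq2[of s \<sigma>] p \<sigma> by (simp add: c_def s_def norm_sgn)
  have "(norm D0)\<^sup>2 = a\<^sup>2 + 2 * a * b * c + b\<^sup>2"
    unfolding D0_def power2_norm_eq_inner
    by (simp add: inner_add_left inner_add_right s1 \<sigma>1 c_def inner_commute[of \<sigma> s] power2_eq_square algebra_simps)
  also have "\<dots> = (a + b * c)\<^sup>2 + b\<^sup>2 * (1 - c\<^sup>2)" by (simp add: power2_eq_square algebra_simps)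
  also have "a + b * c = 1 - b * \<beta> * (1 - c)" by (simp add: a_def kb algebra_simps)
  also have "(1 - b * \<beta> * (1 - c))\<^sup>2 + b\<^sup>2 * (1 - c\<^sup>2) = 1 - 2 * (b * (1 - c) * (\<beta> - b)) - (b * (1 - c))\<^sup>2 * (1 - \<beta>\<^sup>2)"
    by (simp add: power2_eq_square algebra_simps)
  also have "\<dots> \<le> 1"
  proof -
    have "b * (1 - c) * (\<beta> - b) \<ge> 0" using b c by auto
    moreover have "\<beta>\<^sup>2 \<le> 1" using \<beta> by (simp add: power_le_one)
    then have "(b * (1 - c))\<^sup>2 * (1 - \<beta>\<^sup>2) \<ge> 0" by simp
    ultimately show ?thesis by linarith
  qed
  finally have D0: "norm D0 \<le> 1" by (simp add: power_le_one_iff abs_square_le_1)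
  have "(G k \<sigma> has_derivative (\<lambda>h. ((1 - k) * (\<beta> * r powr (\<beta> - 1) * (s \<bullet> h)) +
      (k * (((\<beta> - 1) * r powr (\<beta> - 2) * (s \<bullet> h)) * (p \<bullet> \<sigma>) + r powr (\<beta> - 1) * (h \<bullet> \<sigma>)))) / \<beta>)) (at p)"
  proof -
    have 3: "((\<lambda>p. p \<bullet> \<sigma>) has_derivative (\<lambda>h. h \<bullet> \<sigma>)) (at p)" by (intro derivative_intros)
    note 4 = has_derivative_mult[OF has_derivative_norm_powr[OF p, of "\<beta> - 1"] 3]
    note 5 = has_derivative_add[OF has_derivative_mult_right[OF has_derivative_norm_powr[OF p, of \<beta>], of "1 - k"]
        has_derivative_mult_right[OF 4, of k]]
    have "G k \<sigma> = (\<lambda>p. ((1 - k) * norm p powr \<beta> + k * (norm p powr (\<beta> - 1) * (p \<bullet> \<sigma>))) * inverse \<beta>)"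
      by (simp add: G_def fun_eq_iff divide_inverse mult.assoc)
    moreover note has_derivative_mult_left[OF 5, of "inverse \<beta>"]
    ultimately show ?thesis by (simp add: r_def s_def divide_inverse algebra_simps)
  qed
  moreover have "((1 - k) * (\<beta> * r powr (\<beta> - 1) * (s \<bullet> h)) +
      (k * (((\<beta> - 1) * r powr (\<beta> - 2) * (s \<bullet> h)) * (p \<bullet> \<sigma>) + r powr (\<beta> - 1) * (h \<bullet> \<sigma>)))) / \<beta> = (r powr (\<beta> - 1) *\<^sub>R D0) \<bullet> h" for h
  proof -
    have "p \<bullet> \<sigma> = r * c" using p by (simp add: r_def c_def s_def sgn_div_norm)
    moreover have "r powr (\<beta> - 2) * r = r powr (\<beta> - 1)" using r powr_add[of r "\<beta> - 2" 1] by simp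
    ultimately have e: "r powr (\<beta> - 2) * (p \<bullet> \<sigma>) = r powr (\<beta> - 1) * c" by (metis mult.assoc)
    have "(((\<beta> - 1) * r powr (\<beta> - 2) * (s \<bullet> h)) * (p \<bullet> \<sigma>)) = (\<beta> - 1) * (r powr (\<beta> - 2) * (p \<bullet> \<sigma>)) * (s \<bullet> h)" by simp
    also have "\<dots> = r powr (\<beta> - 1) * ((\<beta> - 1) * c * (s \<bullet> h))" unfolding e by simp
    finally have e2: "(((\<beta> - 1) * r powr (\<beta> - 2) * (s \<bullet> h)) * (p \<bullet> \<sigma>)) = r powr (\<beta> - 1) * ((\<beta> - 1) * c * (s \<bullet> h))" .
    have "((1 - k) * (\<beta> * r powr (\<beta> - 1) * (s \<bullet> h)) + (k * (r powr (\<beta> - 1) * ((\<beta> - 1) * c * (s \<bullet> h)) + r powr (\<beta> - 1) * (h \<bullet> \<sigma>))))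
      = \<beta> * (r powr (\<beta> - 1) * (a * (s \<bullet> h) + b * (\<sigma> \<bullet> h)))"
      by (simp add: a_def kb inner_commute algebra_simps)
    then show ?thesis unfolding e2 using \<beta> by (simp add: D0_def inner_add_left)
  qed
  ultimately have "(G k \<sigma> has_derivative (\<lambda>h. (r powr (\<beta> - 1) *\<^sub>R D0) \<bullet> h)) (at p)" by simp
  moreover have "norm (r powr (\<beta> - 1) *\<^sub>R D0) \<le> norm p powr (\<beta> - 1)"
    using mult_left_mono[OF D0, of "r powr (\<beta> - 1)"] by (simp add: r_def)
  ultimately show ?thesis by (rule that)
qed

lemma G_lipschitz:
  fixes p :: 'a
  assumes d: "0 < d" "d < norm p" and \<sigma>: "norm \<sigma> = 1" and k: "0 \<le> k" "k \<le> \<beta>\<^sup>2"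
    and q: "q \<in> ball p d" "q' \<in> ball p d"
  shows "\<bar>G k \<sigma> q - G k \<sigma> q'\<bar> \<le> (norm p - d) powr (\<beta> - 1) * norm (q - q')"
proof -
  have far: "norm y > norm p - d" if "y \<in> ball p d" for y
    using that norm_triangle_ineq2[of p y] by (auto simp: dist_norm)
  have "\<exists>D. (G k \<sigma> has_derivative (\<lambda>h. D \<bullet> h)) (at y) \<and> norm D \<le> (norm p - d) powr (\<beta> - 1)" if y: "y \<in> ball p d" for y
  proof -
    have y0: "y \<noteq> 0" using far[OF y] d by auto
    obtain D where D: "(G k \<sigma> has_derivative (\<lambda>h. D \<bullet> h)) (at y)" "norm D \<le> norm y powr (\<beta> - 1)"
      using G_derivative[OF y0 \<sigma> k] by blast
    moreover have "norm y powr (\<beta> - 1) \<le> (norm p - d) powr (\<beta> - 1)"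
      using far[OF y] d \<beta> by (intro powr_mono2') auto
    ultimately show ?thesis by (intro exI[of _ D]) auto
  qed
  then obtain D where D: "\<And>y. y \<in> ball p d \<Longrightarrow> (G k \<sigma> has_derivative (\<lambda>h. D y \<bullet> h)) (at y)"
    "\<And>y. y \<in> ball p d \<Longrightarrow> norm (D y) \<le> (norm p - d) powr (\<beta> - 1)" by metis
  have "norm (G k \<sigma> q - G k \<sigma> q') \<le> (norm p - d) powr (\<beta> - 1) * norm (q - q')"
  proof (rule differentiable_bound[OF convex_ball _ _ q])
    fix y assume y: "y \<in> ball p d"
    show "(G k \<sigma> has_derivative (\<lambda>h. D y \<bullet> h)) (at y within ball p d)"
      using D(1)[OF y] has_derivative_at_withinI by blast
    show "onorm ((\<bullet>) (D y)) \<le> (norm p - d) powr (\<beta> - 1)"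
    proof (rule onorm_le)
      fix h
      have "\<bar>D y \<bullet> h\<bar> \<le> norm (D y) * norm h" by (rule Cauchy_Schwarz_ineq2)
      also have "\<dots> \<le> (norm p - d) powr (\<beta> - 1) * norm h" by (intro mult_right_mono D y norm_ge_zero)
      finally show "norm (D y \<bullet> h) \<le> (norm p - d) powr (\<beta> - 1) * norm h" by simp
    qed
  qed
  then show ?thesis by simp
qed

lemma pot_ge:
  assumes "p \<noteq> 0" "v \<le> V (p /\<^sub>R norm p)"
  shows "ennreal (v * norm p powr - \<alpha>) \<le> potential W p"
  using assms by (simp add: pot_eq powr_minus field_simps ennreal_leI divide_right_mono)

definition act :: "real \<Rightarrow> real \<Rightarrow> (real \<Rightarrow> 'a) \<Rightarrow> real" where
  "act a b x = enn2real (action W a b x)"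

lemma act_finite_sub:
  assumes x: "x \<in> H1 a b" and f: "action W a b x < \<infinity>" and st: "a \<le> s" "s \<le> t" "t \<le> b"
  shows "action W s t x < \<infinity>"
proof -
  have "action W a b x = action W a s x + action W s b x" using action_add[OF W_meas x] st by auto
  moreover have "action W s b x = action W s t x + action W t b x"
    using action_add[OF W_meas H1_restrict[OF x, of s b]] st by auto
  ultimately show ?thesis using f by (auto simp: ennreal_add_eq_top less_top)
qed

lemma action_mono_sub:
  assumes x: "x \<in> H1 a b" and st: "a \<le> s" "s \<le> t" "t \<le> b"
  shows "action W s t x \<le> action W a b x"
proof -
  have "action W a b x = action W a s x + action W s b x" using action_add[OF W_meas x] st by auto
  moreover have "action W s b x = action W s t x + action W t b x"
    using action_add[OF W_meas H1_restrict[OF x, of s b]] st by auto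
  ultimately show ?thesis by (simp add: add_increasing add_increasing2)
qed

lemma act_add:
  assumes x: "x \<in> H1 a c" and f: "action W a c x < \<infinity>" and ab: "a \<le> b" "b \<le> c"
  shows "act a c x = act a b x + act b c x"
  unfolding act_def action_add[OF W_meas x ab]
  using act_finite_sub[OF x f, of a b] act_finite_sub[OF x f, of b c] ab by (intro enn2real_plus) auto

lemma action_act:
  assumes x: "x \<in> H1 a b" and f: "action W a b x < \<infinity>"
  shows "action W a b x = ennreal (act a b x)"
  using f by (simp add: act_def)

text \<open>The metric \<open>r\<^sup>2\<^sup>\<beta>\<^sup>-\<^sup>2 |dx|\<^sup>2\<close> is flat in two dimensions, and \<open>G\<close> plays the role of a
  linear coordinate: its gradient never exceeds the conformal factor.\<close>

lemma calibration:
  assumes ab: "a \<le> b" and x: "x \<in> H1 a b" and v: "v > 0"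
    and xv: "\<And>t. t \<in> {a..b} \<Longrightarrow> x t \<noteq> 0 \<and> v \<le> V (x t /\<^sub>R norm (x t))"
    and \<sigma>: "norm \<sigma> = 1" and k: "0 \<le> k" "k \<le> \<beta>\<^sup>2"
  shows "ennreal (sqrt (2 * v) * \<bar>G k \<sigma> (x b) - G k \<sigma> (x a)\<bar>) \<le> action W a b x"
proof (cases "action W a b x < \<infinity>")
  case False
  then show ?thesis by (simp add: not_less top_unique)
next
  case f: True
  have main: "sqrt (2 * v) * \<bar>G k \<sigma> (x b) - G k \<sigma> (x a)\<bar> \<le> (1 + e) * act a b x" if e: "e > 0" for e
  proof -
    \<comment> \<open>The estimate is additive over subdivisions, so it suffices to prove it on
      short intervals with the lossy factor 1 + e, which is removed at the end.\<close>
    define P where "P = (\<lambda>s t. a \<le> s \<and> s \<le> t \<and> t \<le> b \<longrightarrow> sqrt (2 * v) * \<bar>G k \<sigma> (x t) - G k \<sigma> (x s)\<bar> \<le> (1 + e) * act s t x)"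
    have "P a b"
      using ab
    proof (induction rule: Bolzano)
      case (trans s t u)
      show ?case unfolding P_def
      proof (intro impI)
        assume u: "a \<le> s \<and> s \<le> u \<and> u \<le> b"
        then have st: "s \<le> t" "t \<le> u" using trans by auto
        have 1: "sqrt (2 * v) * \<bar>G k \<sigma> (x t) - G k \<sigma> (x s)\<bar> \<le> (1 + e) * act s t x"
          "sqrt (2 * v) * \<bar>G k \<sigma> (x u) - G k \<sigma> (x t)\<bar> \<le> (1 + e) * act t u x"
          using trans(1,2) u st unfolding P_def by auto
        have "act s u x = act s t x + act t u x"
          by (rule act_add) (use H1_restrict[OF x, of s u] act_finite_sub[OF x f, of s u] u st in auto)
        moreover have "sqrt (2 * v) * \<bar>G k \<sigma> (x u) - G k \<sigma> (x s)\<bar> \<le> sqrt (2 * v) * (\<bar>G k \<sigma> (x t) - G k \<sigma> (x s)\<bar> + \<bar>G k \<sigma> (x u) - G k \<sigma> (x t)\<bar>)"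
          using v by (intro mult_left_mono) auto
        ultimately show "sqrt (2 * v) * \<bar>G k \<sigma> (x u) - G k \<sigma> (x s)\<bar> \<le> (1 + e) * act s u x"
          using 1 by (simp add: distrib_left)
      qed
    next
      case (local t)
      then have t: "t \<in> {a..b}" by simp
      define r where "r = norm (x t)"
      have r: "r > 0" using xv[OF t] by (simp add: r_def)
      \<comment> \<open>On the ball of radius d around x t the conformal factor lies between
        \<open>(r + d) powr (\<beta> - 1)\<close> and \<open>(r - d) powr (\<beta> - 1)\<close>; d
        is taken so small that their quotient is below 1 + e.\<close>
      have "((\<lambda>d. (r - d) powr (\<beta> - 1) / (r + d) powr (\<beta> - 1)) \<longlongrightarrow> (r - 0) powr (\<beta> - 1) / (r + 0) powr (\<beta> - 1)) (at_right 0)"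
        using r by (intro tendsto_intros) auto
      then have "((\<lambda>d. (r - d) powr (\<beta> - 1) / (r + d) powr (\<beta> - 1)) \<longlongrightarrow> 1) (at_right 0)" using r by simp
      then have "\<forall>\<^sub>F d in at_right 0. (r - d) powr (\<beta> - 1) / (r + d) powr (\<beta> - 1) < 1 + e"
        by (rule order_tendstoD(2)) (use e in simp)
      moreover have "\<forall>\<^sub>F d in at_right 0. d < r" "\<forall>\<^sub>F d in at_right 0. 0 < (d::real)"
        using r by (auto simp: eventually_at_right_field eventually_at_right_less)
      ultimately have "\<forall>\<^sub>F d in at_right 0. 0 < d \<and> d < r \<and> (r - d) powr (\<beta> - 1) / (r + d) powr (\<beta> - 1) < 1 + e"
        by eventually_elim auto
      then obtain d where d: "0 < d" "d < r" "(r - d) powr (\<beta> - 1) / (r + d) powr (\<beta> - 1) < 1 + e"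
        using eventually_happens[of _ "at_right (0::real)"] trivial_limit_at_right_real by blast
      have "continuous_on {a..b} x" by (rule H1_continuous[OF x])
      then obtain \<eta> where \<eta>: "\<eta> > 0" "\<And>s. s \<in> {a..b} \<Longrightarrow> \<bar>s - t\<bar> < \<eta> \<Longrightarrow> dist (x s) (x t) < d"
        using t d(1) unfolding continuous_on_iff dist_real_def by meson
      show ?case
      proof (intro exI conjI allI impI)
        show "\<eta> > 0" by fact
        fix s u assume su: "s \<le> t \<and> t \<le> u \<and> u - s < \<eta>"
        show "P s u" unfolding P_def
        proof (intro impI)
          assume s': "a \<le> s \<and> s \<le> u \<and> u \<le> b"
          have in_ball: "x w \<in> ball (x t) d" if "w \<in> {s..u}" for w
          proof -
            have "\<bar>w - t\<bar> < \<eta>" using su that by auto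
            then show ?thesis using \<eta>(2)[of w] that s' by (simp add: dist_commute)
          qed
          define m where "m = v * (r + d) powr - \<alpha>"
          have m0: "m > 0" using v r d by (simp add: m_def)
          have A0: "ennreal (sqrt (2 * m) * norm (x u - x s)) \<le> action W s u x"
          proof (rule action_lower[OF W_meas H1_restrict[OF x]])
            fix w assume w: "w \<in> {s<..<u}"
            then have wx: "x w \<noteq> 0" "v \<le> V (x w /\<^sub>R norm (x w))" using xv[of w] s' by auto
            have "norm (x w) \<le> r + d" using in_ball[of w] w norm_triangle_ineq2[of "x w" "x t"] by (auto simp: r_def dist_norm norm_minus_commute)
            then have "(r + d) powr - \<alpha> \<le> norm (x w) powr - \<alpha>" using wx \<alpha> by (intro powr_mono2') auto
            then have "ennreal m \<le> ennreal (v * norm (x w) powr - \<alpha>)" unfolding m_def using v by (intro ennreal_leI mult_left_mono) auto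
            also have "\<dots> \<le> potential W (x w)" by (rule pot_ge[OF wx])
            finally show "ennreal m \<le> potential W (x w)" .
          qed (use s' m0 in auto)
          have A: "sqrt (2 * m) * norm (x u - x s) \<le> act s u x"
          proof -
            have "action W s u x = ennreal (act s u x)"
              by (rule action_act[OF H1_restrict[OF x] act_finite_sub[OF x f]]) (use s' in auto)
            moreover have "0 \<le> act s u x" by (simp add: act_def)
            ultimately show ?thesis
              using A0 by (simp add: ennreal_le_iff)
          qed
          have sm: "sqrt (2 * m) = sqrt (2 * v) * (r + d) powr (\<beta> - 1)"
          proof -
            have "(r + d) powr - \<alpha> = ((r + d) powr (\<beta> - 1))\<^sup>2" using \<beta>_def by (simp add: power2_eq_square flip: powr_add)
            then show ?thesis by (simp add: m_def real_sqrt_mult flip: mult.assoc)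
          qed
          have rd: "(r + d) powr (\<beta> - 1) > 0" using r d by simp
          have L: "(r - d) powr (\<beta> - 1) \<le> (1 + e) * (r + d) powr (\<beta> - 1)"
            using d(3) rd by (simp add: divide_less_eq)
          have "\<bar>G k \<sigma> (x u) - G k \<sigma> (x s)\<bar> \<le> (r - d) powr (\<beta> - 1) * norm (x u - x s)"
            using G_lipschitz[of d "x t" \<sigma> k "x u" "x s"] d \<sigma> k in_ball[of u] in_ball[of s] s' by (auto simp: r_def)
          also have "\<dots> \<le> ((1 + e) * (r + d) powr (\<beta> - 1)) * norm (x u - x s)"
            by (rule mult_right_mono[OF L]) simp
          finally have "sqrt (2 * v) * \<bar>G k \<sigma> (x u) - G k \<sigma> (x s)\<bar> \<le> sqrt (2 * v) * (((1 + e) * (r + d) powr (\<beta> - 1)) * norm (x u - x s))"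
            using v by (intro mult_left_mono) auto
          also have "\<dots> = (1 + e) * (sqrt (2 * m) * norm (x u - x s))" by (simp add: sm)
          also have "\<dots> \<le> (1 + e) * act s u x" using A e by (intro mult_left_mono) auto
          finally show "sqrt (2 * v) * \<bar>G k \<sigma> (x u) - G k \<sigma> (x s)\<bar> \<le> (1 + e) * act s u x" .
        qed
      qed
    qed
    then show ?thesis using ab by (simp add: P_def)
  qed
  have "sqrt (2 * v) * \<bar>G k \<sigma> (x b) - G k \<sigma> (x a)\<bar> \<le> act a b x"
  proof (cases "act a b x = 0")
    case True
    then show ?thesis using main[of 1] by simp
  next
    case False
    then have p: "act a b x > 0" by (simp add: act_def less_le)
    show ?thesis
    proof (rule field_le_epsilon)
      fix e :: real assume "e > 0"
      then have "sqrt (2 * v) * \<bar>G k \<sigma> (x b) - G k \<sigma> (x a)\<bar> \<le> (1 + e / act a b x) * act a b x"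
        using p by (intro main) simp
      also have "\<dots> = act a b x + e" using p by (simp add: distrib_right)
      finally show "sqrt (2 * v) * \<bar>G k \<sigma> (x b) - G k \<sigma> (x a)\<bar> \<le> act a b x + e" .
    qed
  qed
  then show ?thesis unfolding action_act[OF x f] by (rule ennreal_leI)
qed

lemma G_tendsto_0: "G k \<sigma> 0 = 0" "isCont (G k \<sigma>) 0"
proof -
  show "G k \<sigma> 0 = 0" by (simp add: G_def)
  have bound: "\<bar>G k \<sigma> p\<bar> \<le> (\<bar>1 - k\<bar> + \<bar>k\<bar> * norm \<sigma>) / \<beta> * norm p powr \<beta>" for p :: 'a
  proof (cases "p = 0")
    case False
    have e: "norm p powr (\<beta> - 1) * norm p = norm p powr \<beta>" using False powr_add[of "norm p" "\<beta> - 1" 1] by simp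
    have "\<bar>norm p powr (\<beta> - 1) * (p \<bullet> \<sigma>)\<bar> \<le> norm p powr (\<beta> - 1) * (norm p * norm \<sigma>)"
      unfolding abs_mult using Cauchy_Schwarz_ineq2[of p \<sigma>] by (intro mult_mono) auto
    also have "\<dots> = norm p powr \<beta> * norm \<sigma>" using e by (metis mult.assoc)
    finally have 1: "\<bar>k * (norm p powr (\<beta> - 1) * (p \<bullet> \<sigma>))\<bar> \<le> \<bar>k\<bar> * (norm p powr \<beta> * norm \<sigma>)"
      unfolding abs_mult by (intro mult_left_mono) auto
    have "\<bar>(1 - k) * norm p powr \<beta> + k * (norm p powr (\<beta> - 1) * (p \<bullet> \<sigma>))\<bar>
        \<le> \<bar>1 - k\<bar> * norm p powr \<beta> + \<bar>k\<bar> * (norm p powr \<beta> * norm \<sigma>)"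
      using 1 abs_mult[of "1 - k" "norm p powr \<beta>"] abs_triangle_ineq[of "(1 - k) * norm p powr \<beta>"] by force
    also have "\<dots> = (\<bar>1 - k\<bar> + \<bar>k\<bar> * norm \<sigma>) * norm p powr \<beta>" by (simp add: algebra_simps)
    finally show ?thesis using \<beta> by (simp add: G_def mult.assoc divide_right_mono)
  qed (simp add: G_def)
  have "((\<lambda>p::'a. (\<bar>1 - k\<bar> + \<bar>k\<bar> * norm \<sigma>) / \<beta> * norm p powr \<beta>) \<longlongrightarrow> (\<bar>1 - k\<bar> + \<bar>k\<bar> * norm \<sigma>) / \<beta> * norm (0::'a) powr \<beta>) (at 0)"
    by (intro tendsto_mult tendsto_const tendsto_powr' tendsto_norm tendsto_ident_at) (use \<beta> in \<open>auto simp: eventually_at_filter\<close>)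
  then have "((\<lambda>p::'a. (\<bar>1 - k\<bar> + \<bar>k\<bar> * norm \<sigma>) / \<beta> * norm p powr \<beta>) \<longlongrightarrow> 0) (at 0)" by simp
  then have "(G k \<sigma> \<longlongrightarrow> 0) (at 0)"
    by (rule Lim_null_comparison[rotated]) (use bound in auto)
  then show "isCont (G k \<sigma>) 0" by (simp add: isCont_def G_def)
qed

text \<open>The calibration applies up to any time before the path hits the origin; continuity of G
  at 0 gives the limit.\<close>

lemma calibration_to_zero:
  assumes ab: "a \<le> b" and x: "x \<in> H1 a b" and z: "x b = 0" and nz: "\<And>t. a \<le> t \<Longrightarrow> t < b \<Longrightarrow> x t \<noteq> 0"
    and \<sigma>: "norm \<sigma> = 1" and k: "0 \<le> k" "k \<le> \<beta>\<^sup>2"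
  shows "ennreal (sqrt (2 * v0) * \<bar>G k \<sigma> (x a)\<bar>) \<le> action W a b x"
proof (cases "a < b")
  case False
  then show ?thesis using ab z by (simp add: G_tendsto_0)
next
  case True
  have lim: "(x \<longlongrightarrow> x b) (at_left b)" using H1_continuous[OF x] True continuous_on_Icc_at_leftD by blast
  have "((\<lambda>t. G k \<sigma> (x t)) \<longlongrightarrow> G k \<sigma> 0) (at_left b)"
    using isCont_tendsto_compose[OF G_tendsto_0(2)] lim z by metis
  then have "((\<lambda>t. ennreal (sqrt (2 * v0) * \<bar>G k \<sigma> (x t) - G k \<sigma> (x a)\<bar>)) \<longlongrightarrow> ennreal (sqrt (2 * v0) * \<bar>G k \<sigma> 0 - G k \<sigma> (x a)\<bar>)) (at_left b)"
    by (intro tendsto_intros) auto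
  moreover have "\<forall>\<^sub>F t in at_left b. ennreal (sqrt (2 * v0) * \<bar>G k \<sigma> (x t) - G k \<sigma> (x a)\<bar>) \<le> action W a b x"
  proof -
    have "ennreal (sqrt (2 * v0) * \<bar>G k \<sigma> (x t) - G k \<sigma> (x a)\<bar>) \<le> action W a b x" if t: "a < t" "t < b" for t
    proof -
      have "ennreal (sqrt (2 * v0) * \<bar>G k \<sigma> (x t) - G k \<sigma> (x a)\<bar>) \<le> action W a t x"
      proof (rule calibration[OF _ H1_restrict[OF x] v0 _ \<sigma> k])
        fix u assume "u \<in> {a..t}"
        then have "x u \<noteq> 0" using nz t by auto
        then show "x u \<noteq> 0 \<and> v0 \<le> V (x u /\<^sub>R norm (x u))" using V_ge sgn_in_sphere by blast
      qed (use t in auto)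
      also have "\<dots> \<le> action W a b x" by (rule action_mono_sub[OF x]) (use t in auto)
      finally show ?thesis .
    qed
    then show ?thesis using True by (auto simp: eventually_at_left)
  qed
  ultimately have "ennreal (sqrt (2 * v0) * \<bar>G k \<sigma> 0 - G k \<sigma> (x a)\<bar>) \<le> action W a b x"
    by (rule tendsto_upperbound) simp
  then show ?thesis by (simp add: G_tendsto_0)
qed

text \<open>A path through the origin is cut at its first and its last zero, and each of the two
  outer pieces pays the full value of G at its end. The resulting sum dominates the difference, so
  the first claim holds for such paths too.\<close>

lemma calibration_total:
  assumes ab: "a \<le> b" and x: "x \<in> H1 a b" and \<sigma>: "norm \<sigma> = 1" and k: "0 \<le> k" "k \<le> \<beta>\<^sup>2"
  shows "ennreal (sqrt (2 * v0) * \<bar>G k \<sigma> (x b) - G k \<sigma> (x a)\<bar>) \<le> action W a b x"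
    and "(\<exists>t\<in>{a..b}. x t = 0) \<Longrightarrow> ennreal (sqrt (2 * v0) * (\<bar>G k \<sigma> (x b)\<bar> + \<bar>G k \<sigma> (x a)\<bar>)) \<le> action W a b x"
proof -
  show 2: "ennreal (sqrt (2 * v0) * (\<bar>G k \<sigma> (x b)\<bar> + \<bar>G k \<sigma> (x a)\<bar>)) \<le> action W a b x" if ex: "\<exists>t\<in>{a..b}. x t = 0"
  proof -
    define Z where "Z = {t \<in> {a..b}. x t = 0}"
    have "closed Z" unfolding Z_def
      using continuous_closed_preimage[OF H1_continuous[OF x], of "{0}"] by (simp add: vimage_def Int_def)
    moreover have "bounded Z" by (rule bounded_subset[of "{a..b}"]) (auto simp: Z_def)
    ultimately have Z: "compact Z" "Z \<noteq> {}" using ex by (auto simp: compact_eq_bounded_closed Z_def)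
    obtain t1 where t1: "t1 \<in> Z" "\<And>t. t \<in> Z \<Longrightarrow> t1 \<le> t" using compact_attains_inf[OF Z] by blast
    obtain t2 where t2: "t2 \<in> Z" "\<And>t. t \<in> Z \<Longrightarrow> t \<le> t2" using compact_attains_sup[OF Z] by blast
    have t: "a \<le> t1" "t1 \<le> t2" "t2 \<le> b" "x t1 = 0" "x t2 = 0" using t1 t2 by (auto simp: Z_def)
    have A: "ennreal (sqrt (2 * v0) * \<bar>G k \<sigma> (x a)\<bar>) \<le> action W a t1 x"
      by (rule calibration_to_zero[OF _ H1_restrict[OF x] _ _ \<sigma> k]) (use t t1(2) in \<open>force simp: Z_def\<close>)+
    have B: "ennreal (sqrt (2 * v0) * \<bar>G k \<sigma> (x b)\<bar>) \<le> action W t2 b x"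
    proof -
      have h: "x \<in> H1 t2 b" using H1_restrict[OF x] t by auto
      note r = reverse_action[OF W_meas t(3) h]
      have "ennreal (sqrt (2 * v0) * \<bar>G k \<sigma> (x (- (- b)))\<bar>) \<le> action W (-b) (-t2) (\<lambda>t. x (- t))"
      proof (rule calibration_to_zero[OF _ r(1) _ _ \<sigma> k])
        fix u assume "- b \<le> u" "u < - t2"
        then show "x (- u) \<noteq> 0" using t2(2)[of "- u"] t by (force simp: Z_def)
      qed (use t in auto)
      then show ?thesis using r(2) by simp
    qed
    have "ennreal (sqrt (2 * v0) * (\<bar>G k \<sigma> (x b)\<bar> + \<bar>G k \<sigma> (x a)\<bar>)) = ennreal (sqrt (2 * v0) * \<bar>G k \<sigma> (x a)\<bar>) + ennreal (sqrt (2 * v0) * \<bar>G k \<sigma> (x b)\<bar>)"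
      using v0 by (subst ennreal_plus[symmetric]) (auto simp: distrib_left)
    also have "\<dots> \<le> action W a t1 x + action W t1 b x"
      using A B action_mono_sub[OF H1_restrict[OF x, of t1 b], of t2 b] t by (intro add_mono) auto
    also have "\<dots> = action W a b x" using action_add[OF W_meas x, of t1] t by simp
    finally show ?thesis .
  qed
  show "ennreal (sqrt (2 * v0) * \<bar>G k \<sigma> (x b) - G k \<sigma> (x a)\<bar>) \<le> action W a b x"
  proof (cases "\<exists>t\<in>{a..b}. x t = 0")
    case True
    have "ennreal (sqrt (2 * v0) * \<bar>G k \<sigma> (x b) - G k \<sigma> (x a)\<bar>) \<le> ennreal (sqrt (2 * v0) * (\<bar>G k \<sigma> (x b)\<bar> + \<bar>G k \<sigma> (x a)\<bar>))"
      using v0 by (intro ennreal_leI mult_left_mono) auto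
    then show ?thesis using 2[OF True] by simp
  next
    case False
    have "x u \<noteq> 0 \<and> v0 \<le> V (x u /\<^sub>R norm (x u))" if "u \<in> {a..b}" for u
      using False that V_ge sgn_in_sphere by blast
    then show ?thesis by (rule calibration[OF ab x v0 _ \<sigma> k])
  qed
qed

end

section \<open>The distance given by the minimal action\<close>

context kepler
begin

definition h :: "real \<Rightarrow> real" where
  "h r = sqrt (2 * v0) * r powr \<beta> / \<beta>"

lemma h_G: "sqrt (2 * v0) * G 0 \<sigma> p = h (norm p)"
  by (simp add: h_def G_def)

lemma h_mono: "0 \<le> r \<Longrightarrow> r \<le> s \<Longrightarrow> h r \<le> h s"
  using \<beta> v0 by (auto simp: h_def intro!: divide_right_mono mult_left_mono powr_mono2)

lemma h_nonneg: "0 \<le> h r"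
  using \<beta> v0 by (simp add: h_def)

lemma h_pos: "r > 0 \<Longrightarrow> h r > 0"
  using \<beta> v0 by (simp add: h_def)

lemma h_0: "h 0 = 0"
  by (simp add: h_def)

lemma h_mult: "0 \<le> m \<Longrightarrow> 0 \<le> r \<Longrightarrow> h (m * r) = m powr \<beta> * h r"
  by (simp add: h_def powr_mult)

lemma h_at_top: "filterlim h at_top at_top"
proof -
  have "filterlim (\<lambda>r. exp (\<beta> * ln r)) at_top at_top"
    by (rule filterlim_compose[OF exp_at_top filterlim_tendsto_pos_mult_at_top[OF tendsto_const \<beta>(1) ln_at_top]])
  moreover have "\<forall>\<^sub>F r in at_top. exp (\<beta> * ln r) = r powr \<beta>"
    using eventually_gt_at_top[of 0] by eventually_elim (simp add: powr_def)
  ultimately have p: "filterlim (\<lambda>r. r powr \<beta>) at_top at_top"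
    using filterlim_cong by fast
  have "filterlim (\<lambda>r. (sqrt (2 * v0) / \<beta>) * r powr \<beta>) at_top at_top"
    by (rule filterlim_tendsto_pos_mult_at_top[OF tendsto_const _ p]) (use \<beta> v0 in auto)
  then show ?thesis by (simp add: h_def[abs_def])
qed

lemma G_unit:
  assumes "r \<ge> 0" "norm s = 1"
  shows "G k \<sigma> (r *\<^sub>R s) = r powr \<beta> / \<beta> * (1 - k * (1 - s \<bullet> \<sigma>))"
proof (cases "r = 0")
  case False
  have "r powr (\<beta> - 1) * r = r powr \<beta>" using False assms powr_add[of r "\<beta> - 1" 1] by simp
  then have "r powr (\<beta> - 1) * (r * (s \<bullet> \<sigma>)) = r powr \<beta> * (s \<bullet> \<sigma>)" by (metis mult.assoc)
  then show ?thesis using assms by (simp add: G_def mult.assoc) (simp add: algebra_simps)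
qed (simp add: G_def)

lemma reach_lower:
  assumes "reach W S p q c" and "norm \<sigma> = 1" "0 \<le> k" "k \<le> \<beta>\<^sup>2"
  shows "sqrt (2 * v0) * \<bar>G k \<sigma> q - G k \<sigma> p\<bar> \<le> c"
proof -
  from assms(1) obtain a b x where x: "a \<le> b" "x \<in> H1 a b" "x a = p" "x b = q"
    "action W a b x \<le> ennreal c" and c: "0 \<le> c" unfolding reach_def by blast
  have "ennreal (sqrt (2 * v0) * \<bar>G k \<sigma> q - G k \<sigma> p\<bar>) \<le> ennreal c"
    using calibration_total(1)[OF x(1,2) assms(2-4)] x(3-5) by (auto intro: order_trans)
  then show ?thesis using c by (simp add: ennreal_le_iff)
qed

lemma ex_unit: "\<exists>\<sigma>::'a. norm \<sigma> = 1"
  using norm_Basis nonempty_Basis by blast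

lemma reach_lower_h:
  assumes "reach W S p q c"
  shows "\<bar>h (norm q) - h (norm p)\<bar> \<le> c"
proof -
  obtain \<sigma> :: 'a where "norm \<sigma> = 1" using ex_unit by blast
  then have "sqrt (2 * v0) * \<bar>G 0 \<sigma> q - G 0 \<sigma> p\<bar> \<le> c" using reach_lower[OF assms, of \<sigma> 0] by simp
  moreover have "sqrt (2 * v0) * \<bar>G 0 \<sigma> q - G 0 \<sigma> p\<bar> = \<bar>sqrt (2 * v0) * G 0 \<sigma> q - sqrt (2 * v0) * G 0 \<sigma> p\<bar>"
    using v0 by (simp add: abs_mult flip: right_diff_distrib)
  ultimately show ?thesis by (simp only: h_G)
qed

lemma reach_split:
  assumes ab: "a \<le> b" and x: "x \<in> H1 a b" and S: "\<And>t. t \<in> {a..b} \<Longrightarrow> x t \<in> S" and t: "t \<in> {a..b}"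
    and c: "action W a b x \<le> ennreal c" "0 \<le> c"
  obtains c1 c2 where "reach W S (x a) (x t) c1" "reach W S (x t) (x b) c2" "c1 + c2 \<le> c"
proof -
  have f: "action W a b x < \<infinity>" using c by (auto simp: le_less_trans)
  have st: "a \<le> t" "t \<le> b" using t by auto
  have f1: "action W a t x = ennreal (act a t x)" and f2: "action W t b x = ennreal (act t b x)"
    by (rule action_act[OF H1_restrict[OF x] act_finite_sub[OF x f]]; use st in simp)+
  have "reach W S (x a) (x t) (act a t x)"
    by (rule reachI[OF st(1) H1_restrict[OF x]]) (use S f1 st in \<open>auto simp: act_def\<close>)
  moreover have "reach W S (x t) (x b) (act t b x)"
    by (rule reachI[OF st(2) H1_restrict[OF x]]) (use S f2 st in \<open>auto simp: act_def\<close>)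
  moreover have "act a t x + act t b x \<le> c"
    using act_add[OF x f st] action_act[OF x f] c by (simp add: ennreal_le_iff)
  ultimately show ?thesis by (rule that)
qed

lemma reach_ray:
  assumes s: "norm s = 1" and r: "0 \<le> r0" "r0 \<le> r1" and S: "\<And>r. r0 \<le> r \<Longrightarrow> r \<le> r1 \<Longrightarrow> r *\<^sub>R s \<in> S"
  shows "reach W S (r0 *\<^sub>R s) (r1 *\<^sub>R s) (sqrt (2 * V s) * (r1 powr \<beta> - r0 powr \<beta>) / \<beta>)"
proof -
  have v: "V s > 0" using V_ge[of s] v0 s by auto
  have "reach W S (0 + r0 *\<^sub>R s) (0 + r1 *\<^sub>R s) (1 * (sqrt (2 * V s) * (r1 powr \<beta> - r0 powr \<beta>) / \<beta>))"
  proof (rule reach_affine_ray[OF v r])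
    fix r assume "r0 < r" "r < r1"
    then have "r > 0" using r by simp
    then have "(r *\<^sub>R s) /\<^sub>R norm (r *\<^sub>R s) = s" "norm (r *\<^sub>R s) = r" "r *\<^sub>R s \<noteq> 0" using s by auto
    then show "potential W (0 + r *\<^sub>R s) \<le> ennreal (1 * V s * r powr - \<alpha>)"
      using pot_eq[of "r *\<^sub>R s"] by (simp add: powr_minus divide_inverse)
  qed (use S s in auto)
  then show ?thesis by simp
qed

lemma reach_from_zero:
  fixes p :: 'a
  assumes "p \<noteq> 0"
  shows "reach W UNIV 0 p (sqrt (2 * V (p /\<^sub>R norm p)) * norm p powr \<beta> / \<beta>)"
  using reach_ray[of "p /\<^sub>R norm p" 0 "norm p" UNIV] assms by simp

lemma reach_exists: "\<exists>c. reach W UNIV p q c"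
proof -
  have 0: "\<exists>c. reach W UNIV 0 p c" for p :: 'a
    using reach_from_zero reach_refl by (metis UNIV_I)
  obtain c d where "reach W UNIV 0 p c" "reach W UNIV 0 q d" using 0 by blast
  then show ?thesis using reach_trans reach_sym by blast
qed

lemma bdd_below_reach: "bdd_below {c. reach W UNIV p q c}"
  by (rule bdd_belowI[of _ 0]) (simp add: reach_def)

lemma jd_le: "reach W S p q c \<Longrightarrow> jd W p q \<le> c"
  unfolding jd_def by (rule cInf_lower[OF _ bdd_below_reach]) (auto intro: reach_mono)

lemma jd_greatest: "(\<And>c. reach W UNIV p q c \<Longrightarrow> l \<le> c) \<Longrightarrow> l \<le> jd W p q"
  unfolding jd_def using reach_exists by (intro cInf_greatest) auto

lemma jd_approx:
  assumes "jd W p q < c"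
  shows "reach W UNIV p q c"
proof -
  obtain d where "reach W UNIV p q d" "d < c"
    using assms reach_exists bdd_below_reach unfolding jd_def by (subst (asm) cInf_less_iff) auto
  then show ?thesis using reach_mono[of W UNIV p q d c UNIV] by auto
qed

lemma jd_nonneg: "0 \<le> jd W p q"
  by (rule jd_greatest) (simp add: reach_def)

lemma jd_refl: "jd W p p = 0"
  using jd_le[OF reach_refl[of p UNIV]] jd_nonneg[of p p] by simp

lemma jd_sym: "jd W p q = jd W q p"
proof -
  have "reach W UNIV p q = reach W UNIV q p"
    by (intro ext iffI; erule reach_sym)
  then show ?thesis unfolding jd_def by simp
qed

lemma jd_triangle: "jd W p r \<le> jd W p q + jd W q r"
proof (rule field_le_epsilon)
  fix e :: real assume e: "e > 0"
  have "reach W UNIV p q (jd W p q + e / 2)" "reach W UNIV q r (jd W q r + e / 2)"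
    using e by (auto intro!: jd_approx)
  then have "jd W p r \<le> (jd W p q + e / 2) + (jd W q r + e / 2)" by (intro jd_le[OF reach_trans])
  then show "jd W p r \<le> jd W p q + jd W q r + e" by simp
qed

lemma jd_scale_le:
  assumes m: "m > 0"
  shows "jd W (m *\<^sub>R p) (m *\<^sub>R q) \<le> m powr \<beta> * jd W p q"
proof (rule field_le_epsilon)
  fix e :: real assume e: "e > 0"
  have mp: "m powr \<beta> > 0" using m by simp
  have "reach W UNIV p q (jd W p q + e / m powr \<beta>)" using e mp by (auto intro!: jd_approx)
  from jd_le[OF reach_scale[OF this m]]
  show "jd W (m *\<^sub>R p) (m *\<^sub>R q) \<le> m powr \<beta> * jd W p q + e" using mp by (simp add: distrib_left)
qed

lemma jd_scale:
  assumes m: "m > 0"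
  shows "jd W (m *\<^sub>R p) (m *\<^sub>R q) = m powr \<beta> * jd W p q"
proof (rule antisym[OF jd_scale_le[OF m]])
  have "jd W p q \<le> (1 / m) powr \<beta> * jd W (m *\<^sub>R p) (m *\<^sub>R q)"
    using jd_scale_le[of "1 / m" "m *\<^sub>R p" "m *\<^sub>R q"] m by simp
  then show "m powr \<beta> * jd W p q \<le> jd W (m *\<^sub>R p) (m *\<^sub>R q)"
    using m by (simp add: powr_divide field_simps)
qed

lemma jd_le_action:
  assumes "a \<le> b" "x \<in> H1 a b"
  shows "ennreal (jd W (x a) (x b)) \<le> action W a b x"
proof (cases "action W a b x < \<infinity>")
  case True
  have "action W a b x \<le> ennreal (act a b x)" using action_act[OF assms(2) True] by (rule eq_refl)
  then have "reach W UNIV (x a) (x b) (act a b x)"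
    by (intro reachI[OF assms refl refl]) (simp_all add: act_def)
  from jd_le[OF this] show ?thesis
    unfolding action_act[OF assms(2) True] by (rule ennreal_leI)
qed (simp add: not_less top_unique)

text \<open>\<open>min_action\<close> insists on a < b whereas \<open>jd\<close> admits degenerate
  intervals; distinct end points reconcile the two.\<close>

lemma min_action_jd:
  assumes "p \<noteq> q"
  shows "min_action q p W = ennreal (jd W p q)"
  unfolding min_action_def
proof (rule antisym)
  show "Inf {action W a b x |a b x. a < b \<and> x \<in> H1 a b \<and> x a = p \<and> x b = q} \<le> ennreal (jd W p q)"
  proof (rule ennreal_le_epsilon)
    fix e :: real assume e: "e > 0"
    then have "reach W UNIV p q (jd W p q + e)" by (intro jd_approx) simp
    then obtain a b x where x: "a \<le> b" "x \<in> H1 a b" "x a = p" "x b = q"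
      "action W a b x \<le> ennreal (jd W p q + e)" unfolding reach_def by blast
    then have "a < b" using assms by (cases "a = b") auto
    then have "Inf {action W a b x |a b x. a < b \<and> x \<in> H1 a b \<and> x a = p \<and> x b = q} \<le> action W a b x"
      using x by (intro Inf_lower) blast
    also have "\<dots> \<le> ennreal (jd W p q) + ennreal e" using x(5) e jd_nonneg by simp
    finally show "Inf {action W a b x |a b x. a < b \<and> x \<in> H1 a b \<and> x a = p \<and> x b = q} \<le> ennreal (jd W p q) + ennreal e" .
  qed
  show "ennreal (jd W p q) \<le> Inf {action W a b x |a b x. a < b \<and> x \<in> H1 a b \<and> x a = p \<and> x b = q}"
    by (rule Inf_greatest) (use jd_le_action in \<open>auto simp: less_imp_le\<close>)
qed

lemma jd_lower_h: "\<bar>h (norm q) - h (norm p)\<bar> \<le> jd W p q"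
  by (rule jd_greatest) (rule reach_lower_h)

lemma jd_zero_ge: "h (norm p) \<le> jd W 0 p"
  using jd_lower_h[of p 0] h_0 by simp

lemma jd_zero_le: "p \<noteq> 0 \<Longrightarrow> jd W 0 p \<le> sqrt (2 * V (p /\<^sub>R norm p)) * norm p powr \<beta> / \<beta>"
  by (rule jd_le[OF reach_from_zero])

lemma jd_ray_le:
  assumes "norm s = 1" "V s = v0" "0 \<le> r0" "r0 \<le> r1"
  shows "jd W (r0 *\<^sub>R s) (r1 *\<^sub>R s) \<le> h r1 - h r0"
  using jd_le[OF reach_ray[OF assms(1,3,4), of UNIV]] assms(2)
  by (simp add: h_def diff_divide_distrib right_diff_distrib)

text \<open>Speed at most 1. Letting T exceed the distance includes the constant path p = q over a
  short positive time, which \<open>Morse_action_le_jd\<close> employs.\<close>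

lemma H1_segment:
  fixes p q :: 'a
  assumes T: "T > 0" "norm (q - p) \<le> T"
  shows "(\<lambda>t. p + (t / T) *\<^sub>R (q - p)) \<in> H1 0 T" "kin 0 T (\<lambda>t. p + (t / T) *\<^sub>R (q - p)) \<le> ennreal (T / 2)"
proof -
  have b: "norm ((p + (t / T) *\<^sub>R (q - p)) - (p + (s / T) *\<^sub>R (q - p))) \<le> t - s" if "s \<le> t" for s t
  proof -
    have "(p + (t / T) *\<^sub>R (q - p)) - (p + (s / T) *\<^sub>R (q - p)) = ((t - s) / T) *\<^sub>R (q - p)"
      by (simp add: diff_divide_distrib flip: scaleR_diff_left)
    then have "norm ((p + (t / T) *\<^sub>R (q - p)) - (p + (s / T) *\<^sub>R (q - p))) = (t - s) / T * norm (q - p)"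
      using that T by simp
    also have "\<dots> \<le> (t - s) / T * T" using T that by (intro mult_left_mono) auto
    finally show ?thesis using T by simp
  qed
  have T0: "0 \<le> T" using T by simp
  note r = H1_of_derivative_bound[OF T0, of "\<lambda>_. 1" "\<lambda>t. t" "\<lambda>t. p + (t / T) *\<^sub>R (q - p)"]
  show "(\<lambda>t. p + (t / T) *\<^sub>R (q - p)) \<in> H1 0 T"
    by (rule r(1)) (use b in auto)
  have "kin 0 T (\<lambda>t. p + (t / T) *\<^sub>R (q - p)) \<le> (\<integral>\<^sup>+t\<in>{0<..<T}. ennreal (1\<^sup>2 / 2) \<partial>lborel)"
    by (rule r(2)) (use b in auto)
  also have "\<dots> = ennreal (T / 2)" 
  proof -
    have "(\<integral>\<^sup>+t\<in>{0<..<T}. ennreal (1\<^sup>2 / 2) \<partial>lborel) = ennreal (1\<^sup>2 / 2) * ennreal (T - 0)"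
      by (subst nn_integral_cmult_indicator) (use T in auto)
    also have "\<dots> = ennreal (1\<^sup>2 / 2 * (T - 0))" using T by (intro ennreal_mult[symmetric]) auto
    finally show ?thesis by simp
  qed
  finally show "kin 0 T (\<lambda>t. p + (t / T) *\<^sub>R (q - p)) \<le> ennreal (T / 2)" .
qed

lemma jd_segment:
  fixes p q :: 'a
  assumes M: "M \<ge> 0" and pot: "\<And>u. 0 \<le> u \<Longrightarrow> u \<le> 1 \<Longrightarrow> potential W (p + u *\<^sub>R (q - p)) \<le> ennreal M"
  shows "jd W p q \<le> (1 / 2 + M) * norm (q - p)"
proof (cases "p = q")
  case True then show ?thesis by (simp add: jd_refl)
next
  case False
  define T where "T = norm (q - p)"
  have T: "T > 0" "norm (q - p) \<le> T" using False by (auto simp: T_def)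
  let ?x = "\<lambda>t. p + (t / T) *\<^sub>R (q - p)"
  note x = H1_segment[OF T]
  have T0: "0 \<le> T" using T by simp
  have "pote W 0 T ?x \<le> ennreal (M * (T - 0))"
    by (rule pote_upper[OF T0 M]) (use pot T in auto)
  then have "action W 0 T ?x \<le> ennreal (T / 2) + ennreal (M * T)"
    unfolding action_split[OF W_meas T0 x(1)] by (intro add_mono x) simp
  also have "\<dots> = ennreal ((1 / 2 + M) * T)" using T M by (simp add: distrib_right flip: ennreal_plus)
  finally have "reach W UNIV p q ((1 / 2 + M) * T)"
    using T M by (intro reachI[OF T0 x(1)]) auto
  then show ?thesis unfolding T_def by (rule jd_le)
qed

end

section \<open>Dependence on the potential\<close>

text \<open>What the estimates of \<open>jd\<close> retain of the C2 distance: uniform closeness of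
  the values and closeness of the exponents.\<close>

definition close :: "('a::euclidean_space \<Rightarrow> real) \<Rightarrow> real \<Rightarrow> ('a \<Rightarrow> real) \<Rightarrow> real \<Rightarrow> real \<Rightarrow> bool" where
  "close V \<alpha> V' \<alpha>' e \<longleftrightarrow> (\<forall>s\<in>sphere 0 1. \<bar>V s - V' s\<bar> \<le> e) \<and> \<bar>\<alpha> - \<alpha>'\<bar> \<le> e"

lemma close_sym: "close V \<alpha> V' \<alpha>' e \<longleftrightarrow> close V' \<alpha>' V \<alpha> e"
  by (simp add: close_def abs_minus_commute)

lemma closeD: "close V \<alpha> V' \<alpha>' e \<Longrightarrow> s \<in> sphere 0 1 \<Longrightarrow> \<bar>V s - V' s\<bar> \<le> e"
  by (simp add: close_def)

lemma close_mono: "close V \<alpha> V' \<alpha>' e \<Longrightarrow> e \<le> e' \<Longrightarrow> close V \<alpha> V' \<alpha>' e'"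
  unfolding close_def by (meson order_trans)

context kepler
begin

text \<open>Bounds the quotient of two e-close potentials on the annulus between radii 1 / M and M.
  The first factor compares the values on the sphere, which are at least \<open>v0\<close>, the
  second the powers of the radius.\<close>

definition ratio :: "real \<Rightarrow> real \<Rightarrow> real" where
  "ratio M e = (1 + e / v0) * M powr e"

lemma ratio_ge_1: "M \<ge> 1 \<Longrightarrow> e \<ge> 0 \<Longrightarrow> ratio M e \<ge> 1"
  using v0 mult_mono[of 1 "1 + e / v0" 1 "M powr e"] by (simp add: ratio_def ge_one_powr_ge_zero)

lemma ratio_tendsto: "M \<ge> 1 \<Longrightarrow> (ratio M \<longlongrightarrow> 1) (at_right 0)"
  unfolding ratio_def using v0 by (auto intro!: tendsto_eq_intros)

lemma potential_ratio:
  assumes K: "kepler V' \<alpha>' v0" and cl: "close V \<alpha> V' \<alpha>' e" and M: "M \<ge> 1"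
    and p: "p \<noteq> 0" "1 / M \<le> norm p" "norm p \<le> M"
  shows "potential (V', \<alpha>') p \<le> ennreal (ratio M e) * potential W p"
proof -
  interpret K': kepler V' \<alpha>' v0 by (rule K)
  let ?s = "p /\<^sub>R norm p"
  have s: "?s \<in> sphere 0 1" by (rule sgn_in_sphere[OF p(1)])
  have e: "e \<ge> 0" using cl unfolding close_def by linarith
  have n: "norm p > 0" using p by simp
  have V: "V ?s \<ge> v0" by (rule V_ge[OF s])
  have "V' ?s \<le> V ?s + e" using closeD[OF cl s] by linarith
  also have "\<dots> \<le> V ?s * (1 + e / v0)"
  proof -
    have "e \<le> V ?s * (e / v0)" using V v0 e by (simp add: field_simps mult_left_mono)
    then show ?thesis by (simp add: distrib_left)
  qed
  finally have A: "V' ?s \<le> V ?s * (1 + e / v0)" .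
  have "norm p powr (\<alpha> - \<alpha>') \<le> M powr \<bar>\<alpha> - \<alpha>'\<bar>"
  proof (cases "\<alpha> \<ge> \<alpha>'")
    case True
    then show ?thesis using p n by (simp add: powr_mono2)
  next
    case False
    have "norm p powr (\<alpha> - \<alpha>') = (1 / norm p) powr (\<alpha>' - \<alpha>)"
      using n by (simp add: powr_divide powr_diff)
    also have "\<dots> \<le> M powr (\<alpha>' - \<alpha>)"
      using False p n M by (intro powr_mono2) (auto simp: field_simps)
    finally show ?thesis using False by simp
  qed
  also have "\<dots> \<le> M powr e" using M cl by (intro powr_mono) (auto simp: close_def)
  finally have B: "norm p powr (\<alpha> - \<alpha>') \<le> M powr e" .
  have "V' ?s / norm p powr \<alpha>' = V' ?s * (norm p powr (\<alpha> - \<alpha>') / norm p powr \<alpha>)"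
    using n by (simp add: powr_diff)
  also have "\<dots> \<le> (V ?s * (1 + e / v0)) * (M powr e / norm p powr \<alpha>)"
    using V v0 e by (intro mult_mono A divide_right_mono B) auto
  also have "\<dots> = ratio M e * (V ?s / norm p powr \<alpha>)" by (simp add: ratio_def)
  finally have "ennreal (V' ?s / norm p powr \<alpha>') \<le> ennreal (ratio M e * (V ?s / norm p powr \<alpha>))" by (rule ennreal_leI)
  also have "\<dots> = ennreal (ratio M e) * ennreal (V ?s / norm p powr \<alpha>)"
    using ratio_ge_1[OF M e] V v0 by (intro ennreal_mult) auto
  finally show ?thesis using p(1) by (simp add: pot_eq K'.pot_eq)
qed

lemma action_ratio:
  assumes K: "kepler V' \<alpha>' v0" and cl: "close V \<alpha> V' \<alpha>' e" and M: "M \<ge> 1" and ab: "a \<le> b" and x: "x \<in> H1 a b"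
    and xM: "\<And>t. t \<in> {a<..<b} \<Longrightarrow> 1 / M \<le> norm (x t) \<and> norm (x t) \<le> M"
  shows "action (V', \<alpha>') a b x \<le> ennreal (ratio M e) * action W a b x"
proof -
  interpret K': kepler V' \<alpha>' v0 by (rule K)
  have e: "e \<ge> 0" using cl unfolding close_def by linarith
  note r = ratio_ge_1[OF M e]
  note [measurable] = potential_clamp_measurable[OF W_meas ab H1_continuous[OF x]]
  have "pote (V', \<alpha>') a b x \<le> (\<integral>\<^sup>+t. ennreal (ratio M e) * (potential W (x (clamp1 a b t)) * indicator {a<..<b} t) \<partial>lborel)"
    unfolding pote_def
  proof (rule nn_integral_mono)
    fix t
    show "potential (V', \<alpha>') (x t) * indicator {a<..<b} t \<le> ennreal (ratio M e) * (potential W (x (clamp1 a b t)) * indicator {a<..<b} t)"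
    proof (cases "t \<in> {a<..<b}")
      case True
      have "x t \<noteq> 0" using xM[OF True] M by auto
      then show ?thesis using potential_ratio[OF K cl M, of "x t"] xM[OF True] True clamp1_id[of t a b] by auto
    qed simp
  qed
  also have "\<dots> = ennreal (ratio M e) * pote W a b x"
    unfolding pote_clamp by (rule nn_integral_cmult) measurable
  finally have P: "pote (V', \<alpha>') a b x \<le> ennreal (ratio M e) * pote W a b x" .
  have "kin a b x \<le> ennreal (ratio M e) * kin a b x"
    using mult_right_mono[of 1 "ennreal (ratio M e)" "kin a b x"] r by simp
  then show ?thesis
    unfolding action_split[OF W_meas ab x] action_split[OF K'.W_meas ab x] distrib_left by (intro add_mono P)
qed

lemma jd_ratio:
  assumes K: "kepler V' \<alpha>' v0" and cl: "close V \<alpha> V' \<alpha>' e" and M: "M \<ge> 1" and ab: "a \<le> b" and x: "x \<in> H1 a b"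
    and xM: "\<And>t. t \<in> {a<..<b} \<Longrightarrow> 1 / M \<le> norm (x t) \<and> norm (x t) \<le> M"
    and c: "action W a b x \<le> ennreal c" "0 \<le> c"
  shows "jd (V', \<alpha>') (x a) (x b) \<le> ratio M e * c"
proof -
  interpret K': kepler V' \<alpha>' v0 by (rule K)
  have e: "e \<ge> 0" using cl unfolding close_def by linarith
  note r = ratio_ge_1[OF M e]
  have "ennreal (jd (V', \<alpha>') (x a) (x b)) \<le> action (V', \<alpha>') a b x" by (rule K'.jd_le_action[OF ab x])
  also have "\<dots> \<le> ennreal (ratio M e) * action W a b x" by (rule action_ratio[OF K cl M ab x xM])
  also have "\<dots> \<le> ennreal (ratio M e) * ennreal c" by (rule mult_left_mono[OF c(1)]) simp
  also have "\<dots> = ennreal (ratio M e * c)" using r c by (intro ennreal_mult[symmetric]) auto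
  finally show ?thesis using r c by (simp add: ennreal_le_iff)
qed

lemma V_bounded: "\<exists>B. B \<ge> 0 \<and> (\<forall>s\<in>sphere 0 1. V s \<le> B)"
proof -
  have "bounded (V ` sphere 0 1)"
    by (intro compact_imp_bounded compact_continuous_image V_cont compact_sphere)
  then obtain B where "\<forall>y\<in>V ` sphere 0 1. norm y \<le> B" unfolding bounded_iff by blast
  then have "V s \<le> \<bar>B\<bar>" if "s \<in> sphere 0 1" for s
  proof -
    have "norm (V s) \<le> B" using that \<open>\<forall>y\<in>V ` sphere 0 1. norm y \<le> B\<close> by blast
    then show ?thesis unfolding real_norm_def by linarith
  qed
  then show ?thesis by (intro exI[of _ "\<bar>B\<bar>"]) simp
qed

definition VM :: real where "VM = (SOME B. B \<ge> 0 \<and> (\<forall>s\<in>sphere 0 1. V s \<le> B))"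

lemma VM: "VM \<ge> 0" "s \<in> sphere 0 1 \<Longrightarrow> V s \<le> VM"
  using someI_ex[OF V_bounded] unfolding VM_def by blast+

lemma close_V_le: "close V \<alpha> V' \<alpha>' e \<Longrightarrow> e \<le> 1 \<Longrightarrow> s \<in> sphere 0 1 \<Longrightarrow> V' s \<le> VM + 1"
  using VM(2)[of s] closeD[of V \<alpha> V' \<alpha>' e s] by linarith

lemma close_\<beta>: "close V \<alpha> V' \<alpha>' e \<Longrightarrow> e \<le> \<beta> \<Longrightarrow> \<beta> / 2 \<le> kepler.\<beta> \<alpha>'"
  if "kepler V' \<alpha>' v0"
  unfolding close_def kepler.\<beta>_def[OF that] \<beta>_def by (simp add: abs_le_iff)

text \<open>The constant depends only on \<open>norm p\<close> and the bound \<open>VM\<close>, so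
  the estimate is uniform over all potentials close to V.\<close>

lemma jd_near:
  assumes K: "kepler V' \<alpha>' v0" and cl: "close V \<alpha> V' \<alpha>' e" "e \<le> 1" and p: "p \<noteq> 0" and q: "norm (q - p) \<le> norm p / 2"
  shows "jd (V', \<alpha>') p q \<le> (1 / 2 + (VM + 1) * (max 1 (2 / norm p))\<^sup>2) * norm (q - p)"
proof -
  interpret K': kepler V' \<alpha>' v0 by (rule K)
  let ?m = "max 1 (2 / norm p)"
  show ?thesis
  proof (rule K'.jd_segment)
    show "0 \<le> (VM + 1) * ?m\<^sup>2" using VM(1) by simp
    fix u :: real assume u: "0 \<le> u" "u \<le> 1"
    let ?y = "p + u *\<^sub>R (q - p)"
    have "norm (u *\<^sub>R (q - p)) \<le> 1 * norm (q - p)" using u by (simp add: mult_left_le_one_le)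
    then have ny: "norm ?y \<ge> norm p / 2" using norm_triangle_ineq2[of p "- (u *\<^sub>R (q - p))"] q by simp
    then have y: "?y \<noteq> 0" using p by auto
    have y0: "norm ?y > 0" using y by simp
    have "1 / norm ?y powr \<alpha>' = (1 / norm ?y) powr \<alpha>'" using y by (simp add: powr_divide)
    also have "\<dots> \<le> ?m powr \<alpha>'"
      using ny y0 p K'.\<alpha> by (intro powr_mono2) (auto simp: le_max_iff_disj field_simps)
    also have "\<dots> \<le> ?m powr 2" using K'.\<alpha> by (intro powr_mono) auto
    also have "\<dots> = ?m\<^sup>2" by (simp add: powr_numeral)
    finally have 1: "1 / norm ?y powr \<alpha>' \<le> ?m\<^sup>2" .
    have s: "?y /\<^sub>R norm ?y \<in> sphere 0 1" by (rule sgn_in_sphere[OF y])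
    have "V' (?y /\<^sub>R norm ?y) / norm ?y powr \<alpha>' = V' (?y /\<^sub>R norm ?y) * (1 / norm ?y powr \<alpha>')" by simp
    also have "\<dots> \<le> (VM + 1) * ?m\<^sup>2"
      using close_V_le[OF cl s] K'.V_ge[OF s] v0 by (intro mult_mono 1) auto
    finally show "potential (V', \<alpha>') ?y \<le> ennreal ((VM + 1) * ?m\<^sup>2)"
      unfolding K'.pot_eq[OF y] by (rule ennreal_leI)
  qed
qed

lemma jd_near_zero:
  assumes K: "kepler V' \<alpha>' v0" and cl: "close V \<alpha> V' \<alpha>' e" "e \<le> 1" "e \<le> \<beta>" and z: "norm z \<le> \<rho>" "\<rho> \<le> 1"
  shows "jd (V', \<alpha>') 0 z \<le> sqrt (2 * (VM + 1)) * \<rho> powr (\<beta> / 2) / (\<beta> / 2)"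
proof -
  interpret K': kepler V' \<alpha>' v0 by (rule K)
  have \<rho>: "\<rho> \<ge> 0" using z norm_ge_zero order_trans by blast
  show ?thesis
  proof (cases "z = 0")
    case True
    then show ?thesis using VM(1) \<beta> by (simp add: K'.jd_refl)
  next
    case False
    have b: "\<beta> / 2 \<le> K'.\<beta>" by (rule close_\<beta>[OF K cl(1,3)])
    have "norm z powr K'.\<beta> \<le> \<rho> powr K'.\<beta>" using z K'.\<beta> by (intro powr_mono2) auto
    also have "\<dots> \<le> \<rho> powr (\<beta> / 2)" using b \<rho> z \<beta> by (intro powr_mono') auto
    finally have 1: "norm z powr K'.\<beta> \<le> \<rho> powr (\<beta> / 2)" .
    have "jd (V', \<alpha>') 0 z \<le> sqrt (2 * V' (z /\<^sub>R norm z)) * norm z powr K'.\<beta> / K'.\<beta>" by (rule K'.jd_zero_le[OF False])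
    also have "\<dots> \<le> sqrt (2 * (VM + 1)) * \<rho> powr (\<beta> / 2) / (\<beta> / 2)"
      using close_V_le[OF cl(1,2) sgn_in_sphere[OF False]] K'.V_ge[OF sgn_in_sphere[OF False]] v0 VM(1) b \<beta>
      by (intro frac_le mult_mono 1 real_sqrt_le_mono mult_nonneg_nonneg) auto
    finally show ?thesis .
  qed
qed

text \<open>One almost optimal path for V is tested against V'. Near the origin the two potentials
  have no bounded quotient; therefore the piece between the first and the last visit to a small ball
  is replaced by a detour through the origin, which is cheap uniformly in the nearby
  potentials.\<close>

lemma jd_usc_fixed:
  assumes p: "p \<noteq> 0" and q: "q \<noteq> 0" and e: "e > 0"
  obtains d where "d > 0" "\<And>V' \<alpha>'. kepler V' \<alpha>' v0 \<Longrightarrow> close V \<alpha> V' \<alpha>' d \<Longrightarrow> jd (V', \<alpha>') p q \<le> jd W p q + e"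
proof -
  define c where "c = jd W p q + e / 4"
  have c0: "c > 0" using jd_nonneg[of p q] e by (simp add: c_def)
  have "reach W UNIV p q c" using e by (intro jd_approx) (simp add: c_def)
  then obtain a b x where ab: "a \<le> b" and x: "x \<in> H1 a b" and xe: "x a = p" "x b = q" and ac: "action W a b x \<le> ennreal c"
    unfolding reach_def by blast
  have "bounded (x ` {a..b})" using H1_continuous[OF x] by (intro compact_imp_bounded compact_continuous_image) auto
  then obtain B where B: "\<And>t. t \<in> {a..b} \<Longrightarrow> norm (x t) \<le> B" unfolding bounded_iff by blast
  define K where "K = sqrt (2 * (VM + 1)) / (\<beta> / 2)"
  have "((\<lambda>\<rho>::real. \<rho> powr (\<beta> / 2)) \<longlongrightarrow> 0 powr (\<beta> / 2)) (at_right 0)"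
    by (rule tendsto_powr'[OF tendsto_ident_at tendsto_const])
       (use \<beta> in \<open>auto intro: eventually_mono[OF eventually_at_right_less]\<close>)
  then have "((\<lambda>\<rho>. K * \<rho> powr (\<beta> / 2)) \<longlongrightarrow> K * 0) (at_right 0)"
    by (intro tendsto_mult tendsto_const) simp
  then have "\<forall>\<^sub>F \<rho> in at_right 0. K * \<rho> powr (\<beta> / 2) < e / 8"
    using e order_tendstoD(2)[of _ "K * 0" _ "e / 8"] by auto
  moreover have "\<forall>\<^sub>F \<rho> in at_right 0. \<rho> < 1 \<and> \<rho> < norm p \<and> \<rho> < norm q" "\<forall>\<^sub>F \<rho> in at_right 0. 0 < (\<rho>::real)"
    using p q by (auto simp: eventually_at_right_less intro!: eventually_conj order_tendstoD(2)[OF tendsto_ident_at])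
  ultimately have "\<forall>\<^sub>F \<rho> in at_right 0. K * \<rho> powr (\<beta> / 2) < e / 8 \<and> \<rho> < 1 \<and> \<rho> < norm p \<and> \<rho> < norm q \<and> 0 < \<rho>"
    by eventually_elim auto
  then obtain \<rho> where \<rho>: "K * \<rho> powr (\<beta> / 2) < e / 8" "\<rho> < 1" "\<rho> < norm p" "\<rho> < norm q" "0 < \<rho>"
    using eventually_happens[of _ "at_right (0::real)"] trivial_limit_at_right_real by blast
  \<comment> \<open>The annulus for \<open>ratio\<close> that contains all parts of the path outside
    the ball of radius \<open>\<rho>\<close>.\<close>
  define M where "M = max (1 / \<rho>) B"
  have r1: "1 \<le> 1 / \<rho>" using \<rho> by simp
  have r2: "1 / \<rho> \<le> M" by (simp add: M_def)
  have M: "M \<ge> 1" "B \<le> M" using r1 r2 by (auto simp: M_def)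
  have M': "1 / M \<le> \<rho>" using r2 M(1) \<rho>(5) by (simp add: field_simps)
  have "((\<lambda>d. ratio M d * c) \<longlongrightarrow> 1 * c) (at_right 0)" by (intro tendsto_intros ratio_tendsto M)
  then have "\<forall>\<^sub>F d in at_right 0. ratio M d * c < c + e / 4"
    using e order_tendstoD(2)[of _ "1 * c" _ "c + e / 4"] by auto
  moreover have "\<forall>\<^sub>F d in at_right 0. d < 1 \<and> d < \<beta>" "\<forall>\<^sub>F d in at_right 0. 0 < (d::real)"
    using \<beta> by (auto simp: eventually_at_right_less intro!: eventually_conj order_tendstoD(2)[OF tendsto_ident_at])
  ultimately have "\<forall>\<^sub>F d in at_right 0. ratio M d * c < c + e / 4 \<and> d < 1 \<and> d < \<beta> \<and> 0 < d"
    by eventually_elim auto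
  then obtain d where d: "ratio M d * c < c + e / 4" "d < 1" "d < \<beta>" "0 < d"
    using eventually_happens[of _ "at_right (0::real)"] trivial_limit_at_right_real by blast
  show ?thesis
  proof (rule that[OF d(4)])
    fix V' :: "'a \<Rightarrow> real" and \<alpha>' assume K': "kepler V' \<alpha>' v0" and cl: "close V \<alpha> V' \<alpha>' d"
    interpret K': kepler V' \<alpha>' v0 by (rule K')
    show "jd (V', \<alpha>') p q \<le> jd W p q + e"
    proof (cases "\<exists>t\<in>{a..b}. norm (x t) \<le> \<rho>")
      case False
      have "jd (V', \<alpha>') (x a) (x b) \<le> ratio M d * c"
      proof (rule jd_ratio[OF K' cl M(1) ab x _ ac])
        fix t assume "t \<in> {a<..<b}"
        then have t: "t \<in> {a..b}" by simp
        then have "norm (x t) > \<rho>" using False by (meson not_le)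
        then show "1 / M \<le> norm (x t) \<and> norm (x t) \<le> M" using B[OF t] M M' by linarith
      qed (use c0 in simp)
      then show ?thesis using d(1) e xe by (simp add: c_def)
    next
      case True
      define Z where "Z = {t \<in> {a..b}. norm (x t) \<le> \<rho>}"
      have "closed Z" unfolding Z_def
        using continuous_closed_preimage[OF continuous_on_norm[OF H1_continuous[OF x]], of "{..\<rho>}"] by (simp add: vimage_def Int_def)
      moreover have "bounded Z" by (rule bounded_subset[of "{a..b}"]) (auto simp: Z_def)
      ultimately have Z: "compact Z" "Z \<noteq> {}" using True by (auto simp: compact_eq_bounded_closed Z_def)
      obtain t1 where t1: "t1 \<in> Z" "\<And>t. t \<in> Z \<Longrightarrow> t1 \<le> t" using compact_attains_inf[OF Z] by blast
      obtain t2 where t2: "t2 \<in> Z" "\<And>t. t \<in> Z \<Longrightarrow> t \<le> t2" using compact_attains_sup[OF Z] by blast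
      have t: "a \<le> t1" "t1 \<le> t2" "t2 \<le> b" "norm (x t1) \<le> \<rho>" "norm (x t2) \<le> \<rho>" using t1 t2 by (auto simp: Z_def)
      have f: "action W a b x < \<infinity>" using ac by (auto simp: le_less_trans)
      have h1: "x \<in> H1 a t1" "x \<in> H1 t2 b" using H1_restrict[OF x] t by auto
      have ff: "action W a t1 x < \<infinity>" "action W t2 b x < \<infinity>" using act_finite_sub[OF x f] t by auto
      have s: "act a t1 x + act t2 b x \<le> c"
      proof -
        have "act a b x = act a t1 x + act t1 b x" using act_add[OF x f, of t1] t by auto
        moreover have "act t1 b x = act t1 t2 x + act t2 b x"
          using act_add[OF H1_restrict[OF x, of t1 b] act_finite_sub[OF x f, of t1 b], of t2] t by auto
        moreover have "act t1 t2 x \<ge> 0" by (simp add: act_def)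
        moreover have "act a b x \<le> c" using ac action_act[OF x f] c0 by (simp add: ennreal_le_iff)
        ultimately show ?thesis by linarith
      qed
      have j1: "jd (V', \<alpha>') (x a) (x t1) \<le> ratio M d * act a t1 x"
      proof (rule jd_ratio[OF K' cl M(1) t(1) h1(1)])
        fix u assume u: "u \<in> {a<..<t1}"
        then have "u \<notin> Z" using t1(2) by force
        then have "norm (x u) > \<rho>" using u t by (auto simp: Z_def)
        moreover have "norm (x u) \<le> B" using B[of u] u t by auto
        ultimately show "1 / M \<le> norm (x u) \<and> norm (x u) \<le> M" using M M' by linarith
      next
        show "action W a t1 x \<le> ennreal (act a t1 x)" using action_act[OF h1(1) ff(1)] by (rule eq_refl)
      qed (simp add: act_def)
      have j2: "jd (V', \<alpha>') (x t2) (x b) \<le> ratio M d * act t2 b x"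
      proof (rule jd_ratio[OF K' cl M(1) t(3) h1(2)])
        fix u assume u: "u \<in> {t2<..<b}"
        then have "u \<notin> Z" using t2(2) by force
        then have "norm (x u) > \<rho>" using u t by (auto simp: Z_def)
        moreover have "norm (x u) \<le> B" using B[of u] u t by auto
        ultimately show "1 / M \<le> norm (x u) \<and> norm (x u) \<le> M" using M M' by linarith
      next
        show "action W t2 b x \<le> ennreal (act t2 b x)" using action_act[OF h1(2) ff(2)] by (rule eq_refl)
      qed (simp add: act_def)
      have j0: "jd (V', \<alpha>') 0 z \<le> e / 8" if "norm z \<le> \<rho>" for z
        using jd_near_zero[OF K' cl _ _ that] d \<rho> by (simp add: K_def)
      have "ratio M d * act a t1 x + ratio M d * act t2 b x \<le> ratio M d * c"
        unfolding distrib_left[symmetric] using s ratio_ge_1[OF M(1), of d] d by (intro mult_left_mono) auto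
      moreover have "jd (V', \<alpha>') p q \<le> jd (V', \<alpha>') p (x t1) + (jd (V', \<alpha>') (x t1) 0 + jd (V', \<alpha>') 0 (x t2)) + jd (V', \<alpha>') (x t2) q"
        using K'.jd_triangle[of p q "x t1"] K'.jd_triangle[of "x t1" q "x t2"] K'.jd_triangle[of "x t1" "x t2" 0] by linarith
      ultimately show ?thesis
        using j1 j2 j0[OF t(4)] j0[OF t(5)] K'.jd_sym[of "x t1" 0] d(1) e xe by (simp add: c_def)
    qed
  qed
qed

lemma jd_usc:
  assumes p: "p \<noteq> 0" and q: "q \<noteq> 0" and e: "e > 0"
  obtains d where "d > 0" "\<And>V' \<alpha>' p' q'. kepler V' \<alpha>' v0 \<Longrightarrow> close V \<alpha> V' \<alpha>' d \<Longrightarrow>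
    norm (p' - p) \<le> d \<Longrightarrow> norm (q' - q) \<le> d \<Longrightarrow> jd (V', \<alpha>') p' q' \<le> jd W p q + e"
proof -
  obtain d0 where d0: "d0 > 0" "\<And>V' \<alpha>'. kepler V' \<alpha>' v0 \<Longrightarrow> close V \<alpha> V' \<alpha>' d0 \<Longrightarrow> jd (V', \<alpha>') p q \<le> jd W p q + e / 2"
    using jd_usc_fixed[OF p q, of "e / 2"] e by auto
  define C where "C = (\<lambda>p::'a. 1 / 2 + (VM + 1) * (max 1 (2 / norm p))\<^sup>2)"
  have C: "C p > 0" for p using VM(1) by (auto simp: C_def add_pos_nonneg)
  \<comment> \<open>The halves of the norms keep the segments to the moved end points off the
    origin, as \<open>jd_near\<close> requires; the last two terms make each of them cost at most e
    / 4.\<close>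
  define d where "d = Min {d0, 1, norm p / 2, norm q / 2, e / (4 * C p), e / (4 * C q)}"
  have d: "d > 0" "d \<le> d0" "d \<le> 1" "d \<le> norm p / 2" "d \<le> norm q / 2" "d \<le> e / (4 * C p)" "d \<le> e / (4 * C q)"
    using d0 p q e C by (auto simp: d_def)
  show ?thesis
  proof (rule that[OF d(1)])
    fix V' \<alpha>' p' q' assume K': "kepler V' \<alpha>' v0" and cl: "close V \<alpha> V' \<alpha>' d" and p': "norm (p' - p) \<le> d" and q': "norm (q' - q) \<le> d"
    interpret K': kepler V' \<alpha>' v0 by (rule K')
    have "jd (V', \<alpha>') p p' \<le> C p * norm (p' - p)"
      unfolding C_def by (rule jd_near[OF K' cl d(3) p]) (use p' d in simp)
    also have "\<dots> \<le> C p * (e / (4 * C p))" using p' d C[of p] by (intro mult_left_mono) auto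
    finally have 1: "jd (V', \<alpha>') p p' \<le> e / 4" using C[of p] by simp
    have "jd (V', \<alpha>') q q' \<le> C q * norm (q' - q)"
      unfolding C_def by (rule jd_near[OF K' cl d(3) q]) (use q' d in simp)
    also have "\<dots> \<le> C q * (e / (4 * C q))" using q' d C[of q] by (intro mult_left_mono) auto
    finally have 2: "jd (V', \<alpha>') q q' \<le> e / 4" using C[of q] by simp
    show "jd (V', \<alpha>') p' q' \<le> jd W p q + e"
      using d0(2)[OF K' close_mono[OF cl d(2)]] 1 2 K'.jd_sym[of p p'] K'.jd_triangle[of p' q' p] K'.jd_triangle[of p q' q] by linarith
  qed
qed

end

section \<open>Almost minimal paths avoiding the origin\<close>

context kepler
begin

lemma reach_scale_out:
  assumes "reach W {p. r \<le> norm p} p q c" "r > 0"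
  shows "reach W {p. 1 \<le> norm p} ((1 / r) *\<^sub>R p) ((1 / r) *\<^sub>R q) ((1 / r) powr \<beta> * c)"
proof -
  have "reach W ((\<lambda>p. (1 / r) *\<^sub>R p) ` {p. r \<le> norm p}) ((1 / r) *\<^sub>R p) ((1 / r) *\<^sub>R q) ((1 / r) powr \<beta> * c)"
    by (rule reach_scale[OF assms(1)]) (use assms(2) in simp)
  moreover have "(\<lambda>p. (1 / r) *\<^sub>R p) ` {p::'a. r \<le> norm p} \<subseteq> {p. 1 \<le> norm p}"
    using assms(2) by (auto simp: field_simps)
  ultimately show ?thesis using reach_mono by blast
qed

text \<open>Cutting at the point nearest to the origin leaves both halves outside the ball through
  that point; after rescaling the point to norm 1 they lie outside the unit ball.\<close>

lemma reach_through_minimum: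
  assumes "reach W UNIV p q c"
  obtains z c1 c2 where "reach W {y. norm z \<le> norm y} p z c1" "reach W {y. norm z \<le> norm y} z q c2"
    "c1 + c2 \<le> c" "norm z \<le> norm p" "norm z \<le> norm q"
proof -
  from assms obtain a b x where ab: "a \<le> b" and x: "x \<in> H1 a b" and xe: "x a = p" "x b = q"
    and ac: "action W a b x \<le> ennreal c" and c: "0 \<le> c" unfolding reach_def by blast
  have "continuous_on {a..b} (\<lambda>t. norm (x t))" by (intro continuous_on_norm H1_continuous[OF x])
  then obtain t where t: "t \<in> {a..b}" "\<And>s. s \<in> {a..b} \<Longrightarrow> norm (x t) \<le> norm (x s)"
    using continuous_attains_inf[of "{a..b}" "\<lambda>t. norm (x t)"] ab by auto
  obtain c1 c2 where "reach W {y. norm (x t) \<le> norm y} (x a) (x t) c1" "reach W {y. norm (x t) \<le> norm y} (x t) (x b) c2" "c1 + c2 \<le> c"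
    using reach_split[OF ab x _ t(1) ac c, of "{y. norm (x t) \<le> norm y}"] t(2) by auto
  then show ?thesis using that[of "x t" c1 c2] xe t(2)[of a] t(2)[of b] ab by auto
qed

text \<open>\<open>h (norm p)\<close> can grow along a path by no more than its cost, so a bound on
  the cost confines the path to a ball.\<close>

lemma reach_bounded:
  assumes "reach W S p q c" "h (norm p) + c \<le> h r" "0 \<le> r"
  obtains a b x where "a \<le> b" "x \<in> H1 a b" "x a = p" "x b = q" "\<And>t. t \<in> {a..b} \<Longrightarrow> x t \<in> S \<and> norm (x t) \<le> r"
    "action W a b x \<le> ennreal c" "0 \<le> c"
proof -
  from assms obtain a b x where ab: "a \<le> b" and x: "x \<in> H1 a b" and xe: "x a = p" "x b = q"
    and S: "\<forall>t\<in>{a..b}. x t \<in> S" and ac: "action W a b x \<le> ennreal c" and c: "0 \<le> c" unfolding reach_def by blast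
  have "norm (x t) \<le> r" if t: "t \<in> {a..b}" for t
  proof (rule ccontr)
    assume n: "\<not> norm (x t) \<le> r"
    obtain c1 c2 where r: "reach W UNIV (x a) (x t) c1" "reach W UNIV (x t) (x b) c2" "c1 + c2 \<le> c"
      using reach_split[OF ab x _ t ac c, of UNIV] by auto
    have "c2 \<ge> 0" using r(2) by (simp add: reach_def)
    then have "h (norm (x t)) \<le> h r" using reach_lower_h[OF r(1)] r(3) assms(2) xe by auto
    moreover have "r powr \<beta> < norm (x t) powr \<beta>" using n assms(3) \<beta> by (intro powr_less_mono2) auto
    then have "h r < h (norm (x t))" using \<beta> v0 by (simp add: h_def divide_strict_right_mono)
    ultimately show False by simp
  qed
  then show ?thesis using that ab x xe S ac c by blast
qed

text \<open>If the almost optimal path comes near the origin, rescaling its distance from the origin to 1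
  moves its end points far out. Otherwise the origin is still optimal up to a small error, because
  the two potentials are close on the region visited by the path, and prolonging the path by radial
  segments hardly affects its optimality.\<close>

lemma approx_data:
  assumes \<xi>: "norm \<xi>p = 1" "norm \<xi>m = 1" "V \<xi>p = v0" "V \<xi>m = v0"
    and In: "jd W \<xi>m \<xi>p = 2 * h 1"
    and ex: "\<And>e. e > 0 \<Longrightarrow> \<exists>V' \<alpha>'. kepler V' \<alpha>' v0 \<and> V' \<xi>p = v0 \<and> V' \<xi>m = v0 \<and> close V \<alpha> V' \<alpha>' e \<and>
       jd (V', \<alpha>') \<xi>m \<xi>p < 2 * kepler.h \<alpha>' v0 1"
    and N: "N \<ge> (1::real)"
  obtains V' \<alpha>' R z c1 c2 where "kepler V' \<alpha>' v0" "V' \<xi>p = v0" "V' \<xi>m = v0" "close V \<alpha> V' \<alpha>' (1 / N)" "R \<ge> N" "norm z = 1"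
    "reach (V', \<alpha>') {p. 1 \<le> norm p} (R *\<^sub>R \<xi>m) z c1" "reach (V', \<alpha>') {p. 1 \<le> norm p} z (R *\<^sub>R \<xi>p) c2"
    "c1 + c2 \<le> jd (V', \<alpha>') (R *\<^sub>R \<xi>m) (R *\<^sub>R \<xi>p) + 1 / N"
proof -
  \<comment> \<open>The perturbed exponent is at least \<open>\<beta> / 2\<close>, so
    \<open>K'.h B\<close> is at least three times \<open>K'.h 1\<close>. A path that starts at norm
    1 and costs at most \<open>2 * K'.h 1\<close> therefore stays in the ball of radius B.\<close>
  define B where "B = 3 powr (2 / \<beta>)"
  define M where "M = max N B"
  have M: "M \<ge> 1" "N \<le> M" "B \<le> M" using N by (auto simp: M_def)
  have N3: "N ^ 3 > 0" using N by simp
  \<comment> \<open>The first term dominates \<open>2 * K'.h 1\<close>, since the perturbed exponent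
    is at least \<open>\<beta> - d / 2\<close>. The second is the lower bound that optimality of the
    origin for V imposes on the cost for V'. They differ arbitrarily little for small d.\<close>
  have "((\<lambda>d. 2 * sqrt (2 * v0) / (\<beta> - d / 2) - 2 * h 1 / ratio M d) \<longlongrightarrow> 2 * sqrt (2 * v0) / (\<beta> - 0 / 2) - 2 * h 1 / 1) (at_right 0)"
    using \<beta> by (intro tendsto_intros ratio_tendsto M) auto
  moreover have "2 * sqrt (2 * v0) / (\<beta> - 0 / 2) - 2 * h 1 / 1 = 0" by (simp add: h_def)
  ultimately have "\<forall>\<^sub>F d in at_right 0. 2 * sqrt (2 * v0) / (\<beta> - d / 2) - 2 * h 1 / ratio M d < 1 / (4 * N ^ 3)"
    using N3 by (intro order_tendstoD(2)) auto
  moreover have "\<forall>\<^sub>F d in at_right 0. d < 1 \<and> d < \<beta> \<and> d < 1 / N" "\<forall>\<^sub>F d in at_right 0. 0 < (d::real)"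
    using \<beta> N by (auto simp: eventually_at_right_less intro!: eventually_conj order_tendstoD(2)[OF tendsto_ident_at])
  ultimately have "\<forall>\<^sub>F d in at_right 0. 2 * sqrt (2 * v0) / (\<beta> - d / 2) - 2 * h 1 / ratio M d < 1 / (4 * N ^ 3) \<and> d < 1 \<and> d < \<beta> \<and> d < 1 / N \<and> 0 < d"
    by eventually_elim auto
  then obtain d where d: "2 * sqrt (2 * v0) / (\<beta> - d / 2) - 2 * h 1 / ratio M d < 1 / (4 * N ^ 3)" "d < 1" "d < \<beta>" "d < 1 / N" "0 < d"
    using eventually_happens[of _ "at_right (0::real)"] trivial_limit_at_right_real by blast
  obtain V' \<alpha>' where K': "kepler V' \<alpha>' v0" and V': "V' \<xi>p = v0" "V' \<xi>m = v0" and cl: "close V \<alpha> V' \<alpha>' d"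
    and Out: "jd (V', \<alpha>') \<xi>m \<xi>p < 2 * kepler.h \<alpha>' v0 1" using ex[OF d(5)] by blast
  interpret K': kepler V' \<alpha>' v0 by (rule K')
  have b: "\<beta> / 2 \<le> K'.\<beta>" by (rule close_\<beta>[OF K' cl]) (use d in simp)
  define c where "c = jd (V', \<alpha>') \<xi>m \<xi>p"
  define e where "e = 2 * K'.h 1 - c"
  have e: "e > 0" using Out by (simp add: e_def c_def)
  have h1: "K'.h 1 > 0" by (rule K'.h_pos) simp
  \<comment> \<open>The bound e / 2 keeps the path off the origin,
    \<open>e / (8 * N * K'.h 1)\<close> keeps the error below 1 / (2 N) after rescaling, and
    \<open>1 / (4 * N ^ 3)\<close> is half of the bound on e in the second case.\<close>
  define \<tau> where "\<tau> = Min {e / 2, e / (8 * N * K'.h 1), 1 / (4 * N ^ 3), 1 / (2 * N\<^sup>2)}"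
  have \<tau>: "\<tau> > 0" "\<tau> \<le> e / 2" "\<tau> \<le> e / (8 * N * K'.h 1)" "\<tau> \<le> 1 / (4 * N ^ 3)" "\<tau> \<le> 1 / (2 * N\<^sup>2)"
    using e h1 N N3 by (auto simp: \<tau>_def)
  have r0: "reach (V', \<alpha>') UNIV \<xi>m \<xi>p (c + \<tau>)" using \<tau> by (intro K'.jd_approx) (simp add: c_def)
  obtain z c1 c2 where z: "reach (V', \<alpha>') {y. norm z \<le> norm y} \<xi>m z c1" "reach (V', \<alpha>') {y. norm z \<le> norm y} z \<xi>p c2"
    "c1 + c2 \<le> c + \<tau>" "norm z \<le> 1"
    using K'.reach_through_minimum[OF r0] \<xi> by metis
  define \<rho> where "\<rho> = norm z"
  \<comment> \<open>Descending to norm \<open>\<rho>\<close> and returning costs at least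
    \<open>2 * (K'.h 1 - K'.h \<rho>)\<close>, whereas the path costs at most
    \<open>2 * K'.h 1 - e / 2\<close>.\<close>
  have hz: "K'.h \<rho> \<ge> e / 4"
    using K'.reach_lower_h[OF z(1)] K'.reach_lower_h[OF z(2)] z(3) \<tau>(2) \<xi> e
    by (simp add: \<rho>_def e_def abs_le_iff)
  have \<rho>0: "\<rho> > 0"
  proof (rule ccontr)
    assume "\<not> \<rho> > 0"
    then have "\<rho> = 0" by (simp add: \<rho>_def)
    then show False using hz e K'.h_0 by simp
  qed
  have \<rho>1: "\<rho> \<le> 1" using z(4) by (simp add: \<rho>_def)
  define m where "m = 1 / \<rho>"
  have m: "m > 0" "m \<ge> 1" using \<rho>0 \<rho>1 by (auto simp: m_def)
  have hm: "K'.h \<rho> * m powr K'.\<beta> = K'.h 1"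
    using K'.h_mult[of m \<rho>] \<rho>0 by (simp add: m_def)
  have m\<tau>: "m powr K'.\<beta> * \<tau> \<le> 1 / (2 * N)"
  proof -
    have "(e / 4) * m powr K'.\<beta> \<le> K'.h 1" using mult_right_mono[OF hz, of "m powr K'.\<beta>"] hm by simp
    then have "m powr K'.\<beta> \<le> 4 * K'.h 1 / e" using e by (simp add: field_simps)
    then have "m powr K'.\<beta> * \<tau> \<le> (4 * K'.h 1 / e) * (e / (8 * N * K'.h 1))" using \<tau> e h1 N by (intro mult_mono) auto
    also have "\<dots> = 1 / (2 * N)" using e h1 N by simp
    finally show ?thesis .
  qed
  have nz: "norm (m *\<^sub>R z) = 1" using \<rho>0 by (simp add: m_def \<rho>_def)
  have clN: "close V \<alpha> V' \<alpha>' (1 / N)" by (rule close_mono[OF cl]) (use d in simp)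
  show ?thesis
  proof (cases "\<rho> \<le> 1 / N")
    case True
    have "reach (V', \<alpha>') {p. 1 \<le> norm p} (m *\<^sub>R \<xi>m) (m *\<^sub>R z) (m powr K'.\<beta> * c1)"
      "reach (V', \<alpha>') {p. 1 \<le> norm p} (m *\<^sub>R z) (m *\<^sub>R \<xi>p) (m powr K'.\<beta> * c2)"
      unfolding m_def by (rule K'.reach_scale_out[OF _ \<rho>0]; use z in \<open>simp add: \<rho>_def\<close>)+
    moreover have "m powr K'.\<beta> * c1 + m powr K'.\<beta> * c2 \<le> jd (V', \<alpha>') (m *\<^sub>R \<xi>m) (m *\<^sub>R \<xi>p) + 1 / N"
    proof -
      have "m powr K'.\<beta> * (c1 + c2) \<le> m powr K'.\<beta> * (c + \<tau>)" using z(3) by (intro mult_left_mono) auto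
      moreover have "1 / (2 * N) \<le> 1 / N" using N by (simp add: field_simps)
      ultimately show ?thesis using m\<tau> K'.jd_scale[OF m(1), of \<xi>m \<xi>p] by (simp add: distrib_left c_def)
    qed
    moreover have "m \<ge> N" using True \<rho>0 N by (simp add: m_def field_simps)
    ultimately show ?thesis using that[OF K' V' clN _ nz] by blast
  next
    case False
    have mN: "m \<le> N" using False \<rho>0 N by (simp add: m_def field_simps)
    have hN: "K'.h N = N powr K'.\<beta> * K'.h 1" using K'.h_mult[of N 1] N by simp
    \<comment> \<open>Here the path stays between radii 1 / N and B, so it can be tested against V
      itself. There the origin is optimal, hence the deficit e for V' is small.\<close>
    have e_small: "e \<le> 1 / (2 * N ^ 3)"
    proof -
      have ct: "c + \<tau> \<le> 2 * K'.h 1" using \<tau>(2) e by (simp add: e_def)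
      have B: "3 * K'.h 1 \<le> K'.h B"
      proof -
        have "3 = (3 powr (2 / \<beta>)) powr (\<beta> / 2)" using \<beta> by (simp add: powr_powr)
        also have "\<dots> \<le> B powr K'.\<beta>" unfolding B_def using b \<beta> by (intro powr_mono) (auto simp: ge_one_powr_ge_zero)
        finally show ?thesis using K'.h_mult[of B 1] h1 by (simp add: B_def)
      qed
      have "reach (V', \<alpha>') {y. norm z \<le> norm y} \<xi>m \<xi>p (c + \<tau>)"
        using reach_mono[OF K'.reach_trans[OF z(1,2)] z(3)] by simp
      then obtain a b' x where x: "a \<le> b'" "x \<in> H1 a b'" "x a = \<xi>m" "x b' = \<xi>p"
        "\<And>t. t \<in> {a..b'} \<Longrightarrow> x t \<in> {y. norm z \<le> norm y} \<and> norm (x t) \<le> B"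
        "action (V', \<alpha>') a b' x \<le> ennreal (c + \<tau>)" "0 \<le> c + \<tau>"
        by (rule K'.reach_bounded[of _ _ _ _ B]) (use \<xi> ct B in \<open>auto simp: B_def\<close>)
      have "jd W (x a) (x b') \<le> K'.ratio M d * (c + \<tau>)"
      proof (rule K'.jd_ratio[OF kepler_axioms _ M(1) x(1,2) _ x(6,7)])
        show "close V' \<alpha>' V \<alpha> d" using cl by (simp add: close_sym)
        fix t assume "t \<in> {a<..<b'}"
        then have "\<rho> \<le> norm (x t)" "norm (x t) \<le> B" using x(5)[of t] by (auto simp: \<rho>_def)
        moreover have "1 / M \<le> 1 / N" using M N by (simp add: field_simps)
        ultimately show "1 / M \<le> norm (x t) \<and> norm (x t) \<le> M" using False M by linarith
      qed
      moreover have rr: "K'.ratio M d = ratio M d" by (simp add: ratio_def K'.ratio_def)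
      ultimately have "2 * h 1 \<le> ratio M d * (c + \<tau>)" using In x by simp
      moreover have "ratio M d > 0" using ratio_ge_1[OF M(1), of d] d by simp
      ultimately have 1: "2 * h 1 / ratio M d \<le> c + \<tau>" by (simp add: field_simps)
      have "\<beta> - d / 2 \<le> K'.\<beta>" using cl unfolding close_def by (simp add: \<beta>_def K'.\<beta>_def abs_le_iff)
      moreover have "\<beta> - d / 2 > 0" using d \<beta> by simp
      ultimately have "2 * K'.h 1 \<le> 2 * sqrt (2 * v0) / (\<beta> - d / 2)"
        using v0 by (simp add: K'.h_def frac_le)
      then have "e \<le> 1 / (4 * N ^ 3) + 1 / (4 * N ^ 3)" using 1 d(1) \<tau>(4) by (simp add: e_def)
      also have "\<dots> = 1 / (2 * N ^ 3)" using N by (simp add: field_simps)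
      finally show ?thesis .
    qed
    have rays: "reach (V', \<alpha>') {y. norm z \<le> norm y} s (N *\<^sub>R s) (K'.h N - K'.h 1)" if s: "norm s = 1" "V' s = v0" for s
    proof -
      have "reach (V', \<alpha>') {y. norm z \<le> norm y} (1 *\<^sub>R s) (N *\<^sub>R s) (sqrt (2 * V' s) * (N powr K'.\<beta> - 1 powr K'.\<beta>) / K'.\<beta>)"
        by (rule K'.reach_ray) (use s N \<rho>1 in \<open>auto simp: \<rho>_def\<close>)
      then show ?thesis using s by (simp add: K'.h_def diff_divide_distrib right_diff_distrib)
    qed
    define D where "D = K'.h N - K'.h 1"
    have r1: "reach (V', \<alpha>') {y. \<rho> \<le> norm y} (N *\<^sub>R \<xi>m) z (D + c1)"
      unfolding \<rho>_def D_def by (rule K'.reach_trans[OF K'.reach_sym[OF rays] z(1)]) (use \<xi> V' in auto)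
    have r2: "reach (V', \<alpha>') {y. \<rho> \<le> norm y} z (N *\<^sub>R \<xi>p) (c2 + D)"
      unfolding \<rho>_def D_def by (rule K'.reach_trans[OF z(2) rays]) (use \<xi> V' in auto)
    have s1: "reach (V', \<alpha>') {p. 1 \<le> norm p} ((m * N) *\<^sub>R \<xi>m) (m *\<^sub>R z) (m powr K'.\<beta> * (D + c1))"
      using K'.reach_scale_out[OF r1 \<rho>0] by (simp add: m_def)
    have s2: "reach (V', \<alpha>') {p. 1 \<le> norm p} (m *\<^sub>R z) ((m * N) *\<^sub>R \<xi>p) (m powr K'.\<beta> * (c2 + D))"
      using K'.reach_scale_out[OF r2 \<rho>0] by (simp add: m_def)
    have j: "jd (V', \<alpha>') ((m * N) *\<^sub>R \<xi>m) ((m * N) *\<^sub>R \<xi>p) = m powr K'.\<beta> * (N powr K'.\<beta> * c)"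
      using K'.jd_scale[of "m * N" \<xi>m \<xi>p] m N by (simp add: c_def powr_mult)
    have Nb: "1 \<le> N powr K'.\<beta>" "N powr K'.\<beta> \<le> N"
      using N K'.\<beta> powr_mono[of K'.\<beta> 1 N] by (auto simp: ge_one_powr_ge_zero)
    have mb: "m powr K'.\<beta> \<le> N"
      using m mN K'.\<beta> powr_mono[of K'.\<beta> 1 m] by (auto intro: order_trans)
    \<comment> \<open>The optimal cost between the prolonged end points is
      \<open>N powr K'.\<beta> * c\<close>, so the radial prolongation adds an error of at most N
      times e. Rescaling multiplies it by at most N again, which is why e had to be of order
      \<open>N ^ 3\<close> in the denominator.\<close>
    have "D + c1 + (c2 + D) \<le> N powr K'.\<beta> * c + (N powr K'.\<beta> - 1) * e + \<tau>"
      using z(3) by (simp add: D_def hN e_def algebra_simps)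
    also have "\<dots> \<le> N powr K'.\<beta> * c + N * e + \<tau>"
      using mult_right_mono[of "N powr K'.\<beta> - 1" N e] Nb e by linarith
    finally have "m powr K'.\<beta> * (D + c1 + (c2 + D)) \<le> m powr K'.\<beta> * (N powr K'.\<beta> * c + N * e + \<tau>)"
      by (intro mult_left_mono) auto
    also have "\<dots> = m powr K'.\<beta> * (N powr K'.\<beta> * c) + m powr K'.\<beta> * (N * e) + m powr K'.\<beta> * \<tau>" by (simp add: distrib_left)
    also have "\<dots> \<le> m powr K'.\<beta> * (N powr K'.\<beta> * c) + N * (N * (1 / (2 * N ^ 3))) + 1 / (2 * N)"
    proof -
      have "m powr K'.\<beta> * (N * e) \<le> N * (N * (1 / (2 * N ^ 3)))"
        using mb e_small e N by (intro mult_mono) auto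
      then show ?thesis using m\<tau> by linarith
    qed
    finally have E: "m powr K'.\<beta> * (D + c1 + (c2 + D))
        \<le> m powr K'.\<beta> * (N powr K'.\<beta> * c) + N * (N * (1 / (2 * N ^ 3))) + 1 / (2 * N)" .
    have "N * (N * (1 / (2 * N ^ 3))) + 1 / (2 * N) = 1 / N" using N by (simp add: power3_eq_cube field_simps)
    moreover have "m powr K'.\<beta> * (D + c1) + m powr K'.\<beta> * (c2 + D) = m powr K'.\<beta> * (D + c1 + (c2 + D))"
      by (simp only: distrib_left)
    ultimately have "m powr K'.\<beta> * (D + c1) + m powr K'.\<beta> * (c2 + D) \<le> jd (V', \<alpha>') ((m * N) *\<^sub>R \<xi>m) ((m * N) *\<^sub>R \<xi>p) + 1 / N"
      using E unfolding j by linarith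
    moreover have "m * N \<ge> N" using m N by simp
    ultimately show ?thesis using that[OF K' V' clN _ nz s1 s2] by blast
  qed
qed

end

section \<open>Equipartition of energy for almost minimal paths\<close>

text \<open>The minimum of \<open>l * K + P / l\<close> over l is twice the square root of K P, so
  the hypothesis says that the square of the difference of the roots is at most e. If K or P
  vanishes, the infimum is only approached and \<open>small\<close> takes over.\<close>

lemma equipartition_of_scaling:
  fixes K P e :: real
  assumes K: "0 \<le> K" and P: "0 \<le> P" and e: "0 \<le> e"
    and sc: "\<And>l. l > 0 \<Longrightarrow> K + P \<le> l * K + P / l + e"
  shows "\<bar>sqrt K - sqrt P\<bar> \<le> sqrt e"
proof -
  have small: "Q \<le> e" if Q: "0 \<le> Q" and sc: "\<And>l. l > 0 \<Longrightarrow> Q \<le> Q / l + e" for Q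
  proof (rule ccontr)
    assume "\<not> Q \<le> e"
    then have q: "Q - e > 0" "Q > 0" using e by auto
    \<comment> \<open>With \<open>l = 2 * Q / (Q - e)\<close> the term Q / l is only half of Q -
      e.\<close>
    have "Q \<le> Q / (2 * Q / (Q - e)) + e" using q by (intro sc) simp
    also have "Q / (2 * Q / (Q - e)) = (Q - e) / 2" using q by simp
    finally have "2 * Q \<le> Q - e + 2 * e" by (simp add: field_simps)
    then show False using q by auto
  qed
  have "(sqrt K - sqrt P)\<^sup>2 \<le> e"
  proof (cases "K = 0 \<or> P = 0")
    case True
    then show ?thesis
    proof
      assume "K = 0"
      moreover have "P \<le> e" using sc P \<open>K = 0\<close> by (intro small) auto
      ultimately show ?thesis using P by simp
    next
      assume P0: "P = 0"
      have "K \<le> e"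
      proof (rule small[OF K])
        fix l :: real assume "l > 0"
        then show "K \<le> K / l + e" using sc[of "1 / l"] P0 by simp
      qed
      then show ?thesis using P0 K by simp
    qed
  next
    case False
    then have KP: "K > 0" "P > 0" using K P by auto
    define k p where "k = sqrt K" and "p = sqrt P"
    have kp: "k > 0" "p > 0" "K = k * k" "P = p * p" using KP by (auto simp: k_def p_def)
    have "K + P \<le> (p / k) * K + P / (p / k) + e" using kp by (intro sc) simp
    also have "(p / k) * K + P / (p / k) = 2 * k * p" using kp by (simp add: field_simps)
    finally show ?thesis unfolding k_def[symmetric] p_def[symmetric] using kp by (simp add: power2_eq_square algebra_simps)
  qed
  then have "sqrt ((sqrt K - sqrt P)\<^sup>2) \<le> sqrt e" by (rule real_sqrt_le_mono)
  then show ?thesis by simp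
qed

text \<open>A diagonal subsequence converges at the rationals, and the common modulus w makes it
  Cauchy at every time. Division by \<open>c q\<close> provides the uniform bound for the
  extraction.\<close>

lemma equicontinuous_subsequence:
  fixes Y :: "nat \<Rightarrow> real \<Rightarrow> 'a::euclidean_space"
  assumes b: "\<And>n t. norm (Y n t) \<le> b t" and w: "\<And>n s t. norm (Y n t - Y n s) \<le> w \<bar>t - s\<bar>"
    and w0: "(w \<longlongrightarrow> 0) (at_right 0)"
  obtains k x where "strict_mono k" "\<And>t. (\<lambda>n. Y (k n) t) \<longlonglongrightarrow> x t"
proof -
  define c where "c = (\<lambda>t. \<bar>b t\<bar> + 1)"
  have c: "c t > 0" for t by (simp add: c_def add_nonneg_pos)
  have bound: "norm (Y n q /\<^sub>R c q) \<le> 1" for n q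
    using b[of n q] c[of q] by (simp add: c_def field_simps)
  obtain k where k: "strict_mono k" "\<And>q. q \<in> \<rat> \<Longrightarrow> \<exists>l. (\<lambda>n. Y (k n) q /\<^sub>R c q) \<longlonglongrightarrow> l"
    by (rule function_convergent_subsequence[of \<rat> "\<lambda>n q. Y n q /\<^sub>R c q" 1]) (use countable_rat bound in auto)
  have conv: "\<exists>l. (\<lambda>n. Y (k n) t) \<longlonglongrightarrow> l" for t
  proof -
    have "Cauchy (\<lambda>n. Y (k n) t)"
    proof (rule metric_CauchyI)
      fix e :: real assume e: "e > 0"
      have "\<forall>\<^sub>F d in at_right 0. w d < e / 3" using w0 e by (intro order_tendstoD(2)) auto
      then obtain d where d: "d > 0" "\<And>u. 0 < u \<Longrightarrow> u < d \<Longrightarrow> w u < e / 3"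
        by (auto simp: eventually_at_right_field)
      obtain q where q: "q \<in> \<rat>" "t < q" "q < t + d" using Rats_dense_in_real[of t "t + d"] d(1) by auto
      have near: "dist (Y (k n) t) (Y (k n) q) < e / 3" for n
        using w[of "k n" t q] d(2)[of "\<bar>t - q\<bar>"] q by (auto simp: dist_norm)
      obtain l where "(\<lambda>n. Y (k n) q /\<^sub>R c q) \<longlonglongrightarrow> l" using k(2)[OF q(1)] by blast
      then have "(\<lambda>n. c q *\<^sub>R (Y (k n) q /\<^sub>R c q)) \<longlonglongrightarrow> c q *\<^sub>R l" by (intro tendsto_intros)
      then have "(\<lambda>n. Y (k n) q) \<longlonglongrightarrow> c q *\<^sub>R l" using c[of q] by simp
      then have "Cauchy (\<lambda>n. Y (k n) q)" by (rule LIMSEQ_imp_Cauchy)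
      then obtain M where M: "\<And>m n. m \<ge> M \<Longrightarrow> n \<ge> M \<Longrightarrow> dist (Y (k m) q) (Y (k n) q) < e / 3"
        using e unfolding Cauchy_def by (metis divide_pos_pos zero_less_numeral)
      show "\<exists>M. \<forall>m\<ge>M. \<forall>n\<ge>M. dist (Y (k m) t) (Y (k n) t) < e"
      proof (intro exI allI impI)
        fix m n assume "M \<le> m" "M \<le> n"
        then have "dist (Y (k m) q) (Y (k n) q) < e / 3" by (rule M)
        moreover have "dist (Y (k m) t) (Y (k n) t) \<le> dist (Y (k m) t) (Y (k m) q) + dist (Y (k m) q) (Y (k n) q) + dist (Y (k n) q) (Y (k n) t)"
          by metric
        ultimately show "dist (Y (k m) t) (Y (k n) t) < e"
          using near[of m] near[of n] by (simp add: dist_commute)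
      qed
    qed
    then show ?thesis by (auto simp: Cauchy_convergent_iff convergent_def)
  qed
  then obtain x where "\<And>t. (\<lambda>n. Y (k n) t) \<longlonglongrightarrow> x t" by metis
  then show ?thesis using that k(1) by blast
qed

context kepler
begin

lemma reach_join:
  assumes "reach W S p z c" "reach W S z q d"
  obtains A B X where "A \<le> 0" "0 \<le> B" "X \<in> H1 A B" "X A = p" "X 0 = z" "X B = q"
    "\<And>t. t \<in> {A..B} \<Longrightarrow> X t \<in> S" "action W A B X \<le> ennreal (c + d)"
proof -
  from assms(1) obtain a b x where x: "a \<le> b" "x \<in> H1 a b" "x a = p" "x b = z" "\<forall>t\<in>{a..b}. x t \<in> S"
    "action W a b x \<le> ennreal c" and c: "0 \<le> c" unfolding reach_def by blast
  from assms(2) obtain a' b' y where y: "a' \<le> b'" "y \<in> H1 a' b'" "y a' = z" "y b' = q" "\<forall>t\<in>{a'..b'}. y t \<in> S"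
    "action W a' b' y \<le> ennreal d" and d: "0 \<le> d" unfolding reach_def by blast
  let ?x = "\<lambda>t. x (b + t)" and ?y = "\<lambda>t. y (a' + t)"
  have x': "?x \<in> H1 (a - b) 0" "action W (a - b) 0 ?x = action W a b x"
    using H1_time_shift[OF x(2,1) W_meas, of b] by auto
  have y': "?y \<in> H1 0 (b' - a')" "action W 0 (b' - a') ?y = action W a' b' y"
    using H1_time_shift[OF y(2,1) W_meas, of a'] by auto
  have eq: "?x 0 = ?y 0" using x y by simp
  have o: "a - b \<le> 0" "0 \<le> b' - a'" using x y by auto
  show ?thesis
  proof (rule that[of "a - b" "b' - a'" "\<lambda>t. if t \<le> 0 then ?x t else ?y t"])
    show "(\<lambda>t. if t \<le> 0 then ?x t else ?y t) \<in> H1 (a - b) (b' - a')" by (rule H1_concat[OF x'(1) y'(1) eq o])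
    show "action W (a - b) (b' - a') (\<lambda>t. if t \<le> 0 then ?x t else ?y t) \<le> ennreal (c + d)"
      unfolding action_concat[OF W_meas x'(1) y'(1) eq o] x'(2) y'(2) using x(6) y(6) c d by (simp add: add_mono)
    show "(if t \<le> 0 then ?x t else ?y t) \<in> S" if "t \<in> {a - b..b' - a'}" for t
      using that x(5) y(5) by auto
  qed (use x y o eq in auto)
qed

lemma act_nonneg: "0 \<le> act a b x"
  by (simp add: act_def)

lemma reach_act:
  assumes "x \<in> H1 a b" "action W a b x < \<infinity>" "a \<le> b"
  shows "reach W UNIV (x a) (x b) (act a b x)"
  by (rule reachI[OF assms(3,1) refl refl]) (use action_act[OF assms(1,2)] act_nonneg in auto)

lemma jd_le_act:
  assumes "x \<in> H1 a b" "action W a b x < \<infinity>" "a \<le> b"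
  shows "jd W (x a) (x b) \<le> act a b x"
  by (rule jd_le[OF reach_act[OF assms]])

definition kn :: "real \<Rightarrow> real \<Rightarrow> (real \<Rightarrow> 'a) \<Rightarrow> real" where "kn a b x = enn2real (kin a b x)"
definition pt :: "real \<Rightarrow> real \<Rightarrow> (real \<Rightarrow> 'a) \<Rightarrow> real" where "pt a b x = enn2real (pote W a b x)"

lemma act_kn_pt:
  assumes ab: "a \<le> b" and x: "x \<in> H1 a b" and f: "action W a b x < \<infinity>"
  shows "act a b x = kn a b x + pt a b x" "kin a b x = ennreal (kn a b x)" "pote W a b x = ennreal (pt a b x)"
proof -
  have s: "action W a b x = kin a b x + pote W a b x" by (rule action_split[OF W_meas ab x])
  then have k: "kin a b x < \<infinity>" "pote W a b x < \<infinity>" using f by (auto simp: ennreal_add_eq_top less_top)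
  show "kin a b x = ennreal (kn a b x)" "pote W a b x = ennreal (pt a b x)" using k by (auto simp: kn_def pt_def)
  show "act a b x = kn a b x + pt a b x" unfolding act_def s kn_def pt_def using k by (intro enn2real_plus) auto
qed

text \<open>Action is additive, each piece costs at least the distance of its ends, and the distance
  obeys the triangle inequality; hence the excess of a piece is at most that of the whole.\<close>

lemma near_min_sub:
  assumes x: "x \<in> H1 a b" and ac: "action W a b x \<le> ennreal (jd W (x a) (x b) + e)" and e: "0 \<le> e"
    and st: "a \<le> s" "s \<le> t" "t \<le> b"
  shows "action W s t x < \<infinity>" "act s t x \<le> jd W (x s) (x t) + e"
proof -
  have f: "action W a b x < \<infinity>" using ac by (auto simp: le_less_trans)
  show "action W s t x < \<infinity>" by (rule act_finite_sub[OF x f st])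
  have jl: "jd W (x u) (x v) \<le> act u v x" if "a \<le> u" "u \<le> v" "v \<le> b" for u v
    by (rule jd_le_act[OF H1_restrict[OF x that] act_finite_sub[OF x f that] that(2)])
  have "act a b x = act a s x + act s b x" using act_add[OF x f, of s] st by auto
  moreover have "act s b x = act s t x + act t b x"
    using act_add[OF H1_restrict[OF x, of s b] act_finite_sub[OF x f, of s b], of t] st by auto
  moreover have "act a b x \<le> jd W (x a) (x b) + e"
    using ac e jd_nonneg[of "x a" "x b"] unfolding action_act[OF x f] by (subst (asm) ennreal_le_iff) simp_all
  moreover have "jd W (x a) (x b) \<le> jd W (x a) (x s) + jd W (x s) (x t) + jd W (x t) (x b)"
    using jd_triangle[of "x a" "x b" "x s"] jd_triangle[of "x s" "x b" "x t"] by linarith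
  ultimately show "act s t x \<le> jd W (x s) (x t) + e" using jl[of a s] jl[of t b] st by linarith
qed

text \<open>Changing the speed by a factor l multiplies the kinetic action by l, divides the
  potential action by l and keeps the end points, so the distance bounds the result from below for
  every l.\<close>

lemma near_min_equipartition:
  assumes x: "x \<in> H1 s t" and st: "s \<le> t" and f: "action W s t x < \<infinity>" and ac: "act s t x \<le> jd W (x s) (x t) + e" and e: "0 \<le> e"
  shows "\<bar>sqrt (kn s t x) - sqrt (pt s t x)\<bar> \<le> sqrt e"
proof (rule equipartition_of_scaling)
  show "0 \<le> kn s t x" "0 \<le> pt s t x" by (auto simp: kn_def pt_def)
  fix l :: real assume l: "l > 0"
  have st': "s / l \<le> t / l" using st l by (simp add: divide_right_mono)
  have x': "x \<in> H1 (0 + l * (s / l)) (0 + l * (t / l))" using x l by simp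
  let ?y = "\<lambda>u. x (0 + l * u)"
  have y: "?y \<in> H1 (s / l) (t / l)" "kin (s / l) (t / l) ?y = ennreal l * kin s t x"
    using H1_affine[OF x' st' l, of 1] l by auto
  have p: "pote W (s / l) (t / l) ?y = ennreal (1 / l) * pote W s t x"
    using pote_affine[OF W_meas l st', of 0 x] H1_continuous[OF x] l by simp
  note kp = act_kn_pt[OF st x f]
  have "ennreal (jd W (?y (s / l)) (?y (t / l))) \<le> action W (s / l) (t / l) ?y" by (rule jd_le_action[OF st' y(1)])
  also have "\<dots> = ennreal l * ennreal (kn s t x) + ennreal (1 / l) * ennreal (pt s t x)"
    unfolding action_split[OF W_meas st' y(1)] y(2) p kp(2,3) ..
  also have "\<dots> = ennreal (l * kn s t x + pt s t x / l)"
    using l by (simp add: kn_def pt_def flip: ennreal_mult ennreal_plus)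
  finally have "jd W (x s) (x t) \<le> l * kn s t x + pt s t x / l"
    using l by (subst (asm) ennreal_le_iff) (auto simp: kn_def pt_def)
  then show "kn s t x + pt s t x \<le> l * kn s t x + pt s t x / l + e" using ac kp(1) by simp
qed (rule e)

lemma kn_lower:
  assumes x: "x \<in> H1 s t" and st: "s \<le> t"
  shows "(norm (x t - x s))\<^sup>2 \<le> 2 * (t - s) * kn s t x"
proof (cases "s < t")
  case True
  have "(norm (x t - x s))\<^sup>2 / (2 * (t - s)) \<le> kn s t x"
  proof -
    have "kin s t x = ennreal (kn s t x)" using kin_finite[OF st x] by (simp add: kn_def)
    then have "ennreal ((norm (x t - x s))\<^sup>2 / (2 * (t - s))) \<le> ennreal (kn s t x)"
      using kin_lower[OF x True] by (simp only:)
    then show ?thesis by (subst (asm) ennreal_le_iff) (simp_all add: kn_def)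
  qed
  then show ?thesis using True by (simp add: field_simps)
qed (use st in auto)

text \<open>The budget \<open>2 * h R + e\<close> is nearly exhausted by the radial bounds on the
  outer pieces, which cost at least \<open>h R - h 1\<close> and
  \<open>h R - h (norm (x t))\<close>. For the second claim the last piece is calibrated with
  \<open>k = \<beta>\<^sup>2\<close> towards \<open>\<xi>\<close>, which raises its lower bound by
  exactly the left-hand side.\<close>

lemma tail_estimate:
  assumes x: "x \<in> H1 a b" and ac: "action W a b x \<le> ennreal (2 * h R + e)" and e: "0 \<le> e" and R: "R \<ge> 0"
    and xa: "norm (x a) = R" and xb: "x b = R *\<^sub>R \<xi>" and \<xi>: "norm \<xi> = 1"
    and ut: "a \<le> u" "u \<le> t" "t \<le> b" and u: "norm (x u) = 1" and t: "x t \<noteq> 0"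
  shows "act u t x \<le> h 1 + h (norm (x t)) + e"
    and "h (norm (x t)) * \<beta>\<^sup>2 * (1 - (x t /\<^sub>R norm (x t)) \<bullet> \<xi>) \<le> 2 * h 1 + e"
proof -
  have f: "action W a b x < \<infinity>" using ac by (auto simp: le_less_trans)
  have reach: "reach W UNIV (x v) (x w) (act v w x)" if "a \<le> v" "v \<le> w" "w \<le> b" for v w
    by (rule reach_act[OF H1_restrict[OF x that] act_finite_sub[OF x f that] that(2)])
  have s: "act a u x + act u t x + act t b x \<le> 2 * h R + e"
  proof -
    have "act a b x = act a u x + act u b x" using act_add[OF x f, of u] ut by auto
    moreover have "act u b x = act u t x + act t b x"
      using act_add[OF H1_restrict[OF x, of u b] act_finite_sub[OF x f, of u b], of t] ut by auto
    moreover have "act a b x \<le> 2 * h R + e"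
      using ac e h_nonneg[of R] unfolding action_act[OF x f] by (subst (asm) ennreal_le_iff) simp_all
    ultimately show ?thesis by linarith
  qed
  have 1: "h R - h 1 \<le> act a u x" using reach_lower_h[OF reach[of a u]] ut xa u by auto
  have nb: "norm (x b) = R" using xb \<xi> R by simp
  have 2: "h R - h (norm (x t)) \<le> act t b x" using reach_lower_h[OF reach[of t b]] ut nb by auto
  show "act u t x \<le> h 1 + h (norm (x t)) + e" using s 1 2 by linarith
  have 3: "h (norm (x t)) - h 1 \<le> act u t x" using reach_lower_h[OF reach[of u t]] ut u by auto
  let ?s = "x t /\<^sub>R norm (x t)"
  have "sqrt (2 * v0) * \<bar>G (\<beta>\<^sup>2) \<xi> (x b) - G (\<beta>\<^sup>2) \<xi> (x t)\<bar> \<le> act t b x"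
    by (rule reach_lower[OF reach \<xi>]) (use ut in auto)
  then have "sqrt (2 * v0) * (G (\<beta>\<^sup>2) \<xi> (x b) - G (\<beta>\<^sup>2) \<xi> (x t)) \<le> act t b x"
    using v0 by (meson abs_ge_self mult_left_mono order_trans real_sqrt_ge_zero less_imp_le mult_nonneg_nonneg zero_le_numeral)
  moreover have "sqrt (2 * v0) * G (\<beta>\<^sup>2) \<xi> (x b) = h R"
    using G_unit[OF R \<xi>, of "\<beta>\<^sup>2" \<xi>] \<xi> by (simp add: xb h_def dot_square_norm)
  moreover have "sqrt (2 * v0) * G (\<beta>\<^sup>2) \<xi> (x t) = h (norm (x t)) * (1 - \<beta>\<^sup>2 * (1 - ?s \<bullet> \<xi>))"
    using G_unit[of "norm (x t)" ?s "\<beta>\<^sup>2" \<xi>] t by (simp add: h_def)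
  ultimately have "h R - h (norm (x t)) * (1 - \<beta>\<^sup>2 * (1 - ?s \<bullet> \<xi>)) \<le> act t b x" by (simp add: right_diff_distrib)
  then have "h R - h (norm (x t)) + h (norm (x t)) * \<beta>\<^sup>2 * (1 - ?s \<bullet> \<xi>) \<le> act t b x" by (simp add: algebra_simps)
  then show "h (norm (x t)) * \<beta>\<^sup>2 * (1 - ?s \<bullet> \<xi>) \<le> 2 * h 1 + e" using s 1 3 by linarith
qed

end

section \<open>Paths off the origin whose speed is bounded by the potential\<close>

context kepler
begin

definition pr :: "'a \<Rightarrow> real" where
  "pr p = V (p /\<^sub>R norm p) / norm p powr \<alpha>"

lemma pot_pr: "p \<noteq> 0 \<Longrightarrow> potential W p = ennreal (pr p)"
  by (simp add: pot_eq pr_def)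

lemma pr_pos: "p \<noteq> 0 \<Longrightarrow> pr p > 0"
  using V_ge[OF sgn_in_sphere, of p] v0 by (simp add: pr_def)

lemma pr_cont: "continuous_on (- {0}) pr"
  unfolding pr_def by (rule continuous_pot)

lemma pr_path_cont: "continuous_on S x \<Longrightarrow> (\<And>t. t \<in> S \<Longrightarrow> x t \<noteq> 0) \<Longrightarrow> continuous_on S (\<lambda>t. pr (x t))"
  by (rule continuous_on_compose2[OF pr_cont]) auto

lemma pote_integral:
  assumes x: "continuous_on {s..t} x" and nz: "\<And>u. u \<in> {s..t} \<Longrightarrow> x u \<noteq> 0"
  shows "pote W s t x = ennreal (integral {s..t} (\<lambda>u. pr (x u)))"
proof -
  have c: "continuous_on {s..t} (\<lambda>u. pr (x u))" by (rule pr_path_cont[OF x nz])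
  have si: "set_integrable lborel {s..t} (\<lambda>u. pr (x u))" by (rule borel_integrable_atLeastAtMost'[OF c])
  have "pote W s t x = (\<integral>\<^sup>+u. ennreal (indicator {s..t} u *\<^sub>R pr (x u)) \<partial>lborel)"
    unfolding pote_def
    by (rule nn_integral_cong_AE, rule AE_mp[OF AE_lborel_singleton[of s]], rule AE_mp[OF AE_lborel_singleton[of t]], rule AE_I2)
       (use nz pot_pr in \<open>auto simp: indicator_def\<close>)
  also have "\<dots> = ennreal (LINT u:{s..t}|lborel. pr (x u))"
    unfolding set_lebesgue_integral_def
    by (rule nn_integral_eq_integral) (use si pr_pos[OF nz] in \<open>auto simp: set_integrable_def indicator_def less_imp_le\<close>)
  also have "(LINT u:{s..t}|lborel. pr (x u)) = integral {s..t} (\<lambda>u. pr (x u))"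
    by (rule set_borel_integral_eq_integral[OF si])
  finally show ?thesis .
qed

text \<open>The hypothesis is what equipartition leaves in the limit: kinetic action at most the
  potential one, on every subinterval. Locally it bounds the speed by
  \<open>M = sqrt (2 * pr (x u))\<close>, and the criterion for absolute continuity turns this into
  a bound on the kinetic action.\<close>

lemma path_of_energy_bound:
  assumes st: "s \<le> t" and x: "continuous_on {s..t} x" and nz: "\<And>u. u \<in> {s..t} \<Longrightarrow> x u \<noteq> 0"
    and bd: "\<And>r u. s \<le> r \<Longrightarrow> r \<le> u \<Longrightarrow> u \<le> t \<Longrightarrow> (norm (x u - x r))\<^sup>2 \<le> 2 * (u - r) * integral {r..u} (\<lambda>w. pr (x w))"
  shows "x \<in> H1 s t" "action W s t x \<le> ennreal (2 * integral {s..t} (\<lambda>w. pr (x w)))"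
proof -
  define M where "M = (\<lambda>u. sqrt (2 * pr (x u)))"
  have c: "continuous_on {s..t} (\<lambda>u. pr (x u))" by (rule pr_path_cont[OF x nz])
  have Mc: "continuous_on {s..t} M" unfolding M_def by (intro continuous_intros c)
  have Mp: "M u > 0" if "u \<in> {s..t}" for u using pr_pos[OF nz[OF that]] by (simp add: M_def)
  define P where "P = (\<lambda>u. integral {s..u} M)"
  have PD: "(P has_real_derivative M u) (at u within {s..t})" if "u \<in> {s..t}" for u
    unfolding P_def by (rule integral_has_real_derivative[OF Mc that])
  have Pd: "P u - P r = integral {r..u} M" if "s \<le> r" "r \<le> u" "u \<le> t" for r u
  proof -
    have "M integrable_on {s..u}" by (rule integrable_continuous_interval, rule continuous_on_subset[OF Mc]) (use that in auto)
    from Henstock_Kurzweil_Integration.integral_combine[OF that(1,2) this] show ?thesis by (simp add: P_def)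
  qed
  have bound: "norm (x u - x r) \<le> P u - P r" if ru: "s \<le> r" "r \<le> u" "u \<le> t" for r u
  proof (rule field_le_epsilon)
    fix e0 :: real assume e0: "e0 > 0"
    define e where "e = e0 / (u - r + 1)"
    have e: "e > 0" using e0 ru by (simp add: e_def)
    define D where "D = (\<lambda>r' u'. r \<le> r' \<and> r' \<le> u' \<and> u' \<le> u \<longrightarrow> norm (x u' - x r') \<le> P u' - P r' + e * (u' - r'))"
    have "D r u" using ru(2)
    proof (induction rule: Bolzano)
      case (trans a b c)
      show ?case unfolding D_def
      proof (intro impI)
        assume "r \<le> a \<and> a \<le> c \<and> c \<le> u"
        then have "norm (x b - x a) \<le> P b - P a + e * (b - a)" "norm (x c - x b) \<le> P c - P b + e * (c - b)"
          using trans unfolding D_def by auto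
        moreover have "norm (x c - x a) \<le> norm (x c - x b) + norm (x b - x a)" by norm
        moreover have "e * (b - a) + e * (c - b) = e * (c - a)" by (simp add: algebra_simps)
        ultimately show "norm (x c - x a) \<le> P c - P a + e * (c - a)" by linarith
      qed
    next
      case (local y)
      then have y: "y \<in> {s..t}" using ru by auto
      obtain d where d: "d > 0" "\<And>w. w \<in> {s..t} \<Longrightarrow> \<bar>w - y\<bar> < d \<Longrightarrow> \<bar>M w - M y\<bar> < e / 2"
        using Mc y e unfolding continuous_on_iff dist_real_def by (meson half_gt_zero)
      show ?case
      proof (intro exI conjI allI impI)
        show "d > 0" by fact
        fix a b assume ab: "a \<le> y \<and> y \<le> b \<and> b - a < d"
        show "D a b" unfolding D_def
        proof (intro impI)
          assume o: "r \<le> a \<and> a \<le> b \<and> b \<le> u"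
          have near: "\<bar>M w - M y\<bar> < e / 2" if "w \<in> {a..b}" for w
            using d(2)[of w] that ab o ru by auto
          \<comment> \<open>On the short interval M lies between m - e and m. The increment of x is
            thus at most (b - a) m and that of P at least (b - a) (m - e); the loss is e per unit of
            time.\<close>
          define m where "m = M y + e / 2"
          have m: "m > 0" using Mp[OF y] e by (simp add: m_def)
          have sub: "{a..b} \<subseteq> {s..t}" using o ru by auto
          have "integral {a..b} (\<lambda>w. pr (x w)) \<le> integral {a..b} (\<lambda>w. m\<^sup>2 / 2)"
          proof (rule integral_le)
            show "(\<lambda>w. pr (x w)) integrable_on {a..b}" by (rule integrable_continuous_interval[OF continuous_on_subset[OF c sub]])
            fix w assume w: "w \<in> {a..b}"
            have "M w \<le> m" using near[OF w] unfolding m_def by argo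
            moreover have "0 \<le> M w" using Mp[of w] w sub by (auto simp: less_imp_le)
            ultimately have "(M w)\<^sup>2 \<le> m\<^sup>2" by (rule power_mono)
            moreover have "(M w)\<^sup>2 = 2 * pr (x w)" using pr_pos[OF nz, of w] w sub by (auto simp: M_def)
            ultimately show "pr (x w) \<le> m\<^sup>2 / 2" by simp
          qed auto
          also have "\<dots> = (b - a) * (m\<^sup>2 / 2)" using o by simp
          finally have "2 * (b - a) * integral {a..b} (\<lambda>w. pr (x w)) \<le> 2 * (b - a) * ((b - a) * (m\<^sup>2 / 2))"
            using o by (intro mult_left_mono) auto
          also have "\<dots> = ((b - a) * m)\<^sup>2" by (simp add: power2_eq_square)
          finally have "(norm (x b - x a))\<^sup>2 \<le> ((b - a) * m)\<^sup>2" using bd[of a b] o ru by linarith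
          then have 1: "norm (x b - x a) \<le> (b - a) * m" by (rule power2_le_imp_le) (use o m in simp)
          have "integral {a..b} (\<lambda>w. m - e) \<le> integral {a..b} M"
          proof (rule integral_le)
            show "M integrable_on {a..b}" by (rule integrable_continuous_interval[OF continuous_on_subset[OF Mc sub]])
            fix w assume w: "w \<in> {a..b}"
            show "m - e \<le> M w" using near[OF w] unfolding m_def by argo
          qed auto
          then have "(b - a) * (m - e) \<le> P b - P a" using Pd[of a b] o ru by simp
          then show "norm (x b - x a) \<le> P b - P a + e * (b - a)" using 1 by (simp add: algebra_simps)
        qed
      qed
    qed
    then have "norm (x u - x r) \<le> P u - P r + e * (u - r)" using ru by (simp add: D_def)
    moreover have "e * (u - r) \<le> e0" using e0 ru by (simp add: e_def field_simps)
    ultimately show "norm (x u - x r) \<le> P u - P r + e0" by linarith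
  qed
  note H = H1_of_derivative_bound[OF st Mc Mp PD bound]
  show h: "x \<in> H1 s t" by (rule H(1))
  have I0: "integral {s..t} (\<lambda>w. pr (x w)) \<ge> 0"
    by (rule Henstock_Kurzweil_Integration.integral_nonneg[OF integrable_continuous_interval[OF c]]) (use pr_pos[OF nz] in \<open>auto simp: less_imp_le\<close>)
  have "kin s t x \<le> (\<integral>\<^sup>+u\<in>{s<..<t}. ennreal ((M u)\<^sup>2 / 2) \<partial>lborel)" by (rule H(2))
  also have "\<dots> = pote W s t x"
    unfolding pote_def
  proof (rule nn_integral_cong)
    fix u
    show "ennreal ((M u)\<^sup>2 / 2) * indicator {s<..<t} u = potential W (x u) * indicator {s<..<t} u"
      using pr_pos[OF nz, of u] pot_pr[OF nz, of u] by (cases "u \<in> {s<..<t}") (auto simp: M_def)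
  qed
  also have pI: "pote W s t x = ennreal (integral {s..t} (\<lambda>w. pr (x w)))" by (rule pote_integral[OF x nz])
  finally have k: "kin s t x \<le> ennreal (integral {s..t} (\<lambda>w. pr (x w)))" .
  have "action W s t x \<le> ennreal (integral {s..t} (\<lambda>w. pr (x w))) + ennreal (integral {s..t} (\<lambda>w. pr (x w)))"
    unfolding action_split[OF W_meas st h] pI by (intro add_mono k order_refl)
  also have "\<dots> = ennreal (2 * integral {s..t} (\<lambda>w. pr (x w)))" using I0 by (simp flip: ennreal_plus)
  finally show "action W s t x \<le> ennreal (2 * integral {s..t} (\<lambda>w. pr (x w)))" .
qed

end

text \<open>If y fell below some b at arbitrarily late times, the Lipschitz bound would keep it
  below b + C for a unit of time after each of them. Every such interval adds at least m to the
  integral of f, which is nevertheless bounded by \<open>H b\<close> whenever y is below b.\<close>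

lemma filterlim_at_top_of_integral_bound:
  fixes y :: "real \<Rightarrow> real"
  assumes y: "continuous_on UNIV y" "\<And>t. y t > 0" and C: "\<And>s t. \<bar>y t - y s\<bar> \<le> C * \<bar>t - s\<bar>"
    and f: "continuous_on UNIV f" "\<And>t. f t \<ge> v * y t powr - a" and v: "v > 0" and a: "a > 0"
    and H: "mono_on {0..} H" and bd: "\<And>t. t \<ge> 0 \<Longrightarrow> integral {0..t} f \<le> H (y t)"
  shows "filterlim y at_top at_top"
proof (rule ccontr)
  assume "\<not> filterlim y at_top at_top"
  then obtain b where nb: "\<not> (\<forall>\<^sub>F t in at_top. b \<le> y t)" unfolding filterlim_at_top by blast
  have inf: "\<exists>t\<ge>T. y t < b" for T
    using nb unfolding eventually_at_top_linorder by (meson not_le)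
  have C0: "C \<ge> 0" using C[of 1 0] by auto
  have b: "b > 0" using inf[of 0] y(2) by (meson less_trans)
  define m where "m = v * (b + C) powr - a"
  have m: "m > 0" using v b C0 by (simp add: m_def)
  have fi: "f integrable_on {s..t}" for s t by (rule integrable_continuous_interval[OF continuous_on_subset[OF f(1) subset_UNIV]])
  have f0: "f t \<ge> 0" for t using f(2)[of t] v by (meson mult_nonneg_nonneg order_trans powr_ge_zero less_imp_le)
  have "\<exists>t\<ge>0. integral {0..t} f \<ge> real n * m" for n
  proof (induction n)
    case 0
    show ?case by (intro exI[of _ 0]) simp
  next
    case (Suc n)
    then obtain t where t: "t \<ge> 0" "integral {0..t} f \<ge> real n * m" by blast
    obtain t' where t': "t' \<ge> t" "y t' < b" using inf by blast
    have "integral {t'..t' + 1} (\<lambda>_. m) \<le> integral {t'..t' + 1} f"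
    proof (rule integral_le)
      fix u assume u: "u \<in> {t'..t' + 1}"
      have "C * \<bar>u - t'\<bar> \<le> C * 1" using u C0 by (intro mult_left_mono) auto
      then have "y u \<le> b + C" using C[of u t'] t' by linarith
      then have "(b + C) powr - a \<le> y u powr - a" using y(2) a by (intro powr_mono2') auto
      then have "m \<le> v * y u powr - a" unfolding m_def using v by (intro mult_left_mono) auto
      then show "m \<le> f u" using f(2)[of u] by simp
    qed (use fi in auto)
    then have 1: "m \<le> integral {t'..t' + 1} f" by simp
    have 2: "integral {0..t'} f = integral {0..t} f + integral {t..t'} f"
      by (rule Henstock_Kurzweil_Integration.integral_combine[symmetric]) (use t t' fi in auto)
    have 3: "integral {0..t' + 1} f = integral {0..t'} f + integral {t'..t' + 1} f"
      by (rule Henstock_Kurzweil_Integration.integral_combine[symmetric]) (use t t' fi in auto)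
    have 4: "integral {t..t'} f \<ge> 0" by (rule Henstock_Kurzweil_Integration.integral_nonneg[OF fi]) (use f0 in auto)
    show ?case
      using 1 2 3 4 t t' by (intro exI[of _ "t' + 1"]) (auto simp: distrib_right)
  qed
  moreover obtain n where n: "real n * m > H b"
    using reals_Archimedean3[OF m] by blast
  ultimately obtain t where t: "t \<ge> 0" "integral {0..t} f \<ge> real n * m" by blast
  obtain t' where t': "t' \<ge> t" "y t' < b" using inf by blast
  have "integral {0..t'} f = integral {0..t} f + integral {t..t'} f"
    by (rule Henstock_Kurzweil_Integration.integral_combine[symmetric]) (use t t' fi in auto)
  moreover have "integral {t..t'} f \<ge> 0" by (rule Henstock_Kurzweil_Integration.integral_nonneg[OF fi]) (use f0 in auto)
  moreover have "integral {0..t'} f \<le> H (y t')" by (rule bd) (use t t' in auto)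
  moreover have "H (y t') \<le> H b" using H t' y(2)[of t'] b by (auto simp: mono_on_def)
  ultimately show False using t n by linarith
qed

lemma tendsto_unit_vector:
  fixes s :: "real \<Rightarrow> 'a::real_inner"
  assumes s: "\<forall>\<^sub>F t in F. norm (s t) = 1" and \<xi>: "norm \<xi> = 1" and l: "((\<lambda>t. 1 - s t \<bullet> \<xi>) \<longlongrightarrow> 0) F"
  shows "(s \<longlongrightarrow> \<xi>) F"
proof -
  have "((\<lambda>t. sqrt (2 * (1 - s t \<bullet> \<xi>))) \<longlongrightarrow> sqrt (2 * 0)) F" by (intro tendsto_intros l)
  moreover have "\<forall>\<^sub>F t in F. sqrt (2 * (1 - s t \<bullet> \<xi>)) = norm (s t - \<xi>)"
    using s
  proof eventually_elim
    case (elim t)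
    then have "(norm (s t - \<xi>))\<^sup>2 = 2 * (1 - s t \<bullet> \<xi>)"
      using \<xi> by (simp add: power2_norm_eq_inner inner_diff_left inner_diff_right inner_commute norm_eq_1)
    then show ?case by (metis norm_ge_zero real_sqrt_unique)
  qed
  ultimately have "((\<lambda>t. norm (s t - \<xi>)) \<longlongrightarrow> 0) F" by (simp add: filterlim_cong)
  then show ?thesis by (simp add: tendsto_norm_zero_iff LIM_zero_iff)
qed

section \<open>Limits of almost minimal paths\<close>

text \<open>The sequence e bounds both the distance of the potentials and the excess of the paths.
  Time 0 is placed at a point nearest to the origin, so that no compactness is lost through time
  shifts.\<close>

locale approx = kepler V \<alpha> v0 for V :: "'a::euclidean_space \<Rightarrow> real" and \<alpha> v0 +
  fixes Vn :: "nat \<Rightarrow> 'a \<Rightarrow> real" and \<alpha>n e R A B :: "nat \<Rightarrow> real" and X :: "nat \<Rightarrow> real \<Rightarrow> 'a" and \<xi>m \<xi>p :: 'a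
  assumes K: "\<And>n. kepler (Vn n) (\<alpha>n n) v0" and cl: "\<And>n. close V \<alpha> (Vn n) (\<alpha>n n) (e n)"
    and e0: "\<And>n. 0 \<le> e n" and e1: "\<And>n. e n \<le> 1" and e_lim: "e \<longlonglongrightarrow> 0"
    and A: "\<And>n. A n \<le> 0" and B: "\<And>n. 0 \<le> B n" and XH: "\<And>n. X n \<in> H1 (A n) (B n)"
    and XA: "\<And>n. X n (A n) = R n *\<^sub>R \<xi>m" and XB: "\<And>n. X n (B n) = R n *\<^sub>R \<xi>p"
    and X0: "\<And>n. norm (X n 0) = 1" and X1: "\<And>n t. t \<in> {A n..B n} \<Longrightarrow> 1 \<le> norm (X n t)"
    and Xact: "\<And>n. action (Vn n, \<alpha>n n) (A n) (B n) (X n) \<le> ennreal (jd (Vn n, \<alpha>n n) (X n (A n)) (X n (B n)) + e n)"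
    and Rlim: "filterlim R at_top sequentially" and R0: "\<And>n. 0 \<le> R n"
    and \<xi>m: "norm \<xi>m = 1" "\<And>n. Vn n \<xi>m = v0" and \<xi>p: "norm \<xi>p = 1" "\<And>n. Vn n \<xi>p = v0"
begin

text \<open>Everything proved for late times and \<open>\<xi>p\<close> thus holds for early times
  and \<open>\<xi>m\<close>.\<close>

lemma reversed: "approx V \<alpha> v0 Vn \<alpha>n e R (\<lambda>n. - B n) (\<lambda>n. - A n) (\<lambda>n t. X n (- t)) \<xi>p \<xi>m"
proof (intro approx.intro[OF kepler_axioms] approx_axioms.intro)
  fix n
  interpret Kn: kepler "Vn n" "\<alpha>n n" v0 by (rule K)
  have AB: "A n \<le> B n" using A[of n] B[of n] by simp
  note r = reverse_action[OF Kn.W_meas AB XH]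
  show "(\<lambda>t. X n (- t)) \<in> H1 (- B n) (- A n)" by (rule r(1))
  show "action (Vn n, \<alpha>n n) (- B n) (- A n) (\<lambda>t. X n (- t))
      \<le> ennreal (jd (Vn n, \<alpha>n n) (X n (- (- B n))) (X n (- (- A n))) + e n)"
    unfolding r(2) using Xact[of n] by (simp add: Kn.jd_sym[of "X n (B n)"])
  show "1 \<le> norm (X n (- t))" if "t \<in> {- B n..- A n}" for t using X1[of "- t" n] that by auto
qed (use K cl e0 e1 e_lim A B XA XB X0 Rlim R0 \<xi>m \<xi>p in auto)

lemma subsequence:
  assumes k: "strict_mono k"
  shows "approx V \<alpha> v0 (\<lambda>n. Vn (k n)) (\<lambda>n. \<alpha>n (k n)) (\<lambda>n. e (k n)) (\<lambda>n. R (k n)) (\<lambda>n. A (k n)) (\<lambda>n. B (k n)) (\<lambda>n. X (k n)) \<xi>m \<xi>p"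
proof -
  have "(\<lambda>n. e (k n)) \<longlonglongrightarrow> 0" using LIMSEQ_subseq_LIMSEQ[OF e_lim k] by (simp add: o_def)
  moreover have "filterlim (\<lambda>n. R (k n)) at_top sequentially"
    by (rule filterlim_compose[OF Rlim filterlim_subseq[OF k]])
  ultimately show ?thesis
    by (intro approx.intro[OF kepler_axioms] approx_axioms.intro) (use K cl e0 e1 A B XH XA XB X0 X1 Xact R0 \<xi>m \<xi>p in auto)
qed

definition Mp :: real where "Mp = VM + 1"

lemma Mp: "Mp > 0"
  using VM(1) by (simp add: Mp_def)

lemma pr_le:
  assumes "1 \<le> norm p"
  shows "kepler.pr (Vn n) (\<alpha>n n) p \<le> Mp" "0 \<le> kepler.pr (Vn n) (\<alpha>n n) p"
proof -
  interpret Kn: kepler "Vn n" "\<alpha>n n" v0 by (rule K)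
  have p: "p \<noteq> 0" using assms by auto
  have s: "p /\<^sub>R norm p \<in> sphere 0 1" by (rule sgn_in_sphere[OF p])
  have "norm p powr \<alpha>n n \<ge> 1" using assms Kn.\<alpha> by (intro ge_one_powr_ge_zero) auto
  then have "Kn.pr p \<le> Vn n (p /\<^sub>R norm p) / 1" unfolding Kn.pr_def
    using Kn.V_ge[OF s] v0 by (intro divide_left_mono) auto
  also have "\<dots> \<le> Mp" using close_V_le[OF cl e1 s] by (simp add: Mp_def)
  finally show "Kn.pr p \<le> Mp" .
  show "0 \<le> Kn.pr p" using Kn.pr_pos[OF p] by simp
qed

definition Y :: "nat \<Rightarrow> real \<Rightarrow> 'a" where "Y n t = X n (clamp1 (A n) (B n) t)"

lemma AB: "A n \<le> B n"
  using A[of n] B[of n] by simp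

lemma Y_cont: "continuous_on UNIV (Y n)"
  unfolding Y_def by (rule continuous_clamp1[OF AB H1_continuous[OF XH]])

lemma Y1: "1 \<le> norm (Y n t)"
  unfolding Y_def by (rule X1[OF clamp1_in[OF AB]])

lemma Y_eq: "t \<in> {A n..B n} \<Longrightarrow> Y n t = X n t"
  by (simp add: Y_def clamp1_id)

lemma sub:
  assumes "A n \<le> s" "s \<le> t" "t \<le> B n"
  shows "X n \<in> H1 s t" "action (Vn n, \<alpha>n n) s t (X n) < \<infinity>"
    "kepler.act (Vn n) (\<alpha>n n) s t (X n) \<le> jd (Vn n, \<alpha>n n) (X n s) (X n t) + e n"
    "\<bar>sqrt (kepler.kn s t (X n)) - sqrt (kepler.pt (Vn n) (\<alpha>n n) s t (X n))\<bar> \<le> sqrt (e n)"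
    "kepler.pt (Vn n) (\<alpha>n n) s t (X n) = integral {s..t} (\<lambda>u. kepler.pr (Vn n) (\<alpha>n n) (Y n u))"
    "kepler.act (Vn n) (\<alpha>n n) s t (X n) = kepler.kn s t (X n) + kepler.pt (Vn n) (\<alpha>n n) s t (X n)"
    "(norm (X n t - X n s))\<^sup>2 \<le> 2 * (t - s) * kepler.kn s t (X n)"
proof -
  interpret Kn: kepler "Vn n" "\<alpha>n n" v0 by (rule K)
  show h: "X n \<in> H1 s t" by (rule H1_restrict[OF XH assms])
  note ns = Kn.near_min_sub[OF XH Xact e0 assms]
  show f: "action (Vn n, \<alpha>n n) s t (X n) < \<infinity>" by (rule ns(1))
  show a: "Kn.act s t (X n) \<le> jd (Vn n, \<alpha>n n) (X n s) (X n t) + e n" by (rule ns(2))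
  show "\<bar>sqrt (Kn.kn s t (X n)) - sqrt (Kn.pt s t (X n))\<bar> \<le> sqrt (e n)"
    by (rule Kn.near_min_equipartition[OF h assms(2) f a e0])
  show "Kn.act s t (X n) = Kn.kn s t (X n) + Kn.pt s t (X n)" by (rule Kn.act_kn_pt(1)[OF assms(2) h f])
  show "(norm (X n t - X n s))\<^sup>2 \<le> 2 * (t - s) * Kn.kn s t (X n)" by (rule Kn.kn_lower[OF h assms(2)])
  have nz: "X n u \<noteq> 0" if "u \<in> {s..t}" for u using X1[of u n] that assms by force
  have c: "continuous_on {s..t} (\<lambda>u. Kn.pr (X n u))" by (rule Kn.pr_path_cont[OF H1_continuous[OF h] nz])
  have "0 \<le> integral {s..t} (\<lambda>u. Kn.pr (X n u))"
    by (rule Henstock_Kurzweil_Integration.integral_nonneg[OF integrable_continuous_interval[OF c]])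
       (use Kn.pr_pos[OF nz] in \<open>auto simp: less_imp_le\<close>)
  moreover have "pote (Vn n, \<alpha>n n) s t (X n) = ennreal (integral {s..t} (\<lambda>u. Kn.pr (X n u)))"
    by (rule Kn.pote_integral[OF H1_continuous[OF h] nz])
  ultimately have "Kn.pt s t (X n) = integral {s..t} (\<lambda>u. Kn.pr (X n u))"
    by (simp add: Kn.pt_def)
  also have "\<dots> = integral {s..t} (\<lambda>u. Kn.pr (Y n u))"
    by (rule Henstock_Kurzweil_Integration.integral_cong) (use Y_eq assms in auto)
  finally show "Kn.pt s t (X n) = integral {s..t} (\<lambda>u. Kn.pr (Y n u))" .
qed

lemma prY_integrable: "(\<lambda>u. kepler.pr (Vn n) (\<alpha>n n) (Y n u)) integrable_on {s..t}"
proof -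
  interpret Kn: kepler "Vn n" "\<alpha>n n" v0 by (rule K)
  have "Y n u \<noteq> 0" for u using Y1[of n u] by force
  then have "continuous_on {s..t} (\<lambda>u. Kn.pr (Y n u))"
    by (intro Kn.pr_path_cont continuous_on_subset[OF Y_cont subset_UNIV])
  then show ?thesis by (rule integrable_continuous_interval)
qed

text \<open>A modulus of continuity common to all paths: by equipartition the root of the kinetic
  action over a time d exceeds that of the potential action, which is at most Mp d, by no more than
  \<open>sqrt (e n) \<le> 1\<close>.\<close>

definition w :: "real \<Rightarrow> real" where "w d = sqrt (2 * d) * (sqrt (Mp * d) + 1)"

lemma w_mono: "0 \<le> d \<Longrightarrow> d \<le> d' \<Longrightarrow> w d \<le> w d'"
  using Mp unfolding w_def by (intro mult_mono add_mono real_sqrt_le_mono mult_left_mono) auto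

lemma w_lim: "(w \<longlongrightarrow> 0) (at_right 0)"
  unfolding w_def[abs_def] by (auto intro!: tendsto_eq_intros)

lemma X_holder:
  assumes "A n \<le> s" "s \<le> t" "t \<le> B n"
  shows "norm (X n t - X n s) \<le> w (t - s)"
proof -
  note u = sub[OF assms]
  have "integral {s..t} (\<lambda>u. kepler.pr (Vn n) (\<alpha>n n) (Y n u)) \<le> integral {s..t} (\<lambda>u. Mp)"
    by (rule integral_le[OF prY_integrable]) (use pr_le Y1 in auto)
  then have p: "kepler.pt (Vn n) (\<alpha>n n) s t (X n) \<le> Mp * (t - s)" using u(5) assms by (simp add: mult.commute)
  have "sqrt (kepler.kn s t (X n)) \<le> sqrt (Mp * (t - s)) + sqrt (e n)"
    using u(4) real_sqrt_le_mono[OF p] by linarith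
  also have "\<dots> \<le> sqrt (Mp * (t - s)) + 1" using e1[of n] by simp
  finally have k: "sqrt (kepler.kn s t (X n)) \<le> sqrt (Mp * (t - s)) + 1" .
  have "norm (X n t - X n s) = sqrt ((norm (X n t - X n s))\<^sup>2)" by simp
  also have "\<dots> \<le> sqrt (2 * (t - s) * kepler.kn s t (X n))" by (rule real_sqrt_le_mono[OF u(7)])
  also have "\<dots> = sqrt (2 * (t - s)) * sqrt (kepler.kn s t (X n))" by (rule real_sqrt_mult)
  also have "\<dots> \<le> w (t - s)" unfolding w_def using k assms by (intro mult_left_mono) auto
  finally show ?thesis .
qed

lemma Y_holder: "norm (Y n t - Y n s) \<le> w \<bar>t - s\<bar>"
proof -
  have *: "norm (Y n t - Y n s) \<le> w (t - s)" if st: "s \<le> t" for s t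
  proof -
    have i: "clamp1 (A n) (B n) s \<in> {A n..B n}" "clamp1 (A n) (B n) t \<in> {A n..B n}" "clamp1 (A n) (B n) s \<le> clamp1 (A n) (B n) t"
      using clamp1_in[OF AB] clamp1_mono[OF st] by auto
    have "norm (Y n t - Y n s) \<le> w (clamp1 (A n) (B n) t - clamp1 (A n) (B n) s)"
      unfolding Y_def by (rule X_holder) (use i in auto)
    also have "\<dots> \<le> w (t - s)"
      by (rule w_mono) (use i st AB[of n] in \<open>auto simp: clamp1_def\<close>)
    finally show ?thesis .
  qed
  show ?thesis using *[of s t] *[of t s] by (cases "s \<le> t") (auto simp: norm_minus_commute)
qed

text \<open>With the common modulus w a path needs ever more time to travel from norm 1 to norm
  \<open>R n\<close>, so the time intervals exhaust the line.\<close>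

lemma B_large: "\<forall>\<^sub>F n in sequentially. T \<le> B n"
proof -
  have "\<forall>\<^sub>F n in sequentially. 1 + w \<bar>T\<bar> < R n" using Rlim by (simp add: filterlim_at_top_dense)
  then show ?thesis
  proof eventually_elim
    case (elim n)
    show ?case
    proof (rule ccontr)
      assume "\<not> T \<le> B n"
      then have "w (B n - 0) \<le> w \<bar>T\<bar>" using B[of n] by (intro w_mono) auto
      moreover have "norm (X n (B n) - X n 0) \<le> w (B n - 0)" using A B by (intro X_holder) auto
      moreover have "norm (X n (B n)) = R n" using R0[of n] by (simp add: XB \<xi>p)
      ultimately show False using elim X0[of n] norm_triangle_ineq2[of "X n (B n)" "X n 0"] by linarith
    qed
  qed
qed

lemma A_large: "\<forall>\<^sub>F n in sequentially. A n \<le> - T"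
proof -
  interpret r: approx V \<alpha> v0 Vn \<alpha>n e R "\<lambda>n. - B n" "\<lambda>n. - A n" "\<lambda>n t. X n (- t)" \<xi>p \<xi>m by (rule reversed)
  show ?thesis using r.B_large[of T] by (rule eventually_mono) linarith
qed

lemma limit_exists: obtains k x where "strict_mono k" "\<And>t. (\<lambda>n. Y (k n) t) \<longlonglongrightarrow> x t"
proof (rule equicontinuous_subsequence[of Y "\<lambda>t. 1 + w \<bar>t\<bar>" w])
  fix n t
  have "Y n 0 = X n 0" using A B by (intro Y_eq) auto
  then show "norm (Y n t) \<le> 1 + w \<bar>t\<bar>"
    using Y_holder[of n t 0] X0[of n] norm_triangle_ineq2[of "Y n t" "Y n 0"] by simp
qed (use Y_holder w_lim in auto)

end

locale approx_limit = approx +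
  fixes x :: "real \<Rightarrow> 'a"
  assumes lim: "\<And>t. (\<lambda>n. X n (clamp1 (A n) (B n) t)) \<longlonglongrightarrow> x t"
begin

lemma limY: "(\<lambda>n. Y n t) \<longlonglongrightarrow> x t"
  using lim by (simp add: Y_def)

lemma x_holder: "norm (x t - x s) \<le> w \<bar>t - s\<bar>"
  by (rule LIMSEQ_le_const2[OF tendsto_norm[OF tendsto_diff[OF limY limY]]]) (use Y_holder in auto)

lemma x1: "1 \<le> norm (x t)"
  by (rule LIMSEQ_le_const[OF tendsto_norm[OF limY]]) (use Y1 in auto)

lemma xnz: "x t \<noteq> 0"
  using x1[of t] by force

lemma x0: "norm (x 0) = 1"
proof -
  have "Y n 0 = X n 0" for n using A B by (intro Y_eq) auto
  then have "(\<lambda>n. norm (Y n 0)) = (\<lambda>_. 1)" using X0 by auto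
  then show ?thesis using tendsto_norm[OF limY[of 0]] by (simp add: tendsto_const_iff LIMSEQ_const_iff)
qed

lemma x_cont: "continuous_on UNIV x"
  unfolding continuous_on_iff
proof (intro ballI allI impI)
  fix s \<epsilon> :: real assume \<epsilon>: "\<epsilon> > 0"
  have "\<forall>\<^sub>F d in at_right 0. w d < \<epsilon>" using w_lim \<epsilon> by (intro order_tendstoD(2)) auto
  then obtain d where d: "d > 0" "\<And>u. 0 < u \<Longrightarrow> u < d \<Longrightarrow> w u < \<epsilon>" by (auto simp: eventually_at_right_field)
  show "\<exists>d>0. \<forall>t\<in>UNIV. dist t s < d \<longrightarrow> dist (x t) (x s) < \<epsilon>"
  proof (intro exI[of _ d] conjI ballI impI d(1))
    fix t assume "dist t s < d"
    then show "dist (x t) (x s) < \<epsilon>"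
      using x_holder[of t s] d(2)[of "\<bar>t - s\<bar>"] \<epsilon> by (cases "t = s") (auto simp: dist_norm)
  qed
qed

lemma \<alpha>n_lim: "\<alpha>n \<longlonglongrightarrow> \<alpha>"
proof -
  have "(\<lambda>n. \<alpha>n n - \<alpha>) \<longlonglongrightarrow> 0"
    by (rule Lim_null_comparison[OF _ e_lim]) (use cl in \<open>auto simp: close_def abs_minus_commute\<close>)
  then show ?thesis by (simp add: LIM_zero_iff)
qed

lemma pr_lim: "(\<lambda>n. kepler.pr (Vn n) (\<alpha>n n) (Y n u)) \<longlonglongrightarrow> pr (x u)"
proof -
  have nz: "Y n u \<noteq> 0" for n using Y1[of n u] by force
  have s: "(\<lambda>n. Y n u /\<^sub>R norm (Y n u)) \<longlonglongrightarrow> x u /\<^sub>R norm (x u)"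
    by (intro tendsto_intros limY) (use xnz in simp)
  have 1: "(\<lambda>n. V (Y n u /\<^sub>R norm (Y n u))) \<longlonglongrightarrow> V (x u /\<^sub>R norm (x u))"
    by (rule continuous_on_tendsto_compose[OF V_cont s sgn_in_sphere[OF xnz]]) (use sgn_in_sphere[OF nz] in auto)
  have "(\<lambda>n. Vn n (Y n u /\<^sub>R norm (Y n u)) - V (Y n u /\<^sub>R norm (Y n u))) \<longlonglongrightarrow> 0"
  proof (rule Lim_null_comparison[OF _ e_lim], rule always_eventually, rule allI)
    fix n show "norm (Vn n (Y n u /\<^sub>R norm (Y n u)) - V (Y n u /\<^sub>R norm (Y n u))) \<le> e n"
      using closeD[OF cl[of n] sgn_in_sphere[OF nz[of n]]] by (simp add: abs_minus_commute)
  qed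
  from tendsto_add[OF this 1] have 2: "(\<lambda>n. Vn n (Y n u /\<^sub>R norm (Y n u))) \<longlonglongrightarrow> V (x u /\<^sub>R norm (x u))" by simp
  have 3: "(\<lambda>n. norm (Y n u) powr \<alpha>n n) \<longlonglongrightarrow> norm (x u) powr \<alpha>"
    by (intro tendsto_powr tendsto_norm limY \<alpha>n_lim) (use xnz in simp)
  have 4: "kepler.pr (Vn n) (\<alpha>n n) p = Vn n (p /\<^sub>R norm p) / norm p powr \<alpha>n n" for n p
    by (rule kepler.pr_def[OF K])
  show ?thesis unfolding pr_def 4 by (rule tendsto_divide[OF 2 3]) (use xnz in simp)
qed

abbreviation Q :: "real \<Rightarrow> real \<Rightarrow> real" where "Q s t \<equiv> integral {s..t} (\<lambda>u. pr (x u))"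

lemma inside: "\<forall>\<^sub>F n in sequentially. A n \<le> s \<and> t \<le> B n"
  using A_large[of "- s"] B_large[of t] by eventually_elim auto

lemma pt_lim: "(\<lambda>n. integral {s..t} (\<lambda>u. kepler.pr (Vn n) (\<alpha>n n) (Y n u))) \<longlonglongrightarrow> Q s t"
  by (rule dominated_convergence(2)[where h="\<lambda>_. Mp"]) (use prY_integrable pr_le[OF Y1] pr_lim in auto)

text \<open>The potential actions converge by dominated convergence, and equipartition passes the
  limit on to the kinetic actions because the excess tends to 0.\<close>

lemma kn_lim:
  assumes st: "s \<le> t"
  shows "(\<lambda>n. kepler.kn s t (X n)) \<longlonglongrightarrow> Q s t"
proof -
  have p: "(\<lambda>n. sqrt (integral {s..t} (\<lambda>u. kepler.pr (Vn n) (\<alpha>n n) (Y n u)))) \<longlonglongrightarrow> sqrt (Q s t)"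
    by (intro tendsto_intros pt_lim)
  have se: "(\<lambda>n. sqrt (e n)) \<longlonglongrightarrow> 0" using tendsto_real_sqrt[OF e_lim] by simp
  have d: "(\<lambda>n. sqrt (kepler.kn s t (X n)) - sqrt (integral {s..t} (\<lambda>u. kepler.pr (Vn n) (\<alpha>n n) (Y n u)))) \<longlonglongrightarrow> 0"
  proof (rule Lim_null_comparison[OF _ se])
    show "\<forall>\<^sub>F n in sequentially. norm (sqrt (kepler.kn s t (X n)) - sqrt (integral {s..t} (\<lambda>u. kepler.pr (Vn n) (\<alpha>n n) (Y n u)))) \<le> sqrt (e n)"
      using inside[of s t] by eventually_elim (use sub(4,5) st in auto)
  qed
  have "(\<lambda>n. sqrt (kepler.kn s t (X n))) \<longlonglongrightarrow> sqrt (Q s t)" using tendsto_add[OF d p] by simp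
  then have "(\<lambda>n. (sqrt (kepler.kn s t (X n)))\<^sup>2) \<longlonglongrightarrow> (sqrt (Q s t))\<^sup>2" by (rule tendsto_power)
  moreover have "(\<lambda>n. (sqrt (kepler.kn s t (X n)))\<^sup>2) = (\<lambda>n. kepler.kn s t (X n))"
    by (simp add: kn_def)
  moreover have "Q s t \<ge> 0"
  proof (rule LIMSEQ_le_const[OF pt_lim])
    have "0 \<le> integral {s..t} (\<lambda>u. kepler.pr (Vn n) (\<alpha>n n) (Y n u))" for n
      by (rule Henstock_Kurzweil_Integration.integral_nonneg[OF prY_integrable]) (use pr_le[OF Y1] in auto)
    then show "\<exists>N. \<forall>n\<ge>N. 0 \<le> integral {s..t} (\<lambda>u. kepler.pr (Vn n) (\<alpha>n n) (Y n u))" by auto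
  qed
  then have "(sqrt (Q s t))\<^sup>2 = Q s t" by simp
  ultimately show ?thesis by (simp only:)
qed

lemma energy_bound:
  assumes st: "s \<le> t"
  shows "(norm (x t - x s))\<^sup>2 \<le> 2 * (t - s) * Q s t"
proof (rule tendsto_le[OF sequentially_bot])
  show "(\<lambda>n. 2 * (t - s) * kepler.kn s t (X n)) \<longlonglongrightarrow> 2 * (t - s) * Q s t" by (intro tendsto_intros kn_lim st)
  show "(\<lambda>n. (norm (Y n t - Y n s))\<^sup>2) \<longlonglongrightarrow> (norm (x t - x s))\<^sup>2" by (intro tendsto_intros limY)
  show "\<forall>\<^sub>F n in sequentially. (norm (Y n t - Y n s))\<^sup>2 \<le> 2 * (t - s) * kepler.kn s t (X n)"
    using inside[of s t] by eventually_elim (use sub(7) Y_eq st in auto)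
qed

lemma act_lim:
  assumes st: "s \<le> t"
  shows "(\<lambda>n. kepler.act (Vn n) (\<alpha>n n) s t (X n)) \<longlonglongrightarrow> 2 * Q s t"
proof -
  have "(\<lambda>n. kepler.kn s t (X n) + integral {s..t} (\<lambda>u. kepler.pr (Vn n) (\<alpha>n n) (Y n u))) \<longlonglongrightarrow> Q s t + Q s t"
    by (intro tendsto_intros kn_lim pt_lim st)
  then have "(\<lambda>n. kepler.kn s t (X n) + integral {s..t} (\<lambda>u. kepler.pr (Vn n) (\<alpha>n n) (Y n u))) \<longlonglongrightarrow> 2 * Q s t" by simp
  then show ?thesis
    by (rule Lim_transform_eventually) (use inside[of s t] in \<open>eventually_elim, use sub(5,6) st in auto\<close>)
qed

text \<open>The pieces of the approximating paths cost at most the distance for the approximating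
  potential plus \<open>e n\<close>; upper semicontinuity of \<open>jd\<close> bounds this by the
  distance for W at the limit points.\<close>

lemma act_le_jd:
  assumes st: "s \<le> t"
  shows "2 * Q s t \<le> jd W (x s) (x t)"
proof (rule field_le_epsilon)
  fix \<epsilon> :: real assume \<epsilon>: "\<epsilon> > 0"
  obtain d where d: "d > 0" "\<And>V' \<alpha>' p' q'. kepler V' \<alpha>' v0 \<Longrightarrow> close V \<alpha> V' \<alpha>' d \<Longrightarrow>
    norm (p' - x s) \<le> d \<Longrightarrow> norm (q' - x t) \<le> d \<Longrightarrow> jd (V', \<alpha>') p' q' \<le> jd W (x s) (x t) + \<epsilon>"
    using jd_usc[OF xnz[of s] xnz[of t] \<epsilon>] by blast
  have l: "(\<lambda>n. kepler.act (Vn n) (\<alpha>n n) s t (X n) - e n) \<longlonglongrightarrow> 2 * Q s t - 0" by (intro tendsto_diff act_lim st e_lim)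
  have near: "\<forall>\<^sub>F n in sequentially. norm (Y n u - x u) < d" for u
    using limY[of u] d(1) by (auto simp: tendsto_iff dist_norm)
  have ed: "\<forall>\<^sub>F n in sequentially. e n < d" using e_lim d(1) order_tendstoD(2) by blast
  have "2 * Q s t - 0 \<le> jd W (x s) (x t) + \<epsilon>"
  proof (rule tendsto_upperbound[OF l _ sequentially_bot])
    show "\<forall>\<^sub>F n in sequentially. kepler.act (Vn n) (\<alpha>n n) s t (X n) - e n \<le> jd W (x s) (x t) + \<epsilon>"
      using inside[of s t] near[of s] near[of t] ed
    proof eventually_elim
      case (elim n)
      have "jd (Vn n, \<alpha>n n) (Y n s) (Y n t) \<le> jd W (x s) (x t) + \<epsilon>"
        using elim by (intro d(2) K close_mono[OF cl]) auto
      moreover have "kepler.act (Vn n) (\<alpha>n n) s t (X n) \<le> jd (Vn n, \<alpha>n n) (X n s) (X n t) + e n"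
        using elim st by (intro sub(3)) auto
      moreover have "Y n s = X n s" "Y n t = X n t" using elim st by (auto intro!: Y_eq)
      ultimately show ?case by simp
    qed
  qed
  then show "2 * Q s t \<le> jd W (x s) (x t) + \<epsilon>" by simp
qed

lemma x_minimizes:
  assumes st: "s \<le> t"
  shows "x \<in> H1 s t" "action W s t x \<le> ennreal (jd W (x s) (x t))"
proof -
  note p = path_of_energy_bound[OF st continuous_on_subset[OF x_cont subset_UNIV] xnz energy_bound]
  show "x \<in> H1 s t" by (rule p(1))
  show "action W s t x \<le> ennreal (jd W (x s) (x t))"
    using p(2) ennreal_leI[OF act_le_jd[OF st]] by (rule order_trans)
qed

lemma x_lipschitz: "norm (x t - x s) \<le> sqrt (2 * Mp) * \<bar>t - s\<bar>"
proof -
  have *: "norm (x t - x s) \<le> sqrt (2 * Mp) * (t - s)" if st: "s \<le> t" for s t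
  proof -
    have "Q s t \<le> Mp * (t - s)"
    proof (rule LIMSEQ_le_const2[OF pt_lim], intro exI allI impI)
      fix n
      have "integral {s..t} (\<lambda>u. kepler.pr (Vn n) (\<alpha>n n) (Y n u)) \<le> integral {s..t} (\<lambda>u. Mp)"
        by (rule integral_le[OF prY_integrable]) (use pr_le Y1 in auto)
      then show "integral {s..t} (\<lambda>u. kepler.pr (Vn n) (\<alpha>n n) (Y n u)) \<le> Mp * (t - s)" using st by (simp add: mult.commute)
    qed
    then have "2 * (t - s) * Q s t \<le> 2 * (t - s) * (Mp * (t - s))" using st by (intro mult_left_mono) auto
    also have "\<dots> = (sqrt (2 * Mp) * (t - s))\<^sup>2" using Mp by (simp add: power_mult_distrib) (simp add: power2_eq_square)
    finally have "(norm (x t - x s))\<^sup>2 \<le> (sqrt (2 * Mp) * (t - s))\<^sup>2" using energy_bound[OF st] by linarith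
    then show ?thesis by (rule power2_le_imp_le) (use st Mp in simp)
  qed
  show ?thesis using *[of s t] *[of t s] by (cases "s \<le> t") (auto simp: norm_minus_commute)
qed

lemma h_lim: "r > 0 \<Longrightarrow> rn \<longlonglongrightarrow> r \<Longrightarrow> (\<lambda>n. kepler.h (\<alpha>n n) v0 (rn n)) \<longlonglongrightarrow> h r"
proof -
  assume r: "r > 0" "rn \<longlonglongrightarrow> r"
  have b: "(\<lambda>n. 1 - \<alpha>n n / 2) \<longlonglongrightarrow> \<beta>" unfolding \<beta>_def by (intro tendsto_intros \<alpha>n_lim) auto
  have "kepler.h (\<alpha>n n) v0 q = sqrt (2 * v0) * q powr (1 - \<alpha>n n / 2) / (1 - \<alpha>n n / 2)" for n q
    unfolding kepler.h_def[OF K] kepler.\<beta>_def[OF K] ..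
  then show ?thesis unfolding h_def using r \<beta> b by (auto intro!: tendsto_intros)
qed

lemma tail:
  assumes t: "0 \<le> t"
  shows "2 * Q 0 t \<le> h 1 + h (norm (x t))"
    and "h (norm (x t)) * \<beta>\<^sup>2 * (1 - (x t /\<^sub>R norm (x t)) \<bullet> \<xi>p) \<le> 2 * h 1"
proof -
  have ev: "\<forall>\<^sub>F n in sequentially. kepler.act (Vn n) (\<alpha>n n) 0 t (X n) \<le> kepler.h (\<alpha>n n) v0 1 + kepler.h (\<alpha>n n) v0 (norm (Y n t)) + e n \<and>
     kepler.h (\<alpha>n n) v0 (norm (Y n t)) * (1 - \<alpha>n n / 2)\<^sup>2 * (1 - (Y n t /\<^sub>R norm (Y n t)) \<bullet> \<xi>p) \<le> 2 * kepler.h (\<alpha>n n) v0 1 + e n"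
    using inside[of 0 t]
  proof eventually_elim
    case (elim n)
    interpret Kn: kepler "Vn n" "\<alpha>n n" v0 by (rule K)
    \<comment> \<open>The competitor through the origin provides the budget required by
      \<open>tail_estimate\<close>.\<close>
    have "jd (Vn n, \<alpha>n n) (R n *\<^sub>R \<xi>m) (R n *\<^sub>R \<xi>p) \<le> jd (Vn n, \<alpha>n n) (0 *\<^sub>R \<xi>m) (R n *\<^sub>R \<xi>m) + jd (Vn n, \<alpha>n n) (0 *\<^sub>R \<xi>p) (R n *\<^sub>R \<xi>p)"
      using Kn.jd_triangle[of "R n *\<^sub>R \<xi>m" "R n *\<^sub>R \<xi>p" 0] Kn.jd_sym[of "R n *\<^sub>R \<xi>m" 0] by simp
    also have "\<dots> \<le> 2 * Kn.h (R n)"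
      using Kn.jd_ray_le[of \<xi>m 0 "R n"] Kn.jd_ray_le[of \<xi>p 0 "R n"] R0[of n] \<xi>m \<xi>p Kn.h_0 by simp
    finally have ac: "action (Vn n, \<alpha>n n) (A n) (B n) (X n) \<le> ennreal (2 * Kn.h (R n) + e n)"
      using Xact[of n] unfolding XA XB by (auto elim!: order_trans intro!: ennreal_leI)
    have nA: "norm (X n (A n)) = R n" using R0[of n] by (simp add: XA \<xi>m)
    have tn: "X n t \<noteq> 0" using X1[of t n] elim A[of n] t by force
    have Yt: "Y n t = X n t" using elim A[of n] t by (intro Y_eq) auto
    note te = Kn.tail_estimate[OF XH ac e0 R0 nA XB \<xi>p(1) A t _ X0 tn]
    show ?case unfolding Yt using te elim by (simp add: Kn.\<beta>_def)
  qed
  have ev1: "\<forall>\<^sub>F n in sequentially. kepler.act (Vn n) (\<alpha>n n) 0 t (X n) \<le> kepler.h (\<alpha>n n) v0 1 + kepler.h (\<alpha>n n) v0 (norm (Y n t)) + e n"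
    and ev2: "\<forall>\<^sub>F n in sequentially. kepler.h (\<alpha>n n) v0 (norm (Y n t)) * (1 - \<alpha>n n / 2)\<^sup>2 * (1 - (Y n t /\<^sub>R norm (Y n t)) \<bullet> \<xi>p) \<le> 2 * kepler.h (\<alpha>n n) v0 1 + e n"
    using ev by (simp_all only: eventually_conj_iff)
  have r: "norm (x t) > 0" using xnz by simp
  note l1 = h_lim[OF zero_less_one tendsto_const] and l2 = h_lim[OF r tendsto_norm[OF limY]]
  have "2 * Q 0 t \<le> h 1 + h (norm (x t)) + 0"
    by (rule tendsto_le[OF sequentially_bot _ act_lim[OF t] ev1]) (intro tendsto_add l1 l2 e_lim)
  then show "2 * Q 0 t \<le> h 1 + h (norm (x t))" by simp
  have "h (norm (x t)) * (1 - \<alpha> / 2)\<^sup>2 * (1 - (x t /\<^sub>R norm (x t)) \<bullet> \<xi>p) \<le> 2 * h 1 + 0"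
  proof (rule tendsto_le[OF sequentially_bot])
    show "(\<lambda>n. kepler.h (\<alpha>n n) v0 (norm (Y n t)) * (1 - \<alpha>n n / 2)\<^sup>2 * (1 - (Y n t /\<^sub>R norm (Y n t)) \<bullet> \<xi>p))
      \<longlonglongrightarrow> h (norm (x t)) * (1 - \<alpha> / 2)\<^sup>2 * (1 - (x t /\<^sub>R norm (x t)) \<bullet> \<xi>p)"
      by (intro tendsto_mult l2 tendsto_intros limY \<alpha>n_lim) (use xnz in auto)
    show "(\<lambda>n. 2 * kepler.h (\<alpha>n n) v0 1 + e n) \<longlonglongrightarrow> 2 * h 1 + 0" by (intro tendsto_intros l1 e_lim)
  qed (rule ev2)
  then show "h (norm (x t)) * \<beta>\<^sup>2 * (1 - (x t /\<^sub>R norm (x t)) \<bullet> \<xi>p) \<le> 2 * h 1" by (simp add: \<beta>_def)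
qed

lemma escape: "filterlim (\<lambda>t. norm (x t)) at_top at_top"
proof (rule filterlim_at_top_of_integral_bound)
  show "continuous_on UNIV (\<lambda>t. norm (x t))" by (intro continuous_on_norm x_cont)
  show "continuous_on UNIV (\<lambda>t. pr (x t))" by (rule pr_path_cont[OF x_cont xnz])
  show "\<bar>norm (x t) - norm (x s)\<bar> \<le> sqrt (2 * Mp) * \<bar>t - s\<bar>" for s t
    using x_lipschitz[of t s] norm_triangle_ineq3[of "x t" "x s"] by linarith
  show "v0 * norm (x t) powr - \<alpha> \<le> pr (x t)" for t
    using V_ge[OF sgn_in_sphere[OF xnz[of t]]] by (simp add: pr_def powr_minus divide_inverse mult_right_mono)
  show "mono_on {0..} (\<lambda>r. (h 1 + h r) / 2)"
    by (rule mono_onI) (use h_mono in \<open>auto intro!: divide_right_mono\<close>)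
  show "integral {0..t} (\<lambda>t. pr (x t)) \<le> (h 1 + h (norm (x t))) / 2" if "0 \<le> t" for t
    using tail(1)[OF that] by simp
qed (use xnz v0 \<alpha> in auto)

lemma direction: "((\<lambda>t. x t /\<^sub>R norm (x t)) \<longlongrightarrow> \<xi>p) at_top"
proof (rule tendsto_unit_vector)
  show "\<forall>\<^sub>F t in at_top. norm (x t /\<^sub>R norm (x t)) = 1" using xnz by (intro always_eventually) auto
  have "filterlim (\<lambda>t. h (norm (x t))) at_top at_top" by (rule filterlim_compose[OF h_at_top escape])
  then have "((\<lambda>t. inverse (h (norm (x t)))) \<longlongrightarrow> 0) at_top" by (rule tendsto_inverse_0_at_top)
  then have z: "((\<lambda>t. (2 * h 1 / \<beta>\<^sup>2) * inverse (h (norm (x t)))) \<longlongrightarrow> (2 * h 1 / \<beta>\<^sup>2) * 0) at_top" by (intro tendsto_intros)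
  show "((\<lambda>t. 1 - (x t /\<^sub>R norm (x t)) \<bullet> \<xi>p) \<longlongrightarrow> 0) at_top"
  proof (rule Lim_null_comparison)
    show "((\<lambda>t. (2 * h 1 / \<beta>\<^sup>2) * inverse (h (norm (x t)))) \<longlongrightarrow> 0) at_top" using z by simp
    show "\<forall>\<^sub>F t in at_top. norm (1 - (x t /\<^sub>R norm (x t)) \<bullet> \<xi>p) \<le> (2 * h 1 / \<beta>\<^sup>2) * inverse (h (norm (x t)))"
      using eventually_ge_at_top[of 0]
    proof eventually_elim
      case (elim t)
      let ?c = "(x t /\<^sub>R norm (x t)) \<bullet> \<xi>p"
      have "?c \<le> 1" using norm_cauchy_schwarz[of "x t /\<^sub>R norm (x t)" \<xi>p] xnz[of t] \<xi>p by simp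
      moreover have hp: "h (norm (x t)) > 0" using xnz[of t] by (intro h_pos) simp
      have "1 - ?c \<le> (2 * h 1) / (h (norm (x t)) * \<beta>\<^sup>2)"
        using tail(2)[OF elim] hp \<beta> by (simp add: pos_le_divide_eq mult.commute)
      then have "1 - ?c \<le> (2 * h 1 / \<beta>\<^sup>2) * inverse (h (norm (x t)))" by (simp add: divide_inverse ac_simps)
      ultimately show ?case by simp
    qed
  qed
qed (rule \<xi>p)

end

section \<open>Morse minimizers and geodesics\<close>

context kepler
begin

lemma minimizer_exists:
  assumes \<xi>: "norm \<xi>p = 1" "norm \<xi>m = 1"
    and data: "\<And>N. N \<ge> (1::real) \<Longrightarrow> \<exists>V' \<alpha>' R z c1 c2. kepler V' \<alpha>' v0 \<and> V' \<xi>p = v0 \<and> V' \<xi>m = v0 \<and>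
      close V \<alpha> V' \<alpha>' (1 / N) \<and> R \<ge> N \<and> norm z = 1 \<and>
      reach (V', \<alpha>') {p. 1 \<le> norm p} (R *\<^sub>R \<xi>m) z c1 \<and> reach (V', \<alpha>') {p. 1 \<le> norm p} z (R *\<^sub>R \<xi>p) c2 \<and>
      c1 + c2 \<le> jd (V', \<alpha>') (R *\<^sub>R \<xi>m) (R *\<^sub>R \<xi>p) + 1 / N"
  shows "\<exists>x. parabolic_Morse_minimizer \<xi>p \<xi>m W x"
proof -
  define N where "N = (\<lambda>n. real (Suc n))"
  have "\<exists>V' \<alpha>' R A B X. kepler V' \<alpha>' v0 \<and> V' \<xi>p = v0 \<and> V' \<xi>m = v0 \<and> close V \<alpha> V' \<alpha>' (1 / N n) \<and> R \<ge> N n \<and>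
      A \<le> 0 \<and> 0 \<le> B \<and> X \<in> H1 A B \<and> X A = R *\<^sub>R \<xi>m \<and> X B = R *\<^sub>R \<xi>p \<and> norm (X 0) = 1 \<and> (\<forall>t\<in>{A..B}. 1 \<le> norm (X t)) \<and>
      action (V', \<alpha>') A B X \<le> ennreal (jd (V', \<alpha>') (X A) (X B) + 1 / N n)" for n
  proof -
    obtain V' \<alpha>' R z c1 c2 where d: "kepler V' \<alpha>' v0" "V' \<xi>p = v0" "V' \<xi>m = v0"
      "close V \<alpha> V' \<alpha>' (1 / N n)" "R \<ge> N n" "norm z = 1"
      "reach (V', \<alpha>') {p. 1 \<le> norm p} (R *\<^sub>R \<xi>m) z c1" "reach (V', \<alpha>') {p. 1 \<le> norm p} z (R *\<^sub>R \<xi>p) c2"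
      "c1 + c2 \<le> jd (V', \<alpha>') (R *\<^sub>R \<xi>m) (R *\<^sub>R \<xi>p) + 1 / N n"
      using data[of "N n"] by (auto simp: N_def)
    obtain A B X where X: "A \<le> 0" "0 \<le> B" "X \<in> H1 A B" "X A = R *\<^sub>R \<xi>m" "X 0 = z" "X B = R *\<^sub>R \<xi>p"
      "\<And>t. t \<in> {A..B} \<Longrightarrow> X t \<in> {p. 1 \<le> norm p}" "action (V', \<alpha>') A B X \<le> ennreal (c1 + c2)"
      using kepler.reach_join[OF d(1,7,8)] by blast
    have "action (V', \<alpha>') A B X \<le> ennreal (jd (V', \<alpha>') (X A) (X B) + 1 / N n)"
      unfolding X(4,6) using X(8) ennreal_leI[OF d(9)] by (rule order_trans)
    moreover have "\<forall>t\<in>{A..B}. 1 \<le> norm (X t)" using X(7) by blast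
    ultimately show ?thesis using d(1-5) X(1-4,6) X(5) d(6)
      by (intro exI[of _ V'] exI[of _ \<alpha>'] exI[of _ R] exI[of _ A] exI[of _ B] exI[of _ X]) simp
  qed
  then obtain Vn \<alpha>n R A B X where s: "\<And>n. kepler (Vn n) (\<alpha>n n) v0" "\<And>n. Vn n \<xi>p = v0" "\<And>n. Vn n \<xi>m = v0"
    "\<And>n. close V \<alpha> (Vn n) (\<alpha>n n) (1 / N n)" "\<And>n. R n \<ge> N n" "\<And>n. A n \<le> 0" "\<And>n. 0 \<le> B n" "\<And>n. X n \<in> H1 (A n) (B n)"
    "\<And>n. X n (A n) = R n *\<^sub>R \<xi>m" "\<And>n. X n (B n) = R n *\<^sub>R \<xi>p" "\<And>n. norm (X n 0) = 1" "\<And>n. \<forall>t\<in>{A n..B n}. 1 \<le> norm (X n t)"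
    "\<And>n. action (Vn n, \<alpha>n n) (A n) (B n) (X n) \<le> ennreal (jd (Vn n, \<alpha>n n) (X n (A n)) (X n (B n)) + 1 / N n)"
    by metis
  have N1: "N n \<ge> 1" for n by (simp add: N_def)
  have Rl: "filterlim R at_top sequentially"
  proof (rule filterlim_at_top_mono[of N])
    have "filterlim (\<lambda>n. real (Suc n)) at_top sequentially"
      by (rule filterlim_compose[OF filterlim_real_sequentially filterlim_Suc])
    then show "filterlim N at_top sequentially" by (simp add: N_def)
  qed (use s(5) in auto)
  have eN: "(\<lambda>n. 1 / N n) \<longlonglongrightarrow> 0"
    unfolding N_def by (rule LIMSEQ_Suc[OF lim_const_over_n])
  have "approx V \<alpha> v0 Vn \<alpha>n (\<lambda>n. 1 / N n) R A B X \<xi>m \<xi>p"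
  proof (intro approx.intro[OF kepler_axioms] approx_axioms.intro)
    show "0 \<le> R n" for n using s(5)[of n] N1[of n] by linarith
    show "0 \<le> 1 / N n" "1 / N n \<le> 1" for n using N1[of n] by auto
    show "1 \<le> norm (X n t)" if "t \<in> {A n..B n}" for n t using s(12) that by blast
  qed (rule s eN Rl \<xi>)+
  then interpret a: approx V \<alpha> v0 Vn \<alpha>n "\<lambda>n. 1 / N n" R A B X \<xi>m \<xi>p .
  obtain k x where kx: "strict_mono k" "\<And>t. (\<lambda>n. a.Y (k n) t) \<longlonglongrightarrow> x t" using a.limit_exists by blast
  interpret b: approx_limit V \<alpha> v0 "\<lambda>n. Vn (k n)" "\<lambda>n. \<alpha>n (k n)" "\<lambda>n. 1 / N (k n)" "\<lambda>n. R (k n)" "\<lambda>n. A (k n)" "\<lambda>n. B (k n)" "\<lambda>n. X (k n)" \<xi>m \<xi>p x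
    by (intro approx_limit.intro approx_limit_axioms.intro a.subsequence[OF kx(1)])
       (use kx(2) in \<open>simp add: a.Y_def\<close>)
  \<comment> \<open>The same limit with time reversed and \<open>\<xi>p\<close>,
    \<open>\<xi>m\<close> exchanged; it yields the behaviour at \<open>at_bot\<close>.\<close>
  interpret c: approx_limit V \<alpha> v0 "\<lambda>n. Vn (k n)" "\<lambda>n. \<alpha>n (k n)" "\<lambda>n. 1 / N (k n)" "\<lambda>n. R (k n)" "\<lambda>n. - B (k n)" "\<lambda>n. - A (k n)"
    "\<lambda>n t. X (k n) (- t)" \<xi>p \<xi>m "\<lambda>t. x (- t)"
  proof (intro approx_limit.intro approx_limit_axioms.intro b.reversed)
    fix t
    have "- clamp1 (- B n) (- A n) t = clamp1 (A n) (B n) (- t)" for n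
      using a.AB[of n] by (auto simp: clamp1_def max_def min_def)
    then show "(\<lambda>n. X (k n) (- clamp1 (- B (k n)) (- A (k n)) t)) \<longlonglongrightarrow> x (- t)"
      using b.lim[of "- t"] by simp
  qed
  have "parabolic_Morse_minimizer \<xi>p \<xi>m W x"
    unfolding parabolic_Morse_minimizer_def
  proof (intro conjI exI[of _ 0] allI impI)
    show "x \<in> H1_loc" unfolding H1_loc_def using b.x_minimizes(1) by auto
    show "0 < norm (x 0)" "norm (x 0) \<le> norm (x t)" for t using b.x0 b.x1[of t] by auto
    show "filterlim (\<lambda>t. norm (x t)) at_top at_top" by (rule b.escape)
    show "filterlim (\<lambda>t. norm (x t)) at_top at_bot" unfolding filterlim_at_bot_mirror by (rule c.escape)
    show "((\<lambda>t. x t /\<^sub>R norm (x t)) \<longlongrightarrow> \<xi>p) at_top" by (rule b.direction)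
    show "((\<lambda>t. x t /\<^sub>R norm (x t)) \<longlongrightarrow> \<xi>m) at_bot" unfolding filterlim_at_bot_mirror by (rule c.direction)
    fix s t s' t' z assume z: "s < t \<and> s' < t' \<and> z \<in> H1 s' t' \<and> z s' = x s \<and> z t' = x t"
    have "action W s t x \<le> ennreal (jd W (x s) (x t))" by (rule b.x_minimizes(2)) (use z in simp)
    also have "\<dots> \<le> action W s' t' z" using jd_le_action[of s' t' z] z by auto
    finally show "action W s t x \<le> action W s' t' z" .
  qed
  then show ?thesis by blast
qed

text \<open>Competitors in the definition of a Morse minimizer live on intervals of positive length.
  If \<open>x s = x t\<close>, an almost optimal path for \<open>jd\<close> may be degenerate, and
  resting at the point for a short time replaces it.\<close>

lemma Morse_action_le_jd:
  assumes m: "parabolic_Morse_minimizer \<xi>p \<xi>m W x" and st: "s \<le> t"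
  shows "action W s t x \<le> ennreal (jd W (x s) (x t))"
proof (cases "s = t")
  case True then show ?thesis by (simp add: action_degenerate)
next
  case False
  then have lt: "s < t" using st by simp
  have xnz: "x u \<noteq> 0" for u
    using m unfolding parabolic_Morse_minimizer_def by (metis leD norm_zero)
  have min: "\<And>a' b' z. a' < b' \<Longrightarrow> z \<in> H1 a' b' \<Longrightarrow> z a' = x s \<Longrightarrow> z b' = x t \<Longrightarrow> action W s t x \<le> action W a' b' z"
    using m lt unfolding parabolic_Morse_minimizer_def by blast
  show ?thesis
  proof (rule ennreal_le_epsilon)
    fix e :: real assume e: "e > 0"
    have jn: "ennreal (jd W (x s) (x t)) + ennreal e = ennreal (jd W (x s) (x t) + e)" using e jd_nonneg by simp
    have "reach W UNIV (x s) (x t) (jd W (x s) (x t) + e)" using e by (intro jd_approx) simp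
    then obtain a b z where z: "a \<le> b" "z \<in> H1 a b" "z a = x s" "z b = x t" "action W a b z \<le> ennreal (jd W (x s) (x t) + e)"
      unfolding reach_def by blast
    show "action W s t x \<le> ennreal (jd W (x s) (x t)) + ennreal e"
    proof (cases "a < b")
      case True
      then show ?thesis using min[OF True z(2-4)] z(5) unfolding jn by (rule_tac order_trans)
    next
      case False
      then have eq: "x s = x t" using z by simp
      define p where "p = x s"
      \<comment> \<open>The estimates for the constant path allow T / 2 for the kinetic and
        \<open>pr p * T\<close> for the potential part, together e.\<close>
      define T where "T = e / (1 / 2 + pr p)"
      have pp: "pr p > 0" using pr_pos[OF xnz] by (simp add: p_def)
      have T: "T > 0" "norm (p - p) \<le> T" using e pp by (auto simp: T_def add_pos_pos)
      note H = H1_segment[OF T]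
      have T0: "0 \<le> T" using T by simp
      have "pote W 0 T (\<lambda>t. p + (t / T) *\<^sub>R (p - p)) \<le> ennreal (pr p * (T - 0))"
        by (rule pote_upper[OF T0]) (use pot_pr[OF xnz, of s] pp in \<open>auto simp: p_def\<close>)
      then have "action W 0 T (\<lambda>t. p + (t / T) *\<^sub>R (p - p)) \<le> ennreal (T / 2) + ennreal (pr p * T)"
        unfolding action_split[OF W_meas T0 H(1)] by (intro add_mono H(2)) simp
      also have "\<dots> = ennreal ((1 / 2 + pr p) * T)" using T pp by (simp add: distrib_right flip: ennreal_plus)
      also have "(1 / 2 + pr p) * T = e" using pp by (simp add: T_def)
      finally have "action W 0 T (\<lambda>t. p + (t / T) *\<^sub>R (p - p)) \<le> ennreal e" .
      then have "action W s t x \<le> ennreal e"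
        using min[OF T(1) H(1)] eq by (auto simp: p_def intro: order_trans)
      then show ?thesis by (simp add: add_increasing)
    qed
  qed
qed

end

section \<open>Geodesics and their defect relative to the distance from the origin\<close>

locale geodesic = kepler V \<alpha> v0 for V :: "'a::euclidean_space \<Rightarrow> real" and \<alpha> v0 +
  fixes x :: "real \<Rightarrow> 'a"
  assumes xH: "\<And>s t. s \<le> t \<Longrightarrow> x \<in> H1 s t" and xnz: "\<And>t. x t \<noteq> 0"
    and geo: "\<And>s t. s \<le> t \<Longrightarrow> action W s t x \<le> ennreal (jd W (x s) (x t))"
begin

lemma reversed: "geodesic V \<alpha> v0 (\<lambda>t. x (- t))"
proof (intro geodesic.intro[OF kepler_axioms] geodesic_axioms.intro)
  fix s t :: real assume st: "s \<le> t"
  then have ts: "- t \<le> - s" by simp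
  note r = reverse_action[OF W_meas ts xH[OF ts]]
  show "(\<lambda>t. x (- t)) \<in> H1 s t" using r(1) by simp
  show "action W s t (\<lambda>t. x (- t)) \<le> ennreal (jd W (x (- s)) (x (- t)))"
    using r(2) geo[OF ts] by (simp add: jd_sym[of "x (- t)"])
qed (rule xnz)

lemma fin: "s \<le> t \<Longrightarrow> action W s t x < \<infinity>"
  using geo[of s t] by (auto simp: le_less_trans)

lemma act_jd: "s \<le> t \<Longrightarrow> act s t x = jd W (x s) (x t)"
proof (rule antisym)
  assume st: "s \<le> t"
  show "act s t x \<le> jd W (x s) (x t)"
    using geo[OF st] jd_nonneg[of "x s" "x t"] unfolding action_act[OF xH[OF st] fin[OF st]] by (subst (asm) ennreal_le_iff)
  show "jd W (x s) (x t) \<le> act s t x" by (rule jd_le_act[OF xH[OF st] fin[OF st] st])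
qed

lemma act_split: "s \<le> t \<Longrightarrow> t \<le> u \<Longrightarrow> act s u x = act s t x + act t u x"
  by (rule act_add[OF xH fin]) auto

lemma x_cont: "continuous_on UNIV x"
proof -
  have "isCont x t" for t
  proof -
    have "continuous_on {t - 1<..<t + 1} x"
      by (rule continuous_on_subset[OF H1_continuous[OF xH[of "t - 1" "t + 1"]]]) auto
    then show ?thesis by (simp add: continuous_on_eq_continuous_at)
  qed
  then show ?thesis by (simp add: continuous_on_eq_continuous_at)
qed

definition dir :: "real \<Rightarrow> 'a" where "dir t = x t /\<^sub>R norm (x t)"

lemma dir_unit: "norm (dir t) = 1" "dir t \<in> sphere 0 1"
  using xnz[of t] by (auto simp: dir_def)

lemma x_polar: "x t = norm (x t) *\<^sub>R dir t"
  using xnz[of t] by (simp add: dir_def)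

lemma dir_cont: "continuous_on UNIV dir"
  unfolding dir_def[abs_def] by (intro continuous_intros x_cont) (use xnz in auto)

text \<open>The defect in the triangle inequality between the origin, x s and x t. It is additive in
  time, nonnegative and bounded for fixed s, so it is small over late times.\<close>

definition F :: "real \<Rightarrow> real \<Rightarrow> real" where
  "F s t = act s t x - (jd W 0 (x t) - jd W 0 (x s))"

lemma F_nonneg: "s \<le> t \<Longrightarrow> 0 \<le> F s t"
  using act_jd[of s t] jd_triangle[of 0 "x t" "x s"] by (simp add: F_def)

lemma F_add: "s \<le> t \<Longrightarrow> t \<le> u \<Longrightarrow> F s u = F s t + F t u"
  using act_split[of s t u] by (simp add: F_def)

lemma F_le: "s \<le> t \<Longrightarrow> F s t \<le> 2 * jd W 0 (x s)"
  using act_jd[of s t] jd_triangle[of "x s" "x t" 0] jd_sym[of "x s" 0] by (simp add: F_def)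

text \<open>From T0 on the defect is nondecreasing and bounded; beyond a time at which it nearly
  reaches its supremum its increments are small.\<close>

lemma F_tail:
  assumes e: "e > 0"
  obtains T where "T \<ge> T0" "\<And>s t. T \<le> s \<Longrightarrow> s \<le> t \<Longrightarrow> F s t \<le> e"
proof -
  have bd: "bdd_above (F T0 ` {T0..})" using F_le by (auto intro!: bdd_aboveI)
  define L where "L = Sup (F T0 ` {T0..})"
  have "L - e < L" using e by simp
  then obtain T where T: "T \<ge> T0" "F T0 T > L - e"
    unfolding L_def by (subst (asm) less_cSup_iff) (use bd in auto)
  show ?thesis
  proof (rule that[OF T(1)])
    fix s t assume st: "T \<le> s" "s \<le> t"
    have "F T0 t \<le> L" unfolding L_def by (rule cSup_upper[OF _ bd]) (use T st in auto)
    moreover have "F T0 t = F T0 T + F T s + F s t" using F_add[of T0 T t] F_add[of T s t] T st by simp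
    ultimately show "F s t \<le> e" using T F_nonneg[of T s] st by linarith
  qed
qed

lemma jd_zero_scale: "jd W 0 (x t) = norm (x t) powr \<beta> * jd W 0 (dir t)"
  using jd_scale[of "norm (x t)" 0 "dir t"] xnz[of t] x_polar[of t] by simp

lemma jd_zero_dir: "jd W 0 (dir t) \<le> sqrt (2 * V (dir t)) / \<beta>"
proof -
  have "dir t \<noteq> 0" using dir_unit(1)[of t] by force
  then show ?thesis using jd_zero_le[of "dir t"] dir_unit(1)[of t] by simp
qed

text \<open>A radial segment never costs less than the distance from the origin gains along it, so the
  only way for the angular part of the distance to decrease along the geodesic is a growth of the
  defect \<open>F\<close>.\<close>

lemma angular_decrease:
  assumes st: "s \<le> t" and m: "m > 0" "\<And>u. u \<in> {s..t} \<Longrightarrow> m \<le> norm (x u)"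
  shows "jd W 0 (dir s) \<le> jd W 0 (dir t) + F s t / m powr \<beta>"
proof (rule field_le_epsilon)
  fix e0 :: real assume e0: "e0 > 0"
  have mb: "m powr \<beta> > 0" using m by simp
  define e where "e = e0 * m powr \<beta> / (act s t x + 1)"
  have a0: "act s t x + 1 > 0" using act_nonneg[of s t x] by linarith
  have e: "e > 0" using e0 mb a0 by (simp add: e_def)
  define P where "P = (\<lambda>a b. s \<le> a \<and> a \<le> b \<and> b \<le> t \<longrightarrow> jd W 0 (dir a) - jd W 0 (dir b) \<le> (F a b + e * act a b x) / m powr \<beta>)"
  have "P s t" using st
  proof (induction rule: Bolzano)
    case (trans a b c)
    show ?case unfolding P_def
    proof (intro impI)
      assume o: "s \<le> a \<and> a \<le> c \<and> c \<le> t"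
      have 1: "jd W 0 (dir a) - jd W 0 (dir b) \<le> (F a b + e * act a b x) / m powr \<beta>"
        "jd W 0 (dir b) - jd W 0 (dir c) \<le> (F b c + e * act b c x) / m powr \<beta>"
        using trans o unfolding P_def by auto
      have "(F a b + e * act a b x) / m powr \<beta> + (F b c + e * act b c x) / m powr \<beta> = (F a c + e * act a c x) / m powr \<beta>"
        using F_add[of a b c] act_split[of a b c] trans by (simp add: add_divide_distrib[symmetric] algebra_simps)
      then show "jd W 0 (dir a) - jd W 0 (dir c) \<le> (F a c + e * act a c x) / m powr \<beta>" using 1 by linarith
    qed
  next
    case (local y)
    define \<kappa> where "\<kappa> = 1 + e"
    have \<kappa>: "\<kappa> > 1" using e by (simp add: \<kappa>_def)
    have Vy: "V (dir y) > 0" using V_ge[OF dir_unit(2)] v0 by (rule less_le_trans[rotated])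
    have "continuous_on UNIV (\<lambda>w. V (dir w))"
      by (rule continuous_on_compose2[OF V_cont dir_cont]) (use dir_unit in auto)
    then have ct: "((\<lambda>w. V (dir w)) \<longlongrightarrow> V (dir y)) (nhds y)"
      by (simp add: continuous_on_eq_continuous_at isCont_def tendsto_nhds_iff)
    have "\<forall>\<^sub>F w in nhds y. V (dir w) > V (dir y) / \<kappa>" "\<forall>\<^sub>F w in nhds y. V (dir w) < V (dir y) * \<kappa>"
      using Vy \<kappa> by (intro order_tendstoD(1)[OF ct] order_tendstoD(2)[OF ct]; simp add: divide_less_eq)+
    then have "\<forall>\<^sub>F w in nhds y. V (dir w) > V (dir y) / \<kappa> \<and> V (dir w) < V (dir y) * \<kappa>" by eventually_elim auto
    then obtain d where d: "d > 0" "\<And>w. dist w y < d \<Longrightarrow> V (dir w) > V (dir y) / \<kappa> \<and> V (dir w) < V (dir y) * \<kappa>"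
      unfolding eventually_nhds_metric by blast
    show ?case
    proof (intro exI conjI allI impI)
      show "d > 0" by fact
      fix a b assume ab: "a \<le> y \<and> y \<le> b \<and> b - a < d"
      show "P a b" unfolding P_def
      proof (intro impI)
        assume o: "s \<le> a \<and> a \<le> b \<and> b \<le> t"
        have near: "V (dir w) > V (dir y) / \<kappa>" "V (dir w) < V (dir y) * \<kappa>" if "w \<in> {a..b}" for w
          using d(2)[of w] that ab by (auto simp: dist_real_def)
        \<comment> \<open>A lower bound of V on the piece that misses the values there by a factor
          of at most \<open>\<kappa>\<^sup>2\<close>. Hence the cost of a radial segment in
          direction \<open>dir a\<close> exceeds the calibrated bound by a factor of at most
          \<open>\<kappa>\<close>, whose excess over 1 is charged to
          \<open>e * act a b x\<close>.\<close>
        define v where "v = V (dir y) / \<kappa>"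
        have v: "v > 0" using Vy \<kappa> by (simp add: v_def)
        obtain \<sigma> :: 'a where \<sigma>: "norm \<sigma> = 1" using ex_unit by blast
        have "ennreal (sqrt (2 * v) * \<bar>G 0 \<sigma> (x b) - G 0 \<sigma> (x a)\<bar>) \<le> action W a b x"
          by (rule calibration[OF _ xH v _ \<sigma>]) (use o near xnz in \<open>auto simp: v_def dir_def less_imp_le\<close>)
        then have "sqrt (2 * v) * \<bar>G 0 \<sigma> (x b) - G 0 \<sigma> (x a)\<bar> \<le> act a b x"
          unfolding action_act[OF xH fin, of a b] using o act_nonneg[of a b x]
          by (subst (asm) action_act[OF xH fin]) (auto simp: ennreal_le_iff)
        then have A: "sqrt (2 * v) / \<beta> * \<bar>norm (x b) powr \<beta> - norm (x a) powr \<beta>\<bar> \<le> act a b x"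
          using \<beta> by (simp add: G_def flip: diff_divide_distrib)
        have "V (dir a) \<le> \<kappa>\<^sup>2 * v" using near[of a] o \<kappa> by (simp add: v_def power2_eq_square mult.commute)
        then have "sqrt (2 * V (dir a)) \<le> sqrt (\<kappa>\<^sup>2 * (2 * v))" by (intro real_sqrt_le_mono) simp
        also have "\<dots> = \<kappa> * sqrt (2 * v)" using \<kappa> by (simp add: real_sqrt_mult)
        finally have "sqrt (2 * V (dir a)) / \<beta> \<le> \<kappa> * (sqrt (2 * v) / \<beta>)" using \<beta> by (simp add: divide_right_mono)
        then have Da: "jd W 0 (dir a) \<le> \<kappa> * (sqrt (2 * v) / \<beta>)" using jd_zero_dir[of a] by linarith
        let ?ra = "norm (x a) powr \<beta>" and ?rb = "norm (x b) powr \<beta>"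
        have "jd W 0 (dir a) * (?rb - ?ra) \<le> jd W 0 (dir a) * \<bar>?rb - ?ra\<bar>"
          using jd_nonneg by (intro mult_left_mono) auto
        also have "\<dots> \<le> \<kappa> * (sqrt (2 * v) / \<beta>) * \<bar>?rb - ?ra\<bar>" by (intro mult_right_mono Da) simp
        also have "\<dots> = \<kappa> * (sqrt (2 * v) / \<beta> * \<bar>?rb - ?ra\<bar>)" by simp
        also have "\<dots> \<le> \<kappa> * act a b x" using A \<kappa> by (intro mult_left_mono) auto
        finally have 1: "jd W 0 (dir a) * (?rb - ?ra) \<le> act a b x + e * act a b x" by (simp add: \<kappa>_def distrib_right)
        \<comment> \<open>By homogeneity the distances from the origin are \<open>?ra\<close> and
          \<open>?rb\<close> times those of the directions, and the mixed products
          recombine.\<close>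
        have "?rb * (jd W 0 (dir a) - jd W 0 (dir b)) = F a b - act a b x + jd W 0 (dir a) * (?rb - ?ra)"
          unfolding F_def jd_zero_scale by (simp add: algebra_simps)
        also have "\<dots> \<le> F a b + e * act a b x" using 1 by linarith
        finally have 2: "?rb * (jd W 0 (dir a) - jd W 0 (dir b)) \<le> F a b + e * act a b x" .
        have rb: "m powr \<beta> \<le> ?rb" using m(2)[of b] m(1) o \<beta> by (intro powr_mono2) auto
        have nn: "0 \<le> F a b + e * act a b x" using F_nonneg[of a b] act_nonneg[of a b x] o e by simp
        have rb0: "?rb > 0" using rb mb by linarith
        have "jd W 0 (dir a) - jd W 0 (dir b) \<le> (F a b + e * act a b x) / ?rb"
          unfolding pos_le_divide_eq[OF rb0] using 2 by (simp only: mult.commute)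
        also have "\<dots> \<le> (F a b + e * act a b x) / m powr \<beta>" by (rule divide_left_mono[OF rb nn mult_pos_pos[OF rb0 mb]])
        finally show "jd W 0 (dir a) - jd W 0 (dir b) \<le> (F a b + e * act a b x) / m powr \<beta>" .
      qed
    qed
  qed
  then have "jd W 0 (dir s) - jd W 0 (dir t) \<le> (F s t + e * act s t x) / m powr \<beta>" using st by (simp add: P_def)
  moreover have "e * act s t x \<le> e0 * m powr \<beta>"
    using a0 e0 mb act_nonneg[of s t x] by (simp add: e_def field_simps)
  then have "e * act s t x / m powr \<beta> \<le> e0" using mb by (simp add: divide_le_eq)
  ultimately show "jd W 0 (dir s) \<le> jd W 0 (dir t) + F s t / m powr \<beta> + e0" by (simp add: add_divide_distrib)
qed

end

section \<open>Asymptotics of geodesics\<close>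

context geodesic
begin

text \<open>At a time t minimizing the norm over the whole future, the error in
  \<open>angular_decrease\<close> is at most \<open>e / norm (x t) powr \<beta>\<close> up to any
  later time u. As u grows, \<open>V (dir u)\<close> tends to \<open>v0\<close>; multiplying by
  \<open>norm (x t) powr \<beta>\<close> leaves an error of e that is independent of the
  norm.\<close>

lemma good_times:
  assumes esc: "filterlim (\<lambda>t. norm (x t)) at_top at_top" and d: "(dir \<longlongrightarrow> \<xi>) at_top" and V\<xi>: "norm \<xi> = 1" "V \<xi> = v0"
    and e: "e > 0"
  obtains T1 where "T1 \<ge> T0" "\<And>s t. T1 \<le> s \<Longrightarrow> s \<le> t \<Longrightarrow> F s t \<le> e"
    "\<And>T. T \<ge> T1 \<Longrightarrow> \<exists>t\<ge>T. jd W 0 (x t) \<le> h (norm (x t)) + e \<and> (\<forall>u\<ge>t. norm (x t) \<le> norm (x u))"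
proof -
  obtain T1 where T1: "T1 \<ge> T0" "\<And>s t. T1 \<le> s \<Longrightarrow> s \<le> t \<Longrightarrow> F s t \<le> e" using F_tail[OF e] by blast
  show ?thesis
  proof (rule that[OF T1])
    fix T assume T: "T \<ge> T1"
    have "\<forall>\<^sub>F t in at_top. norm (x T) \<le> norm (x t)" using esc by (simp add: filterlim_at_top)
    then obtain T2 where T2: "\<And>t. t \<ge> T2 \<Longrightarrow> norm (x T) \<le> norm (x t)" by (auto simp: eventually_at_top_linorder)
    have "continuous_on {T..max T T2} (\<lambda>t. norm (x t))" by (intro continuous_on_norm continuous_on_subset[OF x_cont subset_UNIV])
    then obtain t where t: "t \<in> {T..max T T2}" "\<And>u. u \<in> {T..max T T2} \<Longrightarrow> norm (x t) \<le> norm (x u)"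
      using continuous_attains_inf[of "{T..max T T2}" "\<lambda>t. norm (x t)"] by auto
    have tm: "norm (x t) \<le> norm (x u)" if u: "u \<ge> T" for u
    proof (cases "u \<le> max T T2")
      case True then show ?thesis using t(2)[of u] u by simp
    next
      case False
      then have "norm (x T) \<le> norm (x u)" by (intro T2) simp
      moreover have "norm (x t) \<le> norm (x T)" using t(2)[of T] by simp
      ultimately show ?thesis by simp
    qed
    have n: "norm (x t) > 0" using xnz by simp
    have "jd W 0 (dir t) \<le> h 1 + e / norm (x t) powr \<beta>"
    proof (rule tendsto_lowerbound)
      have "((\<lambda>u. V (dir u)) \<longlongrightarrow> V \<xi>) at_top"
        by (rule continuous_on_tendsto_compose[OF V_cont d]) (use V\<xi> dir_unit in auto)
      then have "((\<lambda>u. sqrt (2 * V (dir u)) / \<beta> + e / norm (x t) powr \<beta>) \<longlongrightarrow> sqrt (2 * v0) / \<beta> + e / norm (x t) powr \<beta>) at_top"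
        using V\<xi> \<beta> by (intro tendsto_intros) auto
      then show "((\<lambda>u. sqrt (2 * V (dir u)) / \<beta> + e / norm (x t) powr \<beta>) \<longlongrightarrow> h 1 + e / norm (x t) powr \<beta>) at_top"
        by (simp add: h_def)
      show "\<forall>\<^sub>F u in at_top. jd W 0 (dir t) \<le> sqrt (2 * V (dir u)) / \<beta> + e / norm (x t) powr \<beta>"
        using eventually_ge_at_top[of t]
      proof eventually_elim
        case (elim u)
        have "jd W 0 (dir t) \<le> jd W 0 (dir u) + F t u / norm (x t) powr \<beta>"
          by (rule angular_decrease[OF elim n]) (use tm t in auto)
        also have "\<dots> \<le> sqrt (2 * V (dir u)) / \<beta> + e / norm (x t) powr \<beta>"
          using T1(2)[of t u] elim t T n by (intro add_mono jd_zero_dir divide_right_mono) auto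
        finally show ?case .
      qed
    qed simp
    then have "norm (x t) powr \<beta> * jd W 0 (dir t) \<le> norm (x t) powr \<beta> * (h 1 + e / norm (x t) powr \<beta>)"
      by (intro mult_left_mono) auto
    also have "\<dots> = h (norm (x t)) + e" using n h_mult[of "norm (x t)" 1] by (simp add: distrib_left)
    finally have "jd W 0 (x t) \<le> h (norm (x t)) + e" by (simp add: jd_zero_scale)
    then show "\<exists>t\<ge>T. jd W 0 (x t) \<le> h (norm (x t)) + e \<and> (\<forall>u\<ge>t. norm (x t) \<le> norm (x u))"
      using t tm by (intro exI[of _ t]) auto
  qed
qed

text \<open>Between two good times t and u the action is at most
  \<open>h (norm (x u)) - h (norm (x t)) + 2 * \<eta>\<close>. The calibration with
  \<open>k = \<beta>\<^sup>2\<close> in the direction of x u exceeds the difference of the values of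
  h by a multiple of \<open>1 - dir t \<bullet> dir u\<close>, which is therefore controlled. Good
  times u occur arbitrarily late, so \<open>\<xi>\<close> can take the place of
  \<open>dir u\<close>.\<close>

lemma asymptotics:
  assumes esc: "filterlim (\<lambda>t. norm (x t)) at_top at_top" and d: "(dir \<longlongrightarrow> \<xi>) at_top" and V\<xi>: "norm \<xi> = 1" "V \<xi> = v0"
    and e: "e > 0"
  obtains t where "t \<ge> T0" "jd W 0 (x t) \<le> h (norm (x t)) + e" "h (norm (x t)) * (norm (dir t - \<xi>))\<^sup>2 \<le> e"
proof -
  \<comment> \<open>The 4 collects the bound \<open>2 * \<eta>\<close> and the 2 in \<open>(norm
    (dir t - \<xi>))\<^sup>2 = 2 * (1 - dir t \<bullet> \<xi>)\<close>.\<close>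
  define \<eta> where "\<eta> = min e (e * \<beta>\<^sup>2 / 4)"
  have \<eta>: "\<eta> > 0" "\<eta> \<le> e" "4 * \<eta> \<le> e * \<beta>\<^sup>2" using e \<beta> by (auto simp: \<eta>_def min_def)
  obtain T1 where T1: "T1 \<ge> T0" "\<And>s t. T1 \<le> s \<Longrightarrow> s \<le> t \<Longrightarrow> F s t \<le> \<eta>"
    "\<And>T. T \<ge> T1 \<Longrightarrow> \<exists>t\<ge>T. jd W 0 (x t) \<le> h (norm (x t)) + \<eta> \<and> (\<forall>u\<ge>t. norm (x t) \<le> norm (x u))"
    using good_times[OF esc d V\<xi> \<eta>(1)] by blast
  obtain t where t: "t \<ge> T1" "jd W 0 (x t) \<le> h (norm (x t)) + \<eta>" using T1(3)[OF order_refl] by blast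
  have pair: "h (norm (x t)) * (\<beta>\<^sup>2 * (1 - dir t \<bullet> dir u)) \<le> 2 * \<eta>" if u: "u \<ge> t" "jd W 0 (x u) \<le> h (norm (x u)) + \<eta>" for u
  proof -
    have "act t u x = F t u + jd W 0 (x u) - jd W 0 (x t)" by (simp add: F_def)
    also have "\<dots> \<le> \<eta> + (h (norm (x u)) + \<eta>) - h (norm (x t))"
      using T1(2)[OF t(1) u(1)] u(2) jd_zero_ge[of "x t"] by linarith
    finally have up: "act t u x \<le> h (norm (x u)) - h (norm (x t)) + 2 * \<eta>" by simp
    have g: "sqrt (2 * v0) * G (\<beta>\<^sup>2) (dir u) (x w) = h (norm (x w)) * (1 - \<beta>\<^sup>2 * (1 - dir w \<bullet> dir u))" for w
      using G_unit[of "norm (x w)" "dir w" "\<beta>\<^sup>2" "dir u"] dir_unit[of w] x_polar[of w] by (simp add: h_def)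
    have "sqrt (2 * v0) * \<bar>G (\<beta>\<^sup>2) (dir u) (x u) - G (\<beta>\<^sup>2) (dir u) (x t)\<bar> \<le> act t u x"
      by (rule reach_lower[OF reach_act[OF xH fin]]) (use u dir_unit in auto)
    moreover have "sqrt (2 * v0) * (G (\<beta>\<^sup>2) (dir u) (x u) - G (\<beta>\<^sup>2) (dir u) (x t)) \<le> sqrt (2 * v0) * \<bar>G (\<beta>\<^sup>2) (dir u) (x u) - G (\<beta>\<^sup>2) (dir u) (x t)\<bar>"
      using v0 by (intro mult_left_mono) auto
    ultimately have "h (norm (x u)) * (1 - \<beta>\<^sup>2 * (1 - dir u \<bullet> dir u)) - h (norm (x t)) * (1 - \<beta>\<^sup>2 * (1 - dir t \<bullet> dir u)) \<le> act t u x"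
      unfolding right_diff_distrib[of "sqrt (2 * v0)"] g by linarith
    moreover have "dir u \<bullet> dir u = 1" using dir_unit[of u] by (simp add: dot_square_norm)
    ultimately have "h (norm (x u)) - h (norm (x t)) * (1 - \<beta>\<^sup>2 * (1 - dir t \<bullet> dir u)) \<le> h (norm (x u)) - h (norm (x t)) + 2 * \<eta>"
      using up by simp
    then show ?thesis by (simp add: right_diff_distrib)
  qed
  have lim: "((\<lambda>u. h (norm (x t)) * (\<beta>\<^sup>2 * (1 - dir t \<bullet> dir u))) \<longlongrightarrow> h (norm (x t)) * (\<beta>\<^sup>2 * (1 - dir t \<bullet> \<xi>))) at_top"
    by (intro tendsto_intros d)
  have final: "h (norm (x t)) * (\<beta>\<^sup>2 * (1 - dir t \<bullet> \<xi>)) \<le> 2 * \<eta>"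
  proof (rule ccontr)
    assume "\<not> ?thesis"
    then have "\<forall>\<^sub>F u in at_top. 2 * \<eta> < h (norm (x t)) * (\<beta>\<^sup>2 * (1 - dir t \<bullet> dir u))"
      by (intro order_tendstoD(1)[OF lim]) simp
    then obtain T where T: "\<And>u. u \<ge> T \<Longrightarrow> 2 * \<eta> < h (norm (x t)) * (\<beta>\<^sup>2 * (1 - dir t \<bullet> dir u))" by (auto simp: eventually_at_top_linorder)
    have "max T t \<ge> T1" using t(1) by simp
    from T1(3)[OF this] obtain u where u: "u \<ge> max T t" "jd W 0 (x u) \<le> h (norm (x u)) + \<eta>" by blast
    then show False using T[of u] pair[of u] by (meson max.boundedE not_le)
  qed
  have nd: "(norm (dir t - \<xi>))\<^sup>2 = 2 * (1 - dir t \<bullet> \<xi>)"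
    using dir_unit[of t] V\<xi> by (simp add: power2_norm_eq_inner inner_diff_left inner_diff_right inner_commute norm_eq_1)
  show ?thesis
  proof (rule that[of t])
    show "t \<ge> T0" using t T1 by simp
    show "jd W 0 (x t) \<le> h (norm (x t)) + e" using t \<eta> by simp
    have "\<beta>\<^sup>2 * (h (norm (x t)) * (norm (dir t - \<xi>))\<^sup>2) \<le> \<beta>\<^sup>2 * e"
      unfolding nd using final \<eta>(3) by (simp add: algebra_simps)
    then show "h (norm (x t)) * (norm (dir t - \<xi>))\<^sup>2 \<le> e" using \<beta> by simp
  qed
qed

end

context kepler
begin

text \<open>Moving along the sphere of radius r would cost an amount linear in
  \<open>norm (s - \<xi>)\<close>. The segment to \<open>(2 * r) *\<^sub>R \<xi>\<close> is nearly
  radial, and its length, its distances from the origin and its directions deviate from those of a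
  ray only to second order, as does V by hypothesis.\<close>

lemma connection:
  assumes \<xi>: "norm \<xi> = 1" and T: "d0 > 0" "C \<ge> 0" "\<And>s. norm s = 1 \<Longrightarrow> norm (s - \<xi>) < d0 \<Longrightarrow> V s \<le> v0 + C * (norm (s - \<xi>))\<^sup>2"
  obtains d1 C' where "d1 > 0" "C' \<ge> 0"
    "\<And>s r. norm s = 1 \<Longrightarrow> norm (s - \<xi>) < d1 \<Longrightarrow> r > 0 \<Longrightarrow> jd W (r *\<^sub>R s) ((2 * r) *\<^sub>R \<xi>) \<le> h (2 * r) - h r + C' * (h r * (norm (s - \<xi>))\<^sup>2)"
proof -
  define C0 where "C0 = C / v0"
  have C0: "C0 \<ge> 0" using T v0 by (simp add: C0_def)
  \<comment> \<open>The sum of the coefficients in \<open>(1 + C0 * q) * (1 + 2 * q) - 1\<close>,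
    with \<open>q * q \<le> q\<close>.\<close>
  define C' where "C' = C0 + 2 + 2 * C0"
  have C': "C' \<ge> 0" using C0 by (simp add: C'_def)
  show ?thesis
  proof (rule that[of "min d0 1" C'])
    fix s :: 'a and r :: real assume s: "norm s = 1" "norm (s - \<xi>) < min d0 1" and r: "r > 0"
    define q where "q = (norm (s - \<xi>))\<^sup>2"
    have q: "0 \<le> q" "q \<le> 1" using s by (auto simp: q_def power_le_one)
    define c where "c = s \<bullet> \<xi>"
    have qc: "q = 2 * (1 - c)"
      using s \<xi> by (simp add: q_def c_def power2_norm_eq_inner inner_diff_left inner_diff_right inner_commute norm_eq_1)
    have ip: "s \<bullet> s = 1" "\<xi> \<bullet> \<xi> = 1" "\<xi> \<bullet> s = c" using s \<xi> by (auto simp: dot_square_norm c_def inner_commute)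
    define m where "m = (1 + C0 * q) * (1 + 2 * q)"
    have m1: "m \<ge> 1" using q C0 mult_mono[of 1 "1 + C0 * q" 1 "1 + 2 * q"] by (simp add: m_def)
    have m2: "m \<le> 1 + C' * q"
    proof -
      have "q * q \<le> q" using q mult_left_le[of q q] by simp
      then have "C0 * (q * q) \<le> C0 * q" using C0 by (intro mult_left_mono)
      then show ?thesis by (simp add: m_def C'_def algebra_simps)
    qed
    \<comment> \<open>With \<open>A = s - B\<close> the line \<open>A + t *\<^sub>R B\<close> is at
      s for t = 1 and at \<open>2 *\<^sub>R \<xi>\<close> for t = 2, so the parameter is close to
      the norm.\<close>
    define B where "B = 2 *\<^sub>R \<xi> - s"
    define A where "A = s - B"
    have "(norm B)\<^sup>2 = 1 + 2 * q"
      unfolding power2_norm_eq_inner B_def qc by (simp add: inner_diff_left inner_diff_right ip c_def[symmetric])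
    also have "\<dots> \<le> m" unfolding m_def using q C0 mult_right_mono[of 1 "1 + C0 * q" "1 + 2 * q"] by simp
    finally have B: "(norm B)\<^sup>2 \<le> m" .
    have pot: "potential W (A + t *\<^sub>R B) \<le> ennreal (m * v0 * t powr - \<alpha>)" if t: "1 < t" "t < 2" for t
    proof -
      define u where "u = t - 1"
      have u: "0 < u" "u < 1" using t by (auto simp: u_def)
      define p where "p = A + t *\<^sub>R B"
      have "p = s + u *\<^sub>R B" by (simp add: p_def A_def u_def scaleR_left_diff_distrib)
      then have p: "p = (1 - u) *\<^sub>R s + (2 * u) *\<^sub>R \<xi>"
        by (simp add: B_def scaleR_diff_right scaleR_left_diff_distrib mult.commute)
      have p2: "(norm p)\<^sup>2 = t\<^sup>2 - 2 * (u * (1 - u)) * q"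
        unfolding power2_norm_eq_inner p qc
        by (simp add: inner_add_left inner_add_right ip c_def[symmetric] u_def power2_eq_square algebra_simps)
      have uu: "u * (1 - u) \<le> 1 / 4" using zero_le_power2[of "u - 1 / 2"] by (simp add: power2_eq_square algebra_simps)
      have "2 * (u * (1 - u)) * q \<le> 2 * (1 / 4) * q" using uu q by (intro mult_right_mono mult_left_mono) auto
      also have "\<dots> \<le> t\<^sup>2 * (q / 2)" using t q mult_right_mono[of 1 "t\<^sup>2" "q / 2"] by (simp add: one_le_power)
      finally have lo: "t\<^sup>2 * (1 - q / 2) \<le> (norm p)\<^sup>2" unfolding p2 by (simp add: algebra_simps)
      have q2: "1 - q / 2 > 0" using q by simp
      then have "(norm p)\<^sup>2 > 0" using lo t by (meson less_le_trans mult_pos_pos zero_less_power less_trans zero_less_one)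
      then have pnz: "p \<noteq> 0" by auto
      then have np: "norm p > 0" by simp
      have "norm p powr - \<alpha> = ((norm p)\<^sup>2) powr (- \<alpha> / 2)" using np by (simp add: powr_powr flip: powr_numeral)
      also have "\<dots> \<le> (t\<^sup>2 * (1 - q / 2)) powr (- \<alpha> / 2)" using lo t q2 \<alpha> by (intro powr_mono2') auto
      also have "\<dots> = t powr - \<alpha> * (1 - q / 2) powr (- \<alpha> / 2)" using t q2 by (simp add: powr_mult powr_powr flip: powr_numeral)
      also have "\<dots> \<le> t powr - \<alpha> * (1 + q)"
      proof (rule mult_left_mono)
        \<comment> \<open>The base is at most 1 and \<open>\<alpha> < 2\<close>, so the exponent -1
          gives the larger power; for q at most 1 it is bounded by 1 + q.\<close>
        have "(1 - q / 2) powr (- \<alpha> / 2) \<le> (1 - q / 2) powr - 1" using q q2 \<alpha> by (intro powr_mono') auto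
        also have "\<dots> = 1 / (1 - q / 2)" using q2 by (simp add: powr_minus_divide)
        also have "\<dots> \<le> 1 + q"
        proof -
          have "q * q \<le> q" using q mult_left_le[of q q] by simp
          then have "1 \<le> (1 + q) * (1 - q / 2)" by (simp add: algebra_simps)
          then show ?thesis using q2 by (simp add: pos_divide_le_eq)
        qed
        finally show "(1 - q / 2) powr (- \<alpha> / 2) \<le> 1 + q" .
      qed simp
      finally have np_le: "norm p powr - \<alpha> \<le> t powr - \<alpha> * (1 + q)" .
      let ?d = "p /\<^sub>R norm p"
      have d1: "norm ?d = 1" using pnz by simp
      have gen: "(norm (y - \<xi>))\<^sup>2 = 2 * (1 - y \<bullet> \<xi>)" if "norm y = 1" for y :: 'a
        using that \<xi> by (simp add: power2_norm_eq_inner inner_diff_left inner_diff_right inner_commute norm_eq_1)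
      have "norm p \<le> (1 - u) * norm s + (2 * u) * norm \<xi>" unfolding p using u by (intro norm_triangle_le) simp
      then have npu: "norm p \<le> 1 + u" using s \<xi> by simp
      have c0: "c \<ge> 1 / 2" "c \<le> 1" using q qc by auto
      have "c * norm p \<le> c * (1 + u)" using npu c0 by (intro mult_left_mono) auto
      also have "\<dots> \<le> (1 - u) * c + 2 * u" using c0 u mult_left_mono[of c 1 "2 * u"] by (simp add: algebra_simps)
      also have "\<dots> = p \<bullet> \<xi>" unfolding p by (simp add: inner_add_left ip c_def[symmetric])
      finally have cd: "c \<le> ?d \<bullet> \<xi>" using np by (simp add: pos_le_divide_eq divide_inverse_commute[symmetric])
      have nd: "(norm (?d - \<xi>))\<^sup>2 = 2 * (1 - ?d \<bullet> \<xi>)"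
        by (rule gen[OF d1])
      have ndq: "(norm (?d - \<xi>))\<^sup>2 \<le> q"
        unfolding nd qc by (rule mult_left_mono[OF diff_left_mono[OF cd]]) simp
      have "norm (?d - \<xi>) \<le> norm (s - \<xi>)" by (rule power2_le_imp_le[OF ndq[unfolded q_def] norm_ge_zero])
      then have "V ?d \<le> v0 + C * (norm (?d - \<xi>))\<^sup>2" using s by (intro T(3) d1) auto
      also have "\<dots> \<le> v0 + C * q" using T(2) ndq by (intro add_left_mono mult_left_mono)
      also have "\<dots> = v0 * (1 + C0 * q)" using v0 by (simp add: C0_def distrib_left)
      finally have Vd: "V ?d \<le> v0 * (1 + C0 * q)" .
      have "V ?d / norm p powr \<alpha> = V ?d * norm p powr - \<alpha>" by (simp add: powr_minus divide_inverse)
      also have "\<dots> \<le> (v0 * (1 + C0 * q)) * (t powr - \<alpha> * (1 + q))"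
        using Vd np_le v0 C0 q by (intro mult_mono) auto
      also have "\<dots> \<le> (v0 * (1 + C0 * q)) * (t powr - \<alpha> * (1 + 2 * q))"
        using v0 C0 q by (intro mult_left_mono) auto
      also have "\<dots> = m * v0 * t powr - \<alpha>" by (simp add: m_def)
      finally have "V ?d / norm p powr \<alpha> \<le> m * v0 * t powr - \<alpha>" .
      then show ?thesis unfolding p_def[symmetric] pot_eq[OF pnz] by (rule ennreal_leI)
    qed
    have "reach W UNIV (A + 1 *\<^sub>R B) (A + 2 *\<^sub>R B) (m * (sqrt (2 * v0) * (2 powr \<beta> - 1 powr \<beta>) / \<beta>))"
      by (rule reach_affine_ray[OF v0 _ _ _ B pot]) (use m1 in auto)
    moreover have "A + 1 *\<^sub>R B = s" "A + 2 *\<^sub>R B = 2 *\<^sub>R \<xi>" by (auto simp: A_def B_def algebra_simps scaleR_2)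
    moreover have "sqrt (2 * v0) * (2 powr \<beta> - 1 powr \<beta>) / \<beta> = h 2 - h 1" by (simp add: h_def diff_divide_distrib right_diff_distrib)
    ultimately have "jd W s (2 *\<^sub>R \<xi>) \<le> m * (h 2 - h 1)" using jd_le by metis
    also have "\<dots> \<le> (1 + C' * q) * (h 2 - h 1)" using h_mono[of 1 2] by (intro mult_right_mono m2) auto
    also have "\<dots> \<le> (h 2 - h 1) + C' * (q * h 1)"
    proof -
      have "2 powr \<beta> \<le> 2 powr 1" using \<beta> by (intro powr_mono) auto
      then have "h 2 \<le> 2 * h 1" using h_mult[of 2 1] h_nonneg[of 1] mult_right_mono[of "2 powr \<beta>" 2 "h 1"] by simp
      then have "C' * q * (h 2 - h 1) \<le> C' * q * h 1" using C' q by (intro mult_left_mono) auto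
      then show ?thesis by (simp add: algebra_simps)
    qed
    finally have j: "jd W s (2 *\<^sub>R \<xi>) \<le> (h 2 - h 1) + C' * (q * h 1)" .
    have "jd W (r *\<^sub>R s) ((2 * r) *\<^sub>R \<xi>) = r powr \<beta> * jd W s (2 *\<^sub>R \<xi>)"
      using jd_scale[OF r, of s "2 *\<^sub>R \<xi>"] by (simp add: mult.commute)
    also have "\<dots> \<le> r powr \<beta> * ((h 2 - h 1) + C' * (q * h 1))" using j by (intro mult_left_mono) auto
    also have "\<dots> = h (2 * r) - h r + C' * (h r * q)"
      using h_mult[of r 2] h_mult[of r 1] r by (simp add: algebra_simps)
    finally show "jd W (r *\<^sub>R s) ((2 * r) *\<^sub>R \<xi>) \<le> h (2 * r) - h r + C' * (h r * (norm (s - \<xi>))\<^sup>2)" by (simp add: q_def)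
  qed (use T C' in auto)
qed

end

section \<open>Heteroclinic geodesics\<close>

text \<open>A convex combination with the constant v keeps the minima and lowers exactly the values
  above v. The value \<open>undefined\<close> off the sphere makes the function extensional, as
  \<open>C2_sphere\<close> demands.\<close>

definition shrink :: "real \<Rightarrow> real \<Rightarrow> ('a::euclidean_space \<Rightarrow> real) \<Rightarrow> 'a \<Rightarrow> real" where
  "shrink v e V s = (if s \<in> sphere 0 1 then (1 - e) * V s + e * v else undefined)"

lemma reach_potential_mono:
  assumes "reach W S p q c" "\<And>p. potential W' p \<le> potential W p"
  shows "reach W' S p q c"
proof -
  from assms(1) obtain a b x where x: "a \<le> b" "x \<in> H1 a b" "x a = p" "x b = q" "\<forall>t\<in>{a..b}. x t \<in> S"
    "action W a b x \<le> ennreal c" and c: "0 \<le> c" unfolding reach_def by blast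
  have "action W' a b x \<le> action W a b x"
    unfolding action_def by (intro nn_integral_mono mult_right_mono add_left_mono assms(2)) simp
  then show ?thesis using x c by (intro reachI[OF x(1-4)]) (auto intro: order_trans)
qed

context kepler
begin

lemma kepler_shrink:
  assumes e: "0 \<le> e" "e \<le> 1"
  shows "kepler (shrink v0 e V) \<alpha> v0"
proof
  have "continuous_on (sphere 0 1) (\<lambda>s. (1 - e) * V s + e * v0)" by (intro continuous_intros V_cont)
  then show "continuous_on (sphere 0 1) (shrink v0 e V)"
    by (rule continuous_on_eq) (simp add: shrink_def)
  show "v0 \<le> shrink v0 e V s" if "s \<in> sphere 0 1" for s
    using mult_left_mono[OF V_ge[OF that], of "1 - e"] e that by (simp add: shrink_def algebra_simps)
qed (use v0 \<alpha> in auto)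

lemma shrink_le: "0 \<le> e \<Longrightarrow> s \<in> sphere 0 1 \<Longrightarrow> shrink v0 e V s \<le> V s"
  using mult_left_mono[OF V_ge[of s], of e] by (simp add: shrink_def algebra_simps)

lemma potential_shrink_le:
  assumes e: "0 \<le> e" "e \<le> 1"
  shows "potential (shrink v0 e V, \<alpha>) p \<le> potential W p"
proof (cases "p = 0")
  case False
  interpret K': kepler "shrink v0 e V" \<alpha> v0 by (rule kepler_shrink[OF e])
  show ?thesis unfolding pot_eq[OF False] K'.pot_eq[OF False]
    by (intro ennreal_leI divide_right_mono shrink_le[OF e(1)] sgn_in_sphere[OF False]) simp
qed (simp add: pot_zero)

lemma jd_shrink_le:
  assumes e: "0 \<le> e" "e \<le> 1"
  shows "jd (shrink v0 e V, \<alpha>) p q \<le> jd W p q"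
proof -
  interpret K': kepler "shrink v0 e V" \<alpha> v0 by (rule kepler_shrink[OF e])
  show ?thesis
    by (rule jd_greatest) (rule K'.jd_le[OF reach_potential_mono[OF _ potential_shrink_le[OF e]]])
qed

lemma jd_le_2h:
  assumes "norm \<xi>p = 1" "norm \<xi>m = 1" "V \<xi>p = v0" "V \<xi>m = v0" "0 \<le> r"
  shows "jd W (r *\<^sub>R \<xi>m) (r *\<^sub>R \<xi>p) \<le> 2 * h r"
proof -
  have "jd W 0 (r *\<^sub>R \<xi>m) \<le> h r" "jd W 0 (r *\<^sub>R \<xi>p) \<le> h r"
    using jd_ray_le[of \<xi>m 0 r] jd_ray_le[of \<xi>p 0 r] assms by (auto simp: h_0)
  then show ?thesis using jd_triangle[of "r *\<^sub>R \<xi>m" "r *\<^sub>R \<xi>p" 0] jd_sym[of "r *\<^sub>R \<xi>m" 0] by linarith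
qed

end

locale heteroclinic = geodesic V \<alpha> v0 x for V :: "'a::euclidean_space \<Rightarrow> real" and \<alpha> v0 x +
  fixes \<xi>p \<xi>m :: 'a
  assumes esc: "filterlim (\<lambda>t. norm (x t)) at_top at_top" "filterlim (\<lambda>t. norm (x t)) at_top at_bot"
    and dirs: "(dir \<longlongrightarrow> \<xi>p) at_top" "(dir \<longlongrightarrow> \<xi>m) at_bot"
    and \<xi>: "norm \<xi>p = 1" "norm \<xi>m = 1" "V \<xi>p = v0" "V \<xi>m = v0"
begin

text \<open>The geodesic crosses the sphere of radius R on both sides of time 0, so the distance of
  the crossings is at least \<open>2 * (h R - h (norm (x 0)))\<close>. After division by
  \<open>R powr \<beta>\<close> the constant is negligible and the directions of the crossings are
  close to \<open>\<xi>m\<close> and \<open>\<xi>p\<close>.\<close>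

lemma jd_ge_2h: "2 * h 1 \<le> jd W \<xi>m \<xi>p"
proof -
  define c where "c = jd W \<xi>m \<xi>p"
  define C where "C = 1 / 2 + (VM + 1) * (max 1 (2 / 1))\<^sup>2"
  have C: "C \<ge> 0" using VM(1) by (simp add: C_def)
  have near: "jd W \<xi> s \<le> C * norm (s - \<xi>)" if "norm \<xi> = 1" "norm (s - \<xi>) \<le> 1 / 2" for \<xi> s :: 'a
  proof -
    have "\<xi> \<noteq> 0" using that by force
    moreover have "close V \<alpha> V \<alpha> 0" by (simp add: close_def)
    ultimately show ?thesis using jd_near[OF kepler_axioms, of 0 \<xi> s] that by (simp add: C_def)
  qed
  have main: "2 * h 1 \<le> c + \<eta> * (2 * C + 2 * h 1)" if \<eta>: "0 < \<eta>" "\<eta> \<le> 1 / 2" for \<eta>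
  proof -
    have "\<forall>\<^sub>F t in at_top. dist (dir t) \<xi>p < \<eta>" "\<forall>\<^sub>F t in at_bot. dist (dir t) \<xi>m < \<eta>"
      using dirs \<eta> by (auto simp: tendsto_iff)
    then obtain P M where PM: "\<And>t. t \<ge> P \<Longrightarrow> dist (dir t) \<xi>p < \<eta>" "\<And>t. t \<le> M \<Longrightarrow> dist (dir t) \<xi>m < \<eta>"
      by (auto simp: eventually_at_top_linorder eventually_at_bot_linorder)
    define T where "T = max \<bar>P\<bar> \<bar>M\<bar>"
    have nc: "continuous_on S (\<lambda>t. norm (x t))" for S by (intro continuous_on_norm continuous_on_subset[OF x_cont subset_UNIV])
    have "bounded ((\<lambda>t. norm (x t)) ` {- T..T})" by (intro compact_imp_bounded compact_continuous_image nc) simp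
    then obtain B where B: "\<forall>y\<in>(\<lambda>t. norm (x t)) ` {- T..T}. norm y \<le> B" unfolding bounded_iff by blast
    have BB: "norm (x t) \<le> B" if "t \<in> {- T..T}" for t using bspec[OF B imageI[OF that]] by simp
    \<comment> \<open>Besides making the constant negligible, R must exceed every norm attained on
      \<open>{- T..T}\<close>; this forces the crossing times to where the directions are
      \<open>\<eta>\<close>-close to their limits.\<close>
    have "\<forall>\<^sub>F R in at_top. h (norm (x 0)) / \<eta> \<le> h R" using h_at_top by (simp add: filterlim_at_top)
    moreover have "\<forall>\<^sub>F R in at_top. max B (norm (x 0)) < R" by (rule eventually_gt_at_top)
    ultimately have "\<forall>\<^sub>F R in at_top. h (norm (x 0)) / \<eta> \<le> h R \<and> max B (norm (x 0)) < R" by eventually_elim auto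
    then have "\<exists>R. h (norm (x 0)) / \<eta> \<le> h R \<and> max B (norm (x 0)) < R" by (rule eventually_happens'[OF trivial_limit_at_top_linorder])
    then obtain R where R: "h (norm (x 0)) / \<eta> \<le> h R" "B < R" "norm (x 0) < R" by auto
    have R0: "R > 0" using R(3) norm_ge_zero le_less_trans by blast
    have "\<forall>\<^sub>F t in at_top. R \<le> norm (x t)" "\<forall>\<^sub>F t in at_bot. R \<le> norm (x t)" using esc by (auto simp: filterlim_at_top)
    then obtain P' M' where PM': "\<And>t. t \<ge> P' \<Longrightarrow> R \<le> norm (x t)" "\<And>t. t \<le> M' \<Longrightarrow> R \<le> norm (x t)"
      by (auto simp: eventually_at_top_linorder eventually_at_bot_linorder)
    have "\<exists>t\<ge>0. t \<le> max 0 P' \<and> norm (x t) = R" using R PM'(1)[of "max 0 P'"] by (intro IVT' nc) auto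
    then obtain tp where tp: "tp \<ge> 0" "norm (x tp) = R" by blast
    have "\<exists>t\<ge>min 0 M'. t \<le> 0 \<and> norm (x t) = R" using R PM'(2)[of "min 0 M'"] by (intro IVT2' nc) auto
    then obtain tm where tm: "tm \<le> 0" "norm (x tm) = R" by blast
    have "tp \<notin> {- T..T}" using BB[of tp] R(2) tp(2) by linarith
    then have "tp \<ge> P" using tp by (auto simp: T_def)
    then have dp: "norm (dir tp - \<xi>p) < \<eta>" using PM(1) by (simp add: dist_norm)
    have "tm \<notin> {- T..T}" using BB[of tm] R(2) tm(2) by linarith
    then have "tm \<le> M" using tm by (auto simp: T_def)
    then have dm: "norm (dir tm - \<xi>m) < \<eta>" using PM(2) by (simp add: dist_norm)
    have "h R - h (norm (x 0)) \<le> act tm 0 x" "h R - h (norm (x 0)) \<le> act 0 tp x"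
      using jd_lower_h[of "x 0" "x tm"] jd_lower_h[of "x tp" "x 0"] act_jd[of tm 0] act_jd[of 0 tp] tm tp by auto
    then have lo: "2 * (h R - h (norm (x 0))) \<le> jd W (x tm) (x tp)"
      using act_split[of tm 0 tp] act_jd[of tm tp] tm tp by simp
    have "jd W (x tm) (x tp) = R powr \<beta> * jd W (dir tm) (dir tp)"
      using x_polar[of tm] x_polar[of tp] tm tp jd_scale[OF R0, of "dir tm" "dir tp"] by simp
    also have "jd W (dir tm) (dir tp) \<le> jd W \<xi>m (dir tm) + c + jd W \<xi>p (dir tp)"
      using jd_triangle[of "dir tm" "dir tp" \<xi>m] jd_triangle[of \<xi>m "dir tp" \<xi>p] jd_sym[of "dir tm" \<xi>m] by (simp add: c_def)
    also have "jd W \<xi>m (dir tm) \<le> C * \<eta>"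
      using near[OF \<xi>(2), of "dir tm"] dm \<eta> C mult_left_mono[of "norm (dir tm - \<xi>m)" \<eta> C] by simp
    also have "jd W \<xi>p (dir tp) \<le> C * \<eta>"
      using near[OF \<xi>(1), of "dir tp"] dp \<eta> C mult_left_mono[of "norm (dir tp - \<xi>p)" \<eta> C] by simp
    finally have up: "jd W (x tm) (x tp) \<le> R powr \<beta> * (C * \<eta> + c + C * \<eta>)" by (simp add: mult_left_mono)
    have "h (norm (x 0)) \<le> \<eta> * h R" using R(1) \<eta> by (simp add: divide_le_eq mult.commute)
    moreover have "h R = R powr \<beta> * h 1" using h_mult[of R 1] R0 by simp
    ultimately have "R powr \<beta> * (2 * (h 1 - \<eta> * h 1)) \<le> 2 * (h R - h (norm (x 0)))" by (simp add: algebra_simps)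
    then have "R powr \<beta> * (2 * (h 1 - \<eta> * h 1)) \<le> R powr \<beta> * (C * \<eta> + c + C * \<eta>)" using lo up by linarith
    then have "2 * (h 1 - \<eta> * h 1) \<le> C * \<eta> + c + C * \<eta>" using R0 by (simp add: mult_le_cancel_left)
    then show ?thesis by (simp add: algebra_simps)
  qed
  have "2 * h 1 \<le> c"
  proof (rule field_le_epsilon)
    fix e :: real assume e: "e > 0"
    define D where "D = 2 * C + 2 * h 1 + 1"
    have D: "D > 0" using C h_nonneg[of 1] by (simp add: D_def)
    define \<eta> where "\<eta> = min (1 / 2) (e / D)"
    have \<eta>: "0 < \<eta>" "\<eta> \<le> 1 / 2" "\<eta> \<le> e / D"
      using divide_pos_pos[OF e D] unfolding \<eta>_def by (simp_all only: min_less_iff_conj min.cobounded1 min.cobounded2 zero_less_divide_1_iff zero_less_numeral simp_thms)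
    have "\<eta> * (2 * C + 2 * h 1) \<le> (e / D) * D" using \<eta> D C h_nonneg[of 1] by (intro mult_mono) (auto simp: D_def)
    also have "\<dots> = e" using D by simp
    finally show "2 * h 1 \<le> c + e" using main[OF \<eta>(1,2)] by linarith
  qed
  then show ?thesis by (simp add: c_def)
qed

text \<open>Both errors at the time supplied by \<open>asymptotics\<close> are at most
  \<open>\<eta>\<close>, one of them amplified by C' in the connection to the ray; hence
  \<open>\<eta> = e / (1 + C')\<close>.\<close>

lemma end_connection:
  assumes T: "d0 > 0" "C \<ge> 0" "\<And>s. norm s = 1 \<Longrightarrow> norm (s - \<xi>p) < d0 \<Longrightarrow> V s \<le> v0 + C * (norm (s - \<xi>p))\<^sup>2" and e: "e > 0"
  obtains t r where "t \<ge> T0" "r > 0" "jd W 0 (x t) + jd W (x t) (r *\<^sub>R \<xi>p) \<le> h r + e"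
proof -
  obtain d1 C' where d1: "d1 > 0" "C' \<ge> 0"
    "\<And>s r. norm s = 1 \<Longrightarrow> norm (s - \<xi>p) < d1 \<Longrightarrow> r > 0 \<Longrightarrow> jd W (r *\<^sub>R s) ((2 * r) *\<^sub>R \<xi>p) \<le> h (2 * r) - h r + C' * (h r * (norm (s - \<xi>p))\<^sup>2)"
    using connection[OF \<xi>(1) T] by blast
  define \<eta> where "\<eta> = e / (1 + C')"
  have C1: "1 + C' > 0" using d1 by simp
  have "(1 + C') * \<eta> = e" unfolding \<eta>_def using C1 by simp
  then have \<eta>: "\<eta> > 0" "\<eta> + C' * \<eta> = e" using e C1 divide_pos_pos[OF e C1] unfolding \<eta>_def[symmetric] distrib_right by auto
  have "\<forall>\<^sub>F t in at_top. dist (dir t) \<xi>p < d1" using dirs d1 by (auto simp: tendsto_iff)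
  then obtain P where P: "\<And>t. t \<ge> P \<Longrightarrow> dist (dir t) \<xi>p < d1" by (auto simp: eventually_at_top_linorder)
  obtain t where t: "t \<ge> max T0 P" "jd W 0 (x t) \<le> h (norm (x t)) + \<eta>" "h (norm (x t)) * (norm (dir t - \<xi>p))\<^sup>2 \<le> \<eta>"
    using asymptotics[OF esc(1) dirs(1) \<xi>(1,3) \<eta>(1)] by blast
  have n: "norm (x t) > 0" using xnz by simp
  have "jd W (x t) ((2 * norm (x t)) *\<^sub>R \<xi>p) \<le> h (2 * norm (x t)) - h (norm (x t)) + C' * (h (norm (x t)) * (norm (dir t - \<xi>p))\<^sup>2)"
    using d1(3)[OF dir_unit(1) _ n, of t] P[of t] t(1) x_polar[of t] by (simp add: dist_norm)
  also have "\<dots> \<le> h (2 * norm (x t)) - h (norm (x t)) + C' * \<eta>" using t(3) d1 by (intro add_left_mono mult_left_mono)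
  finally show ?thesis using t \<eta>(2) n by (intro that[of t "2 * norm (x t)"]) auto
qed

lemma reversed_heteroclinic: "heteroclinic V \<alpha> v0 (\<lambda>t. x (- t)) \<xi>m \<xi>p"
proof -
  interpret r: geodesic V \<alpha> v0 "\<lambda>t. x (- t)" by (rule reversed)
  have rd: "r.dir = (\<lambda>t. dir (- t))" by (simp add: r.dir_def dir_def fun_eq_iff)
  show ?thesis
    by (intro heteroclinic.intro heteroclinic_axioms.intro reversed)
       (use esc dirs \<xi> in \<open>simp_all add: rd filterlim_at_bot_mirror\<close>)
qed

text \<open>The competitor runs along the ray of \<open>\<xi>m\<close>, joins the geodesic, follows
  it and leaves it to the ray of \<open>\<xi>p\<close>. For V it costs at most
  \<open>2 * h k + 2 * \<epsilon>\<close>. Lowering V saves at least \<open>e * \<kappa>\<close>,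
  where \<open>\<kappa>\<close> is the integral of f over a window around t0 fixed before the
  connection times are chosen.\<close>

lemma shrink_Out:
  assumes Tp: "dp > 0" "Cp \<ge> 0" "\<And>s. norm s = 1 \<Longrightarrow> norm (s - \<xi>p) < dp \<Longrightarrow> V s \<le> v0 + Cp * (norm (s - \<xi>p))\<^sup>2"
    and Tm: "dm > 0" "Cm \<ge> 0" "\<And>s. norm s = 1 \<Longrightarrow> norm (s - \<xi>m) < dm \<Longrightarrow> V s \<le> v0 + Cm * (norm (s - \<xi>m))\<^sup>2"
    and t0: "V (dir t0) > v0" and e: "0 < e" "e \<le> 1"
  shows "jd (shrink v0 e V, \<alpha>) \<xi>m \<xi>p < 2 * h 1"
proof -
  interpret K': kepler "shrink v0 e V" \<alpha> v0 by (rule kepler_shrink) (use e in auto)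
  interpret r: heteroclinic V \<alpha> v0 "\<lambda>t. x (- t)" \<xi>m \<xi>p by (rule reversed_heteroclinic)
  define f where "f = (\<lambda>u. (V (dir u) - v0) / norm (x u) powr \<alpha>)"
  have fc: "continuous_on UNIV f"
    unfolding f_def
    by (intro continuous_intros continuous_on_compose2[OF V_cont dir_cont] x_cont) (use dir_unit xnz in auto)
  have f0: "f u \<ge> 0" for u using V_ge[OF dir_unit(2), of u] by (simp add: f_def)
  have fi: "f integrable_on {s..t}" for s t by (rule integrable_continuous_interval[OF continuous_on_subset[OF fc subset_UNIV]])
  define T where "T = \<bar>t0\<bar> + 1"
  define \<kappa> where "\<kappa> = integral {- T..T} f"
  have \<kappa>: "\<kappa> > 0"
  proof -
    have "integral {- T..T} f \<noteq> 0"
    proof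
      assume "integral {- T..T} f = 0"
      then have "\<forall>u\<in>{- T..T}. f u = 0"
        by (subst (asm) integral_eq_0_iff) (use continuous_on_subset[OF fc subset_UNIV] f0 in \<open>auto simp: T_def\<close>)
      moreover have "t0 \<in> {- T..T}" by (auto simp: T_def)
      moreover have "f t0 > 0" using t0 xnz[of t0] by (simp add: f_def)
      ultimately show False by force
    qed
    moreover have "integral {- T..T} f \<ge> 0" by (rule Henstock_Kurzweil_Integration.integral_nonneg[OF fi]) (use f0 in auto)
    ultimately show ?thesis by (simp add: \<kappa>_def)
  qed
  \<comment> \<open>The two connections lose \<open>2 * \<epsilon>\<close> out of a gain of
    \<open>4 * \<epsilon>\<close>.\<close>
  define \<epsilon> where "\<epsilon> = e * \<kappa> / 4"
  have \<epsilon>: "\<epsilon> > 0" using e \<kappa> by (simp add: \<epsilon>_def)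
  obtain tp rp where p: "tp \<ge> T" "rp > 0" "jd W 0 (x tp) + jd W (x tp) (rp *\<^sub>R \<xi>p) \<le> h rp + \<epsilon>"
    using end_connection[OF Tp \<epsilon>] by blast
  obtain tm rm where m: "tm \<ge> T" "rm > 0" "jd W 0 (x (- tm)) + jd W (x (- tm)) (rm *\<^sub>R \<xi>m) \<le> h rm + \<epsilon>"
    using r.end_connection[OF Tm \<epsilon>] by blast
  define s where "s = - tm"
  have T1: "T \<ge> 1" by (simp add: T_def)
  have st: "s \<le> - T" "- T \<le> T" "T \<le> tp" "s \<le> tp" using p m T1 by (auto simp: s_def)
  have gain: "jd (shrink v0 e V, \<alpha>) (x s) (x tp) \<le> act s tp x - e * \<kappa>"
  proof -
    have xc: "continuous_on {s..tp} x" by (rule continuous_on_subset[OF x_cont subset_UNIV])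
    have pe: "K'.pr (x u) = pr (x u) - e * f u" for u
      using dir_unit(2)[of u] by (simp add: K'.pr_def pr_def f_def shrink_def dir_def[symmetric] diff_divide_distrib[symmetric] algebra_simps)
    have pri: "(\<lambda>u. pr (x u)) integrable_on {s..tp}"
      by (rule integrable_continuous_interval[OF pr_path_cont[OF xc xnz]])
    have efi: "(\<lambda>u. e * f u) integrable_on {s..tp}"
      by (rule integrable_continuous_interval) (intro continuous_on_mult_left continuous_on_subset[OF fc subset_UNIV])
    have I: "integral {s..tp} (\<lambda>u. K'.pr (x u)) = integral {s..tp} (\<lambda>u. pr (x u)) - e * integral {s..tp} f"
      unfolding pe Henstock_Kurzweil_Integration.integral_diff[OF pri efi] by simp
    have I0: "integral {s..tp} (\<lambda>u. K'.pr (x u)) \<ge> 0" "integral {s..tp} (\<lambda>u. pr (x u)) \<ge> 0"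
      using K'.pr_pos[OF xnz] pr_pos[OF xnz] pri
        integrable_continuous_interval[OF K'.pr_path_cont[OF xc xnz]]
      by (auto intro!: Henstock_Kurzweil_Integration.integral_nonneg simp: less_imp_le)
    have "integral {s..tp} f = integral {s..- T} f + integral {- T..tp} f"
      by (rule Henstock_Kurzweil_Integration.integral_combine[symmetric]) (use st fi in auto)
    moreover have "integral {- T..tp} f = \<kappa> + integral {T..tp} f"
      unfolding \<kappa>_def by (rule Henstock_Kurzweil_Integration.integral_combine[symmetric]) (use st fi in auto)
    moreover have "integral {s..- T} f \<ge> 0" "integral {T..tp} f \<ge> 0"
      by (auto intro!: Henstock_Kurzweil_Integration.integral_nonneg fi f0)
    ultimately have ge: "\<kappa> \<le> integral {s..tp} f" by linarith
    note kp = act_kn_pt[OF st(4) xH[OF st(4)] fin[OF st(4)]]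
    have ptI: "pt s tp x = integral {s..tp} (\<lambda>u. pr (x u))"
      unfolding pt_def pote_integral[OF xc xnz] using I0(2) by simp
    have "ennreal (jd (shrink v0 e V, \<alpha>) (x s) (x tp)) \<le> action (shrink v0 e V, \<alpha>) s tp x"
      by (rule K'.jd_le_action[OF st(4) xH[OF st(4)]])
    also have "\<dots> = ennreal (kn s tp x) + ennreal (integral {s..tp} (\<lambda>u. K'.pr (x u)))"
      unfolding action_split[OF K'.W_meas st(4) xH[OF st(4)]] kp(2) K'.pote_integral[OF xc xnz] ..
    also have "\<dots> = ennreal (kn s tp x + integral {s..tp} (\<lambda>u. K'.pr (x u)))"
      using I0 by (intro ennreal_plus[symmetric]) (auto simp: kn_def)
    finally have "jd (shrink v0 e V, \<alpha>) (x s) (x tp) \<le> kn s tp x + integral {s..tp} (\<lambda>u. K'.pr (x u))"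
      using I0 by (subst (asm) ennreal_le_iff) (auto simp: kn_def)
    also have "\<dots> = act s tp x - e * integral {s..tp} f" unfolding I kp(1) ptI by simp
    also have "\<dots> \<le> act s tp x - e * \<kappa>" using ge e by (simp add: mult_left_mono)
    finally show ?thesis .
  qed
  define k where "k = max rm rp"
  have k: "k > 0" "rm \<le> k" "rp \<le> k" using p m by (auto simp: k_def)
  let ?j = "jd (shrink v0 e V, \<alpha>)"
  have le: "?j p q \<le> jd W p q" for p q by (rule jd_shrink_le) (use e in auto)
  have rays: "?j (k *\<^sub>R \<xi>m) (rm *\<^sub>R \<xi>m) \<le> h k - h rm" "?j (rp *\<^sub>R \<xi>p) (k *\<^sub>R \<xi>p) \<le> h k - h rp"
    using le[of "rm *\<^sub>R \<xi>m" "k *\<^sub>R \<xi>m"] jd_ray_le[of \<xi>m rm k] le[of "rp *\<^sub>R \<xi>p" "k *\<^sub>R \<xi>p"] jd_ray_le[of \<xi>p rp k] \<xi> k p m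
      K'.jd_sym[of "k *\<^sub>R \<xi>m" "rm *\<^sub>R \<xi>m"] by auto
  have "act s tp x \<le> jd W 0 (x s) + jd W 0 (x tp)"
    using act_jd[OF st(4)] jd_triangle[of "x s" "x tp" 0] jd_sym[of "x s" 0] by simp
  then have mid: "?j (x s) (x tp) \<le> jd W 0 (x s) + jd W 0 (x tp) - e * \<kappa>" using gain by linarith
  have "?j (rm *\<^sub>R \<xi>m) (x s) \<le> jd W (x s) (rm *\<^sub>R \<xi>m)" using le[of "x s" "rm *\<^sub>R \<xi>m"] K'.jd_sym[of "x s" "rm *\<^sub>R \<xi>m"] by simp
  moreover have "?j (x tp) (rp *\<^sub>R \<xi>p) \<le> jd W (x tp) (rp *\<^sub>R \<xi>p)" by (rule le)
  moreover have "?j (k *\<^sub>R \<xi>m) (k *\<^sub>R \<xi>p) \<le> ?j (k *\<^sub>R \<xi>m) (rm *\<^sub>R \<xi>m) + ?j (rm *\<^sub>R \<xi>m) (x s) + ?j (x s) (x tp) + ?j (x tp) (rp *\<^sub>R \<xi>p) + ?j (rp *\<^sub>R \<xi>p) (k *\<^sub>R \<xi>p)"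
    using K'.jd_triangle[of "k *\<^sub>R \<xi>m" "k *\<^sub>R \<xi>p" "rm *\<^sub>R \<xi>m"] K'.jd_triangle[of "rm *\<^sub>R \<xi>m" "k *\<^sub>R \<xi>p" "x s"]
      K'.jd_triangle[of "x s" "k *\<^sub>R \<xi>p" "x tp"] K'.jd_triangle[of "x tp" "k *\<^sub>R \<xi>p" "rp *\<^sub>R \<xi>p"] by linarith
  moreover have "e * \<kappa> = 4 * \<epsilon>" by (simp add: \<epsilon>_def)
  ultimately have "?j (k *\<^sub>R \<xi>m) (k *\<^sub>R \<xi>p) \<le> 2 * h k - 2 * \<epsilon>"
    using rays mid p(3) m(3)[folded s_def] by linarith
  moreover have "?j (k *\<^sub>R \<xi>m) (k *\<^sub>R \<xi>p) = k powr \<beta> * ?j \<xi>m \<xi>p" by (rule K'.jd_scale[OF k(1)])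
  moreover have "h k = k powr \<beta> * h 1" using h_mult[of k 1] k by simp
  ultimately have "k powr \<beta> * ?j \<xi>m \<xi>p < k powr \<beta> * (2 * h 1)"
    using \<epsilon> by (simp add: mult.left_commute)
  then show ?thesis by (rule mult_left_less_imp_less) simp
qed

end

section \<open>The space of potentials\<close>

lemma has_derivative_fderiv:
  "f differentiable (at x) \<Longrightarrow> (f has_derivative blinfun_apply (fderiv f x)) (at x)"
  unfolding fderiv_def frechet_derivative_works
  by (subst bounded_linear_Blinfun_apply) (auto dest: has_derivative_bounded_linear)

lemma fderiv_eqI:
  assumes "(f has_derivative blinfun_apply D) (at x)"
  shows "fderiv f x = D"
  by (simp add: fderiv_def frechet_derivative_at[OF assms, symmetric] blinfun_apply_inverse)

lemma fderiv_affine: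
  assumes U: "open U" "x \<in> U" and g: "\<And>y. y \<in> U \<Longrightarrow> g y = c *\<^sub>R f y + k" and f: "f differentiable (at x)"
  shows "g differentiable (at x)" "fderiv g x = c *\<^sub>R fderiv f x"
proof -
  have "((\<lambda>y. c *\<^sub>R f y + k) has_derivative (\<lambda>v. c *\<^sub>R fderiv f x v + 0)) (at x)"
    by (intro has_derivative_add has_derivative_scaleR_right has_derivative_fderiv f has_derivative_const)
  then have "(g has_derivative (\<lambda>v. c *\<^sub>R fderiv f x v + 0)) (at x)"
    by (rule has_derivative_transform_within_open[OF _ U]) (simp add: g)
  then have *: "(g has_derivative blinfun_apply (c *\<^sub>R fderiv f x)) (at x)" by (simp add: scaleR_blinfun.rep_eq)
  show "g differentiable (at x)" using * by (rule differentiableI)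
  show "fderiv g x = c *\<^sub>R fderiv f x" using * by (rule fderiv_eqI)
qed

text \<open>The radial extension has a minimum at \<open>\<xi>\<close> in the whole complement of
  the origin, so its derivative vanishes there. That derivative is itself differentiable at
  \<open>\<xi>\<close>, hence grows at most linearly near it, and the mean value inequality on a
  ball integrates this to a quadratic bound.\<close>

lemma C2_sphere_minimum_upper_bound:
  assumes V: "V \<in> C2_sphere" and \<xi>: "norm \<xi> = 1" and min: "\<And>s. s \<in> sphere 0 1 \<Longrightarrow> V \<xi> \<le> V s"
  obtains d C where "d > 0" "C \<ge> 0" "\<And>s. norm s = 1 \<Longrightarrow> norm (s - \<xi>) < d \<Longrightarrow> V s \<le> V \<xi> + C * (norm (s - \<xi>))\<^sup>2"
proof -
  define F where "F = radial_ext V"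
  define D where "D = fderiv F"
  have d1: "F differentiable (at y)" and d2: "D differentiable (at y)" if "y \<noteq> 0" for y
    using V that by (auto simp: C2_sphere_def C2_on_def F_def D_def)
  have F1: "F s = V s" if "norm s = 1" for s using that by (simp add: F_def radial_ext_def)
  have \<xi>0: "\<xi> \<noteq> 0" using \<xi> by force
  have "blinfun_apply (D \<xi>) = (\<lambda>v. 0)"
  proof (rule differential_zero_maxmin[of \<xi> "- {0}"])
    show "(F has_derivative blinfun_apply (D \<xi>)) (at \<xi>)" unfolding D_def by (rule has_derivative_fderiv[OF d1[OF \<xi>0]])
    have "F \<xi> \<le> F y" if "y \<noteq> 0" for y
      unfolding F1[OF \<xi>] unfolding F_def radial_ext_def by (rule min) (use that in simp)
    then show "(\<forall>y\<in>- {0}. F y \<le> F \<xi>) \<or> (\<forall>y\<in>- {0}. F \<xi> \<le> F y)" by blast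
  qed (use \<xi>0 in auto)
  then have D0: "D \<xi> = 0" by (intro blinfun_eqI) simp
  have "(D has_derivative blinfun_apply (fderiv D \<xi>)) (at \<xi>)" by (rule has_derivative_fderiv[OF d2[OF \<xi>0]])
  then obtain r where r: "r > 0" "\<And>y. norm (y - \<xi>) < r \<Longrightarrow> norm (D y - D \<xi> - fderiv D \<xi> (y - \<xi>)) \<le> 1 * norm (y - \<xi>)"
    unfolding has_derivative_at_alt using zero_less_one by blast
  define C where "C = 1 + norm (fderiv D \<xi>)"
  have C: "C \<ge> 0" by (simp add: C_def)
  have DC: "norm (D y) \<le> C * norm (y - \<xi>)" if "norm (y - \<xi>) < r" for y
  proof -
    have "norm (D y) \<le> norm (D y - fderiv D \<xi> (y - \<xi>)) + norm (fderiv D \<xi> (y - \<xi>))"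
      using norm_triangle_ineq[of "D y - fderiv D \<xi> (y - \<xi>)" "fderiv D \<xi> (y - \<xi>)"] by simp
    also have "\<dots> \<le> norm (y - \<xi>) + norm (fderiv D \<xi>) * norm (y - \<xi>)"
      using r(2)[OF that] D0 norm_blinfun[of "fderiv D \<xi>" "y - \<xi>"] by simp
    also have "\<dots> = C * norm (y - \<xi>)" by (simp add: C_def distrib_right)
    finally show ?thesis .
  qed
  show ?thesis
  \<comment> \<open>A radius below 1 keeps the ball around the unit vector \<open>\<xi>\<close> off
    the origin.\<close>
  proof (rule that[of "min r 1" C])
    fix s :: 'a assume s: "norm s = 1" "norm (s - \<xi>) < min r 1"
    let ?S = "cball \<xi> (norm (s - \<xi>))"
    have yb: "norm (y - \<xi>) \<le> norm (s - \<xi>)" if "y \<in> ?S" for y using that by (simp add: dist_norm norm_minus_commute)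
    have y0: "y \<noteq> 0" if "y \<in> ?S" for y using yb[OF that] s \<xi> by auto
    have "norm (F s - F \<xi>) \<le> (C * norm (s - \<xi>)) * norm (s - \<xi>)"
    proof (rule differentiable_bound[of ?S F "\<lambda>y. blinfun_apply (D y)"])
      fix y assume y: "y \<in> ?S"
      show "(F has_derivative blinfun_apply (D y)) (at y within ?S)"
        unfolding D_def by (rule has_derivative_at_withinI[OF has_derivative_fderiv[OF d1[OF y0[OF y]]]])
      have "norm (D y) \<le> C * norm (y - \<xi>)" using yb[OF y] s by (intro DC) simp
      also have "\<dots> \<le> C * norm (s - \<xi>)" by (rule mult_left_mono[OF yb[OF y] C])
      finally show "onorm (blinfun_apply (D y)) \<le> C * norm (s - \<xi>)" by (simp add: norm_blinfun.rep_eq)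
    qed (auto simp: dist_norm norm_minus_commute)
    then show "V s \<le> V \<xi> + C * (norm (s - \<xi>))\<^sup>2" unfolding F1[OF s(1)] F1[OF \<xi>] by (simp add: power2_eq_square mult.assoc abs_le_iff)
  qed (use r C in auto)
qed

lemma shrink_C2:
  assumes V: "V \<in> C2_sphere"
  shows "shrink v e V \<in> C2_sphere"
    and "x \<noteq> 0 \<Longrightarrow> fderiv (radial_ext (shrink v e V)) x = (1 - e) *\<^sub>R fderiv (radial_ext V) x"
    and "x \<noteq> 0 \<Longrightarrow> fderiv (fderiv (radial_ext (shrink v e V))) x = (1 - e) *\<^sub>R fderiv (fderiv (radial_ext V)) x"
proof -
  let ?F = "radial_ext V" and ?G = "radial_ext (shrink v e V)"
  have V2: "C2_on (- {0}) ?F" using V by (simp add: C2_sphere_def)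
  have o: "open (- {0::'a})" by (rule open_Compl) simp
  have G: "?G y = (1 - e) *\<^sub>R ?F y + e * v" if "y \<in> - {0}" for y using that by (simp add: radial_ext_def shrink_def)
  have 1: "?G differentiable (at x)" "fderiv ?G x = (1 - e) *\<^sub>R fderiv ?F x" if "x \<in> - {0}" for x
    using fderiv_affine[OF o that G, of "\<lambda>y. y"] V2 that by (auto simp: C2_on_def)
  have 2: "fderiv ?G differentiable (at x)" "fderiv (fderiv ?G) x = (1 - e) *\<^sub>R fderiv (fderiv ?F) x" if "x \<in> - {0}" for x
    using fderiv_affine[OF o that, of "fderiv ?G" "1 - e" "fderiv ?F" 0] 1(2) V2 that by (auto simp: C2_on_def)
  show "x \<noteq> 0 \<Longrightarrow> fderiv ?G x = (1 - e) *\<^sub>R fderiv ?F x" "x \<noteq> 0 \<Longrightarrow> fderiv (fderiv ?G) x = (1 - e) *\<^sub>R fderiv (fderiv ?F) x"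
    using 1 2 by auto
  have "continuous_on (- {0}) (\<lambda>x. (1 - e) *\<^sub>R fderiv (fderiv ?F) x)"
    using V2 unfolding C2_on_def by (intro continuous_on_scaleR continuous_on_const) simp
  then have "continuous_on (- {0}) (fderiv (fderiv ?G))" by (rule continuous_on_eq) (simp add: 2)
  then have "C2_on (- {0}) ?G" using 1 2 unfolding C2_on_def by blast
  moreover have "shrink v e V \<in> extensional (sphere 0 1)" by (simp add: shrink_def extensional_def)
  ultimately show "shrink v e V \<in> C2_sphere" by (simp add: C2_sphere_def)
qed

text \<open>One form for all three suprema in \<open>C2_dist\<close>: v is the minimum for the
  function itself and 0 for its derivatives.\<close>

lemma SUP_dist_scaled:
  fixes f :: "'a::euclidean_space \<Rightarrow> 'b::real_normed_vector"
  assumes f: "continuous_on (sphere 0 1) f"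
  shows "\<exists>K\<ge>0. \<forall>e\<ge>0. \<forall>g. (\<forall>s\<in>sphere 0 1. g s = f s - e *\<^sub>R (f s - v)) \<longrightarrow>
    (SUP s\<in>sphere 0 1. dist (f s) (g s)) \<le> e * K"
proof -
  have "bounded ((\<lambda>s. f s - v) ` sphere 0 1)"
    by (intro compact_imp_bounded compact_continuous_image continuous_intros f compact_sphere)
  then obtain K where K: "K > 0" "\<forall>y\<in>(\<lambda>s. f s - v) ` sphere 0 1. norm y \<le> K" unfolding bounded_pos by blast
  have "(SUP s\<in>sphere 0 1. dist (f s) (g s)) \<le> e * K"
    if e: "0 \<le> e" and g: "\<forall>s\<in>sphere 0 1. g s = f s - e *\<^sub>R (f s - v)" for e g
  proof (rule cSUP_least[OF unit_sphere_nonempty])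
    fix s :: 'a assume s: "s \<in> sphere 0 1"
    have "dist (f s) (g s) = e * norm (f s - v)" using e by (simp add: bspec[OF g s] dist_norm)
    also have "\<dots> \<le> e * K" by (rule mult_left_mono[OF bspec[OF K(2) imageI[OF s]] e])
    finally show "dist (f s) (g s) \<le> e * K" .
  qed
  then show ?thesis using K(1) by (intro exI[of _ K]) auto
qed

lemma C2_dist_shrink:
  assumes V: "V \<in> C2_sphere"
  obtains K where "K \<ge> 0" "\<And>e. 0 \<le> e \<Longrightarrow> C2_dist V (shrink v e V) \<le> e * K"
proof -
  note c = C2_sphere_continuous[OF V]
  obtain K1 where K1: "K1 \<ge> 0" "\<forall>e\<ge>0. \<forall>g. (\<forall>s\<in>sphere 0 1. g s = V s - e *\<^sub>R (V s - v)) \<longrightarrow>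
    (SUP s\<in>sphere 0 1. dist (V s) (g s)) \<le> e * K1" using SUP_dist_scaled[OF c(1), of v] by (elim exE conjE)
  obtain K2 where K2: "K2 \<ge> 0" "\<forall>e\<ge>0. \<forall>g. (\<forall>s\<in>sphere 0 1. g s = fderiv (radial_ext V) s - e *\<^sub>R (fderiv (radial_ext V) s - 0)) \<longrightarrow>
    (SUP s\<in>sphere 0 1. dist (fderiv (radial_ext V) s) (g s)) \<le> e * K2" using SUP_dist_scaled[OF c(2), of 0] by (elim exE conjE)
  obtain K3 where K3: "K3 \<ge> 0" "\<forall>e\<ge>0. \<forall>g. (\<forall>s\<in>sphere 0 1. g s = fderiv (fderiv (radial_ext V)) s - e *\<^sub>R (fderiv (fderiv (radial_ext V)) s - 0)) \<longrightarrow>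
    (SUP s\<in>sphere 0 1. dist (fderiv (fderiv (radial_ext V)) s) (g s)) \<le> e * K3" using SUP_dist_scaled[OF c(3), of 0] by (elim exE conjE)
  show ?thesis
  proof (rule that[of "K1 + K2 + K3"])
    fix e :: real assume e: "0 \<le> e"
    let ?G = "shrink v e V"
    have s0: "s \<noteq> 0" if "s \<in> sphere 0 1" for s :: 'a using that by auto
    have "\<forall>s\<in>sphere 0 1. ?G s = V s - e *\<^sub>R (V s - v)" by (simp add: shrink_def algebra_simps)
    then have 1: "(SUP s\<in>sphere 0 1. dist (V s) (?G s)) \<le> e * K1" by (rule K1(2)[THEN spec, THEN mp, OF e, THEN spec, THEN mp])
    have "\<forall>s\<in>sphere 0 1. fderiv (radial_ext ?G) s = fderiv (radial_ext V) s - e *\<^sub>R (fderiv (radial_ext V) s - 0)"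
      using shrink_C2(2)[OF V s0] by (simp add: scaleR_left_diff_distrib)
    then have 2: "(SUP s\<in>sphere 0 1. dist (fderiv (radial_ext V) s) (fderiv (radial_ext ?G) s)) \<le> e * K2"
      by (rule K2(2)[THEN spec, THEN mp, OF e, THEN spec, THEN mp])
    have "\<forall>s\<in>sphere 0 1. fderiv (fderiv (radial_ext ?G)) s = fderiv (fderiv (radial_ext V)) s - e *\<^sub>R (fderiv (fderiv (radial_ext V)) s - 0)"
      using shrink_C2(3)[OF V s0] by (simp add: scaleR_left_diff_distrib)
    then have 3: "(SUP s\<in>sphere 0 1. dist (fderiv (fderiv (radial_ext V)) s) (fderiv (fderiv (radial_ext ?G)) s)) \<le> e * K3"
      by (rule K3(2)[THEN spec, THEN mp, OF e, THEN spec, THEN mp])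
    show "C2_dist V ?G \<le> e * (K1 + K2 + K3)"
      using V shrink_C2(1)[OF V, of v e] add_mono[OF add_mono[OF 1 2] 3] by (simp add: C2_dist_def distrib_left)
  qed (use K1 K2 K3 in simp)
qed

text \<open>The growth constant \<open>\<mu>\<close> becomes \<open>(1 - e) * \<mu>\<close>, which
  stays positive for e < 1.\<close>

lemma calS_shrink:
  assumes V: "V \<in> calS \<xi>p \<xi>m v" and \<xi>: "norm \<xi>p = 1" "norm \<xi>m = 1" and e: "0 \<le> e" "e < 1"
  shows "shrink v e V \<in> calS \<xi>p \<xi>m v"
proof -
  have a: "shrink v e V s - v = (1 - e) * (V s - v)" if "s \<in> sphere 0 1" for s
    using that by (simp add: shrink_def algebra_simps)
  from V obtain \<delta> \<mu> where \<delta>: "\<delta> > 0" "\<mu> > 0"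
    and growth: "\<And>\<xi> s. \<xi> \<in> {\<xi>p, \<xi>m} \<Longrightarrow> s \<in> sphere 0 1 \<Longrightarrow> norm (s - \<xi>) < \<delta> \<Longrightarrow> V s - V \<xi> \<ge> \<mu> * (norm (s - \<xi>))\<^sup>2"
    unfolding calS_def by blast
  have Vp: "V \<xi>p = v" "V \<xi>m = v" and ge: "\<And>s. s \<in> sphere 0 1 \<Longrightarrow> v \<le> V s" and C2: "V \<in> C2_sphere"
    using V by (auto simp: calS_def)
  have eq: "shrink v e V \<xi>p = v" "shrink v e V \<xi>m = v" using a[of \<xi>p] a[of \<xi>m] Vp \<xi> by auto
  have "(1 - e) * \<mu> * (norm (s - \<xi>))\<^sup>2 \<le> shrink v e V s - shrink v e V \<xi>"
    if "\<xi> \<in> {\<xi>p, \<xi>m}" "s \<in> sphere 0 1" "norm (s - \<xi>) < \<delta>" for \<xi> s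
    using mult_left_mono[OF growth[OF that], of "1 - e"] a[OF that(2)] that(1) Vp eq e by auto
  moreover have "(1 - e) * \<mu> > 0" using e \<delta> by simp
  moreover have "shrink v e V s \<ge> v" if "s \<in> sphere 0 1" for s
  proof -
    have "(1 - e) * (V s - v) \<ge> 0" using ge[OF that] e by (intro mult_nonneg_nonneg) auto
    then show ?thesis using a[OF that] by linarith
  qed
  ultimately show ?thesis
    unfolding calS_def using eq shrink_C2(1)[OF C2] \<delta> by blast
qed

section \<open>The sets In and Out in terms of the distance\<close>

lemma calP_kepler:
  assumes "(V, \<alpha>) \<in> calP \<xi>p \<xi>m v" "v > 0"
  shows "kepler V \<alpha> v"
  using assms by unfold_locales (auto simp: calP_def calS_def intro: C2_sphere_continuous(1))

text \<open>The threshold \<open>4 * sqrt (2 * v) / (2 - \<alpha>)\<close> is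
  \<open>2 * h 1\<close>, because \<open>2 - \<alpha> = 2 * \<beta>\<close>.\<close>

lemma calP_Out_iff:
  assumes P: "(V, \<alpha>) \<in> calP \<xi>p \<xi>m v" and v: "v > 0" and ne: "\<xi>p \<noteq> \<xi>m"
  shows "(V, \<alpha>) \<in> Out_set \<xi>p \<xi>m v \<longleftrightarrow> jd (V, \<alpha>) \<xi>m \<xi>p < 2 * kepler.h \<alpha> v 1"
    and "(V, \<alpha>) \<in> In_set \<xi>p \<xi>m v \<longleftrightarrow> jd (V, \<alpha>) \<xi>m \<xi>p = 2 * kepler.h \<alpha> v 1"
proof -
  interpret kepler V \<alpha> v by (rule calP_kepler[OF P v])
  have t: "4 * sqrt (2 * v) / (2 - \<alpha>) = 2 * h 1" using \<alpha> by (simp add: h_def \<beta>_def field_simps)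
  have "min_action \<xi>p \<xi>m W = ennreal (jd W \<xi>m \<xi>p)" by (rule min_action_jd) (use ne in auto)
  then show "W \<in> Out_set \<xi>p \<xi>m v \<longleftrightarrow> jd W \<xi>m \<xi>p < 2 * h 1" "W \<in> In_set \<xi>p \<xi>m v \<longleftrightarrow> jd W \<xi>m \<xi>p = 2 * h 1"
    using P jd_nonneg[of \<xi>m \<xi>p] h_nonneg[of 1] by (auto simp: Out_set_def In_set_def t ennreal_less_iff ennreal_inj)
qed

lemma calP_close:
  assumes P: "(V, \<alpha>) \<in> calP \<xi>p \<xi>m v" "(V', \<alpha>') \<in> calP \<xi>p \<xi>m v"
    and d: "prod_dist C2_dist dist (V, \<alpha>) (V', \<alpha>') < r"
  shows "close V \<alpha> V' \<alpha>' r"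
proof -
  have V: "V \<in> C2_sphere" "V' \<in> C2_sphere" using P by (auto simp: calP_def calS_def)
  note c = C2_sphere_continuous[OF V(1)] C2_sphere_continuous[OF V(2)]
  have "C2_dist V V' \<le> prod_dist C2_dist dist (V, \<alpha>) (V', \<alpha>')" "dist \<alpha> \<alpha>' \<le> prod_dist C2_dist dist (V, \<alpha>) (V', \<alpha>')"
    by (simp_all add: prod_dist_def real_sqrt_sum_squares_ge1 real_sqrt_sum_squares_ge2)
  moreover have "dist (V s) (V' s) \<le> C2_dist V V'" if "s \<in> sphere 0 1" for s
    using cSUP_upper[OF that SUP_dist_bdd[OF c(1,4)]] SUP_dist_nonneg[OF c(2,5)] SUP_dist_nonneg[OF c(3,6)] V
    by (simp add: C2_dist_def)
  ultimately show ?thesis using d unfolding close_def dist_real_def by (meson less_imp_le order_trans order_le_less_trans)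
qed

text \<open>The distance is upper semicontinuous in the potential, and the threshold H depends
  continuously on the exponent; each takes half of the gap e.\<close>

lemma Out_set_open:
  assumes v: "v > 0" and \<xi>: "norm \<xi>p = 1" "norm \<xi>m = 1" "\<xi>p \<noteq> \<xi>m"
  shows "openin (calP_topology \<xi>p \<xi>m v) (Out_set \<xi>p \<xi>m v)"
proof -
  interpret M: Metric_space "calP \<xi>p \<xi>m v" "prod_dist C2_dist dist" by (rule calP_Metric_space)
  have "\<exists>r>0. M.mball P r \<subseteq> Out_set \<xi>p \<xi>m v" if PO: "P \<in> Out_set \<xi>p \<xi>m v" for P
  proof -
    obtain V \<alpha> where P: "P = (V, \<alpha>)" by fastforce
    have PP: "(V, \<alpha>) \<in> calP \<xi>p \<xi>m v" using PO by (auto simp: Out_set_def P)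
    interpret kepler V \<alpha> v by (rule calP_kepler[OF PP v])
    define e where "e = 2 * h 1 - jd W \<xi>m \<xi>p"
    have e: "e > 0" using calP_Out_iff(1)[OF PP v \<xi>(3)] PO by (simp add: P e_def)
    obtain d1 where d1: "d1 > 0" "\<And>V' \<alpha>'. kepler V' \<alpha>' v \<Longrightarrow> close V \<alpha> V' \<alpha>' d1 \<Longrightarrow> jd (V', \<alpha>') \<xi>m \<xi>p \<le> jd W \<xi>m \<xi>p + e / 2"
    proof (rule jd_usc_fixed[of \<xi>m \<xi>p "e / 2"])
      show "\<xi>m \<noteq> 0" "\<xi>p \<noteq> 0" using \<xi> by auto
    qed (use e in auto)
    define H where "H = (\<lambda>a. 2 * (sqrt (2 * v) / (1 - a / 2)))"
    have H: "2 * kepler.h \<alpha>' v 1 = H \<alpha>'" if "kepler V' \<alpha>' v" for V' \<alpha>'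
      unfolding kepler.h_def[OF that] kepler.\<beta>_def[OF that] H_def by simp
    have "isCont H \<alpha>" unfolding H_def using \<alpha> by (intro continuous_intros) auto
    then obtain d2 where d2: "d2 > 0" "\<And>a. dist a \<alpha> < d2 \<Longrightarrow> dist (H a) (H \<alpha>) < e / 2"
      unfolding continuous_at_eps_delta using e by (meson half_gt_zero)
    have "M.mball P (min d1 (d2 / 2)) \<subseteq> Out_set \<xi>p \<xi>m v"
    proof
      fix Q assume Q: "Q \<in> M.mball P (min d1 (d2 / 2))"
      obtain V' \<alpha>' where Qe: "Q = (V', \<alpha>')" by fastforce
      have QP: "(V', \<alpha>') \<in> calP \<xi>p \<xi>m v" using Q by (simp add: M.in_mball Qe)
      have K': "kepler V' \<alpha>' v" by (rule calP_kepler[OF QP v])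
      have cl: "close V \<alpha> V' \<alpha>' (min d1 (d2 / 2))" by (rule calP_close[OF PP QP]) (use Q in \<open>simp add: M.in_mball Qe P\<close>)
      have "dist \<alpha>' \<alpha> \<le> min d1 (d2 / 2)" using cl by (simp add: close_def dist_real_def abs_minus_commute)
      then have "dist \<alpha>' \<alpha> < d2" using d2(1) by simp
      then have "dist (H \<alpha>') (H \<alpha>) < e / 2" by (rule d2(2))
      then have "H \<alpha> - e / 2 < H \<alpha>'" unfolding dist_real_def abs_less_iff by linarith
      moreover have "jd (V', \<alpha>') \<xi>m \<xi>p \<le> jd W \<xi>m \<xi>p + e / 2" by (rule d1(2)[OF K' close_mono[OF cl min.cobounded1]])
      moreover have "jd W \<xi>m \<xi>p = H \<alpha> - e" using H[OF kepler_axioms] by (simp add: e_def)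
      ultimately have "jd (V', \<alpha>') \<xi>m \<xi>p < 2 * kepler.h \<alpha>' v 1" unfolding H[OF K'] by argo
      then show "Q \<in> Out_set \<xi>p \<xi>m v" unfolding Qe using calP_Out_iff(1)[OF QP v \<xi>(3)] by simp
    qed
    then show ?thesis using d1(1) d2(1) by (intro exI[of _ "min d1 (d2 / 2)"]) simp
  qed
  moreover have "Out_set \<xi>p \<xi>m v \<subseteq> calP \<xi>p \<xi>m v" by (auto simp: Out_set_def)
  ultimately show ?thesis unfolding calP_topology_def M.openin_mtopology by blast
qed

text \<open>The competitor through the origin gives \<open>jd \<le> 2 h 1\<close> throughout
  \<open>calP\<close>, so In is the complement of Out and has the same frontier. As Out is open,
  this frontier is the closure of Out without Out.\<close>

lemma Pi_set_iff:
  assumes P: "(V, \<alpha>) \<in> calP \<xi>p \<xi>m v" and v: "v > 0" and \<xi>: "norm \<xi>p = 1" "norm \<xi>m = 1" "\<xi>p \<noteq> \<xi>m"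
  shows "(V, \<alpha>) \<in> Pi_set \<xi>p \<xi>m v \<longleftrightarrow> jd (V, \<alpha>) \<xi>m \<xi>p = 2 * kepler.h \<alpha> v 1 \<and>
    (\<forall>r>0. \<exists>Q\<in>Out_set \<xi>p \<xi>m v. prod_dist C2_dist dist (V, \<alpha>) Q < r)"
proof -
  interpret M: Metric_space "calP \<xi>p \<xi>m v" "prod_dist C2_dist dist" by (rule calP_Metric_space)
  let ?T = "calP_topology \<xi>p \<xi>m v" and ?O = "Out_set \<xi>p \<xi>m v"
  have le: "jd (V, \<alpha>) \<xi>m \<xi>p \<le> 2 * kepler.h \<alpha> v 1" if "(V, \<alpha>) \<in> calP \<xi>p \<xi>m v" for V \<alpha>
    using kepler.jd_le_2h[OF calP_kepler[OF that v] \<xi>(1,2), of 1] that by (auto simp: calP_def calS_def)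
  have "In_set \<xi>p \<xi>m v = topspace ?T - ?O"
  proof (intro set_eqI iffI)
    fix Q assume Q: "Q \<in> In_set \<xi>p \<xi>m v"
    then show "Q \<in> topspace ?T - ?O" by (auto simp: In_set_def Out_set_def topspace_calP_topology)
  next
    fix Q assume "Q \<in> topspace ?T - ?O"
    then have Q: "Q \<in> calP \<xi>p \<xi>m v" "Q \<notin> ?O" by (auto simp: topspace_calP_topology)
    obtain V' \<alpha>' where Qe: "Q = (V', \<alpha>')" by fastforce
    show "Q \<in> In_set \<xi>p \<xi>m v"
      using Q le[of V' \<alpha>'] calP_Out_iff[of V' \<alpha>', OF _ v \<xi>(3)] unfolding Qe by force
  qed
  then have "Pi_set \<xi>p \<xi>m v = ?T closure_of ?O - ?O"
    unfolding Pi_set_def by (simp add: frontier_of_complement) (simp add: frontier_of_def interior_of_openin[OF Out_set_open[OF v \<xi>]])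
  also have "?T closure_of ?O = {P \<in> calP \<xi>p \<xi>m v. \<forall>r>0. \<exists>Q\<in>?O. Q \<in> M.mball P r}"
    unfolding calP_topology_def by (rule M.metric_closure_of)
  finally have "(V, \<alpha>) \<in> Pi_set \<xi>p \<xi>m v \<longleftrightarrow> (\<forall>r>0. \<exists>Q\<in>?O. Q \<in> M.mball (V, \<alpha>) r) \<and> (V, \<alpha>) \<notin> ?O" using P by simp
  moreover have "Q \<in> M.mball (V, \<alpha>) r \<longleftrightarrow> prod_dist C2_dist dist (V, \<alpha>) Q < r" if "Q \<in> ?O" for Q r
    using P that by (auto simp: M.in_mball Out_set_def)
  moreover have "(V, \<alpha>) \<notin> ?O \<longleftrightarrow> jd (V, \<alpha>) \<xi>m \<xi>p = 2 * kepler.h \<alpha> v 1"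
    using calP_Out_iff(1)[OF P v \<xi>(3)] le[OF P] by force
  ultimately show ?thesis by (metis (no_types, lifting))
qed

text \<open>The distance of the direction from \<open>\<xi>m\<close> passes continuously from near 0
  to near \<open>norm (\<xi>p - \<xi>m)\<close>. At an intermediate value below
  \<open>\<delta>\<close> the growth condition makes V exceed its minimum.\<close>

lemma (in heteroclinic) leaves_minimum:
  assumes "\<xi>p \<noteq> \<xi>m" and \<mu>: "\<delta> > 0" "\<mu> > 0"
    and growth: "\<And>s. s \<in> sphere 0 1 \<Longrightarrow> norm (s - \<xi>m) < \<delta> \<Longrightarrow> V s - v0 \<ge> \<mu> * (norm (s - \<xi>m))\<^sup>2"
  obtains t where "V (dir t) > v0"
proof -
  define f where "f = (\<lambda>t. norm (dir t - \<xi>m))"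
  define D where "D = norm (\<xi>p - \<xi>m)"
  define \<eta> where "\<eta> = min (\<delta> / 2) (D / 2)"
  have D: "D > 0" using assms by (simp add: D_def)
  have \<eta>: "\<eta> > 0" "\<eta> < \<delta>" "\<eta> < D" using \<mu> D unfolding \<eta>_def min_def by (simp_all split: if_split)
  have "(f \<longlongrightarrow> D) at_top" unfolding f_def D_def by (intro tendsto_intros dirs)
  then have "\<forall>\<^sub>F t in at_top. \<eta> < f t" using \<eta>(3) by (rule order_tendstoD(1))
  then obtain b where b: "\<And>t. t \<ge> b \<Longrightarrow> \<eta> < f t" by (auto simp: eventually_at_top_linorder)
  have "(f \<longlongrightarrow> norm (\<xi>m - \<xi>m)) at_bot" unfolding f_def by (intro tendsto_intros dirs)
  then have "\<forall>\<^sub>F t in at_bot. f t < \<eta>" using \<eta>(1) by (intro order_tendstoD(2)) auto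
  then obtain a where a: "\<And>t. t \<le> a \<Longrightarrow> f t < \<eta>" by (auto simp: eventually_at_bot_linorder)
  have "continuous_on {min a b..b} f"
    unfolding f_def by (intro continuous_on_norm continuous_on_diff continuous_on_const continuous_on_subset[OF dir_cont subset_UNIV])
  moreover have "f (min a b) \<le> \<eta>" "\<eta> \<le> f b" using a[of "min a b"] b[of b] by simp_all
  ultimately obtain t where t: "f t = \<eta>" using IVT'[of f "min a b" \<eta> b] by auto
  have "V (dir t) - v0 \<ge> \<mu> * (f t)\<^sup>2" unfolding f_def by (rule growth[OF dir_unit(2)]) (use t \<eta> in \<open>simp add: f_def\<close>)
  moreover have "\<mu> * (f t)\<^sup>2 > 0" using t \<eta> \<mu> by simp
  ultimately show ?thesis by (intro that[of t]) linarith
qed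

lemma (in kepler) Morse_heteroclinic:
  assumes m: "parabolic_Morse_minimizer \<xi>p \<xi>m W x"
    and \<xi>: "norm \<xi>p = 1" "norm \<xi>m = 1" "V \<xi>p = v0" "V \<xi>m = v0"
  shows "heteroclinic V \<alpha> v0 x \<xi>p \<xi>m"
proof -
  have xnz: "x t \<noteq> 0" for t using m unfolding parabolic_Morse_minimizer_def by (metis leD norm_zero)
  have xH: "x \<in> H1 s t" if "s \<le> t" for s t
  proof -
    have "x \<in> H1 s (t + 1)" using m that by (simp add: parabolic_Morse_minimizer_def H1_loc_def)
    then show ?thesis by (rule H1_restrict) (use that in auto)
  qed
  interpret geodesic V \<alpha> v0 x
    by unfold_locales (rule xH xnz Morse_action_le_jd[OF m], assumption?)+
  show ?thesis
    by unfold_locales (use m \<xi> in \<open>auto simp: parabolic_Morse_minimizer_def dir_def[abs_def]\<close>)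
qed

theorem theorem1p4:
  fixes \<xi>p \<xi>m :: "'a::euclidean_space" and Vmin \<alpha> :: real and V :: "'a \<Rightarrow> real"
  assumes "DIM('a) \<ge> 2"
    and "\<xi>p \<in> sphere 0 1" and "\<xi>m \<in> sphere 0 1" and "\<xi>p \<noteq> \<xi>m"
    and "Vmin > 0"
    and "(V, \<alpha>) \<in> calP \<xi>p \<xi>m Vmin"
  shows "(\<exists>x. parabolic_Morse_minimizer \<xi>p \<xi>m (V, \<alpha>) x) \<longleftrightarrow> (V, \<alpha>) \<in> Pi_set \<xi>p \<xi>m Vmin"
proof -
  have n: "norm \<xi>p = 1" "norm \<xi>m = 1" using assms by auto
  interpret kepler V \<alpha> Vmin by (rule calP_kepler[OF assms(6,5)])
  have VS: "V \<in> calS \<xi>p \<xi>m Vmin" and V2: "V \<in> C2_sphere" and V\<xi>: "V \<xi>p = Vmin" "V \<xi>m = Vmin"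
    using assms(6) unfolding calP_def calS_def by blast+
  note Pi = Pi_set_iff[OF assms(6,5) n assms(4)]
  show ?thesis
  proof
    assume "W \<in> Pi_set \<xi>p \<xi>m Vmin"
    then have In: "jd W \<xi>m \<xi>p = 2 * h 1" and cl: "\<And>r. r > 0 \<Longrightarrow> \<exists>Q\<in>Out_set \<xi>p \<xi>m Vmin. prod_dist C2_dist dist W Q < r"
      unfolding Pi by auto
    have ex: "\<exists>V' \<alpha>'. kepler V' \<alpha>' Vmin \<and> V' \<xi>p = Vmin \<and> V' \<xi>m = Vmin \<and> close V \<alpha> V' \<alpha>' e \<and>
        jd (V', \<alpha>') \<xi>m \<xi>p < 2 * kepler.h \<alpha>' Vmin 1" if e: "e > 0" for e
    proof -
      obtain V' \<alpha>' where Q: "(V', \<alpha>') \<in> Out_set \<xi>p \<xi>m Vmin" "prod_dist C2_dist dist W (V', \<alpha>') < e"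
        using cl[OF e] by (metis surj_pair)
      have P: "(V', \<alpha>') \<in> calP \<xi>p \<xi>m Vmin" using Q(1) by (auto simp: Out_set_def)
      show ?thesis
        using calP_kepler[OF P assms(5)] calP_close[OF assms(6) P Q(2)] Q(1) P
        unfolding calP_Out_iff(1)[OF P assms(5,4)] by (auto simp: calP_def calS_def)
    qed
    show "\<exists>x. parabolic_Morse_minimizer \<xi>p \<xi>m W x"
    proof (rule minimizer_exists[OF n])
      fix N :: real assume N: "N \<ge> 1"
      show "\<exists>V' \<alpha>' R z c1 c2. kepler V' \<alpha>' Vmin \<and> V' \<xi>p = Vmin \<and> V' \<xi>m = Vmin \<and>
        close V \<alpha> V' \<alpha>' (1 / N) \<and> R \<ge> N \<and> norm z = 1 \<and>
        reach (V', \<alpha>') {p. 1 \<le> norm p} (R *\<^sub>R \<xi>m) z c1 \<and> reach (V', \<alpha>') {p. 1 \<le> norm p} z (R *\<^sub>R \<xi>p) c2 \<and>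
        c1 + c2 \<le> jd (V', \<alpha>') (R *\<^sub>R \<xi>m) (R *\<^sub>R \<xi>p) + 1 / N"
        by (rule approx_data[OF n V\<xi> In ex N]) blast+
    qed
  next
    assume "\<exists>x. parabolic_Morse_minimizer \<xi>p \<xi>m W x"
    then obtain x where x: "parabolic_Morse_minimizer \<xi>p \<xi>m W x" ..
    interpret heteroclinic V \<alpha> Vmin x \<xi>p \<xi>m by (rule Morse_heteroclinic[OF x n V\<xi>])
    have In: "jd W \<xi>m \<xi>p = 2 * h 1" using jd_ge_2h jd_le_2h[OF n V\<xi>, of 1] by simp
    from VS obtain \<delta> \<mu> where "\<delta> > 0" "\<mu> > 0"
      "\<And>s. s \<in> sphere 0 1 \<Longrightarrow> norm (s - \<xi>m) < \<delta> \<Longrightarrow> V s - Vmin \<ge> \<mu> * (norm (s - \<xi>m))\<^sup>2"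
      using V\<xi>(2) unfolding calS_def by force
    then obtain t0 where t0: "V (dir t0) > Vmin" by (rule leaves_minimum[OF assms(4)])
    obtain dp Cp where Tp: "dp > 0" "Cp \<ge> 0" "\<And>s. norm s = 1 \<Longrightarrow> norm (s - \<xi>p) < dp \<Longrightarrow> V s \<le> Vmin + Cp * (norm (s - \<xi>p))\<^sup>2"
      using C2_sphere_minimum_upper_bound[OF V2 n(1)] V_ge unfolding V\<xi> by blast
    obtain dm Cm where Tm: "dm > 0" "Cm \<ge> 0" "\<And>s. norm s = 1 \<Longrightarrow> norm (s - \<xi>m) < dm \<Longrightarrow> V s \<le> Vmin + Cm * (norm (s - \<xi>m))\<^sup>2"
      using C2_sphere_minimum_upper_bound[OF V2 n(2)] V_ge unfolding V\<xi> by blast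
    obtain K where K: "K \<ge> 0" "\<And>e. 0 \<le> e \<Longrightarrow> C2_dist V (shrink Vmin e V) \<le> e * K" using C2_dist_shrink[OF V2] by blast
    have "\<exists>Q\<in>Out_set \<xi>p \<xi>m Vmin. prod_dist C2_dist dist W Q < r" if r: "r > 0" for r
    proof -
      \<comment> \<open>The first bound keeps the lowered potential in \<open>calP\<close>, the
        second keeps its distance \<open>e * K\<close> from V below r.\<close>
      define e where "e = min (1 / 2) (r / (K + 1))"
      have K1: "K + 1 > 0" using K by simp
      have e: "0 < e" "e < 1" "e \<le> r / (K + 1)" using divide_pos_pos[OF r K1] by (auto simp: e_def min_less_iff_disj)
      have Q: "(shrink Vmin e V, \<alpha>) \<in> calP \<xi>p \<xi>m Vmin"
        using calS_shrink[OF VS n, of e] e \<alpha> by (simp add: calP_def)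
      have "jd (shrink Vmin e V, \<alpha>) \<xi>m \<xi>p < 2 * h 1" by (rule shrink_Out[OF Tp Tm t0]) (use e in auto)
      then have O: "(shrink Vmin e V, \<alpha>) \<in> Out_set \<xi>p \<xi>m Vmin" using calP_Out_iff(1)[OF Q assms(5,4)] by simp
      have "prod_dist C2_dist dist W (shrink Vmin e V, \<alpha>) = C2_dist V (shrink Vmin e V)"
        using Metric_space.nonneg[OF C2_Metric_space, of V "shrink Vmin e V"] by (simp add: prod_dist_def)
      also have "\<dots> \<le> e * K" using K(2) e by simp
      also have "\<dots> < e * (K + 1)" using e by (intro mult_strict_left_mono) auto
      also have "\<dots> \<le> r" using e(3) K1 by (simp add: pos_le_divide_eq)
      finally show ?thesis using O by blast
    qed
    then show "W \<in> Pi_set \<xi>p \<xi>m Vmin" unfolding Pi using In by blast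
  qed
qed

end
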